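(* Let $T>0$, let $b\in L_1(0,T;W^1_{1(loc)}(\mathbb{R}^n))$ be a vector field and let $u_0\in L_\infty(\mathbb{R}^n)$. Assume additionally that $$\operatorname{div} b\in L_1(0,T;BMO(\mathbb{R}^n)),\qquad \frac{b}{1+|x|}\in L_1(0,T;L_1(\mathbb{R}^n)),$$ and that, for a fixed $R>0$, $\operatorname{supp}\operatorname{div} b(\cdot,t)\subset B(0,R)$. Then there exists a unique weak solution $u$ to the transport problem $$u_t+b\cdot\nabla u=0\ \text{ in }\ \mathbb{R}^n\times(0,T),\qquad u|_{t=0}=u_0\ \text{ on }\ \mathbb{R}^n$$ such that $$u\in L_\infty(0,T;L_\infty(\mathbb{R}^n))\quad\text{and}\quad \|u\|_{L_\infty(0,T;L_\infty(\mathbb{R}^n))}\le\|u_0\|_{L_\infty(\mathbb{R}^n)}.$$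
   Context: Here $b:\mathbb{R}^n\times(0,T)\to\mathbb{R}^n$ is a given vector field, $u$ is a scalar function, $\operatorname{div}$ and $\nabla$ are taken in the space variable $x\in\mathbb{R}^n$, $B(x,r)$ is the ball of radius $r$ centered at $x$, and the subscript $(loc)$ refers to locality in the space variable. Weak solution: a function $u\in L_\infty(0,T;L_p(\mathbb{R}^n))$ (here $p=\infty$) is a weak solution of $u_t+b\cdot\nabla u=0$, $u|_{t=0}=u_0$ iff $$\int_0^T\int_{\mathbb{R}^n}u\,\phi_t\,dx\,dt+\int_0^T\int_{\mathbb{R}^n}(\operatorname{div} b)\,u\,\phi\,dx\,dt+\int_0^T\int_{\mathbb{R}^n}(b\cdot\nabla\phi)\,u\,dx\,dt=-\int_{\mathbb{R}^n}u_0\,\phi(\cdot,0)\,dx$$ for each $\phi\in C^\infty([0,T];C_0^\infty(\mathbb{R}^n))$ such that $\phi|_{t=T}\equiv0$. $BMO(\mathbb{R}^n)$: the set of locally integrable $f$ with finite semi-norm $$\|f\|_{BMO(\mathbb{R}^n)}=\sup_{x\in\mathbb{R}^n,\,r>0}\frac{1}{|B(x,r)|}\int_{B(x,r)}|f(y)-\{f\}_{B(x,r)}|\,dy,\qquad \{f\}_{B(x,r)}=\frac{1}{|B(x,r)|}\int_{B(x,r)}f(y)\,dy.$$ *)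

theory Defs
  imports "HOL-Analysis.Analysis" "HOL-Probability.Essential_Supremum"
begin

text \<open>
  Functions on space-time are curried, time first: \<open>f t x\<close>.  Elements of the function spaces are
  represented by Lebesgue measurable functions, not by equivalence classes, so equality of
  solutions is equality almost everywhere.
\<close>

definition slab :: "real \<Rightarrow> (real \<times> 'a::euclidean_space) set" where
  "slab T = {0<..<T} \<times> UNIV"


subsection \<open>Smooth functions and test functions\<close>

text \<open>
  The derivatives are taken within \<open>S\<close>, so that they are one-sided at the boundary of
  \<open>S = {0..T} \<times> UNIV\<close>.  The definition is only meant for sets on which derivatives within the set
  are unique, such as this one (for \<open>T > 0\<close>) and \<open>UNIV\<close>.
\<close>

fun Ck_on :: "nat \<Rightarrow> 'a::euclidean_space set \<Rightarrow> ('a \<Rightarrow> real) \<Rightarrow> bool" where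
  "Ck_on 0 S f \<longleftrightarrow> continuous_on S f"
| "Ck_on (Suc k) S f \<longleftrightarrow>
     (\<forall>x\<in>S. f differentiable (at x within S)) \<and>
     (\<forall>v. Ck_on k S (\<lambda>x. frechet_derivative f (at x within S) v))"

definition smooth_on :: "'a::euclidean_space set \<Rightarrow> ('a \<Rightarrow> real) \<Rightarrow> bool" where
  "smooth_on S f \<longleftrightarrow> (\<forall>k. Ck_on k S f)"

definition test_functions :: "('a::euclidean_space \<Rightarrow> real) set" where
  "test_functions = {\<psi>. smooth_on UNIV \<psi> \<and> (\<exists>K. compact K \<and> (\<forall>x. x \<notin> K \<longrightarrow> \<psi> x = 0))}"

text \<open>
  \<open>C\<^sup>\<infinity>([0,T]; C\<^sub>0\<^sup>\<infinity>)\<close> with vanishing value at time \<open>T\<close>.  Since \<open>C\<^sub>0\<^sup>\<infinity>\<close> carries its inductive limit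
  topology, the compact support can be chosen independently of \<open>t \<in> [0,T]\<close>.
\<close>

definition spacetime_test_functions :: "real \<Rightarrow> (real \<Rightarrow> 'a::euclidean_space \<Rightarrow> real) set" where
  "spacetime_test_functions T =
     {\<phi>. smooth_on ({0..T} \<times> UNIV) (\<lambda>(t, x). \<phi> t x) \<and>
         (\<exists>K. compact K \<and> (\<forall>t\<in>{0..T}. \<forall>x. x \<notin> K \<longrightarrow> \<phi> t x = 0)) \<and>
         (\<forall>x. \<phi> T x = 0)}"

definition gradient :: "('a::euclidean_space \<Rightarrow> real) \<Rightarrow> 'a \<Rightarrow> 'a" where
  "gradient f x = (\<Sum>i\<in>Basis. frechet_derivative f (at x) i *\<^sub>R i)"


subsection \<open>Weak derivatives\<close>

definition locally_integrable :: "('a::euclidean_space \<Rightarrow> 'b::euclidean_space) \<Rightarrow> bool" where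
  "locally_integrable f \<longleftrightarrow> (\<forall>K. compact K \<longrightarrow> set_integrable lebesgue K f)"

definition has_weak_partial ::
  "'a::euclidean_space \<Rightarrow> ('a \<Rightarrow> 'b::euclidean_space) \<Rightarrow> ('a \<Rightarrow> 'b) \<Rightarrow> bool" where
  "has_weak_partial i f g \<longleftrightarrow>
     locally_integrable f \<and> locally_integrable g \<and>
     (\<forall>\<psi>\<in>test_functions.
        (LINT x|lebesgue. frechet_derivative \<psi> (at x) i *\<^sub>R f x) = - (LINT x|lebesgue. \<psi> x *\<^sub>R g x))"

definition has_weak_divergence ::
  "('a::euclidean_space \<Rightarrow> 'a) \<Rightarrow> ('a \<Rightarrow> real) \<Rightarrow> bool" where
  "has_weak_divergence f g \<longleftrightarrow>
     locally_integrable f \<and> locally_integrable g \<and>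
     (\<forall>\<psi>\<in>test_functions.
        (LINT x|lebesgue. f x \<bullet> gradient \<psi> x) = - (LINT x|lebesgue. g x * \<psi> x))"

text \<open>
  The complement of the largest open set on which \<open>f\<close> vanishes almost everywhere, i.e. the support
  of \<open>f\<close> as a distribution; it does not depend on the representative of \<open>f\<close>.
\<close>

definition ess_support :: "('a::euclidean_space \<Rightarrow> real) \<Rightarrow> 'a set" where
  "ess_support f = - \<Union>{U. open U \<and> (AE x in lebesgue. x \<in> U \<longrightarrow> f x = 0)}"


subsection \<open>Function spaces\<close>

definition mean :: "'a::euclidean_space set \<Rightarrow> ('a \<Rightarrow> real) \<Rightarrow> real" where
  "mean A f = (LINT y:A|lebesgue. f y) / measure lebesgue A"

definition BMO_seminorm :: "('a::euclidean_space \<Rightarrow> real) \<Rightarrow> ennreal" where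
  "BMO_seminorm f =
     (SUP (x, r) \<in> UNIV \<times> {0<..}. ennreal (mean (ball x r) (\<lambda>y. \<bar>f y - mean (ball x r) f\<bar>)))"

definition BMO :: "('a::euclidean_space \<Rightarrow> real) set" where
  "BMO = {f. locally_integrable f \<and> BMO_seminorm f < \<infinity>}"

definition Linf_norm :: "('a::euclidean_space \<Rightarrow> real) \<Rightarrow> ennreal" where
  "Linf_norm f = esssup lebesgue (\<lambda>x. ennreal \<bar>f x\<bar>)"

definition Linf :: "('a::euclidean_space \<Rightarrow> real) set" where
  "Linf = {f \<in> borel_measurable lebesgue. Linf_norm f < \<infinity>}"

definition Linf_Linf_norm :: "real \<Rightarrow> (real \<Rightarrow> 'a::euclidean_space \<Rightarrow> real) \<Rightarrow> ennreal" where
  "Linf_Linf_norm T u = esssup (lebesgue_on {0<..<T}) (\<lambda>t. Linf_norm (u t))"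

definition Linf_Linf :: "real \<Rightarrow> (real \<Rightarrow> 'a::euclidean_space \<Rightarrow> real) set" where
  "Linf_Linf T =
     {u. (\<lambda>(t, x). u t x) \<in> borel_measurable (lebesgue_on (slab T)) \<and> Linf_Linf_norm T u < \<infinity>}"

text \<open>By Fubini, \<open>L\<^sub>1(0,T; L\<^sub>1(K))\<close> is \<open>L\<^sub>1((0,T) \<times> K)\<close>.\<close>

definition L1_L1 :: "real \<Rightarrow> (real \<Rightarrow> 'a::euclidean_space \<Rightarrow> 'b::euclidean_space) set" where
  "L1_L1 T = {f. set_integrable lebesgue (slab T) (\<lambda>(t, x). f t x)}"

definition L1_L1_loc :: "real \<Rightarrow> (real \<Rightarrow> 'a::euclidean_space \<Rightarrow> 'b::euclidean_space) set" where
  "L1_L1_loc T =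
     {f. \<forall>K. compact K \<longrightarrow> set_integrable lebesgue ({0<..<T} \<times> K) (\<lambda>(t, x). f t x)}"

definition L1_W11_loc :: "real \<Rightarrow> (real \<Rightarrow> 'a::euclidean_space \<Rightarrow> 'b::euclidean_space) set" where
  "L1_W11_loc T =
     {f \<in> L1_L1_loc T. \<forall>i\<in>Basis. \<exists>g\<in>L1_L1_loc T.
        AE t in lebesgue_on {0<..<T}. has_weak_partial i (f t) (g t)}"

definition L1_BMO :: "real \<Rightarrow> (real \<Rightarrow> 'a::euclidean_space \<Rightarrow> real) set" where
  "L1_BMO T =
     {f. (\<lambda>(t, x). f t x) \<in> borel_measurable (lebesgue_on (slab T)) \<and>
         (AE t in lebesgue_on {0<..<T}. f t \<in> BMO) \<and>
         (\<integral>\<^sup>+t. BMO_seminorm (f t) \<partial>lebesgue_on {0<..<T}) < \<infinity>}"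


subsection \<open>The transport problem\<close>

text \<open>
  The weak divergence of \<open>b\<close> is only determined almost everywhere.  It enters through a
  representative \<open>div_b\<close>, tied to \<open>b\<close> by the following predicate.
\<close>

definition is_spatial_divergence ::
  "real \<Rightarrow> (real \<Rightarrow> 'a::euclidean_space \<Rightarrow> 'a) \<Rightarrow> (real \<Rightarrow> 'a \<Rightarrow> real) \<Rightarrow> bool" where
  "is_spatial_divergence T b div_b \<longleftrightarrow>
     (\<lambda>(t, x). div_b t x) \<in> borel_measurable (lebesgue_on (slab T)) \<and>
     (AE t in lebesgue_on {0<..<T}. has_weak_divergence (b t) (div_b t))"

definition weak_solution ::
  "real \<Rightarrow> (real \<Rightarrow> 'a::euclidean_space \<Rightarrow> 'a) \<Rightarrow> (real \<Rightarrow> 'a \<Rightarrow> real) \<Rightarrow> ('a \<Rightarrow> real)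
     \<Rightarrow> (real \<Rightarrow> 'a \<Rightarrow> real) \<Rightarrow> bool" where
  "weak_solution T b div_b u0 u \<longleftrightarrow>
     u \<in> Linf_Linf T \<and>
     (\<forall>\<phi>\<in>spacetime_test_functions T.
        (LINT t:{0<..<T}|lebesgue. LINT x|lebesgue. u t x * deriv (\<lambda>s. \<phi> s x) t)
        + (LINT t:{0<..<T}|lebesgue. LINT x|lebesgue. div_b t x * u t x * \<phi> t x)
        + (LINT t:{0<..<T}|lebesgue. LINT x|lebesgue. (b t x \<bullet> gradient (\<phi> t) x) * u t x)
        = - (LINT x|lebesgue. u0 x * \<phi> 0 x))"

end

theory Submission
  imports Defs
begin

abbreviation Borel where "Borel \<equiv> borel_measurable borel"

abbreviation L1 :: "('a::euclidean_space => 'b::{banach, second_countable_topology}) => bool" where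
 "L1 \<equiv> integrable lborel"

abbreviation ind where "ind \<equiv> indicator"

abbreviation ind01 :: "real => 'b::zero_neq_one" where
 "ind01 \<equiv> indicator {0..1}"

abbreviation cyl :: "real => real => real \<times> 'a::euclidean_space => 'b::zero_neq_one" where
 "cyl T r \<equiv> indicator ({0<..<T} \<times> cball 0 r)"

abbreviation ST where "ST \<equiv> spacetime_test_functions"

abbreviation NN_lborel :: "('a::euclidean_space => ennreal) => ennreal" (binder "NNBINT " 10) where
 "NN_lborel \<equiv> nn_integral lborel"

lemmas int_cong = Bochner_Integration.integral_cong
lemmas int_add = Bochner_Integration.integral_add
lemmas int_diff = Bochner_Integration.integral_diff
lemmas int_sum = Bochner_Integration.integral_sum
lemmas L1_add = Bochner_Integration.integrable_add
lemmas L1_diff = Bochner_Integration.integrable_diff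
lemmas L1_sum = Bochner_Integration.integrable_sum
lemmas L1_bound = Bochner_Integration.integrable_bound


definition unique_derivs :: "'a::euclidean_space set => bool" where
 "unique_derivs S \<longleftrightarrow>
   (\<forall>x\<in>S. \<forall>(f::'a => real) f' f''. (f has_derivative f') (at x within S) -->
    (f has_derivative f'') (at x within S) --> f' = f'')"

lemma unique_derivs_UNIV: "unique_derivs UNIV" unfolding unique_derivs_def by (auto intro: has_derivative_unique)

lemma unique_derivs_slab:
 fixes T :: real
 assumes "T > 0"
 shows "unique_derivs ({0..T} \<times> (UNIV :: 'b::euclidean_space set))" unfolding unique_derivs_def
proof (intro ballI allI impI)
 fix p :: "real \<times> 'b" and f :: "real \<times> 'b => real" and f' f''
 assume p: "p \<in> {0..T} \<times> UNIV"
  and d: "(f has_derivative f') (at p within {0..T} \<times> UNIV)"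
      "(f has_derivative f'') (at p within {0..T} \<times> UNIV)"
 show "f' = f''"
 proof (rule frechet_derivative_unique_within[OF d])
  fix i :: "real \<times> 'b" and e :: real assume i: "i \<in> Basis" and e: "e > 0"
  define d where "d = min (e/2) (T/2)"
  have d: "d > 0" "d < e" "d \<le> T/2" using e assms by (auto simp: d_def)
  obtain t x where tx: "p = (t, x)" "0 \<le> t" "t \<le> T" using p by auto
  consider "i = (1, 0)" | j where "i = (0, j)" using i by (auto simp: Basis_prod_def)
  thus "\<exists>d. 0 < \<bar>d\<bar> \<and> \<bar>d\<bar> < e \<and> p + d *\<^sub>R i \<in> {0..T} \<times> UNIV"
  proof cases
   case 1
   show ?thesis
   proof (cases "t \<le> T/2")
    case True
    thus ?thesis using 1 d tx by (intro exI[of _ d]) auto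
   next
    case False
    thus ?thesis using 1 d tx by (intro exI[of _ "-d"]) auto
   qed
  next
   case 2
   thus ?thesis using d tx by (intro exI[of _ d]) auto
  qed
 qed
qed

lemma has_derivative_within_cong:
 assumes "\<And>x. x \<in> S ==> f x = g x" "x \<in> S"
 shows "(f has_derivative D) (at x within S) \<longleftrightarrow> (g has_derivative D) (at x within S)"
 using assms by (metis has_derivative_transform)

lemma frechet_derivative_within_cong:
 assumes "\<And>x. x \<in> S ==> f x = g x" "x \<in> S"
 shows "frechet_derivative f (at x within S) = frechet_derivative g (at x within S)"
proof -
 have "(f has_derivative D) (at x within S) \<longleftrightarrow> (g has_derivative D) (at x within S)" for D
  using assms by (rule has_derivative_within_cong)
 thus ?thesis by (simp add: frechet_derivative_def)
qed

lemma Ck_on_cong: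
 assumes "\<And>x. x \<in> S ==> f x = g x"
 shows "Ck_on k S f \<longleftrightarrow> Ck_on k S g" using assms
proof (induction k arbitrary: f g)
 case 0
 thus ?case by (auto cong: continuous_on_cong)
next
 case (Suc k)
 have "f differentiable (at x within S) \<longleftrightarrow> g differentiable (at x within S)" if "x \<in> S" for x
  unfolding differentiable_def using has_derivative_within_cong[OF Suc.prems that] by simp
 moreover have "Ck_on k S (\<lambda>x. frechet_derivative f (at x within S) v) =
   Ck_on k S (\<lambda>x. frechet_derivative g (at x within S) v)" for v
  using Suc.prems by (intro Suc.IH) (metis frechet_derivative_within_cong)
 ultimately show ?case by simp
qed

lemma Ck_on_SucI:
 assumes S: "unique_derivs S"
  and f: "\<And>x. x \<in> S ==> (f has_derivative f' x) (at x within S)"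
  and k: "\<And>v. Ck_on k S (\<lambda>x. f' x v)"
 shows "Ck_on (Suc k) S f"
proof -
 have "frechet_derivative f (at x within S) = f' x" if "x \<in> S" for x
  using S f[OF that] that unfolding unique_derivs_def by (metis differentiable_def frechet_derivative_works)
 hence "Ck_on k S (\<lambda>x. frechet_derivative f (at x within S) v) \<longleftrightarrow> Ck_on k S (\<lambda>x. f' x v)" for v
  by (intro Ck_on_cong) simp
 with f k show ?thesis by (auto simp: differentiable_def)
qed

lemma Ck_on_SucD:
 assumes "Ck_on (Suc k) S f"
 shows "x \<in> S ==> (f has_derivative frechet_derivative f (at x within S)) (at x within S)"
  and "Ck_on k S (\<lambda>x. frechet_derivative f (at x within S) v)" using assms by (auto simp: frechet_derivative_works)

lemma Ck_on_lower: "Ck_on (Suc k) S f ==> Ck_on k S f"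
proof (induction k arbitrary: f)
 case 0
 thus ?case by (auto intro!: differentiable_imp_continuous_on simp: differentiable_on_def)
next
 case (Suc k)
 thus ?case by (metis Ck_on.simps(2))
qed

lemma Ck_on_imp_continuous_on: "Ck_on k S f ==> continuous_on S f"
 by (induction k) (auto dest: Ck_on_lower simp del: Ck_on.simps(2))

lemma Ck_on_const: "unique_derivs S ==> Ck_on k S (\<lambda>x. c)"
proof (induction k arbitrary: c)
 case (Suc k)
 thus ?case by (intro Ck_on_SucI[where f'="\<lambda>x v. 0"]) auto
qed auto

lemma Ck_on_bounded_linear:
 assumes "unique_derivs S" "bounded_linear f"
 shows "Ck_on k S f"
proof (cases k)
 case 0
 thus ?thesis using assms by (simp add: bounded_linear.linear linear_continuous_on)
next
 case (Suc j)
 show ?thesis unfolding Suc using assms by (intro Ck_on_SucI[where f'="\<lambda>x. f"] Ck_on_const)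
          (auto intro: bounded_linear_imp_has_derivative)
qed

lemma Ck_on_add:
 assumes "unique_derivs S" "Ck_on k S f" "Ck_on k S g"
 shows "Ck_on k S (\<lambda>x. f x + g x)" using assms(2,3)
proof (induction k arbitrary: f g)
 case (Suc k)
 note D = Ck_on_SucD[OF Suc.prems(1)] Ck_on_SucD[OF Suc.prems(2)]
 show ?case by (rule Ck_on_SucI[OF assms(1) has_derivative_add[OF D(1,3)] Suc.IH[OF D(2,4)]])
qed (simp add: continuous_on_add)

lemma Ck_on_mult:
 assumes "unique_derivs S" "Ck_on k S f" "Ck_on k S g"
 shows "Ck_on k S (\<lambda>x. f x * g x)" using assms(2,3)
proof (induction k arbitrary: f g)
 case (Suc k)
 note D = Ck_on_SucD[OF Suc.prems(1)] Ck_on_SucD[OF Suc.prems(2)]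
 note L = Suc.prems[THEN Ck_on_lower]
 show ?case by (rule Ck_on_SucI[OF assms(1) has_derivative_mult[OF D(1,3)]
     Ck_on_add[OF assms(1) Suc.IH[OF L(1) D(4)] Suc.IH[OF D(2) L(2)]]])
qed (simp add: continuous_on_mult)

lemma Ck_on_cmult: "unique_derivs S ==> Ck_on k S f ==> Ck_on k S (\<lambda>x. c * f x)" by (intro Ck_on_mult Ck_on_const)

lemma Ck_on_diff:
 "unique_derivs S ==> Ck_on k S f ==> Ck_on k S g ==> Ck_on k S (\<lambda>x. f x - g x)"
 using Ck_on_add[of S k f "\<lambda>x. (-1) * g x"] Ck_on_cmult[of S k g "-1"] by simp

lemma Ck_on_sum:
 assumes "unique_derivs S" "finite I" "\<And>i. i \<in> I ==> Ck_on k S (f i)"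
 shows "Ck_on k S (\<lambda>x. \<Sum>i\<in>I. f i x)"
 using assms(2,3) by (induction I rule: finite_induct) (auto intro: assms(1) Ck_on_add Ck_on_const)

lemma Ck_on_compose_real:
 fixes g :: "nat => real => real"
 assumes S: "unique_derivs S"
  and g: "\<And>n s. s \<in> I ==> (g n has_real_derivative g (Suc n) s) (at s)"
  and f: "Ck_on k S f" "f ` S \<subseteq> I"
 shows "Ck_on k S (\<lambda>x. g n (f x))" using f(1)
proof (induction k arbitrary: n)
 case 0
 have "continuous_on I (g n)" using g DERIV_isCont continuous_at_imp_continuous_on by blast
 with 0 f(2) show ?case by (auto intro: continuous_on_compose2)
next
 case (Suc k)
 show ?case
 proof (rule Ck_on_SucI[OF S, where f'="\<lambda>x v. g (Suc n) (f x) * frechet_derivative f (at x within S) v"])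
  fix x assume x: "x \<in> S"
  have "(g n has_derivative (*) (g (Suc n) (f x))) (at (f x))"
   using g f(2) x by (auto simp: has_field_derivative_def)
  from has_derivative_compose[OF Ck_on_SucD(1)[OF Suc.prems x] this]
  show "((\<lambda>x. g n (f x)) has_derivative
    (\<lambda>v. g (Suc n) (f x) * frechet_derivative f (at x within S) v)) (at x within S)" .
 next
  fix v show "Ck_on k S (\<lambda>x. g (Suc n) (f x) * frechet_derivative f (at x within S) v)"
   by (rule Ck_on_mult[OF S Suc.IH[OF Ck_on_lower[OF Suc.prems]] Ck_on_SucD(2)[OF Suc.prems]])
 qed
qed

lemma Ck_on_compose_affine:
 assumes S: "unique_derivs S'" and A: "bounded_linear A" and sub: "\<And>y. y \<in> S' ==> A y + c \<in> S"
  and f: "Ck_on k S f"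
 shows "Ck_on k S' (\<lambda>y. f (A y + c))" using f
proof (induction k arbitrary: f)
 case 0
 have "continuous_on S' (\<lambda>y. A y + c)" using A by (intro continuous_on_add continuous_on_const linear_continuous_on)
 with 0 sub show ?case by (auto intro!: continuous_on_compose2[of S f])
next
 case (Suc k)
 show ?case
 proof (rule Ck_on_SucI[OF S, where f'="\<lambda>y v. frechet_derivative f (at (A y + c) within S) (A v)"])
  fix y assume y: "y \<in> S'"
  have "((\<lambda>y. A y + c) has_derivative A) (at y within S')"
   using A by (auto intro!: derivative_eq_intros bounded_linear_imp_has_derivative)
  from has_derivative_in_compose2[OF Ck_on_SucD(1)[OF Suc.prems] _ y this] sub y
  show "((\<lambda>y. f (A y + c)) has_derivative
    (\<lambda>v. frechet_derivative f (at (A y + c) within S) (A v))) (at y within S')" by (auto simp: image_subset_iff)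
 next
  fix v show "Ck_on k S' (\<lambda>y. frechet_derivative f (at (A y + c) within S) (A v))"
   using Suc.IH[OF Ck_on_SucD(2)[OF Suc.prems]] .
 qed
qed

lemma Ck_on_powr:
 assumes "unique_derivs S" "Ck_on k S f" "\<And>x. x \<in> S ==> f x > 0"
 shows "Ck_on k S (\<lambda>x. f x powr a)"
proof -
 define g :: "nat => real => real" where "g n s = (\<Prod>i<n. a - real i) * s powr (a - real n)" for n s
 have "(g n has_real_derivative g (Suc n) s) (at s)" if "s \<in> {0<..}" for n s
 proof -
  have "((\<lambda>s. s powr (a - real n)) has_real_derivative (a - real n) * s powr (a - real n - 1)) (at s)"
   using that by (intro has_real_derivative_powr) simp
  from DERIV_cmult[OF this, of "\<Prod>i<n. a - real i"] show ?thesis by (simp add: g_def[abs_def] algebra_simps)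
 qed
 from Ck_on_compose_real[where g=g and I="{0<..}" and n=0, OF assms(1) this assms(2)] assms(3)
 show ?thesis by (auto simp: g_def)
qed

subsection \<open>bump\<close>

definition flat :: "real poly => real => real" where
 "flat p s = (if s > 0 then poly p (1/s) * exp (- (1/s)) else 0)"

definition flat_step :: "real poly => real poly" where
 "flat_step p = [:0, 0, 1:] * (p - pderiv p)"

lemma tendsto_poly_mult_exp_neg: "((\<lambda>x::real. poly p x * exp (- x)) \<longlongrightarrow> 0) at_top"
proof -
 have "((\<lambda>x. \<Sum>i\<le>degree p. coeff p i * (x ^ i / exp x)) \<longlongrightarrow> (\<Sum>i\<le>degree p. coeff p i * 0)) at_top"
  by (intro tendsto_intros tendsto_power_div_exp_0)
 thus ?thesis by (simp add: poly_altdef sum_distrib_right sum_divide_distrib exp_minus field_simps)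
qed

lemma DERIV_flat: "(flat p has_real_derivative flat (flat_step p) s) (at s)"
proof (cases s "0::real" rule: linorder_cases)
 case less
 have "((\<lambda>s. 0) has_real_derivative flat (flat_step p) s) (at s)" using less by (simp add: flat_def)
 thus ?thesis by (rule has_field_derivative_transform_within_open[where S="{..<0}"])
    (use less in \<open>auto simp: flat_def\<close>)
next
 case greater
 have i: "((\<lambda>s. 1/s) has_real_derivative - (1/s * (1/s))) (at s)"
  using greater by (auto intro!: derivative_eq_intros simp: field_simps)
 have "((\<lambda>s. poly p (1/s) * exp (- (1/s))) has_real_derivative
   poly (pderiv p) (1/s) * (- (1/s * (1/s))) * exp (- (1/s))
   + exp (- (1/s)) * (- (- (1/s * (1/s)))) * poly p (1/s)) (at s)"
  by (intro DERIV_mult DERIV_chain2[OF poly_DERIV i] DERIV_chain2[OF DERIV_exp] DERIV_minus i)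
 hence "((\<lambda>s. poly p (1/s) * exp (- (1/s))) has_real_derivative flat (flat_step p) s) (at s)"
  using greater by (simp add: flat_def flat_step_def algebra_simps)
 thus ?thesis by (rule has_field_derivative_transform_within_open[where S="{0<..}"])
    (use greater in \<open>auto simp: flat_def\<close>)
next
 case equal
 have "((\<lambda>h. poly (pCons 0 p) (inverse h) * exp (- inverse h)) \<longlongrightarrow> 0) (at_right (0::real))"
  using filterlim_compose[OF tendsto_poly_mult_exp_neg filterlim_inverse_at_top_right] .
 hence r: "((\<lambda>h. (flat p h - flat p 0) / h) \<longlongrightarrow> 0) (at_right 0)" by (rule Lim_transform_eventually)
    (auto simp: eventually_at_filter flat_def field_simps)
 have l: "((\<lambda>h. (flat p h - flat p 0) / h) \<longlongrightarrow> 0) (at_left 0)"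
  by (rule Lim_transform_eventually[OF tendsto_const]) (auto simp: eventually_at_filter flat_def)
 show ?thesis unfolding equal using filterlim_split_at[OF l r] by (simp add: DERIV_def flat_def)
qed

lemma Ck_on_flat: 
 assumes "unique_derivs S" "Ck_on k S f"
 shows "Ck_on k S (\<lambda>x. flat p (f x))"
 using Ck_on_compose_real[where g="\<lambda>n. flat ((flat_step ^^ n) p)" and n=0 and I=UNIV, OF assms(1) _ assms(2)]
 by (simp add: DERIV_flat)

definition bump :: "'a::euclidean_space => real" where
 "bump x = flat 1 (1 - x \<bullet> x)"

lemma Ck_on_inner: "unique_derivs S ==> Ck_on k S (\<lambda>x. x \<bullet> c)"
 by (intro Ck_on_bounded_linear bounded_linear_inner_left)

lemma Ck_on_norm_square:
 fixes S :: "'a::euclidean_space set"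
 assumes "unique_derivs S" shows "Ck_on k S (\<lambda>x. x \<bullet> x)"
proof -
 have "Ck_on k S (\<lambda>x. \<Sum>i\<in>Basis. (x \<bullet> i) * (x \<bullet> i))" using assms by (intro Ck_on_sum Ck_on_mult Ck_on_inner) auto
 thus ?thesis by (simp add: euclidean_inner[symmetric])
qed

lemma test_functionI:
 assumes "\<And>k. Ck_on k UNIV \<psi>" "\<And>x. norm x > r ==> \<psi> x = 0"
 shows "\<psi> \<in> test_functions" unfolding test_functions_def smooth_on_def
 using assms by (auto intro!: exI[of _ "cball 0 r"])

lemma test_functionD: "\<psi> \<in> test_functions ==> Ck_on k UNIV \<psi>" by (simp add: test_functions_def smooth_on_def)

lemma test_function_support:
 assumes "\<psi> \<in> test_functions"
 obtains r where "r > 0" "\<And>x. norm x > r ==> \<psi> x = 0"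
proof -
 obtain K where K: "compact K" "\<And>x. x \<notin> K ==> \<psi> x = 0" using assms by (auto simp: test_functions_def)
 obtain r where "r > 0" "\<And>x. x \<in> K ==> norm x \<le> r" using compact_imp_bounded[OF K(1)] unfolding bounded_pos by blast
 with K(2) show ?thesis by (intro that[of r]) (fastforce simp: not_le)+
qed

lemma bump_nonneg: "bump x \<ge> 0" by (simp add: bump_def flat_def)
lemma bump_pos: "norm x < 1 ==> bump x > 0"
 by (simp add: bump_def flat_def dot_square_norm power2_eq_square abs_square_less_1[simplified power2_eq_square])
lemma bump_support: "norm x > 1 ==> bump x = 0"
proof -
 assume "norm x > 1"
 hence "(norm x)\<^sup>2 > 1" by (simp add: one_less_power)
 thus ?thesis by (simp add: bump_def flat_def dot_square_norm)
qed

lemma bump_test_function: "bump \<in> test_functions"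
proof (rule test_functionI)
 fix k
 have "Ck_on k UNIV (\<lambda>x::'a. flat 1 (1 - x \<bullet> x))"
  by (intro Ck_on_flat Ck_on_diff Ck_on_const Ck_on_norm_square unique_derivs_UNIV)
 thus "Ck_on k UNIV (bump :: 'a => real)" by (simp only: bump_def[abs_def])
qed (rule bump_support)


subsection \<open>measure\<close>

lemma nn_integral_lborel_shift:
 fixes f :: "'a::euclidean_space => ennreal"
 assumes [measurable]: "f \<in> Borel"
 shows "(NNBINT x. f (x - h)) = (NNBINT x. f x)"
proof -
 have "(NNBINT x. f x) = (\<integral>\<^sup>+x. f x \<partial>distr lborel borel ((+) (-h)))" by (simp only: lborel_distr_plus)
 also have "\<dots> = (NNBINT x. f (x - h))" by (subst nn_integral_distr) auto
 finally show ?thesis ..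
qed

lemma nn_integral_lborel_affine:
 fixes f :: "'a::euclidean_space => ennreal"
 assumes [measurable]: "f \<in> Borel" and "c \<noteq> 0"
 shows "(NNBINT x. f x) = ennreal (\<bar>c\<bar> ^ DIM('a)) * (NNBINT x. f (t + c *\<^sub>R x))"
 by (subst lborel_affine[OF assms(2), of t])
   (simp add: nn_integral_density nn_integral_distr nn_integral_cmult)

lemma has_bochner_integral_lborel_affine:
 fixes f :: "'a::euclidean_space => 'b::{banach, second_countable_topology}"
 assumes [measurable]: "f \<in> Borel" and "c \<noteq> 0"
 shows "L1 (\<lambda>x. f (t + c *\<^sub>R x)) \<longleftrightarrow> L1 f"
  and "(LBINT x. f x) = \<bar>c\<bar> ^ DIM('a) *\<^sub>R (LBINT x. f (t + c *\<^sub>R x))"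
proof -
 have c: "\<bar>c\<bar> ^ DIM('a) > 0" using assms by simp
 have "L1 f \<longleftrightarrow>
   integrable (density (distr lborel borel (\<lambda>x. t + c *\<^sub>R x)) (\<lambda>_. ennreal (\<bar>c\<bar>^DIM('a)))) f"
  by (simp only: lborel_affine[OF assms(2), of t, symmetric])
 also have "\<dots> \<longleftrightarrow> L1 (\<lambda>x. \<bar>c\<bar> ^ DIM('a) *\<^sub>R f (t + c *\<^sub>R x))"
  using c by (subst integrable_density) (auto simp: integrable_distr_eq)
 also have "\<dots> \<longleftrightarrow> L1 (\<lambda>x. f (t + c *\<^sub>R x))"
 proof
  assume "L1 (\<lambda>x. \<bar>c\<bar> ^ DIM('a) *\<^sub>R f (t + c *\<^sub>R x))"
  from integrable_scaleR_right[OF this, of "inverse (\<bar>c\<bar> ^ DIM('a))"] c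
  show "L1 (\<lambda>x. f (t + c *\<^sub>R x))" by simp
 qed simp
 finally show "L1 (\<lambda>x. f (t + c *\<^sub>R x)) \<longleftrightarrow> L1 f" ..
 have "(LBINT x. f x) =
   (\<integral>x. f x \<partial>density (distr lborel borel (\<lambda>x. t + c *\<^sub>R x)) (\<lambda>_. ennreal (\<bar>c\<bar>^DIM('a))))"
  by (simp only: lborel_affine[OF assms(2), of t, symmetric])
 also have "\<dots> = (LBINT x. \<bar>c\<bar> ^ DIM('a) *\<^sub>R f (t + c *\<^sub>R x))"
  using c by (subst integral_density) (auto simp: integral_distr)
 finally show "(LBINT x. f x) = \<bar>c\<bar> ^ DIM('a) *\<^sub>R (LBINT x. f (t + c *\<^sub>R x))" by simp
qed

lemma lborel_inner_compact:
 fixes A :: "'a::euclidean_space set"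
 assumes A: "A \<in> sets borel" "emeasure lborel A < \<infinity>" and "e > 0"
 obtains K where "compact K" "K \<subseteq> A" "emeasure lborel (A - K) < ennreal e"
proof -
 have "e/3 > 0" using \<open>e > 0\<close> by simp
 with sets_lebesgue_inner_closed[of A "e/3"] A
 obtain C where C: "closed C" "C \<subseteq> A" "emeasure lebesgue (A - C) < ennreal (e/3)"
  by (metis sets_completionI_sets sets_lborel)
 have AC: "A - C \<in> sets borel" using A C by auto
 have "(\<lambda>n. emeasure lborel (A - cball 0 (real n))) \<longlonglongrightarrow> emeasure lborel (\<Inter>n. A - cball 0 (real n))"
 proof (rule Lim_emeasure_decseq)
  show "range (\<lambda>n. A - cball 0 (real n)) \<subseteq> sets lborel" using A by auto
  show "decseq (\<lambda>n. A - cball 0 (real n))" by (auto simp: decseq_def)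
  show "emeasure lborel (A - cball 0 (real n)) \<noteq> \<infinity>" for n
   using A emeasure_mono[of "A - cball 0 (real n)" A lborel] by (auto simp: top_unique)
 qed
 moreover have "(\<Inter>n. A - cball 0 (real n)) = {}" using real_arch_simple[where 'a=real] by (auto simp: not_le)
 ultimately have "(\<lambda>n. emeasure lborel (A - cball 0 (real n))) \<longlonglongrightarrow> 0" by (metis emeasure_empty)
 hence "eventually (\<lambda>n. emeasure lborel (A - cball 0 (real n)) < ennreal (e/3)) sequentially"
  using \<open>e > 0\<close> by (intro order_tendstoD) auto
 then obtain n where n: "emeasure lborel (A - cball 0 (real n)) < ennreal (e/3)"
  by (auto simp: eventually_sequentially)
 show ?thesis
 proof
  show "compact (C \<inter> cball 0 (real n))" using C by (simp add: closed_Int_compact)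
  have "emeasure lborel (A - C \<inter> cball 0 (real n)) \<le> emeasure lborel (A - C) + emeasure lborel (A - cball 0 (real n))"
   using A AC by (intro order_trans[OF emeasure_mono emeasure_subadditive]) auto
  also have "\<dots> \<le> ennreal (e/3) + ennreal (e/3)"
   using C(3)[THEN less_imp_le] n[THEN less_imp_le] AC by (intro add_mono) auto
  also have "\<dots> = ennreal (e/3 + e/3)"
   using \<open>e > 0\<close> by (simp only: ennreal_plus divide_nonneg_nonneg less_imp_le zero_le_numeral)
  also have "\<dots> < ennreal e" using \<open>e > 0\<close> by (intro ennreal_lessI) auto
  finally show "emeasure lborel (A - C \<inter> cball 0 (real n)) < ennreal e" .
 qed (use C in auto)
qed

text \<open>translation continuity\<close>

definition shift_diff :: "('b::euclidean_space => real) => 'b => ennreal" where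
 "shift_diff f h = (NNBINT x. ennreal \<bar>f (x - h) - f x\<bar>)"

lemma shift_diff_small:
 fixes f :: "'b::euclidean_space => real"
 assumes "L1 f" "e > 0"
 shows "\<exists>d>0. \<forall>h. norm h < d --> shift_diff f h \<le> ennreal e" using assms
proof (induction f arbitrary: e rule: integrable_induct)
 case (base A c)
 define e' where "e' = e / (4 * (\<bar>c\<bar> + 1))"
 have "e' > 0" using base by (simp add: e'_def add_nonneg_pos)
 have A[measurable]: "A \<in> sets borel" using base by auto
 obtain U where U: "open U" "A \<subseteq> U" "emeasure lborel (U - A) < ennreal e'"
  using outer_regular_lborel[OF A \<open>e' > 0\<close>] by auto
 obtain K where K: "compact K" "K \<subseteq> A" "emeasure lborel (A - K) < ennreal e'"
  using lborel_inner_compact[OF A _ \<open>e' > 0\<close>] base by auto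
 have [measurable]: "U \<in> sets borel" "K \<in> sets borel" using U K by (auto intro: borel_compact)
 obtain d where d: "d > 0" "\<And>x y. x \<in> K ==> y \<in> - U ==> d \<le> dist x y"
  using separate_compact_closed[of K "- U"] U K by blast
 have "shift_diff (\<lambda>x. ind A x *\<^sub>R c) h \<le> ennreal e" if h: "norm h < d" for h
 proof -
  have in_U: "x \<in> K ==> norm (x - y) < d ==> y \<in> U" for x y using d(2)[of x y] by (auto simp: dist_norm)
  have "ennreal \<bar>ind A (x - h) *\<^sub>R c - ind A x *\<^sub>R c\<bar> \<le>
    ennreal \<bar>c\<bar> * (ind (A - K) (x - h) + ind (U - A) (x - h)
     + (ind (A - K) x + ind (U - A) x))" for x
  proof (cases "(x - h \<in> A) = (x \<in> A)")
   case False
   hence "(1::ennreal) \<le> ind (A - K) (x - h) + ind (U - A) (x - h)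
     + (ind (A - K) x + ind (U - A) x)" using in_U[of "x - h" x] in_U[of x "x - h"] h by (auto simp: indicator_def)
   moreover have "\<bar>ind A (x - h) *\<^sub>R c - ind A x *\<^sub>R c\<bar> = \<bar>c\<bar>" using False by (auto simp: indicator_def)
   ultimately show ?thesis by (metis mult.right_neutral mult_left_mono zero_le)
  qed (simp add: indicator_def)
  hence "shift_diff (\<lambda>x. ind A x *\<^sub>R c) h \<le>
    (NNBINT x. ennreal \<bar>c\<bar> * (ind (A - K) (x - h) + ind (U - A) (x - h)
     + (ind (A - K) x + ind (U - A) x)))" unfolding shift_diff_def by (intro nn_integral_mono) auto
  also have "\<dots> = ennreal \<bar>c\<bar> * ((NNBINT x. ind (A - K) (x - h)) + (NNBINT x. ind (U - A) (x - h))
     + (emeasure lborel (A - K) + emeasure lborel (U - A)))" by (simp add: nn_integral_cmult nn_integral_add)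
  also have "\<dots> = ennreal \<bar>c\<bar> * (emeasure lborel (A - K) + emeasure lborel (U - A)
     + (emeasure lborel (A - K) + emeasure lborel (U - A)))" by (subst (1 2) nn_integral_lborel_shift) auto
  also have "\<dots> \<le> ennreal \<bar>c\<bar> * (ennreal e' + ennreal e' + (ennreal e' + ennreal e'))"
   using U(3)[THEN less_imp_le] K(3)[THEN less_imp_le] by (intro mult_left_mono add_mono) auto
  also have "ennreal e' + ennreal e' + (ennreal e' + ennreal e') = ennreal (e' + e' + (e' + e'))"
   using \<open>e' > 0\<close> by (simp only: ennreal_plus add_nonneg_nonneg less_imp_le)
  also have "ennreal \<bar>c\<bar> * \<dots> = ennreal (\<bar>c\<bar> * (4 * e'))" using \<open>e' > 0\<close> by (simp add: ennreal_mult)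
  also have "\<dots> \<le> ennreal e" using base by (intro ennreal_leI) (auto simp: e'_def field_simps)
  finally show ?thesis .
 qed
 with d show ?case by blast
next
 case (add f g)
 have [measurable]: "f \<in> Borel" "g \<in> Borel" using add.hyps by auto
 obtain d1 d2 where d: "d1 > 0" "\<And>h. norm h < d1 ==> shift_diff f h \<le> ennreal (e/2)"
   "d2 > 0" "\<And>h. norm h < d2 ==> shift_diff g h \<le> ennreal (e/2)" using add.IH[of "e/2"] add.prems by auto
 have "shift_diff (\<lambda>x. f x + g x) h \<le> ennreal e" if h: "norm h < min d1 d2" for h
 proof -
  have "shift_diff (\<lambda>x. f x + g x) h \<le> (NNBINT x. ennreal \<bar>f (x - h) - f x\<bar> + ennreal \<bar>g (x - h) - g x\<bar>)"
   unfolding shift_diff_def by (intro nn_integral_mono) (auto simp flip: ennreal_plus intro!: ennreal_leI)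
  also have "\<dots> = shift_diff f h + shift_diff g h" unfolding shift_diff_def by (intro nn_integral_add) auto
  also have "\<dots> \<le> ennreal (e/2) + ennreal (e/2)" using d h by (intro add_mono) auto
  finally show ?thesis using add.prems by (simp flip: ennreal_plus)
 qed
 thus ?case using d by (intro exI[of _ "min d1 d2"]) auto
next
 case (lim f s)
 have [measurable]: "f \<in> Borel" "s n \<in> Borel" for n using lim.hyps by auto
 have int: "L1 (s n)" for n using lim.hyps by auto
 have "(\<lambda>n. NNBINT x. ennreal (norm (f x - s n x))) \<longlonglongrightarrow> 0"
 proof (rule nn_integral_dominated_convergence_norm[where w="\<lambda>x. 2 * norm (f x)"])
  show "(NNBINT x. ennreal (2 * norm (f x))) < \<infinity>"
   using lim.hyps(4) by (simp add: integrable_iff_bounded nn_integral_cmult ennreal_mult ennreal_mult_less_top)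
 qed (use lim.hyps in auto)
 hence "eventually (\<lambda>n. (NNBINT x. ennreal (norm (f x - s n x))) < ennreal (e/3)) sequentially"
  using lim.prems by (intro order_tendstoD) auto
 then obtain n where n: "(NNBINT x. ennreal \<bar>f x - s n x\<bar>) < ennreal (e/3)" by (auto simp: eventually_sequentially)
 obtain d where d: "d > 0" "\<And>h. norm h < d ==> shift_diff (s n) h \<le> ennreal (e/3)"
  using lim.IH[of "e/3" n] lim.prems by auto
 have "shift_diff f h \<le> ennreal e" if h: "norm h < d" for h
 proof -
  have "shift_diff f h \<le> (NNBINT x. ennreal \<bar>f (x - h) - s n (x - h)\<bar> + ennreal \<bar>s n (x - h) - s n x\<bar>
    + ennreal \<bar>f x - s n x\<bar>)" unfolding shift_diff_def
   by (intro nn_integral_mono) (auto simp flip: ennreal_plus intro!: ennreal_leI)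
  also have "\<dots> = (NNBINT x. ennreal \<bar>f (x - h) - s n (x - h)\<bar>) + shift_diff (s n) h
    + (NNBINT x. ennreal \<bar>f x - s n x\<bar>)" by (simp add: shift_diff_def nn_integral_add)
  also have "(NNBINT x. ennreal \<bar>f (x - h) - s n (x - h)\<bar>) = (NNBINT x. ennreal \<bar>f x - s n x\<bar>)"
   by (rule nn_integral_lborel_shift[of "\<lambda>x. ennreal \<bar>f x - s n x\<bar>"]) auto
  also have "(NNBINT x. ennreal \<bar>f x - s n x\<bar>) + shift_diff (s n) h
    + (NNBINT x. ennreal \<bar>f x - s n x\<bar>) \<le> ennreal (e/3) + ennreal (e/3) + ennreal (e/3)"
   using n d(2)[OF h] by (intro add_mono) auto
  also have "\<dots> = ennreal e" using lim.prems by (simp flip: ennreal_plus)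
  finally show ?thesis .
 qed
 with d show ?case by blast
qed

text \<open>mollification\<close>

lemma mollification_L1:
 fixes f :: "'b::euclidean_space => real" and k :: "'a::euclidean_space => real"
 assumes f: "L1 f" and k[measurable]: "k \<in> Borel"
  and k0: "\<And>z. 0 \<le> k z" and kM: "\<And>z. k z \<le> M" and k1: "L1 k" "(LBINT z. k z) = 1"
  and supp: "\<And>z. norm z > d ==> k z = 0"
  and L[measurable]: "L \<in> Borel" and Ld: "\<And>z. norm z \<le> d ==> shift_diff f (L z) \<le> e"
  and int: "AE x in lborel. L1 (\<lambda>z. f (x - L z) * k z)"
 shows "(NNBINT x. ennreal \<bar>(LBINT z. f (x - L z) * k z) - f x\<bar>) \<le> e"
proof -
 have [measurable]: "f \<in> Borel" using f by auto
 have kn: "(NNBINT z. ennreal (k z)) = 1" using k0 k1 by (subst nn_integral_eq_integral) auto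
 have "(NNBINT x. ennreal \<bar>(LBINT z. f (x - L z) * k z) - f x\<bar>)
   \<le> (NNBINT x. (NNBINT z. ennreal (\<bar>f (x - L z) - f x\<bar> * k z)))" using int
 proof (intro nn_integral_mono_AE, eventually_elim)
  fix x assume i: "L1 (\<lambda>z. f (x - L z) * k z)"
  have "(LBINT z. f (x - L z) * k z) - f x = (LBINT z. f (x - L z) * k z - f x * k z)"
   using i k1 by (subst int_diff) auto
  also have "ennreal \<bar>\<dots>\<bar> \<le> (NNBINT z. ennreal \<bar>f (x - L z) * k z - f x * k z\<bar>)"
   using integral_norm_bound_ennreal[of lborel "\<lambda>z. f (x - L z) * k z - f x * k z"] i k1 by auto
  also have "\<dots> = (NNBINT z. ennreal (\<bar>f (x - L z) - f x\<bar> * k z))"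
   using k0 by (intro nn_integral_cong) (simp add: abs_mult flip: left_diff_distrib)
  finally show "ennreal \<bar>(LBINT z. f (x - L z) * k z) - f x\<bar>
   \<le> (NNBINT z. ennreal (\<bar>f (x - L z) - f x\<bar> * k z))" .
 qed
 also have "\<dots> = (NNBINT z. (NNBINT x. ennreal (\<bar>f (x - L z) - f x\<bar> * k z)))" by (rule lborel_pair.Fubini') auto
 also have "\<dots> = (NNBINT z. shift_diff f (L z) * ennreal (k z))" unfolding shift_diff_def using k0
  by (intro nn_integral_cong) (simp add: ennreal_mult nn_integral_multc)
 also have "\<dots> \<le> (NNBINT z. e * ennreal (k z))"
  using Ld supp by (intro nn_integral_mono) (metis ennreal_0 le_less_linear mult_right_mono mult_zero_right order_refl zero_le)
 also have "\<dots> = e" by (simp add: nn_integral_cmult kn)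
 finally show ?thesis .
qed


lemma test_has_derivative:
 "\<psi> \<in> test_functions ==> (\<psi> has_derivative frechet_derivative \<psi> (at x)) (at x)"
 using Ck_on_SucD(1)[OF test_functionD[of \<psi> "Suc 0"]] by auto

lemma has_derivative_zero_outside:
 assumes "\<And>x. norm x > r ==> \<psi> x = 0" "norm x > r"
 shows "(\<psi> has_derivative (\<lambda>v. 0)) (at x)"
proof -
 have "open {x::'a. norm x > r}" by (intro open_Collect_less continuous_intros)
 from has_derivative_transform_within_open[OF has_derivative_const this, of x 0 \<psi>] assms
 show ?thesis by auto
qed

lemma test_deriv:
 assumes "\<psi> \<in> test_functions"
 shows "(\<lambda>x. frechet_derivative \<psi> (at x) v) \<in> test_functions"
proof -
 obtain r where r: "\<And>x. norm x > r ==> \<psi> x = 0" using test_function_support[OF assms] by auto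
 show ?thesis
 proof (rule test_functionI)
  fix k show "Ck_on k UNIV (\<lambda>x. frechet_derivative \<psi> (at x) v)"
   using Ck_on_SucD(2)[OF test_functionD[OF assms, of "Suc k"]] .
 next
  fix x :: 'a assume x: "norm x > r"
  have "(\<psi> has_derivative (\<lambda>x. 0)) (at x)" using has_derivative_zero_outside[of r \<psi>] r x by blast
  from frechet_derivative_at[OF this] show "frechet_derivative \<psi> (at x) v = 0" by metis
 qed
qed

lemma test_continuous: "\<psi> \<in> test_functions ==> continuous_on UNIV \<psi>" using test_functionD[of \<psi> 0] by simp

lemma test_measurable[measurable_dest]: "\<psi> \<in> test_functions ==> \<psi> \<in> Borel"
 by (intro borel_measurable_continuous_onI test_continuous)

lemma test_bounded:
 assumes "\<psi> \<in> test_functions"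
 obtains C where "C > 0" "\<And>x. \<bar>\<psi> x\<bar> \<le> C"
proof -
 obtain r where r: "\<And>x. norm x > r ==> \<psi> x = 0" using test_function_support[OF assms] by auto
 have "compact (\<psi> ` cball 0 r)"
  by (rule compact_continuous_image[OF continuous_on_subset[OF test_continuous[OF assms] subset_UNIV] compact_cball])
 from compact_imp_bounded[OF this] obtain C where C: "C > 0" "\<forall>y\<in>\<psi> ` cball 0 r. norm y \<le> C"
  unfolding bounded_pos by auto
 have "\<bar>\<psi> x\<bar> \<le> C" for x
 proof (cases "norm x > r")
  case True
  thus ?thesis using r[of x] C by simp
 next
  case False
  hence "\<psi> x \<in> \<psi> ` cball 0 r" by simp
  thus ?thesis using C(2) real_norm_def by metis
 qed
 with C show ?thesis by (intro that[of C]) auto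
qed

lemma integrable_bounded_support:
 fixes f :: "'a::euclidean_space => 'b::{banach, second_countable_topology}"
 assumes "f \<in> Borel" "\<And>x. norm (f x) \<le> C" "\<And>x. norm x > r ==> f x = 0"
 shows "L1 f"
proof (rule L1_bound)
 show "L1 (\<lambda>x. ind (cball 0 r) x *\<^sub>R C)"
  by (intro integrable_scaleR_left integrable_real_indicator) (use emeasure_lborel_cball_finite[of 0 r] in auto)
 show "AE x in lborel. norm (f x) \<le> norm (ind (cball 0 r) x *\<^sub>R C)"
  using assms(2,3) by (auto simp: indicator_def not_le intro: order_trans[OF _ abs_ge_self])
qed (use assms in auto)

lemma integrable_bounded_mult:
 fixes k u :: "'a => real"
 assumes "integrable M k" "u \<in> borel_measurable M" "AE x in M. \<bar>u x\<bar> \<le> C"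
 shows "integrable M (\<lambda>x. u x * k x)"
proof (rule L1_bound)
 show "integrable M (\<lambda>x. C * k x)" using assms by simp
 show "AE x in M. norm (u x * k x) \<le> norm (C * k x)"
  using assms(3) by eventually_elim (auto simp: abs_mult intro!: mult_right_mono)
qed (use assms in auto)

lemma test_integrable: "\<psi> \<in> test_functions ==> L1 \<psi>"
 by (rule test_function_support, assumption, rule test_bounded, assumption)
   (rule integrable_bounded_support, auto dest: test_measurable)

lemma gradient_inner:
 assumes "\<psi> \<in> test_functions"
 shows "frechet_derivative \<psi> (at x) v = gradient \<psi> x \<bullet> v"
proof -
 interpret bounded_linear "frechet_derivative \<psi> (at x)"
  using test_has_derivative[OF assms] has_derivative_bounded_linear by blast
 have "frechet_derivative \<psi> (at x) v = frechet_derivative \<psi> (at x) (\<Sum>i\<in>Basis. (v \<bullet> i) *\<^sub>R i)"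
  by (simp add: euclidean_representation)
 also have "\<dots> = gradient \<psi> x \<bullet> v"
  by (simp add: sum scaleR gradient_def inner_sum_right inner_commute[of _ v] mult.commute)
 finally show ?thesis .
qed

lemma gradient_has_derivative:
 "\<psi> \<in> test_functions ==> (\<psi> has_derivative (\<lambda>v. gradient \<psi> x \<bullet> v)) (at x)"
 by (rule has_derivative_eq_rhs[OF test_has_derivative]) (auto simp: gradient_inner)

lemma gradient_eqI: "(f has_derivative (\<lambda>v. g \<bullet> v)) (at x) ==> gradient f x = g"
 unfolding gradient_def by (subst frechet_derivative_at[symmetric]) (auto simp: euclidean_representation)

lemma test_gradient_component: "\<psi> \<in> test_functions ==> (\<lambda>x. gradient \<psi> x \<bullet> v) \<in> test_functions"
 using test_deriv[of \<psi> v] by (simp add: gradient_inner)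

lemma gradient_measurable[measurable_dest]:
 assumes "\<psi> \<in> test_functions" shows "gradient \<psi> \<in> Borel" using test_gradient_component[OF assms, THEN test_measurable]
 by (simp add: borel_measurable_euclidean_space[where f="gradient \<psi>"])

lemma gradient_support:
 assumes "\<psi> \<in> test_functions" "\<And>x. norm x > r ==> \<psi> x = 0" "norm x > r"
 shows "gradient \<psi> x = 0"
proof (rule gradient_eqI)
 show "(\<psi> has_derivative (\<lambda>v. 0 \<bullet> v)) (at x)" using has_derivative_zero_outside[of r \<psi> x] assms by simp
qed

lemma gradient_bounded:
 assumes "\<psi> \<in> test_functions"
 obtains C where "C > 0" "\<And>x. norm (gradient \<psi> x) \<le> C"
proof -
 have "\<exists>C. \<forall>x. \<bar>gradient \<psi> x \<bullet> i\<bar> \<le> C" for i using test_bounded[OF test_gradient_component[OF assms, of i]] by metis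
 then obtain C where C: "\<And>i x. \<bar>gradient \<psi> x \<bullet> i\<bar> \<le> C i" by metis
 have "norm (gradient \<psi> x) \<le> (\<Sum>i\<in>Basis. C i)" for x by (rule order_trans[OF norm_le_l1 sum_mono]) (use C in auto)
 thus ?thesis by (intro that[of "\<bar>\<Sum>i\<in>Basis. C i\<bar> + 1"]) (auto intro: order_trans[OF _ add_increasing2[OF _ abs_ge_self]])
qed

lemma test_mult_smooth:
 assumes "\<psi> \<in> test_functions" "\<And>k. Ck_on k UNIV f"
 shows "(\<lambda>x. f x * \<psi> x) \<in> test_functions"
proof -
 obtain r where r: "\<And>x. norm x > r ==> \<psi> x = 0" using test_function_support[OF assms(1)] by auto
 show ?thesis by (rule test_functionI[where r=r])
    (simp_all add: r Ck_on_mult[OF unique_derivs_UNIV assms(2) test_functionD[OF assms(1)]])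
qed

lemma test_cmult: "\<psi> \<in> test_functions ==> (\<lambda>x. c * \<psi> x) \<in> test_functions"
 by (intro test_mult_smooth Ck_on_const unique_derivs_UNIV)

lemma test_affine:
 fixes \<psi> :: "'a::euclidean_space => real"
 assumes "\<psi> \<in> test_functions" "a \<noteq> 0"
 shows "(\<lambda>y. \<psi> (c + a *\<^sub>R y)) \<in> test_functions"
proof -
 obtain r where r: "\<And>x. norm x > r ==> \<psi> x = 0" using test_function_support[OF assms(1)] by auto
 show ?thesis
 proof (rule test_functionI[where r="(\<bar>r\<bar> + norm c) / \<bar>a\<bar>"])
  fix k show "Ck_on k UNIV (\<lambda>y. \<psi> (c + a *\<^sub>R y))"
   using Ck_on_compose_affine[where A="\<lambda>y. a *\<^sub>R y" and c=c and S=UNIV, OF unique_derivs_UNIV _ _ test_functionD[OF assms(1)], of k]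
   by (simp add: add.commute bounded_linear_scaleR_right)
 next
  fix y :: 'a assume "norm y > (\<bar>r\<bar> + norm c) / \<bar>a\<bar>"
  hence "norm (a *\<^sub>R y) > \<bar>r\<bar> + norm c" using assms(2) by (simp add: field_simps)
  moreover have "norm (a *\<^sub>R y) \<le> norm (c + a *\<^sub>R y) + norm c"
   by (metis add_diff_cancel_left' norm_triangle_sub add.commute norm_triangle_ineq4)
  ultimately show "\<psi> (c + a *\<^sub>R y) = 0" by (intro r) auto
 qed
qed

lemma gradient_affine:
 assumes "\<psi> \<in> test_functions"
 shows "gradient (\<lambda>y. \<psi> (c + a *\<^sub>R y)) y = a *\<^sub>R gradient \<psi> (c + a *\<^sub>R y)"
proof (rule gradient_eqI)
 have "((\<lambda>y. c + a *\<^sub>R y) has_derivative (\<lambda>v. a *\<^sub>R v)) (at y)" by (auto intro!: derivative_eq_intros)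
 from has_derivative_compose[OF this gradient_has_derivative[OF assms]]
 show "((\<lambda>y. \<psi> (c + a *\<^sub>R y)) has_derivative (\<lambda>v. (a *\<^sub>R gradient \<psi> (c + a *\<^sub>R y)) \<bullet> v)) (at y)" by simp
qed

lemma test_reflect: "\<psi> \<in> test_functions ==> (\<lambda>y. \<psi> (x - y)) \<in> test_functions" using test_affine[of \<psi> "-1" x] by simp

lemma gradient_reflect: "\<psi> \<in> test_functions ==> gradient (\<lambda>y. \<psi> (x - y)) y = - gradient \<psi> (x - y)"
 using gradient_affine[of \<psi> x "-1" y] by simp

text \<open>uniform differentiability\<close>

lemma test_lipschitz:
 assumes "\<psi> \<in> test_functions"
 obtains C where "C > 0" "\<And>x y. \<bar>\<psi> x - \<psi> y\<bar> \<le> C * norm (x - y)"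
proof -
 obtain C where C: "C > 0" "\<And>x. norm (gradient \<psi> x) \<le> C" using gradient_bounded[OF assms] by metis
 have "norm (\<psi> x - \<psi> y) \<le> C * norm (x - y)" for x y
 proof (rule differentiable_bound[where S=UNIV and f'="\<lambda>x v. gradient \<psi> x \<bullet> v"])
  fix x
  show "(\<psi> has_derivative (\<lambda>v. gradient \<psi> x \<bullet> v)) (at x within UNIV)" using gradient_has_derivative[OF assms] by simp
  show "onorm (\<lambda>v. gradient \<psi> x \<bullet> v) \<le> C"
   using C(1) by (intro onorm_bound) (auto intro: order_trans[OF Cauchy_Schwarz_ineq2 mult_right_mono[OF C(2)]])
 qed auto
 with C show ?thesis by (intro that[of C]) auto
qed

lemma gradient_lipschitz:
 assumes "\<psi> \<in> test_functions"
 obtains C where "C > 0" "\<And>x y. norm (gradient \<psi> x - gradient \<psi> y) \<le> C * norm (x - y)"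
proof -
 have "\<exists>C>0. \<forall>x y. \<bar>gradient \<psi> x \<bullet> i - gradient \<psi> y \<bullet> i\<bar> \<le> C * norm (x - y)" for i
  using test_lipschitz[OF test_gradient_component[OF assms, of i]] by metis
 then obtain C where C: "\<And>i. C i > 0" "\<And>i x y. \<bar>gradient \<psi> x \<bullet> i - gradient \<psi> y \<bullet> i\<bar> \<le> C i * norm (x - y)" by metis
 have "norm (gradient \<psi> x - gradient \<psi> y) \<le> (\<Sum>i\<in>Basis. C i) * norm (x - y)" for x y unfolding sum_distrib_right
  by (rule order_trans[OF norm_le_l1 sum_mono]) (use C in \<open>simp add: inner_diff_left\<close>)
 moreover have "(\<Sum>i\<in>Basis. C i) > 0" using C by (intro sum_pos) auto
 ultimately show ?thesis by (intro that)
qed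

lemma test_uniformly_differentiable:
 assumes "\<psi> \<in> test_functions" "e > 0"
 obtains d where "d > 0" "\<And>x h. norm h < d ==> \<bar>\<psi> (x + h) - \<psi> x - gradient \<psi> x \<bullet> h\<bar> \<le> e * norm h"
proof -
 obtain C where C: "C > 0" "\<And>x y. norm (gradient \<psi> x - gradient \<psi> y) \<le> C * norm (x - y)"
  using gradient_lipschitz[OF assms(1)] by metis
 obtain d where d: "d > 0" "\<And>x y. dist y x < d ==> dist (gradient \<psi> y) (gradient \<psi> x) < e"
 proof (rule that)
  show "e / C > 0" using C assms(2) by simp
  show "dist (gradient \<psi> y) (gradient \<psi> x) < e" if "dist y x < e / C" for x y
   using C(1) that by (intro le_less_trans[OF C(2)[of y x, folded dist_norm]]) (simp add: field_simps)
 qed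
 show ?thesis
 proof (rule that[OF d(1)])
  fix x h :: 'a assume h: "norm h < d"
  have "norm (\<psi> (x + h) - \<psi> x - (\<lambda>v. gradient \<psi> x \<bullet> v) (x + h - x)) \<le> norm (x + h - x) * e"
  proof (rule differentiable_bound_linearization[where S="ball x d" and f'="\<lambda>y v. gradient \<psi> y \<bullet> v"])
   fix y assume y: "y \<in> ball x d"
   show "(\<psi> has_derivative (\<lambda>v. gradient \<psi> y \<bullet> v)) (at y within ball x d)"
    using gradient_has_derivative[OF assms(1)] has_derivative_at_withinI by blast
   have "norm (gradient \<psi> y - gradient \<psi> x) \<le> e" using d(2)[of y x] y by (auto simp: dist_norm norm_minus_commute)
   thus "onorm ((\<lambda>v. gradient \<psi> y \<bullet> v) - (\<lambda>v. gradient \<psi> x \<bullet> v)) \<le> e"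
    by (intro onorm_bound) (use \<open>e > 0\<close> in \<open>auto simp flip: inner_diff_left
       intro: order_trans[OF Cauchy_Schwarz_ineq2 mult_right_mono]\<close>)
  next
   fix t :: real assume t: "t \<in> {0..1}"
   hence "norm (t *\<^sub>R h) \<le> 1 * norm h" unfolding norm_scaleR by (intro mult_right_mono) auto
   thus "x + t *\<^sub>R (x + h - x) \<in> ball x d" using h by (auto simp: dist_norm)
  qed (use d in auto)
  thus "\<bar>\<psi> (x + h) - \<psi> x - gradient \<psi> x \<bullet> h\<bar> \<le> e * norm h" by (simp add: mult.commute)
 qed
qed

text \<open>convolution\<close>

definition conv :: "('a::euclidean_space => real) => ('a => real) => 'a => real" where
 "conv u k x = (LBINT y. u y * k (x - y))"

lemma conv_integrable:
 assumes "u \<in> Borel" "\<And>y. \<bar>u y\<bar> \<le> M" "k \<in> test_functions"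
 shows "L1 (\<lambda>y. u y * k (x - y))"
 using assms by (intro integrable_bounded_mult[where C=M] test_integrable test_reflect) auto

lemma conv_has_derivative:
 assumes u: "u \<in> Borel" "\<And>y. \<bar>u y\<bar> \<le> M" and k: "k \<in> test_functions"
 shows "(conv u k has_derivative (\<lambda>v. conv u (\<lambda>z. gradient k z \<bullet> v) x)) (at x)" unfolding has_derivative_at_alt
proof (intro conjI allI impI)
 note gk = test_gradient_component[OF k]
 note int = conv_integrable[OF u]
 define g where "g = (\<Sum>i\<in>Basis. conv u (\<lambda>z. gradient k z \<bullet> i) x *\<^sub>R i)"
 have "conv u (\<lambda>z. gradient k z \<bullet> v) x = g \<bullet> v" for v
 proof -
  have "conv u (\<lambda>z. gradient k z \<bullet> v) x
    = (LBINT y. (\<Sum>i\<in>Basis. (u y * (gradient k (x - y) \<bullet> i)) * (v \<bullet> i)))"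
   unfolding conv_def by (subst euclidean_inner) (simp add: sum_distrib_left mult.assoc)
  also have "\<dots> = (\<Sum>i\<in>Basis. conv u (\<lambda>z. gradient k z \<bullet> i) x * (v \<bullet> i))" unfolding conv_def using int[OF gk]
   by (subst int_sum) (auto intro!: integrable_mult_left)
  also have "\<dots> = g \<bullet> v" by (simp add: g_def inner_sum_left) (simp add: inner_commute)
  finally show ?thesis .
 qed
 thus "bounded_linear (\<lambda>v. conv u (\<lambda>z. gradient k z \<bullet> v) x)" by (simp add: bounded_linear_inner_right)
 fix e :: real assume "e > 0"
 obtain r where r: "r > 0" "\<And>x. norm x > r ==> k x = 0" using test_function_support[OF k] by metis
 define V where "V = measure lborel (cball x (r + 1))"
 have "V \<ge> 0" by (simp add: V_def)
 have "M \<ge> 0" using u(2)[of 0] by linarith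
 define e' where "e' = e / (M * V + 1)"
 have MV: "M * V + 1 > 0" using \<open>V \<ge> 0\<close> \<open>M \<ge> 0\<close> by (simp add: add_nonneg_pos)
 have "e' > 0" using \<open>e > 0\<close> MV by (simp add: e'_def)
 obtain d where d: "d > 0"
   "\<And>x h. norm h < d ==> \<bar>k (x + h) - k x - gradient k x \<bullet> h\<bar> \<le> e' * norm h"
  using test_uniformly_differentiable[OF k \<open>e' > 0\<close>] by metis
 show "\<exists>d>0. \<forall>y. norm (y - x) < d -->
   norm (conv u k y - conv u k x - conv u (\<lambda>z. gradient k z \<bullet> (y - x)) x) \<le> e * norm (y - x)"
 proof (intro exI[of _ "min d 1"] conjI allI impI)
  fix z assume z: "norm (z - x) < min d 1"
  define h where "h = z - x"
  have zh: "z = x + h" and h: "norm h < d" "norm h < 1" using z by (auto simp: h_def)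
  define F where "F y = u y * k (x + h - y) - u y * k (x - y) - u y * (gradient k (x - y) \<bullet> h)" for y
  have iF: "L1 F" unfolding F_def using int[OF k] int[OF gk] by (intro L1_diff)
  have "norm (F y) \<le> ind (cball x (r + 1)) y * (M * (e' * norm h))" for y
  proof (cases "y \<in> cball x (r + 1)")
   case True
   have "F y = u y * (k (x - y + h) - k (x - y) - gradient k (x - y) \<bullet> h)" by (simp add: F_def algebra_simps)
   thus ?thesis using True u(2)[of y] d(2)[OF h(1), of "x - y"] \<open>M \<ge> 0\<close> by (auto simp: abs_mult intro!: mult_mono)
  next
   case False
   hence y: "norm (x - y) > r + 1" by (simp add: dist_norm)
   have "norm (x - y) \<le> norm (x + h - y) + norm h"
    using norm_triangle_ineq4[of "x + h - y" h] by (simp add: algebra_simps)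
   hence "F y = 0" using y h gradient_support[of k r "x - y"] k r by (simp add: F_def)
   thus ?thesis using False by simp
  qed
  hence "\<bar>(LBINT y. F y)\<bar> \<le> (LBINT y. ind (cball x (r + 1)) y * (M * (e' * norm h)))"
   using iF emeasure_lborel_cball_finite[of x "r+1"]
   by (intro order_trans[OF integral_norm_bound[of lborel F, unfolded real_norm_def] integral_mono])
     (auto intro!: integrable_mult_left integrable_real_indicator)
  also have "\<dots> = V * (M * (e' * norm h))" by (simp add: V_def)
  also have "\<dots> = (M * V) * e' * norm h" by simp
  also have "\<dots> \<le> e * norm h" unfolding e'_def using MV \<open>e > 0\<close> by (intro mult_right_mono) (auto simp: field_simps)
  also have "(LBINT y. F y) = conv u k z - conv u k x - conv u (\<lambda>w. gradient k w \<bullet> (z - x)) x"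
   unfolding F_def conv_def zh using int[OF k] int[OF gk] by (simp add: int_diff)
  finally show "norm (conv u k z - conv u k x - conv u (\<lambda>w. gradient k w \<bullet> (z - x)) x) \<le> e * norm (z - x)"
   by (simp add: zh)
 qed (use d in auto)
qed

lemma Ck_on_conv:
 assumes u: "u \<in> Borel" "\<And>y. \<bar>u y\<bar> \<le> M" and k: "\<kappa> \<in> test_functions"
 shows "Ck_on k UNIV (conv u \<kappa>)" using k
proof (induction k arbitrary: \<kappa>)
 case 0
 thus ?case using has_derivative_continuous[OF conv_has_derivative[OF u, of \<kappa>]]
  by (simp add: continuous_on_eq_continuous_at)
next
 case (Suc k)
 show ?case by (rule Ck_on_SucI[OF unique_derivs_UNIV conv_has_derivative[OF u Suc.prems]
     Suc.IH[OF test_gradient_component[OF Suc.prems]]])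
qed

lemma conv_bound:
 assumes u: "u \<in> Borel" "\<And>y. \<bar>u y\<bar> \<le> M" and k: "k \<in> test_functions"
  and k0: "\<And>z. k z \<ge> 0" and k1: "(LBINT z. k z) = 1"
 shows "\<bar>conv u k x\<bar> \<le> M"
proof -
 have M: "M \<ge> 0" using u(2)[of 0] by linarith
 have one: "(LBINT y. k (x - y)) = 1"
  using has_bochner_integral_lborel_affine(2)[of k "-1" x] k k1 by (simp add: test_measurable)
 have "\<bar>conv u k x\<bar> \<le> (LBINT y. norm (u y * k (x - y)))"
  unfolding conv_def using integral_norm_bound[of lborel "\<lambda>y. u y * k (x - y)"] by simp
 also have "\<dots> \<le> (LBINT y. M * k (x - y))"
  using u k0 by (intro integral_mono integrable_norm conv_integrable[OF u k] integrable_mult_right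
    test_integrable test_reflect k) (auto simp: abs_mult intro!: mult_right_mono)
 also have "\<dots> = M" by (simp add: one)
 finally show ?thesis .
qed

text \<open>mollifier\<close>

definition mollifier :: "real => 'a::euclidean_space => real" where
 "mollifier e x = bump (x /\<^sub>R e) / (e ^ DIM('a) * (LBINT y. bump (y::'a)))"

lemma bump_integral_pos: "(LBINT y. bump (y::'a::euclidean_space)) > 0"
proof -
 have i: "L1 (bump :: 'a => real)" by (rule test_integrable[OF bump_test_function])
 have "(LBINT y. bump (y::'a)) \<noteq> 0"
 proof
  assume "(LBINT y. bump (y::'a)) = 0"
  hence "AE y in lborel. bump (y::'a) = 0" using integral_nonneg_eq_0_iff_AE[OF i] by (simp add: bump_nonneg)
  hence "AE y in lborel. y \<notin> ball (0::'a) 1" by eventually_elim (use bump_pos in \<open>force simp: dist_norm\<close>)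
  hence "emeasure lborel (ball (0::'a) 1) = 0" by (subst (asm) AE_iff_measurable) auto
  thus False using content_ball_pos[of 1 "0::'a"] by (simp add: Sigma_Algebra.measure_def)
 qed
 thus ?thesis using integral_nonneg_AE[of "bump :: 'a => real" lborel] by (simp add: bump_nonneg less_le)
qed

lemma mollifier_test: "e > 0 ==> mollifier e \<in> test_functions"
 using test_cmult[OF test_affine[OF bump_test_function, of "inverse e" 0], of "1 / (e ^ DIM('a) * (LBINT y. bump (y::'a)))"]
 by (simp add: mollifier_def[abs_def])

lemma mollifier_nonneg: "e > 0 ==> mollifier e x \<ge> 0"
 using bump_integral_pos[where 'a='a] by (auto simp: mollifier_def bump_nonneg)

lemma mollifier_support: "e > 0 ==> norm x > e ==> mollifier e x = 0"
 by (auto simp: mollifier_def bump_support field_simps)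

lemma mollifier_integral: "e > 0 ==> (LBINT x. mollifier e (x::'a::euclidean_space)) = 1"
proof -
 assume e: "e > 0"
 have "(LBINT x. bump (x::'a)) = (1/e) ^ DIM('a) * (LBINT x. bump ((x::'a) /\<^sub>R e))"
  using has_bochner_integral_lborel_affine(2)[of "bump :: 'a => real" "inverse e" 0] e
  by (simp add: test_measurable[OF bump_test_function] inverse_eq_divide)
 thus ?thesis using e bump_integral_pos[where 'a='a] by (auto simp: mollifier_def field_simps power_divide)
qed

lemma mollifier_scale: "e > 0 ==> mollifier e (x :: 'a::euclidean_space) = mollifier 1 (x /\<^sub>R e) / e ^ DIM('a)"
 by (simp add: mollifier_def)


text \<open>fundamental lemma\<close>

lemma fundamental_lemma:
 fixes f :: "'a::euclidean_space => real"
 assumes [measurable]: "f \<in> Borel"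
  and int: "\<And>r. L1 (\<lambda>x. ind (cball 0 r) x * f x)"
  and zero: "\<And>\<psi>. \<psi> \<in> test_functions ==> (LBINT x. f x * \<psi> x) = 0"
 shows "AE x in lborel. f x = 0"
proof -
 have "AE x in lborel. norm x \<le> real n --> f x = 0" for n
 proof -
  define r where "r = real n"
  define F where "F x = ind (cball 0 (r + 1)) x * f x" for x
  have F[measurable]: "F \<in> Borel" and iF: "L1 F" using int by (auto simp: F_def[abs_def])
  have "(NNBINT x. ennreal \<bar>ind (cball 0 r) x * f x\<bar>) \<le> ennreal e" if "e > 0" for e :: real
  proof -
   obtain d where d: "d > 0" "\<And>h. norm h < d ==> shift_diff F h \<le> ennreal e"
    using shift_diff_small[OF iF \<open>e > 0\<close>] by metis
   define \<epsilon> where "\<epsilon> = min (d/2) 1"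
   have \<epsilon>: "\<epsilon> > 0" "\<epsilon> < d" "\<epsilon> \<le> 1" using d by (auto simp: \<epsilon>_def)
   note m = mollifier_test[OF \<epsilon>(1), where 'a='a]
   have [measurable]: "(mollifier \<epsilon> :: 'a => real) \<in> Borel" using m by auto
   obtain C where C: "\<And>x::'a. \<bar>mollifier \<epsilon> x\<bar> \<le> C" using test_bounded[OF m] by metis
   have ip: "L1 (\<lambda>z. F (x - z) * mollifier \<epsilon> z)" for x
    using integrable_bounded_mult[of lborel "\<lambda>z. F (x - z)" "mollifier \<epsilon>" C] C
     has_bochner_integral_lborel_affine(1)[OF F, of "-1" x] iF by (auto simp: mult.commute)
   have conv0: "(LBINT z. F (x - z) * mollifier \<epsilon> z) = 0" if x: "norm x \<le> r" for x
   proof -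
    have "(LBINT z. F (x - z) * mollifier \<epsilon> z) = (LBINT y. F y * mollifier \<epsilon> (x - y))"
     using has_bochner_integral_lborel_affine(2)[of "\<lambda>z. F (x - z) * mollifier \<epsilon> z" "-1" x] by simp
    also have "\<dots> = (LBINT y. f y * mollifier \<epsilon> (x - y))"
    proof (intro int_cong refl)
     fix y show "F y * mollifier \<epsilon> (x - y) = f y * mollifier \<epsilon> (x - y)"
     proof (cases "norm (x - y) > \<epsilon>")
      case False
      hence "norm y \<le> r + 1" using x \<epsilon> norm_triangle_ineq4[of x "x - y"] by simp
      thus ?thesis by (simp add: F_def)
     qed (simp add: mollifier_support \<epsilon>)
    qed
    also have "\<dots> = 0" by (rule zero[OF test_reflect[OF m]])
    finally show ?thesis .
   qed
   have "(NNBINT x. ennreal \<bar>ind (cball 0 r) x * f x\<bar>)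
     \<le> (NNBINT x. ennreal \<bar>(LBINT z. F (x - z) * mollifier \<epsilon> z) - F x\<bar>)"
   proof (intro nn_integral_mono)
    fix x
    show "ennreal \<bar>ind (cball 0 r) x * f x\<bar> \<le> ennreal \<bar>(LBINT z. F (x - z) * mollifier \<epsilon> z) - F x\<bar>"
    proof (cases "norm x \<le> r")
     case True
     thus ?thesis using conv0[OF True] by (simp add: F_def)
    qed simp
   qed
   also have "\<dots> \<le> ennreal e"
   proof (rule mollification_L1[where d=\<epsilon> and M=C and L="\<lambda>z. z", OF iF])
    show "mollifier \<epsilon> z \<le> C" for z :: 'a using C[of z] by linarith
    show "shift_diff F z \<le> ennreal e" if "norm z \<le> \<epsilon>" for z using d(2)[of z] that \<epsilon> by linarith
   qed (use ip in \<open>simp_all add: \<epsilon> mollifier_nonneg mollifier_support mollifier_integral test_integrable[OF m]\<close>)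
   finally show ?thesis .
  qed
  hence "(NNBINT x. ennreal \<bar>ind (cball 0 r) x * f x\<bar>) \<le> 0" by (intro ennreal_le_epsilon[where y=0]) simp_all
  hence "(NNBINT x. ennreal \<bar>ind (cball 0 r) x * f x\<bar>) = 0" by simp
  hence "AE x in lborel. ennreal \<bar>ind (cball 0 r) x * f x\<bar> = 0"
   using nn_integral_0_iff_AE[of "\<lambda>x. ennreal \<bar>ind (cball 0 r) x * f x\<bar>" lborel]
    borel_measurable_integrable[OF int[of r]] by auto
  thus ?thesis by eventually_elim (auto simp: indicator_def r_def)
 qed
 hence "AE x in lborel. \<forall>n. norm x \<le> real n --> f x = 0" unfolding AE_all_countable by blast
 thus ?thesis by eventually_elim (use real_arch_simple in blast)
qed

text \<open>cutoff\<close>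

lemma cutoff_exists:
 obtains \<zeta> :: "'a::euclidean_space => real" where "\<zeta> \<in> test_functions" "\<And>x. 0 \<le> \<zeta> x" "\<And>x. \<zeta> x \<le> 1"
  "\<And>x. norm x \<le> 1 ==> \<zeta> x = 1" "\<And>x. norm x > 2 ==> \<zeta> x = 0"
proof
 define \<mu> where "\<mu> = (mollifier (1/4) :: 'a => real)"
 have \<mu>: "\<mu> \<in> test_functions" by (simp add: \<mu>_def mollifier_test)
 define u where "u = (ind (ball 0 (3/2)) :: 'a => real)"
 have u: "u \<in> Borel" "\<And>x. \<bar>u x\<bar> \<le> 1" unfolding u_def by (measurable, auto simp: indicator_def)
 have [measurable]: "\<mu> \<in> Borel" using \<mu> by auto
 have one: "(LBINT y. \<mu> (x - y)) = 1" for x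
  using has_bochner_integral_lborel_affine(2)[of \<mu> "-1" x] mollifier_integral[of "1/4", where 'a='a]
  by (simp flip: \<mu>_def)
 show zero: "conv u \<mu> x = 0" if "norm x > 2" for x
 proof -
  have "u y * \<mu> (x - y) = 0" for y using that norm_triangle_ineq4[of "x - y" "- y"]
   by (cases "norm (x - y) > 1/4") (auto simp: u_def \<mu>_def mollifier_support indicator_def dist_norm)
  hence "(\<lambda>y. u y * \<mu> (x - y)) = (\<lambda>y. 0)" by blast
  thus ?thesis by (simp only: conv_def integral_zero)
 qed
 show "conv u \<mu> \<in> test_functions" using zero Ck_on_conv[OF u \<mu>] by (intro test_functionI[where r=2]) auto
 show "conv u \<mu> x \<ge> 0" for x
  unfolding conv_def by (intro integral_nonneg_AE) (auto simp: u_def \<mu>_def mollifier_nonneg)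
 show "conv u \<mu> x \<le> 1" for x using conv_bound[OF u \<mu>, of x] by (simp add: \<mu>_def mollifier_nonneg mollifier_integral)
 show "conv u \<mu> x = 1" if "norm x \<le> 1" for x
 proof -
  have "u y * \<mu> (x - y) = \<mu> (x - y)" for y using that norm_triangle_ineq4[of x "x - y"]
   by (cases "norm (x - y) > 1/4") (auto simp: u_def \<mu>_def mollifier_support indicator_def dist_norm)
  hence "(\<lambda>y. u y * \<mu> (x - y)) = (\<lambda>y. \<mu> (x - y))" by blast
  thus ?thesis by (simp only: conv_def one)
 qed
qed


lemma cball_in_borel[measurable]: "cball x r \<in> sets borel" by (intro borel_closed closed_cball)

lemma integrable_pairI:
 fixes F :: "'a::euclidean_space \<times> 'b::euclidean_space => 'c::{banach, second_countable_topology}"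
 assumes [measurable]: "F \<in> borel_measurable (lborel \<Otimes>\<^sub>M lborel)"
  and "(NNBINT x. (NNBINT y. ennreal (norm (F (x, y))))) < \<infinity>"
 shows "integrable (lborel \<Otimes>\<^sub>M lborel) F"
proof (rule integrableI_bounded)
 have "(\<integral>\<^sup>+p. ennreal (norm (F p)) \<partial>(lborel \<Otimes>\<^sub>M lborel)) = (NNBINT x. (NNBINT y. ennreal (norm (F (x, y)))))"
  by (subst lborel.nn_integral_fst[symmetric]) auto
 thus "(\<integral>\<^sup>+p. ennreal (norm (F p)) \<partial>(lborel \<Otimes>\<^sub>M lborel)) < \<infinity>" using assms(2) by simp
qed measurable

lemma integral_lborel_shift:
 fixes f :: "'a::euclidean_space => 'b::{banach, second_countable_topology}"
 assumes "f \<in> Borel"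
 shows "(LBINT x. f (x - h)) = (LBINT x. f x)"
  and "L1 (\<lambda>x. f (x - h)) \<longleftrightarrow> L1 f" using has_bochner_integral_lborel_affine[OF assms, of 1 "-h"] by auto

definition loc_int :: "('a::euclidean_space => real) => bool" where
 "loc_int f \<longleftrightarrow> f \<in> Borel \<and> (\<forall>r. L1 (\<lambda>x. ind (cball 0 r) x * f x))"

lemma loc_int_measurable[measurable_dest]: "loc_int f ==> f \<in> Borel" by (simp add: loc_int_def)

lemma loc_int_bounded_support:
 assumes f: "loc_int f" and k: "k \<in> Borel" "\<And>x. \<bar>k x\<bar> \<le> C" "\<And>x. norm x > r ==> k x = 0"
 shows "L1 (\<lambda>x. f x * k x)"
proof -
 have "L1 (\<lambda>x. k x * (ind (cball 0 r) x * f x))"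
  using f k(1,2) by (intro integrable_bounded_mult[of _ _ k C]) (auto simp: loc_int_def)
 moreover have "k x * (ind (cball 0 r) x * f x) = f x * k x" for x
  using k(3)[of x] by (auto simp: indicator_def not_le)
 ultimately show ?thesis by simp
qed

lemma loc_int_test:
 assumes "loc_int f" "\<psi> \<in> test_functions"
 shows "L1 (\<lambda>x. f x * \<psi> x)"
proof -
 obtain r where "\<And>x. norm x > r ==> \<psi> x = 0" using test_function_support[OF assms(2)] by metis
 moreover obtain C where "\<And>x. \<bar>\<psi> x\<bar> \<le> C" using test_bounded[OF assms(2)] by metis
 ultimately show ?thesis using assms by (intro loc_int_bounded_support[where C=C and r=r]) auto
qed

lemma loc_int_add: "loc_int f ==> loc_int g ==> loc_int (\<lambda>x. f x + g x)" by (auto simp: loc_int_def distrib_left)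

lemma loc_int_cmult: "loc_int f ==> loc_int (\<lambda>x. c * f x)"
proof -
 have "(\<lambda>x. ind (cball 0 r) x * (c * f x)) = (\<lambda>x. c * (ind (cball 0 r) x * f x))" for r by (simp add: ac_simps)
 thus "loc_int f ==> loc_int (\<lambda>x. c * f x)" by (auto simp: loc_int_def)
qed

lemma loc_int_diff: "loc_int f ==> loc_int g ==> loc_int (\<lambda>x. f x - g x)"
 using loc_int_add[of f "\<lambda>x. -1 * g x"] loc_int_cmult[of g "-1"] by simp

lemma loc_int_shift:
 assumes "loc_int f" shows "loc_int (\<lambda>x. f (x - h))" unfolding loc_int_def
proof safe
 have [measurable]: "f \<in> Borel" using assms by (rule loc_int_measurable)
 show "(\<lambda>x. f (x - h)) \<in> Borel" by measurable
 fix r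
 have "L1 (\<lambda>x. (\<lambda>y. ind (cball 0 (r + norm h)) y * f y) (x - h))"
  using assms by (subst integral_lborel_shift) (auto simp: loc_int_def)
 hence "L1 (\<lambda>x. ind (cball 0 r) x * (ind (cball 0 (r + norm h)) (x - h) * f (x - h)))"
  by (rule integrable_bounded_mult[where C=1]) (auto simp: indicator_def)
 moreover have "ind (cball 0 r) x * (ind (cball 0 (r + norm h)) (x - h) * f (x - h))
   = ind (cball 0 r) x * f (x - h)" for x using norm_triangle_ineq4[of x h] by (auto simp: indicator_def)
 ultimately show "L1 (\<lambda>x. ind (cball 0 r) x * f (x - h))" by simp
qed

lemma segment_average_integrable:
 fixes g :: "'a::euclidean_space => real"
 assumes "loc_int g"
 shows "integrable (lborel \<Otimes>\<^sub>M lborel) (\<lambda>(x, \<sigma>). ind (cball 0 r) x * (ind01 \<sigma> * g (x - \<sigma> *\<^sub>R h)))"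
proof -
 have [measurable]: "g \<in> Borel" using assms by (rule loc_int_measurable)
 have ms: "(\<lambda>(x, \<sigma>). ind (cball 0 r) x * (ind01 \<sigma> * g (x - \<sigma> *\<^sub>R h))) \<in> borel_measurable (lborel \<Otimes>\<^sub>M lborel)"
  by (simp add: split_beta') measurable
 define g' where "g' x = ennreal \<bar>ind (cball 0 (r + norm h)) x * g x\<bar>" for x
 have [measurable]: "g' \<in> Borel" unfolding g'_def by measurable
 have fin: "(NNBINT x. g' x) < \<infinity>" using assms unfolding loc_int_def integrable_iff_bounded g'_def by simp
 have "(NNBINT x. (NNBINT \<sigma>. ennreal (norm (ind (cball 0 r) x * (ind01 \<sigma> * g (x - \<sigma> *\<^sub>R h))))))
   \<le> (NNBINT x. (NNBINT \<sigma>. ind01 \<sigma> * g' (x - \<sigma> *\<^sub>R h)))"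
 proof (intro nn_integral_mono)
  fix x and \<sigma> :: real
  show "ennreal (norm (ind (cball 0 r) x * (ind01 \<sigma> * g (x - \<sigma> *\<^sub>R h))))
    \<le> ind01 \<sigma> * g' (x - \<sigma> *\<^sub>R h)"
  proof (cases "norm x \<le> r \<and> \<sigma> \<in> {0..1}")
   case True
   hence "\<bar>\<sigma>\<bar> * norm h \<le> 1 * norm h" by (intro mult_right_mono) auto
   hence "norm (x - \<sigma> *\<^sub>R h) \<le> r + norm h" using True norm_triangle_ineq4[of x "\<sigma> *\<^sub>R h"] by simp
   thus ?thesis using True by (simp add: g'_def)
  qed (auto simp: indicator_def)
 qed
 also have "\<dots> = (NNBINT \<sigma>. (NNBINT x. ind01 \<sigma> * g' (x - \<sigma> *\<^sub>R h)))" by (rule lborel_pair.Fubini') measurable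
 also have "\<dots> = (NNBINT \<sigma>. ind01 \<sigma> * (NNBINT x. g' x))"
  by (intro nn_integral_cong) (simp add: nn_integral_cmult nn_integral_lborel_shift)
 also have "\<dots> = (NNBINT x. g' x)" by (simp add: nn_integral_multc)
 finally show ?thesis using ms fin by (intro integrable_pairI) auto
qed

lemma weak_derivative_difference:
 fixes f g :: "'a::euclidean_space => real"
 assumes f: "loc_int f" and g: "loc_int g"
  and weak: "\<And>\<psi>. \<psi> \<in> test_functions ==> (LBINT x. (gradient \<psi> x \<bullet> h) * f x) = - (LBINT x. \<psi> x * g x)"
 shows "AE x in lborel. f x - f (x - h) = (LBINT \<sigma>. ind01 \<sigma> * g (x - \<sigma> *\<^sub>R h))"
proof -
 have [measurable]: "f \<in> Borel" "g \<in> Borel" using f g by (auto intro: loc_int_measurable)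
 define P where "P x = (LBINT \<sigma>. ind01 \<sigma> * g (x - \<sigma> *\<^sub>R h))" for x
 have P[measurable]: "P \<in> Borel" unfolding P_def by measurable
 have lP: "loc_int P" unfolding loc_int_def
  using lborel_pair.integrable_fst'[OF segment_average_integrable[OF g, of _ h]] P by (simp add: P_def)
 have "AE x in lborel. f x - f (x - h) - P x = 0"
 proof (rule fundamental_lemma)
  show "(\<lambda>x. f x - f (x - h) - P x) \<in> Borel" by measurable
  show "L1 (\<lambda>x. ind (cball 0 r) x * (f x - f (x - h) - P x))" for r
   using loc_int_diff[OF loc_int_diff[OF f loc_int_shift[OF f]] lP] by (simp add: loc_int_def)
  fix \<psi> :: "'a => real" assume \<psi>: "\<psi> \<in> test_functions"
  hence [measurable]: "\<psi> \<in> Borel" "gradient \<psi> \<in> Borel" by (auto intro: test_measurable gradient_measurable)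
  obtain r where r: "r > 0" "\<And>x. norm x > r ==> \<psi> x = 0" using test_function_support[OF \<psi>] by metis
  obtain C where C: "C > 0" "\<And>x. \<bar>\<psi> x\<bar> \<le> C" using test_bounded[OF \<psi>] by metis
  obtain C' where C': "C' > 0" "\<And>x. norm (gradient \<psi> x) \<le> C'" using gradient_bounded[OF \<psi>] by metis
  have i1: "integrable (lborel \<Otimes>\<^sub>M lborel) (\<lambda>(x, \<sigma>). ind01 \<sigma> * (g (x - \<sigma> *\<^sub>R h) * \<psi> x))"
  proof -
   have "integrable (lborel \<Otimes>\<^sub>M lborel) (\<lambda>p. \<psi> (fst p) * (case p of (x, \<sigma>) => ind (cball 0 r) x * (ind01 \<sigma> * g (x - \<sigma> *\<^sub>R h))))"
    using C by (intro integrable_bounded_mult[OF segment_average_integrable[OF g], where C=C]) auto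
   moreover have "\<psi> (fst p) * (case p of (x, \<sigma>) => ind (cball 0 r) x * (ind01 \<sigma> * g (x - \<sigma> *\<^sub>R h)))
     = (case p of (x, \<sigma>) => ind01 \<sigma> * (g (x - \<sigma> *\<^sub>R h) * \<psi> x))" for p
    using r(2)[of "fst p"] by (cases "norm (fst p) > r") (auto split: prod.split simp: indicator_def)
   ultimately show ?thesis by simp
  qed
  have i2: "integrable (lborel \<Otimes>\<^sub>M lborel) (\<lambda>(x, \<sigma>). ind01 \<sigma> * ((gradient \<psi> (x + \<sigma> *\<^sub>R h) \<bullet> h) * f x))"
  proof -
   have "integrable (lborel \<Otimes>\<^sub>M lborel) (\<lambda>p. (gradient \<psi> (fst p + snd p *\<^sub>R h) \<bullet> h) * (case p of (x, \<sigma>) => ind (cball 0 (r + norm h)) x * (ind01 \<sigma> * f (x - \<sigma> *\<^sub>R 0))))"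
   proof (intro integrable_bounded_mult[OF segment_average_integrable[OF f], where C="C' * norm h"] AE_I2)
    show "\<bar>gradient \<psi> (fst p + snd p *\<^sub>R h) \<bullet> h\<bar> \<le> C' * norm h" for p
     by (rule order_trans[OF Cauchy_Schwarz_ineq2 mult_right_mono[OF C'(2)]]) simp
   qed measurable
   moreover have E: "(gradient \<psi> (x + \<sigma> *\<^sub>R h) \<bullet> h) * (ind (cball 0 (r + norm h)) x * (ind01 \<sigma> * f (x - \<sigma> *\<^sub>R 0)))
     = ind01 \<sigma> * ((gradient \<psi> (x + \<sigma> *\<^sub>R h) \<bullet> h) * f x)" for x \<sigma>
   proof (cases "norm x \<le> r + norm h \<or> \<sigma> \<notin> {0..1}")
    case False
    hence "\<bar>\<sigma>\<bar> * norm h \<le> 1 * norm h" by (intro mult_right_mono) auto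
    hence "norm (x + \<sigma> *\<^sub>R h) > r" using False norm_triangle_ineq4[of "x + \<sigma> *\<^sub>R h" "\<sigma> *\<^sub>R h"] by simp
    thus ?thesis using gradient_support[of \<psi> r] \<psi> r by simp
   qed auto
   ultimately show ?thesis by (simp only: split_beta' E)
  qed
  have shift: "(LBINT x. f (x - h) * \<psi> x) = (LBINT x. f x * \<psi> (x + h))"
   using integral_lborel_shift(1)[of "\<lambda>x. f x * \<psi> (x + h)" h] by simp
  have iP: "(LBINT x. P x * \<psi> x) = (LBINT x. f x * \<psi> x) - (LBINT x. f (x - h) * \<psi> x)"
  proof -
   have "(LBINT x. P x * \<psi> x) = (LBINT x. (LBINT \<sigma>. ind01 \<sigma> * (g (x - \<sigma> *\<^sub>R h) * \<psi> x)))"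
    unfolding P_def by (simp add: mult.assoc flip: integral_mult_left_zero)
   also have "\<dots> = (LBINT \<sigma>. (LBINT x. ind01 \<sigma> * (g (x - \<sigma> *\<^sub>R h) * \<psi> x)))"
    by (rule lborel_pair.Fubini_integral[OF i1, symmetric])
   also have "\<dots> = (LBINT \<sigma>. (LBINT x. - (ind01 \<sigma> * ((gradient \<psi> (x + \<sigma> *\<^sub>R h) \<bullet> h) * f x))))"
   proof (rule int_cong[OF refl])
    fix \<sigma> :: real
    have t: "(\<lambda>y. \<psi> (\<sigma> *\<^sub>R h + 1 *\<^sub>R y)) \<in> test_functions" by (rule test_affine[OF \<psi>]) simp
    have "(LBINT x. g (x - \<sigma> *\<^sub>R h) * \<psi> x) = (LBINT x. \<psi> (\<sigma> *\<^sub>R h + 1 *\<^sub>R x) * g x)"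
     using integral_lborel_shift(1)[of "\<lambda>x. g x * \<psi> (x + \<sigma> *\<^sub>R h)" "\<sigma> *\<^sub>R h"] by (simp add: ac_simps)
    also have "\<dots> = - (LBINT x. (gradient \<psi> (x + \<sigma> *\<^sub>R h) \<bullet> h) * f x)"
     using weak[OF t] gradient_affine[OF \<psi>, of "\<sigma> *\<^sub>R h" 1] by (simp add: add.commute)
    finally show "(LBINT x. ind01 \<sigma> * (g (x - \<sigma> *\<^sub>R h) * \<psi> x))
      = (LBINT x. - (ind01 \<sigma> * ((gradient \<psi> (x + \<sigma> *\<^sub>R h) \<bullet> h) * f x)))" by simp
   qed
   also have "\<dots> = - (LBINT \<sigma>. (LBINT x. (ind01 \<sigma> * ((gradient \<psi> (x + \<sigma> *\<^sub>R h) \<bullet> h) * f x))))" by simp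
   also have "(LBINT \<sigma>. (LBINT x. (ind01 \<sigma> * ((gradient \<psi> (x + \<sigma> *\<^sub>R h) \<bullet> h) * f x))))
     = (LBINT x. (LBINT \<sigma>. (ind01 \<sigma> * ((gradient \<psi> (x + \<sigma> *\<^sub>R h) \<bullet> h) * f x))))"
    by (rule lborel_pair.Fubini_integral[OF i2])
   also have "\<dots> = (LBINT x. f x * \<psi> (x + h) - f x * \<psi> x)"
   proof (rule int_cong[OF refl])
    fix x
    have "(LBINT \<sigma>. ind01 \<sigma> *\<^sub>R (gradient \<psi> (x + \<sigma> *\<^sub>R h) \<bullet> h)) = \<psi> (x + 1 *\<^sub>R h) - \<psi> (x + 0 *\<^sub>R h)"
    proof (rule integral_FTC_Icc)
     fix \<sigma> :: real assume "0 \<le> \<sigma>" "\<sigma> \<le> 1"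
     have "((\<lambda>\<sigma>. x + \<sigma> *\<^sub>R h) has_vector_derivative h) (at \<sigma> within {0..1})" by (auto intro!: derivative_eq_intros)
     hence d: "((\<lambda>\<sigma>. x + \<sigma> *\<^sub>R h) has_derivative (\<lambda>s. s *\<^sub>R h)) (at \<sigma> within {0..1})"
      by (simp add: has_vector_derivative_def)
     show "((\<lambda>\<sigma>. \<psi> (x + \<sigma> *\<^sub>R h)) has_vector_derivative gradient \<psi> (x + \<sigma> *\<^sub>R h) \<bullet> h) (at \<sigma> within {0..1})"
      using has_derivative_compose[OF d gradient_has_derivative[OF \<psi>]] by (simp add: has_vector_derivative_def)
    next
     show "continuous_on {0..1} (\<lambda>\<sigma>. gradient \<psi> (x + \<sigma> *\<^sub>R h) \<bullet> h)"
      using test_continuous[OF test_gradient_component[OF \<psi>, of h]]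
      by (rule continuous_on_compose2) (auto intro!: continuous_intros)
    qed simp
    moreover have "(LBINT \<sigma>. (ind01 \<sigma> * ((gradient \<psi> (x + \<sigma> *\<^sub>R h) \<bullet> h) * f x)))
      = (LBINT \<sigma>. ind01 \<sigma> *\<^sub>R (gradient \<psi> (x + \<sigma> *\<^sub>R h) \<bullet> h)) * f x"
     by (simp add: mult.assoc flip: integral_mult_left_zero)
    ultimately show "(LBINT \<sigma>. (ind01 \<sigma> * ((gradient \<psi> (x + \<sigma> *\<^sub>R h) \<bullet> h) * f x))) = f x * \<psi> (x + h) - f x * \<psi> x"
     by (simp only:) (simp add: algebra_simps)
   qed
   also have "\<dots> = (LBINT x. f x * \<psi> (x + h)) - (LBINT x. f x * \<psi> x)"
    using loc_int_test[OF f test_affine[OF \<psi>, of 1 h]] loc_int_test[OF f \<psi>]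
    by (intro int_diff) (auto simp: add.commute)
   finally show ?thesis using shift by simp
  qed
  have "(LBINT x. (f x - f (x - h) - P x) * \<psi> x) =
    (LBINT x. f x * \<psi> x) - (LBINT x. f (x - h) * \<psi> x) - (LBINT x. P x * \<psi> x)"
   using loc_int_test[OF f \<psi>] loc_int_test[OF loc_int_shift[OF f] \<psi>] loc_int_test[OF lP \<psi>]
   by (simp add: left_diff_distrib int_diff L1_diff)
  thus "(LBINT x. (f x - f (x - h) - P x) * \<psi> x) = 0" using iP by simp
 qed
 thus ?thesis by (simp add: P_def)
qed


subsection \<open>JN\<close>

lemma nn_integral_finite_partition:
 fixes F :: "'a => ennreal"
 assumes "finite \<Q>" "\<And>Q. Q \<in> \<Q> ==> Q \<in> sets M" "disjoint \<Q>" and [measurable]: "F \<in> borel_measurable M"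
 shows "(\<integral>\<^sup>+y. ind (\<Union>\<Q>) y * F y \<partial>M) = (\<Sum>Q\<in>\<Q>. \<integral>\<^sup>+y. ind Q y * F y \<partial>M)"
proof -
 have "ind (\<Union>\<Q>) y = (\<Sum>Q\<in>\<Q>. ind Q y :: ennreal)" for y
 proof (cases "y \<in> \<Union>\<Q>")
  case True
  then obtain Q where Q: "Q \<in> \<Q>" "y \<in> Q" by auto
  have "(\<Sum>Q'\<in>\<Q>. ind Q' y :: ennreal) = (\<Sum>Q'\<in>\<Q>. if Q' = Q then 1 else 0)"
   using Q assms(3) by (intro sum.cong) (auto simp: indicator_def disjoint_def)
  thus ?thesis using Q assms(1) True by simp
 qed (auto simp: indicator_def)
 thus ?thesis using assms(2) by (simp add: sum_distrib_right nn_integral_sum)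
qed

locale cell_tree =
 fixes M :: "'a measure" and C :: "nat => 'a => 'a set" and \<kappa> :: real and f :: "'a => real"
  and avg :: "nat => 'a => real"
 assumes C_sets: "C n x \<in> sets M"
  and C_self: "x \<in> C n x"
  and C_eq: "y \<in> C n x ==> C n y = C n x"
  and C_nest: "C (Suc n) x \<subseteq> C n x"
  and C_finite: "finite (C (Suc n) ` C n x)"
  and C_fin: "emeasure M (C n x) < \<infinity>"
  and C_pos: "measure M (C n x) > 0"
  and C_ratio: "measure M (C n x) \<le> \<kappa> * measure M (C (Suc n) x)"
  and f: "integrable M f"
  and avg_def: "avg n x = (\<integral>y. ind (C n x) y * f y \<partial>M) / measure M (C n x)"
  and avg_meas[measurable]: "avg n \<in> borel_measurable M"
  and osc: "(\<integral>y. ind (C n x) y * \<bar>f y - avg n x\<bar> \<partial>M) \<le> measure M (C n x)"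
begin

lemmas [measurable] = C_sets avg_meas

lemma cell_integrable: "integrable M (\<lambda>y. ind (C n x) y * \<bar>f y - a\<bar>)"
  and cell_integrable': "integrable M (\<lambda>y. ind (C n x) y * (f y - a))"
  and cell_integrable0: "integrable M (\<lambda>y. ind (C n x) y :: real)"
proof -
 show 0: "integrable M (\<lambda>y. ind (C n x) y :: real)" using C_sets C_fin by (intro integrable_real_indicator)
 have "integrable M (\<lambda>y. ind (C n x) y * f y)"
  using integrable_real_mult_indicator[OF C_sets f] by (simp add: mult.commute)
 with 0 show 1: "integrable M (\<lambda>y. ind (C n x) y * (f y - a))" by (simp add: right_diff_distrib)
 from integrable_abs[OF 1] show "integrable M (\<lambda>y. ind (C n x) y * \<bar>f y - a\<bar>)" by (simp add: abs_mult)
qed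

lemma avg_minus: "(\<integral>y. ind (C n x) y * (f y - a) \<partial>M) = (avg n x - a) * measure M (C n x)"
proof -
 have i: "integrable M (\<lambda>y. ind (C n x) y * f y)" using cell_integrable'[of n x 0] by simp
 have "(\<integral>y. ind (C n x) y * (f y - a) \<partial>M) = (\<integral>y. ind (C n x) y * f y \<partial>M) - measure M (C n x) * a"
  using i cell_integrable0[of n x] C_sets sets.sets_into_space[OF C_sets]
  by (simp add: right_diff_distrib Int_absorb2)
 moreover have "(\<integral>y. ind (C n x) y * f y \<partial>M) = avg n x * measure M (C n x)" using C_pos[of n x] by (simp add: avg_def)
 ultimately show ?thesis by (simp add: left_diff_distrib mult.commute)
qed

lemma avg_diff_le: "\<bar>avg n x - a\<bar> * measure M (C n x) \<le> (\<integral>y. ind (C n x) y * \<bar>f y - a\<bar> \<partial>M)"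
proof -
 have "\<bar>avg n x - a\<bar> * measure M (C n x) = \<bar>\<integral>y. ind (C n x) y * (f y - a) \<partial>M\<bar>"
  using C_pos[of n x] by (simp add: avg_minus abs_mult)
 also have "\<dots> \<le> (\<integral>y. \<bar>ind (C n x) y * (f y - a)\<bar> \<partial>M)" by (rule integral_abs_bound)
 finally show ?thesis by (simp add: abs_mult)
qed

lemma avg_child:
 assumes "y \<in> C n x" shows "\<bar>avg (Suc n) y - avg n x\<bar> \<le> \<kappa>"
proof -
 have "\<bar>avg (Suc n) y - avg n x\<bar> * measure M (C (Suc n) y) \<le> (\<integral>z. ind (C (Suc n) y) z * \<bar>f z - avg n x\<bar> \<partial>M)"
  by (rule avg_diff_le)
 also have "\<dots> \<le> (\<integral>z. ind (C n x) z * \<bar>f z - avg n x\<bar> \<partial>M)" using C_nest[of n y] C_eq[OF assms]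
  by (intro integral_mono cell_integrable) (auto simp: indicator_def)
 also have "\<dots> \<le> \<kappa> * measure M (C (Suc n) y)" using osc[of n x] C_ratio[of n y] C_eq[OF assms] by simp
 finally show ?thesis using C_pos[of "Suc n" y] by simp
qed

lemma exp_avg_bound:
 assumes c: "c \<ge> 0" "exp (c * (2 + \<kappa>)) \<le> 3/2" and "\<kappa> \<ge> 0" and a: "\<bar>avg n x - a\<bar> \<le> 2"
 shows "(\<integral>\<^sup>+y. ind (C n x) y * ennreal (exp (c * \<bar>avg (n + N) y - a\<bar>)) \<partial>M)
   \<le> (\<integral>\<^sup>+y. ind (C n x) y * ennreal (2 + 2 * \<bar>f y - a\<bar>) \<partial>M)" using a
proof (induction N arbitrary: n x a)
 case 0
 show ?case
 proof (intro nn_integral_mono)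
  fix y
  have "exp (c * \<bar>avg n y - a\<bar>) \<le> 2 + 2 * \<bar>f y - a\<bar>" if "y \<in> C n x"
  proof -
   have "avg n y = avg n x" using C_eq[OF that] by (simp add: avg_def)
   hence "c * \<bar>avg n y - a\<bar> \<le> c * (2 + \<kappa>)" using 0 c \<open>\<kappa> \<ge> 0\<close> by (intro mult_left_mono) auto
   hence "exp (c * \<bar>avg n y - a\<bar>) \<le> 3/2" using c(2) by (meson exp_le_cancel_iff order_trans)
   also have "\<dots> \<le> 2 + 2 * \<bar>f y - a\<bar>" by simp
   finally show ?thesis .
  qed
  thus "ind (C n x) y * ennreal (exp (c * \<bar>avg (n + 0) y - a\<bar>)) \<le> ind (C n x) y * ennreal (2 + 2 * \<bar>f y - a\<bar>)"
   by (cases "y \<in> C n x") (simp only: ennreal_leI indicator_simps mult_1 add_0_right, simp)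
 qed
next
 case (Suc N)
 define \<Q> where "\<Q> = C (Suc n) ` C n x"
 have [measurable]: "f \<in> borel_measurable M" using f by auto
 have U: "\<Union>\<Q> = C n x" unfolding \<Q>_def using C_nest[of n] C_eq C_self by fast
 have disj: "disjoint \<Q>" unfolding \<Q>_def disjoint_def using C_eq C_self by (auto 0 3) (metis C_eq)+
 have fin: "finite \<Q>" by (simp add: \<Q>_def C_finite)
 have Qs: "Q \<in> sets M" if "Q \<in> \<Q>" for Q using that C_sets by (auto simp: \<Q>_def)
 have part: "(\<integral>\<^sup>+y. ind (C n x) y * F y \<partial>M) = (\<Sum>Q\<in>\<Q>. \<integral>\<^sup>+y. ind Q y * F y \<partial>M)"
  if "F \<in> borel_measurable M" for F using nn_integral_finite_partition[OF fin Qs disj that] U by simp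
 have "(\<integral>\<^sup>+z. ind Q z * ennreal (exp (c * \<bar>avg (n + Suc N) z - a\<bar>)) \<partial>M)
   \<le> (\<integral>\<^sup>+z. ind Q z * ennreal (2 + 2 * \<bar>f z - a\<bar>) \<partial>M)" if Q: "Q \<in> \<Q>" for Q
 proof -
  obtain y where y: "y \<in> C n x" "Q = C (Suc n) y" using Q by (auto simp: \<Q>_def)
  define m where "m = measure M Q"
  have m: "m > 0" using C_pos y by (simp add: m_def)
  define a' where "a' = avg (Suc n) y"
  show ?thesis
  proof (cases "\<bar>a' - a\<bar> \<le> 2")
   case True
   from Suc.IH[OF True[unfolded a'_def]] y show ?thesis by simp
  next
   case False
   have int_eq: "(\<integral>\<^sup>+z. ind Q z * ennreal (2 + 2 * \<bar>f z - b\<bar>) \<partial>M)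
     = ennreal (2 * m + 2 * (\<integral>z. ind Q z * \<bar>f z - b\<bar> \<partial>M))" for b
   proof -
    have "(\<integral>\<^sup>+z. ind Q z * ennreal (2 + 2 * \<bar>f z - b\<bar>) \<partial>M)
     = (\<integral>\<^sup>+z. ennreal (2 * ind Q z + 2 * (ind Q z * \<bar>f z - b\<bar>)) \<partial>M)"
     by (intro nn_integral_cong) (auto simp: indicator_def)
    also have "\<dots> = ennreal (\<integral>z. 2 * ind Q z + 2 * (ind Q z * \<bar>f z - b\<bar>) \<partial>M)"
     unfolding y(2) by (intro nn_integral_eq_integral L1_add integrable_mult_right cell_integrable cell_integrable0) auto
    also have "(\<integral>z. 2 * ind Q z + 2 * (ind Q z * \<bar>f z - b\<bar>) \<partial>M)
      = 2 * m + 2 * (\<integral>z. ind Q z * \<bar>f z - b\<bar> \<partial>M)" unfolding y(2) m_def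
     using cell_integrable[of "Suc n" y b] cell_integrable0[of "Suc n" y] sets.sets_into_space[OF C_sets]
     by (subst int_add) (auto simp: Int_absorb2)
    finally show ?thesis .
   qed
   have "\<bar>a' - a\<bar> \<le> 2 + \<kappa>" using avg_child[OF y(1)] Suc.prems by (simp add: a'_def)
   have "(\<integral>\<^sup>+z. ind Q z * ennreal (exp (c * \<bar>avg (n + Suc N) z - a\<bar>)) \<partial>M)
    \<le> (\<integral>\<^sup>+z. ennreal (3/2) * (ind Q z * ennreal (exp (c * \<bar>avg (Suc n + N) z - a'\<bar>))) \<partial>M)"
   proof (intro nn_integral_mono)
    fix z
    have "c * \<bar>avg (n + Suc N) z - a\<bar> \<le> c * ((2 + \<kappa>) + \<bar>avg (Suc n + N) z - a'\<bar>)"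
     using \<open>\<bar>a' - a\<bar> \<le> 2 + \<kappa>\<close> c by (intro mult_left_mono) auto
    hence "exp (c * \<bar>avg (n + Suc N) z - a\<bar>) \<le> exp (c * (2 + \<kappa>)) * exp (c * \<bar>avg (Suc n + N) z - a'\<bar>)"
     by (simp add: distrib_left flip: exp_add)
    also have "\<dots> \<le> 3/2 * exp (c * \<bar>avg (Suc n + N) z - a'\<bar>)" using c by (intro mult_right_mono) auto
    finally show "ind Q z * ennreal (exp (c * \<bar>avg (n + Suc N) z - a\<bar>))
      \<le> ennreal (3/2) * (ind Q z * ennreal (exp (c * \<bar>avg (Suc n + N) z - a'\<bar>)))"
     by (auto simp: indicator_def simp flip: ennreal_mult intro!: ennreal_leI)
   qed
   also have "\<dots> = ennreal (3/2) * (\<integral>\<^sup>+z. ind Q z * ennreal (exp (c * \<bar>avg (Suc n + N) z - a'\<bar>)) \<partial>M)"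
    unfolding y(2) by (intro nn_integral_cmult) measurable
   also have "\<dots> \<le> ennreal (3/2) * (\<integral>\<^sup>+z. ind Q z * ennreal (2 + 2 * \<bar>f z - a'\<bar>) \<partial>M)"
    using Suc.IH[of "Suc n" y a'] y(2) by (intro mult_left_mono) (auto simp: a'_def)
   also have "\<dots> \<le> ennreal (3/2) * ennreal (2 * m + 2 * m)"
    unfolding int_eq using osc[of "Suc n" y] by (intro mult_left_mono ennreal_leI) (auto simp: y(2) m_def a'_def)
   also have "\<dots> = ennreal (2 * m + 2 * (2 * m))" using m by (simp flip: ennreal_mult)
   also have "\<dots> \<le> ennreal (2 * m + 2 * (\<bar>a' - a\<bar> * m))"
    using False m by (intro ennreal_leI) (auto intro!: mult_right_mono)
   also have "\<dots> \<le> ennreal (2 * m + 2 * (\<integral>z. ind Q z * \<bar>f z - a\<bar> \<partial>M))"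
    using avg_diff_le[of "Suc n" y a] by (intro ennreal_leI) (auto simp: y(2) m_def a'_def)
   also have "\<dots> = (\<integral>\<^sup>+z. ind Q z * ennreal (2 + 2 * \<bar>f z - a\<bar>) \<partial>M)" by (simp only: int_eq)
   finally show ?thesis .
  qed
 qed
 thus ?case by (simp add: part sum_mono)
qed

lemma exp_bound:
 assumes c: "c \<ge> 0" "exp (c * (2 + \<kappa>)) \<le> 3/2" and "\<kappa> \<ge> 0"
  and conv: "(\<lambda>N. \<integral>\<^sup>+y. ind (C 0 x) y * ennreal \<bar>avg N y - f y\<bar> \<partial>M) \<longlonglongrightarrow> 0"
 shows "(\<integral>\<^sup>+y. ind (C 0 x) y * ennreal (exp (c * \<bar>f y - avg 0 x\<bar>)) \<partial>M) \<le> ennreal (4 * measure M (C 0 x))"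
proof -
 have [measurable]: "f \<in> borel_measurable M" "C 0 x \<in> sets M" using f C_sets by auto
 define m where "m = measure M (C 0 x)"
 have b: "(\<integral>\<^sup>+y. ind (C 0 x) y * ennreal (exp (c * \<bar>avg N y - avg 0 x\<bar>)) \<partial>M) \<le> ennreal (4 * m)" for N
 proof -
  have "(\<integral>\<^sup>+y. ind (C 0 x) y * ennreal (exp (c * \<bar>avg (0 + N) y - avg 0 x\<bar>)) \<partial>M)
    \<le> (\<integral>\<^sup>+y. ind (C 0 x) y * ennreal (2 + 2 * \<bar>f y - avg 0 x\<bar>) \<partial>M)" using assms by (intro exp_avg_bound) auto
  also have "\<dots> = (\<integral>\<^sup>+z. ennreal (2 * ind (C 0 x) z + 2 * (ind (C 0 x) z * \<bar>f z - avg 0 x\<bar>)) \<partial>M)"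
   by (intro nn_integral_cong) (auto simp: indicator_def)
  also have "\<dots> = ennreal (\<integral>z. 2 * ind (C 0 x) z + 2 * (ind (C 0 x) z * \<bar>f z - avg 0 x\<bar>) \<partial>M)"
   by (intro nn_integral_eq_integral L1_add integrable_mult_right cell_integrable cell_integrable0) auto
  also have "(\<integral>z. 2 * ind (C 0 x) z + 2 * (ind (C 0 x) z * \<bar>f z - avg 0 x\<bar>) \<partial>M)
     = 2 * m + 2 * (\<integral>z. ind (C 0 x) z * \<bar>f z - avg 0 x\<bar> \<partial>M)"
   using cell_integrable[of 0 x "avg 0 x"] cell_integrable0[of 0 x] sets.sets_into_space[OF C_sets]
   by (subst int_add) (auto simp: Int_absorb2 m_def)
  also have "ennreal \<dots> \<le> ennreal (4 * m)" using osc[of 0 x] by (intro ennreal_leI) (simp add: m_def)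
  finally show ?thesis by simp
 qed
 obtain s where s: "AE y in M. (\<lambda>n. ind (C 0 x) y * (avg (s n) y - f y)) \<longlonglongrightarrow> 0"
 proof -
  have "eventually (\<lambda>N. (\<integral>\<^sup>+y. ind (C 0 x) y * ennreal \<bar>avg N y - f y\<bar> \<partial>M) < 1) sequentially"
   using conv by (rule order_tendstoD) simp
  then obtain N0 where N0: "\<And>N. N \<ge> N0 ==> (\<integral>\<^sup>+y. ind (C 0 x) y * ennreal \<bar>avg N y - f y\<bar> \<partial>M) < 1"
   by (auto simp: eventually_sequentially)
  define u where "u N y = ind (C 0 x) y * (avg (N + N0) y - f y)" for N y
  have un: "(\<integral>\<^sup>+y. ennreal (norm (u N y)) \<partial>M) = (\<integral>\<^sup>+y. ind (C 0 x) y * ennreal \<bar>avg (N + N0) y - f y\<bar> \<partial>M)" for N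
   unfolding u_def by (intro nn_integral_cong) (auto simp: indicator_def)
  have iu: "integrable M (u N)" for N
  proof (rule integrableI_bounded)
   show "u N \<in> borel_measurable M" unfolding u_def by measurable
   show "(\<integral>\<^sup>+y. ennreal (norm (u N y)) \<partial>M) < \<infinity>" unfolding un using N0[of "N + N0"] by (auto intro: less_trans)
  qed
  have "(\<lambda>N. \<integral>y. norm (u N y) \<partial>M) \<longlonglongrightarrow> 0"
  proof -
   have "(\<lambda>N. \<integral>\<^sup>+y. ennreal (norm (u N y)) \<partial>M) \<longlonglongrightarrow> 0" unfolding un by (rule LIMSEQ_ignore_initial_segment[OF conv])
   hence "(\<lambda>N. ennreal (\<integral>y. norm (u N y) \<partial>M)) \<longlonglongrightarrow> ennreal 0" using iu by (simp add: nn_integral_eq_integral)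
   thus ?thesis by (subst (asm) tendsto_ennreal_iff) auto
  qed
  from tendsto_L1_AE_subseq[OF iu this] obtain r where r: "strict_mono (r :: nat => nat)" "AE y in M. (\<lambda>n. u (r n) y) \<longlonglongrightarrow> 0"
   by auto
  show ?thesis by (rule that[of "\<lambda>n. r n + N0"]) (use r(2) in \<open>simp add: u_def\<close>)
 qed
 have "(\<integral>\<^sup>+y. ind (C 0 x) y * ennreal (exp (c * \<bar>f y - avg 0 x\<bar>)) \<partial>M)
   \<le> (\<integral>\<^sup>+y. liminf (\<lambda>n. ind (C 0 x) y * ennreal (exp (c * \<bar>avg (s n) y - avg 0 x\<bar>))) \<partial>M)" using s
 proof (intro nn_integral_mono_AE, eventually_elim)
  fix y assume y: "(\<lambda>n. ind (C 0 x) y * (avg (s n) y - f y)) \<longlonglongrightarrow> 0"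
  show "ind (C 0 x) y * ennreal (exp (c * \<bar>f y - avg 0 x\<bar>))
    \<le> liminf (\<lambda>n. ind (C 0 x) y * ennreal (exp (c * \<bar>avg (s n) y - avg 0 x\<bar>)))"
  proof (cases "y \<in> C 0 x")
   case True
   hence "(\<lambda>n. avg (s n) y) \<longlonglongrightarrow> f y" using y by (simp add: LIM_zero_iff)
   hence "(\<lambda>n. ennreal (exp (c * \<bar>avg (s n) y - avg 0 x\<bar>))) \<longlonglongrightarrow> ennreal (exp (c * \<bar>f y - avg 0 x\<bar>))"
    by (intro tendsto_intros)
   from lim_imp_Liminf[OF _ this] True show ?thesis by simp
  qed simp
 qed
 also have "\<dots> \<le> liminf (\<lambda>n. \<integral>\<^sup>+y. ind (C 0 x) y * ennreal (exp (c * \<bar>avg (s n) y - avg 0 x\<bar>)) \<partial>M)"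
  by (intro nn_integral_liminf) measurable
 also have "\<dots> \<le> ennreal (4 * m)" using b by (intro Liminf_le) auto
 finally show ?thesis by (simp add: m_def)
qed

end


definition side :: "real => nat => real" where "side R n = 4 * R / 2 ^ n"

definition cell :: "real => nat => 'a::euclidean_space => 'a set" where
 "cell R n x = {y. \<forall>i\<in>Basis. \<lfloor>(y \<bullet> i + 2 * R) / side R n\<rfloor> = \<lfloor>(x \<bullet> i + 2 * R) / side R n\<rfloor>}"

lemma side_pos: "R > 0 ==> side R n > 0" by (simp add: side_def)

lemma side_Suc: "side R n = 2 * side R (Suc n)" by (simp add: side_def)

lemma cell_eq: "y \<in> cell R n x ==> cell R n y = cell R n x" by (auto simp: cell_def)

lemma cell_self: "x \<in> cell R n x" by (simp add: cell_def)

lemma floor_side_Suc: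
 assumes "R > 0"
 shows "\<lfloor>t / side R n\<rfloor> = \<lfloor>t / side R (Suc n)\<rfloor> div 2"
proof -
 have "\<lfloor>(t / side R (Suc n)) / real_of_int 2\<rfloor> = \<lfloor>t / side R (Suc n)\<rfloor> div 2" by (rule floor_divide_real_eq_div) simp
 thus ?thesis by (simp add: side_Suc[of R n] ac_simps)
qed

lemma cell_nest: "R > 0 ==> cell R (Suc n) x \<subseteq> cell R n x" by (auto simp: cell_def floor_side_Suc[of R _ n])

lemma cell_children_finite:
 fixes x :: "'a::euclidean_space"
 assumes "R > 0"
 shows "finite (cell R (Suc n) ` cell R n x)"
proof -
 define k where "k i = \<lfloor>(x \<bullet> i + 2 * R) / side R n\<rfloor>" for i
 define G where "G = PiE Basis (\<lambda>i::'a. {2 * k i, 2 * k i + 1})"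
 have "cell R (Suc n) ` cell R n x \<subseteq>
   (\<lambda>g. {y. \<forall>i\<in>Basis. \<lfloor>(y \<bullet> i + 2 * R) / side R (Suc n)\<rfloor> = g i}) ` G"
 proof safe
  fix y assume y: "y \<in> cell R n x"
  define g where "g = restrict (\<lambda>i. \<lfloor>(y \<bullet> i + 2 * R) / side R (Suc n)\<rfloor>) Basis"
  have "g i \<in> {2 * k i, 2 * k i + 1}" if "i \<in> Basis" for i
  proof -
   have "g i div 2 = k i"
    using y that floor_side_Suc[OF assms, of "y \<bullet> i + 2 * R" n] by (simp add: g_def k_def cell_def)
   hence "g i = 2 * k i \<or> g i = 2 * k i + 1" by presburger
   thus ?thesis by simp
  qed
  hence "g \<in> G" by (auto simp: G_def g_def PiE_def extensional_def)
  moreover have "cell R (Suc n) y = {z. \<forall>i\<in>Basis. \<lfloor>(z \<bullet> i + 2 * R) / side R (Suc n)\<rfloor> = g i}"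
   by (auto simp: cell_def g_def)
  ultimately show "cell R (Suc n) y \<in> (\<lambda>g. {y. \<forall>i\<in>Basis. \<lfloor>(y \<bullet> i + 2 * R) / side R (Suc n)\<rfloor> = g i}) ` G" by blast
 qed
 moreover have "finite G" unfolding G_def by (intro finite_PiE) auto
 ultimately show ?thesis using finite_subset by blast
qed

lemma cell_bounds:
 fixes x :: "'a::euclidean_space"
 assumes "R > 0"
 obtains a where "box a (a + side R n *\<^sub>R One) \<subseteq> cell R n x" "cell R n x \<subseteq> cbox a (a + side R n *\<^sub>R One)"
proof
 define s where "s = side R n"
 have s: "s > 0" using side_pos[OF assms] by (simp add: s_def)
 define k where "k i = \<lfloor>(x \<bullet> i + 2 * R) / s\<rfloor>" for i
 define a where "a = (\<Sum>i\<in>Basis. (s * real_of_int (k i) - 2 * R) *\<^sub>R i :: 'a)"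
 have ai: "a \<bullet> i = s * real_of_int (k i) - 2 * R" if "i \<in> Basis" for i
  using that by (simp add: a_def inner_sum_left_Basis)
 have One: "(a + s *\<^sub>R One) \<bullet> i = a \<bullet> i + s" if "i \<in> Basis" for i
  using that by (simp add: inner_add_left inner_sum_left_Basis)
 have eq: "\<lfloor>(t + 2 * R) / s\<rfloor> = k i \<longleftrightarrow> s * real_of_int (k i) - 2 * R \<le> t \<and> t < s * real_of_int (k i) - 2 * R + s" for t i
 proof -
  have "\<lfloor>(t + 2 * R) / s\<rfloor> = k i \<longleftrightarrow> real_of_int (k i) \<le> (t + 2 * R) / s \<and> (t + 2 * R) / s < real_of_int (k i) + 1"
   by (rule floor_eq_iff)
  also have "\<dots> \<longleftrightarrow> s * real_of_int (k i) - 2 * R \<le> t \<and> t < s * real_of_int (k i) - 2 * R + s"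
   using s by (auto simp: field_simps)
  finally show ?thesis .
 qed
 have c: "cell R n x = {y. \<forall>i\<in>Basis. a \<bullet> i \<le> y \<bullet> i \<and> y \<bullet> i < a \<bullet> i + s}"
  using eq ai by (auto simp: cell_def s_def[symmetric] k_def[symmetric])
 show "box a (a + side R n *\<^sub>R One) \<subseteq> cell R n x" unfolding c by (auto simp: mem_box One s_def[symmetric] less_imp_le)
 show "cell R n x \<subseteq> cbox a (a + side R n *\<^sub>R One)"
  unfolding c by (auto simp: mem_box One s_def[symmetric] less_imp_le)
qed

lemma cell_indicator:
 "ind (cell R n x) y =
  (\<Prod>i\<in>Basis. if \<lfloor>(y \<bullet> i + 2 * R) / side R n\<rfloor> = \<lfloor>(x \<bullet> i + 2 * R) / side R n\<rfloor> then 1 else (0::real))"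
 by (auto simp: cell_def indicator_def prod_zero_iff)

lemma cell_indicator_measurable:
 "(\<lambda>p. ind (cell R n (fst p)) (snd p) :: real) \<in> borel_measurable (borel \<Otimes>\<^sub>M borel)"
 unfolding cell_indicator by measurable

lemma cell_sets[measurable]: "cell R n x \<in> sets borel"
proof -
 have "(\<lambda>y. ind (cell R n x) y :: real) \<in> Borel" unfolding cell_indicator by measurable
 thus ?thesis by (simp add: borel_measurable_indicator_iff)
qed

lemma cell_emeasure:
 fixes x :: "'a::euclidean_space"
 assumes "R > 0"
 shows "emeasure lborel (cell R n x) = ennreal (side R n ^ DIM('a))"
proof -
 obtain a where a: "box a (a + side R n *\<^sub>R One) \<subseteq> cell R n x" "cell R n x \<subseteq> cbox a (a + side R n *\<^sub>R One)"
  using cell_bounds[OF assms] by metis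
 have s: "side R n > 0" by (rule side_pos[OF assms])
 have "emeasure lborel (box a (a + side R n *\<^sub>R One)) = ennreal (side R n ^ DIM('a))"
  "emeasure lborel (cbox a (a + side R n *\<^sub>R One)) = ennreal (side R n ^ DIM('a))"
  using s by (auto simp: emeasure_lborel_box_eq emeasure_lborel_cbox_eq inner_add_left inner_sum_left_Basis)
 thus ?thesis using emeasure_mono[OF a(1), of lborel] emeasure_mono[OF a(2), of lborel] by (auto intro: antisym)
qed

lemma cell_measure:
 fixes x :: "'a::euclidean_space"
 shows "R > 0 ==> measure lborel (cell R n x) = side R n ^ DIM('a)"
 using cell_emeasure[of R n x] side_pos[of R n] by (simp add: measure_def)

lemma cell_close:
 assumes "R > 0" "y \<in> cell R n x" "i \<in> Basis"
 shows "\<bar>(x - y) \<bullet> i\<bar> \<le> side R n"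
proof -
 obtain a where a: "cell R n x \<subseteq> cbox a (a + side R n *\<^sub>R One)" using cell_bounds[OF assms(1)] by metis
 have "x \<in> cbox a (a + side R n *\<^sub>R One)" "y \<in> cbox a (a + side R n *\<^sub>R One)" using a assms(2) cell_self by auto
 hence "a \<bullet> i \<le> x \<bullet> i" "x \<bullet> i \<le> a \<bullet> i + side R n" "a \<bullet> i \<le> y \<bullet> i" "y \<bullet> i \<le> a \<bullet> i + side R n"
  using assms(3) by (auto simp: mem_box inner_add_left inner_sum_left_Basis)
 thus ?thesis by (simp add: inner_diff_left)
qed

lemma emeasure_centered_cube:
 assumes "s \<ge> 0"
 shows "emeasure lborel (cbox (- s *\<^sub>R One) (s *\<^sub>R One :: 'a::euclidean_space)) = ennreal ((2 * s) ^ DIM('a))"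
proof -
 have 1: "(\<Prod>b\<in>Basis. (s *\<^sub>R One - - s *\<^sub>R One :: 'a) \<bullet> b) = (\<Prod>b\<in>(Basis::'a set). 2 * s)"
  by (intro prod.cong refl) (simp add: inner_add_left inner_sum_left_Basis)
 have 2: "\<forall>b\<in>Basis. (- s *\<^sub>R One :: 'a) \<bullet> b \<le> (s *\<^sub>R One) \<bullet> b" using assms by (auto simp: inner_sum_left_Basis)
 show ?thesis by (simp only: emeasure_lborel_cbox_eq if_P[OF 2] 1 prod_constant)
qed

lemma norm_le_DIM:
 fixes h :: "'a::euclidean_space" and s :: real
 assumes "\<And>i. i \<in> Basis ==> \<bar>h \<bullet> i\<bar> \<le> s"
 shows "norm h \<le> DIM('a) * s"
 using order_trans[OF norm_le_l1[of h] sum_mono[of Basis "\<lambda>i. \<bar>h \<bullet> i\<bar>" "\<lambda>i. s"]] assms by auto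

lemma mean_lborel:
 assumes [measurable]: "A \<in> sets borel" "g \<in> Borel"
 shows "mean A g = (LBINT y. ind A y * g y) / measure lborel A"
 unfolding mean_def set_lebesgue_integral_def by (subst integral_completion) auto

lemma BMO_ball_oscillation:
 fixes f :: "'a::euclidean_space => real"
 assumes [measurable]: "f \<in> Borel" and f: "BMO_seminorm f \<le> ennreal \<beta>" "\<beta> > 0" and r: "r > 0"
 shows "(LBINT y. ind (ball x r) y * \<bar>f y - mean (ball x r) f\<bar>) \<le> \<beta> * measure lborel (ball x r)"
proof -
 have "ennreal (mean (ball x r) (\<lambda>y. \<bar>f y - mean (ball x r) f\<bar>)) \<le> BMO_seminorm f"
  unfolding BMO_seminorm_def using r by (intro SUP_upper2[of "(x, r)"]) auto
 also note f(1)
 finally have "mean (ball x r) (\<lambda>y. \<bar>f y - mean (ball x r) f\<bar>) \<le> \<beta>" using f(2) by simp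
 moreover have "measure lborel (ball x r) > 0" using content_ball_pos[OF r] by simp
 ultimately show ?thesis by (subst (asm) mean_lborel) (auto simp: field_simps)
qed

lemma oscillation_le:
 fixes f :: "'a::euclidean_space => real"
 assumes f: "L1 f" and Q[measurable]: "Q \<in> sets borel" "emeasure lborel Q < \<infinity>" "measure lborel Q > 0"
 shows "(LBINT y. ind Q y * \<bar>f y - (LBINT y. ind Q y * f y) / measure lborel Q\<bar>)
   \<le> 2 * (LBINT y. ind Q y * \<bar>f y - m\<bar>)"
proof -
 define a where "a = (LBINT y. ind Q y * f y) / measure lborel Q"
 have i0: "L1 (\<lambda>y. ind Q y :: real)" using Q by (intro integrable_real_indicator) auto
 have i1: "L1 (\<lambda>y. ind Q y * f y)" using integrable_real_mult_indicator[of Q lborel f] f Q by (simp add: mult.commute)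
 have i2: "L1 (\<lambda>y. ind Q y * (f y - b))" for b using i0 i1 by (simp add: right_diff_distrib)
 have i3: "L1 (\<lambda>y. ind Q y * \<bar>f y - b\<bar>)" for b using integrable_abs[OF i2[of b]] by (simp add: abs_mult)
 have "(LBINT y. ind Q y * (f y - m)) = (a - m) * measure lborel Q"
  using i0 i1 Q by (simp add: right_diff_distrib a_def left_diff_distrib)
 hence "\<bar>a - m\<bar> * measure lborel Q = \<bar>(LBINT y. ind Q y * (f y - m))\<bar>" by (simp add: abs_mult)
 also have "\<dots> \<le> (LBINT y. \<bar>ind Q y * (f y - m)\<bar>)" by (rule integral_abs_bound)
 finally have am: "\<bar>a - m\<bar> * measure lborel Q \<le> (LBINT y. ind Q y * \<bar>f y - m\<bar>)" by (simp add: abs_mult)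
 have "(LBINT y. ind Q y * \<bar>f y - a\<bar>) \<le> (LBINT y. ind Q y * \<bar>f y - m\<bar> + ind Q y * \<bar>a - m\<bar>)"
  using i0 by (intro integral_mono i3 L1_add integrable_mult_left) (auto simp: indicator_def)
 also have "\<dots> = (LBINT y. ind Q y * \<bar>f y - m\<bar>) + \<bar>a - m\<bar> * measure lborel Q"
  using i0 i3[of m] by (simp add: mult.commute)
 finally show ?thesis using am by (simp add: a_def)
qed

definition JN_const :: "'a::euclidean_space itself => real" where
 "JN_const _ = ln (3/2) / (2 + 2 ^ DIM('a)) / (2 * (DIM('a) + 1) ^ DIM('a) * unit_ball_vol (DIM('a)))"

lemma JN_const_pos: "JN_const TYPE('a::euclidean_space) > 0"
 unfolding JN_const_def by (intro divide_pos_pos mult_pos_pos ln_gt_zero add_pos_pos zero_less_power unit_ball_vol_pos) auto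

lemma John_Nirenberg:
 fixes f :: "'a::euclidean_space => real"
 assumes R: "R > 0" and f: "L1 f" and supp: "AE x in lborel. x \<notin> ball 0 R --> f x = 0"
  and bmo: "BMO_seminorm f \<le> ennreal \<beta>" and \<beta>: "\<beta> > 0"
 shows "(NNBINT x. ind (ball 0 R) x * ennreal (exp (JN_const TYPE('a) * \<bar>f x\<bar> / \<beta>)))
   \<le> ennreal (6 * (4 * R) ^ DIM('a))"
proof -
 define D where "D = DIM('a)"
 have D: "D \<ge> 1" by (simp add: D_def Suc_leI)
 define K where "K = 2 * (real D + 1) ^ D * unit_ball_vol (real D)"
 have K: "K > 0" unfolding K_def by (intro mult_pos_pos zero_less_power unit_ball_vol_pos) auto
 define g where "g x = f x / (K * \<beta>)" for x
 have ig: "L1 g" using f by (simp add: g_def[abs_def])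
 have [measurable]: "f \<in> Borel" "g \<in> Borel" using f ig by auto
 define avg where "avg n x = (LBINT y. ind (cell R n x) y * g y) / measure lborel (cell R n x)" for n x
 note s = side_pos[OF R]
 have \<mu>: "measure lborel (cell R n x) = side R n ^ D" for n and x :: 'a by (simp add: cell_measure R D_def)
 interpret T: cell_tree lborel "cell R" "2 ^ D" g avg
 proof
  show "cell R n x \<in> sets lborel" for n and x :: 'a by simp
  show "emeasure lborel (cell R n x) < \<infinity>" for n and x :: 'a by (simp add: cell_emeasure R)
  show "measure lborel (cell R n x) > 0" for n and x :: 'a using s by (simp add: \<mu>)
  show "measure lborel (cell R n x) \<le> 2 ^ D * measure lborel (cell R (Suc n) x)" for n and x :: 'a
   by (simp add: \<mu> side_Suc[of R n] power_mult_distrib)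
  show "avg n \<in> borel_measurable lborel" for n
  proof -
   have "(\<lambda>x. LBINT y. ind (cell R n x) y * g y) \<in> borel_measurable lborel"
    using cell_indicator_measurable[of R n, where 'a='a]
    by (intro lborel.borel_measurable_lebesgue_integral) (auto simp: split_beta')
   thus ?thesis by (simp add: avg_def[abs_def] \<mu>)
  qed
  show "(LBINT y. ind (cell R n x) y * \<bar>g y - avg n x\<bar>) \<le> measure lborel (cell R n x)" for n x
  proof -
   define Q where "Q = cell R n x"
   define r where "r = (real D + 1) * side R n"
   have r: "r > 0" unfolding r_def using s by (intro mult_pos_pos) auto
   have sub: "Q \<subseteq> ball x r"
   proof
    fix y assume "y \<in> Q"
    hence "norm (x - y) \<le> D * side R n" unfolding D_def Q_def by (auto intro!: norm_le_DIM cell_close[OF R])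
    thus "y \<in> ball x r" using s[of n] by (auto simp: dist_norm r_def algebra_simps)
   qed
   have "measure lborel (ball x r) = unit_ball_vol (real D) * r ^ D" using content_ball[of r x] r by (simp add: D_def)
   hence vB: "2 * measure lborel (ball x r) = K * measure lborel Q"
    by (simp add: K_def r_def Q_def \<mu> power_mult_distrib)
   have eq: "g y - avg n x = (f y - (LBINT y. ind Q y * f y) / measure lborel Q) / (K * \<beta>)" for y
    by (simp add: g_def avg_def Q_def diff_divide_distrib)
   have "(LBINT y. ind Q y * \<bar>g y - avg n x\<bar>)
     = (LBINT y. ind Q y * \<bar>f y - (LBINT y. ind Q y * f y) / measure lborel Q\<bar>) / (K * \<beta>)"
    unfolding eq using K \<beta> by (simp add: abs_divide abs_mult)
   also have "\<dots> \<le> 2 * (LBINT y. ind Q y * \<bar>f y - mean (ball x r) f\<bar>) / (K * \<beta>)"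
    using K \<beta> s by (intro divide_right_mono oscillation_le f) (auto simp: Q_def cell_emeasure R \<mu>)
   also have "\<dots> \<le> 2 * (LBINT y. ind (ball x r) y * \<bar>f y - mean (ball x r) f\<bar>) / (K * \<beta>)"
   proof (intro divide_right_mono mult_left_mono integral_mono)
    have "L1 (\<lambda>y. ind A y * \<bar>f y - m\<bar>)" if "A \<in> sets borel" "emeasure lborel A < \<infinity>" for A m
    proof -
     have "L1 (\<lambda>y. ind A y * f y - ind A y * m)" using integrable_real_mult_indicator[of A lborel f] f that
      by (intro L1_diff integrable_mult_left integrable_real_indicator) (auto simp: mult.commute)
     from integrable_abs[OF this] show ?thesis by (simp add: abs_mult flip: right_diff_distrib)
    qed
    thus "L1 (\<lambda>y. ind Q y * \<bar>f y - mean (ball x r) f\<bar>)"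
     "L1 (\<lambda>y. ind (ball x r) y * \<bar>f y - mean (ball x r) f\<bar>)"
     using emeasure_lborel_ball_finite[of x r] by (auto simp: Q_def cell_emeasure R)
   qed (use sub K \<beta> in \<open>auto simp: indicator_def\<close>)
   also have "\<dots> \<le> 2 * (\<beta> * measure lborel (ball x r)) / (K * \<beta>)"
    using K \<beta> bmo r by (intro divide_right_mono mult_left_mono BMO_ball_oscillation) auto
   also have "\<dots> = (2 * measure lborel (ball x r)) / K" using \<beta> K by (simp add: field_simps)
   also have "\<dots> = measure lborel Q" unfolding vB using K by simp
   finally show ?thesis by (simp add: Q_def)
  qed
 qed (rule cell_self cell_nest[OF R] cell_children_finite[OF R] ig | erule cell_eq | simp add: avg_def)+

 define Q where "Q = cell R 0 (0::'a)"
 have [measurable]: "Q \<in> sets borel" by (simp add: Q_def)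
 have \<mu>Q: "measure lborel Q = (4 * R) ^ D" "emeasure lborel Q < \<infinity>" by (simp_all add: Q_def \<mu> side_def cell_emeasure R)
 have subQ: "ball 0 R \<subseteq> Q"
 proof
  fix y :: 'a assume "y \<in> ball 0 R"
  hence y: "\<bar>y \<bullet> i\<bar> < R" if "i \<in> Basis" for i using Basis_le_norm[OF that, of y] by (auto intro: le_less_trans)
  have "\<lfloor>(y \<bullet> i + 2 * R) / (4 * R)\<rfloor> = 0" if "i \<in> Basis" for i
   using y[OF that] R by (subst floor_eq_iff) (auto simp: field_simps)
  moreover have "\<lfloor>2 * R / (4 * R)\<rfloor> = 0" using R by (subst floor_eq_iff) (auto simp: field_simps)
  ultimately show "y \<in> Q" by (simp add: Q_def cell_def side_def)
 qed
 have conv: "(\<lambda>N. NNBINT y. ind Q y * ennreal \<bar>avg N y - g y\<bar>) \<longlonglongrightarrow> 0"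
 proof (rule order_tendstoI)
  fix e :: ennreal assume "0 < e"
  then obtain e'' where e'': "0 < e''" "e'' < e" using dense by blast
  then obtain e' where e': "e' > 0" "ennreal e' < e" by (cases e'') (auto simp: top_unique)
  define \<eta> where "\<eta> = e' / 2 ^ D"
  have \<eta>: "\<eta> > 0" using e' by (simp add: \<eta>_def)
  obtain d where d: "d > 0" "\<And>h. norm h < d ==> shift_diff g h \<le> ennreal \<eta>" using shift_diff_small[OF ig \<eta>] by metis
  have "(\<lambda>N. D * side R N) \<longlonglongrightarrow> real D * 0" unfolding side_def by (intro tendsto_intros LIMSEQ_divide_realpow_zero) auto
  hence "\<forall>\<^sub>F N in sequentially. D * side R N < d" using d(1) by (intro order_tendstoD) auto
  thus "\<forall>\<^sub>F N in sequentially. (NNBINT y. ind Q y * ennreal \<bar>avg N y - g y\<bar>) < e"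
  proof eventually_elim
   fix N assume N: "D * side R N < d"
   define s where "s = side R N"
   have s0: "s > 0" using side_pos[OF R] by (simp add: s_def)
   define B where "B = cbox (- s *\<^sub>R One) (s *\<^sub>R One :: 'a)"
   have [measurable]: "B \<in> sets borel" by (simp add: B_def)
   have B: "h \<in> B \<longleftrightarrow> (\<forall>i\<in>Basis. \<bar>h \<bullet> i\<bar> \<le> s)" for h by (auto simp: B_def mem_box inner_sum_left_Basis abs_le_iff)
   have eB: "emeasure lborel B = ennreal ((2 * s) ^ D)"
    using s0 unfolding B_def D_def by (intro emeasure_centered_cube) simp
   have pw: "ennreal \<bar>avg N y - g y\<bar> \<le> ennreal (1 / s ^ D) * (NNBINT h. ind B h * ennreal \<bar>g (y - h) - g y\<bar>)" for y
   proof -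
    have "ennreal (\<bar>avg N y - g y\<bar> * s ^ D) \<le> ennreal (LBINT z. ind (cell R N y) z * \<bar>g z - g y\<bar>)"
     using T.avg_diff_le[of N y "g y"] by (intro ennreal_leI) (simp add: \<mu> s_def)
    also have "\<dots> = (NNBINT z. ennreal (ind (cell R N y) z * \<bar>g z - g y\<bar>))"
     by (intro nn_integral_eq_integral[symmetric] T.cell_integrable) auto
    also have "\<dots> = (NNBINT h. ennreal (ind (cell R N y) (y - h) * \<bar>g (y - h) - g y\<bar>))"
     using nn_integral_lborel_affine[of "\<lambda>z. ennreal (ind (cell R N y) z * \<bar>g z - g y\<bar>)" "-1" y] by simp
    also have "\<dots> \<le> (NNBINT h. ind B h * ennreal \<bar>g (y - h) - g y\<bar>)"
    proof (rule nn_integral_mono)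
     fix h
     show "ennreal (ind (cell R N y) (y - h) * \<bar>g (y - h) - g y\<bar>) \<le> ind B h * ennreal \<bar>g (y - h) - g y\<bar>"
     proof (cases "y - h \<in> cell R N y")
      case True
      hence "h \<in> B" using cell_close[OF R True] by (auto simp: B s_def)
      thus ?thesis using True by simp
     qed simp
    qed
    finally have "ennreal (1 / s ^ D) * ennreal (\<bar>avg N y - g y\<bar> * s ^ D)
      \<le> ennreal (1 / s ^ D) * (NNBINT h. ind B h * ennreal \<bar>g (y - h) - g y\<bar>)" by (rule mult_left_mono) simp
    thus ?thesis using s0 by (simp flip: ennreal_mult)
   qed
   have "(NNBINT y. ind Q y * ennreal \<bar>avg N y - g y\<bar>)
     \<le> (NNBINT y. ennreal (1 / s ^ D) * (NNBINT h. ind B h * ennreal \<bar>g (y - h) - g y\<bar>))"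
    using pw by (intro nn_integral_mono) (auto simp: indicator_def)
   also have "\<dots> = ennreal (1 / s ^ D) * (NNBINT y. (NNBINT h. ind B h * ennreal \<bar>g (y - h) - g y\<bar>))"
    by (rule nn_integral_cmult) measurable
   also have "(NNBINT y. (NNBINT h. ind B h * ennreal \<bar>g (y - h) - g y\<bar>))
     = (NNBINT h. (NNBINT y. ind B h * ennreal \<bar>g (y - h) - g y\<bar>))" by (rule lborel_pair.Fubini') measurable
   also have "\<dots> = (NNBINT h. ind B h * shift_diff g h)"
    unfolding shift_diff_def by (intro nn_integral_cong nn_integral_cmult) measurable
   also have "\<dots> \<le> (NNBINT h. ennreal \<eta> * ind B h)"
   proof (rule nn_integral_mono)
    fix h :: 'a
    show "ind B h * shift_diff g h \<le> ennreal \<eta> * ind B h"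
    proof (cases "h \<in> B")
     case True
     hence "norm h \<le> D * s" unfolding D_def by (intro norm_le_DIM) (auto simp: B)
     thus ?thesis using d(2)[of h] N True by (simp add: s_def)
    qed simp
   qed
   also have "\<dots> = ennreal \<eta> * ennreal ((2 * s) ^ D)" by (simp add: nn_integral_cmult eB)
   also have "ennreal (1 / s ^ D) * \<dots> = ennreal e'"
    using s0 e'(1) by (simp add: power_mult_distrib \<eta>_def flip: ennreal_mult)
   finally have "(NNBINT y. ind Q y * ennreal \<bar>avg N y - g y\<bar>) \<le> ennreal e'" by (simp add: mult_left_mono)
   with e'(2) show "(NNBINT y. ind Q y * ennreal \<bar>avg N y - g y\<bar>) < e" by simp
  qed
 qed simp
 define c :: real where "c = ln (3/2) / (2 + 2 ^ D)"
 have c: "c > 0" unfolding c_def by (intro divide_pos_pos ln_gt_zero add_pos_pos) auto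
 have exp_c: "exp (c * (2 + 2 ^ D)) = 3/2" using add_pos_pos[of 2 "2 ^ D :: real"] by (simp add: c_def)
 have exp_2c: "exp (c * 2) \<le> 3/2" using c by (subst exp_c[symmetric]) (auto intro!: mult_left_mono)
 define a where "a = avg 0 0"
 have "(NNBINT y. ind Q y * ennreal (exp (c * \<bar>g y - a\<bar>))) \<le> ennreal (4 * (4 * R) ^ D)"
  using T.exp_bound[of c 0] conv c exp_c \<mu>Q by (simp add: Q_def a_def)
 note JN = this
 have a2: "\<bar>a\<bar> \<le> 2"
 proof -
  define Z where "Z = Q - ball 0 R"
  have "ball 0 R \<subseteq> cbox (- R *\<^sub>R One) (R *\<^sub>R One :: 'a)"
  proof
   fix y :: 'a assume "y \<in> ball 0 R"
   hence "\<bar>y \<bullet> i\<bar> \<le> R" if "i \<in> Basis" for i using Basis_le_norm[OF that, of y] by (auto intro: order_trans)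
   thus "y \<in> cbox (- R *\<^sub>R One) (R *\<^sub>R One)" by (auto simp: mem_box inner_sum_left_Basis abs_le_iff minus_le_iff)
  qed
  hence "emeasure lborel (ball (0::'a) R) \<le> emeasure lborel (cbox (- R *\<^sub>R One) (R *\<^sub>R One :: 'a))"
   by (intro emeasure_mono) auto
  also have "\<dots> = ennreal ((2 * R) ^ D)" using R unfolding D_def by (intro emeasure_centered_cube) simp
  finally have "measure lborel (ball (0::'a) R) \<le> (2 * R) ^ D" using R by (simp add: measure_def enn2real_leI)
  moreover have "2 * (2 * R) ^ D \<le> (4 * R) ^ D"
  proof -
   have "(4 * R) ^ D = 2 ^ D * (2 * R) ^ D" by (subst power_mult_distrib[symmetric]) simp
   moreover have "(2::real) ^ 1 \<le> 2 ^ D" using D by (intro power_increasing) auto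
   hence "2 * (2 * R) ^ D \<le> 2 ^ D * (2 * R) ^ D" using R by (intro mult_right_mono) auto
   ultimately show ?thesis by (simp only:)
  qed
  moreover have "measure lborel Z = (4 * R) ^ D - measure lborel (ball (0::'a) R)"
   unfolding Z_def \<mu>Q(1)[symmetric] using subQ \<mu>Q(2) by (intro measure_Diff) auto
  ultimately have Z: "measure lborel Z \<ge> (4 * R) ^ D / 2" by linarith
  have iZ: "L1 (\<lambda>y. ind Z y * \<bar>a\<bar>)" using \<mu>Q(2) emeasure_mono[of Z Q lborel] unfolding Z_def
   by (intro integrable_mult_left integrable_real_indicator) (auto intro: le_less_trans)
  have "\<bar>a\<bar> * measure lborel Z = (LBINT y. ind Z y * \<bar>a\<bar>)" by (simp add: Z_def)
  also have "\<dots> \<le> (LBINT y. ind Q y * \<bar>g y - a\<bar>)" using supp iZ T.cell_integrable[of 0 0 a, folded Q_def]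
   by (intro integral_mono_AE) (auto simp: Z_def g_def indicator_def elim!: eventually_mono)
  also have "\<dots> \<le> (4 * R) ^ D" using T.osc[of 0 0, folded Q_def a_def] \<mu>Q by simp
  finally have 1: "\<bar>a\<bar> * measure lborel Z \<le> (4 * R) ^ D" .
  have "\<bar>a\<bar> * ((4 * R) ^ D / 2) \<le> \<bar>a\<bar> * measure lborel Z" using Z by (intro mult_left_mono) auto
  hence "\<bar>a\<bar> * ((4 * R) ^ D / 2) \<le> 2 * ((4 * R) ^ D / 2)" using 1 by linarith
  moreover have "(4 * R) ^ D / 2 > 0" using R by simp
  ultimately show ?thesis by (rule mult_right_le_imp_le)
 qed
 have "(NNBINT x. ind (ball 0 R) x * ennreal (exp (JN_const TYPE('a) * \<bar>f x\<bar> / \<beta>)))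
   \<le> (NNBINT x. ennreal (3/2) * (ind Q x * ennreal (exp (c * \<bar>g x - a\<bar>))))"
 proof (rule nn_integral_mono)
  fix x
  have "JN_const TYPE('a) = c / K"
   unfolding JN_const_def c_def K_def D_def by (simp only: of_nat_add of_nat_1 of_nat_power of_nat_mult of_nat_numeral)
  hence "JN_const TYPE('a) * \<bar>f x\<bar> / \<beta> = c * \<bar>g x\<bar>" using K \<beta> by (simp add: g_def abs_divide abs_mult)
  also have "\<dots> \<le> c * (2 + \<bar>g x - a\<bar>)" using c a2 by (intro mult_left_mono) auto
  finally have "exp (JN_const TYPE('a) * \<bar>f x\<bar> / \<beta>) \<le> exp (c * 2) * exp (c * \<bar>g x - a\<bar>)"
   by (simp add: distrib_left flip: exp_add)
  also have "\<dots> \<le> 3/2 * exp (c * \<bar>g x - a\<bar>)" using exp_2c by (intro mult_right_mono) auto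
  finally show "ind (ball 0 R) x * ennreal (exp (JN_const TYPE('a) * \<bar>f x\<bar> / \<beta>))
   \<le> ennreal (3/2) * (ind Q x * ennreal (exp (c * \<bar>g x - a\<bar>)))"
   using subQ by (auto simp: indicator_def simp flip: ennreal_mult intro!: ennreal_leI)
 qed
 also have "\<dots> = ennreal (3/2) * (NNBINT x. ind Q x * ennreal (exp (c * \<bar>g x - a\<bar>)))"
  by (rule nn_integral_cmult) measurable
 also have "\<dots> \<le> ennreal (3/2) * ennreal (4 * (4 * R) ^ D)" using JN by (intro mult_left_mono) auto
 also have "\<dots> = ennreal (6 * (4 * R) ^ D)" using R by (simp flip: ennreal_mult)
 finally show ?thesis by (simp add: D_def)
qed


lemma Hahn_Banach_functions:
 fixes V S :: "('a => real) set" and p l :: "('a => real) => real"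
 assumes V_add: "\<And>f g. f \<in> V ==> g \<in> V ==> (\<lambda>x. f x + g x) \<in> V"
  and V_scale: "\<And>f c. f \<in> V ==> (\<lambda>x. c * f x) \<in> V"
  and p_add: "\<And>f g. f \<in> V ==> g \<in> V ==> p (\<lambda>x. f x + g x) \<le> p f + p g"
  and p_scale: "\<And>f c. f \<in> V ==> c \<ge> 0 ==> p (\<lambda>x. c * f x) = c * p f"
  and SV: "S \<subseteq> V" and S0: "S \<noteq> {}"
  and S_add: "\<And>f g. f \<in> S ==> g \<in> S ==> (\<lambda>x. f x + g x) \<in> S \<and> l (\<lambda>x. f x + g x) = l f + l g"
  and S_scale: "\<And>f c. f \<in> S ==> (\<lambda>x. c * f x) \<in> S \<and> l (\<lambda>x. c * f x) = c * l f"
  and l_le: "\<And>f. f \<in> S ==> l f \<le> p f"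
 obtains F where "\<And>f. f \<in> S ==> F f = l f" "\<And>f. f \<in> V ==> F f \<le> p f"
  "\<And>f g. f \<in> V ==> g \<in> V ==> F (\<lambda>x. f x + g x) = F f + F g"
  "\<And>f c. f \<in> V ==> F (\<lambda>x. c * f x) = c * F f"
proof -
 define good where "good G \<longleftrightarrow>
   (\<forall>f a. (f, a) \<in> G --> f \<in> V \<and> a \<le> p f) \<and>
   (\<forall>f a g b. (f, a) \<in> G --> (g, b) \<in> G --> ((\<lambda>x. f x + g x), a + b) \<in> G) \<and>
   (\<forall>f a c. (f, a) \<in> G --> ((\<lambda>x. c * f x), c * a) \<in> G) \<and>
   (\<lambda>f. (f, l f)) ` S \<subseteq> G" for G
 have good_le: "f \<in> V" "a \<le> p f" if "good G" "(f, a) \<in> G" for G f a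
  using that(1)[unfolded good_def, THEN conjunct1] that(2) by auto
 have good_add: "((\<lambda>x. f x + g x), a + b) \<in> G" if "good G" "(f, a) \<in> G" "(g, b) \<in> G" for G f a g b
  using that(1)[unfolded good_def, THEN conjunct2, THEN conjunct1] that(2,3) by auto
 have good_scale: "((\<lambda>x. c * f x), c * a) \<in> G" if "good G" "(f, a) \<in> G" for G f a c
  using that(1)[unfolded good_def, THEN conjunct2, THEN conjunct2, THEN conjunct1] that(2) by auto
 have good_l: "(\<lambda>f. (f, l f)) ` S \<subseteq> G" if "good G" for G
  using that[unfolded good_def, THEN conjunct2, THEN conjunct2, THEN conjunct2] .
 have l_good: "good ((\<lambda>f. (f, l f)) ` S)"
  unfolding good_def using SV l_le S_add S_scale by (auto simp: image_iff subset_iff)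
 have "\<exists>G\<in>Collect good. \<forall>X\<in>Collect good. G \<subseteq> X --> X = G"
 proof (rule subset_Zorn_nonempty)
  show "Collect good \<noteq> {}" using l_good by auto
  fix \<C> assume C: "\<C> \<noteq> {}" "subset.chain (Collect good) \<C>"
  hence Cg: "\<And>G. G \<in> \<C> ==> good G" and ch: "\<And>G H. G \<in> \<C> ==> H \<in> \<C> ==> G \<subseteq> H \<or> H \<subseteq> G"
   by (auto simp: subset.chain_def subset_eq)
  have "good (\<Union>\<C>)" unfolding good_def
  proof (intro conjI allI impI)
   fix f a g b assume "(f, a) \<in> \<Union>\<C>" "(g, b) \<in> \<Union>\<C>"
   then obtain G H where GH: "G \<in> \<C>" "(f, a) \<in> G" "H \<in> \<C>" "(g, b) \<in> H" by auto
   then obtain L where L: "L \<in> \<C>" "(f, a) \<in> L" "(g, b) \<in> L" using ch[of G H] by auto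
   show "((\<lambda>x. f x + g x), a + b) \<in> \<Union>\<C>" using good_add[OF Cg[OF L(1)] L(2,3)] L(1) by (rule UnionI[rotated])
  next
   fix f a c assume "(f, a) \<in> \<Union>\<C>"
   then obtain L where L: "L \<in> \<C>" "(f, a) \<in> L" by auto
   show "((\<lambda>x. c * f x), c * a) \<in> \<Union>\<C>" using good_scale[OF Cg[OF L(1)] L(2)] L(1) by (rule UnionI[rotated])
  next
   fix f a assume "(f, a) \<in> \<Union>\<C>"
   then obtain L where L: "L \<in> \<C>" "(f, a) \<in> L" by auto
   show "f \<in> V" "a \<le> p f" using good_le[OF Cg[OF L(1)] L(2)] by auto
  next
   show "(\<lambda>f. (f, l f)) ` S \<subseteq> \<Union>\<C>" using C(1) good_l[OF Cg] by blast
  qed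
  thus "\<Union>\<C> \<in> Collect good" by simp
 qed
 then obtain G where G: "good G" and max: "\<And>X. good X ==> G \<subseteq> X ==> X = G" by blast
 have G_le: "\<And>f a. (f, a) \<in> G ==> f \<in> V \<and> a \<le> p f"
  and G_add: "\<And>f a g b. (f, a) \<in> G ==> (g, b) \<in> G ==> ((\<lambda>x. f x + g x), a + b) \<in> G"
  and G_scale: "\<And>f a c. (f, a) \<in> G ==> ((\<lambda>x. c * f x), c * a) \<in> G"
  and G_l: "\<And>f. f \<in> S ==> (f, l f) \<in> G" using good_le[OF G] good_add[OF G] good_scale[OF G] good_l[OF G] by auto
 obtain f0 where f0: "f0 \<in> S" using S0 by auto
 have zero_V: "(\<lambda>x. 0) \<in> V" using V_scale[of f0 0] f0 SV by auto
 have p0: "p (\<lambda>x. 0) = 0" using p_scale[of f0 0] f0 SV by auto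
 have zero_G: "((\<lambda>x. 0), 0) \<in> G" using G_scale[OF G_l[OF f0], of 0] by simp
 have uniq: "a = b" if "(f, a) \<in> G" "(f, b) \<in> G" for f a b
 proof -
  have "a \<le> b" if "(f, a) \<in> G" "(f, b) \<in> G" for a b
   using G_le[OF G_add[OF that(1) G_scale[OF that(2), of "-1"]]] p0 by simp
  thus ?thesis using that by (meson antisym)
 qed
 have dom: "\<exists>a. (g0, a) \<in> G" if g0: "g0 \<in> V" for g0
 proof -
  define X where "X = {a - p (\<lambda>x. f x - g0 x) | f a. (f, a) \<in> G}"
  have minus_V: "(\<lambda>x. f x - g0 x) \<in> V" if "f \<in> V" for f using V_add[OF that V_scale[OF g0, of "-1"]] by simp
  have le: "a - p (\<lambda>x. f x - g0 x) \<le> p (\<lambda>x. g x + g0 x) - b" if "(f, a) \<in> G" "(g, b) \<in> G" for f a g b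
  proof -
   have "a + b \<le> p (\<lambda>x. f x + g x)" using G_le[OF G_add[OF that]] by simp
   also have "\<dots> = p (\<lambda>x. (f x - g0 x) + (g x + g0 x))" by simp
   also have "\<dots> \<le> p (\<lambda>x. f x - g0 x) + p (\<lambda>x. g x + g0 x)"
    using G_le[OF that(1)] G_le[OF that(2)] g0 by (intro p_add minus_V V_add) auto
   finally show ?thesis by simp
  qed
  have X0: "X \<noteq> {}" using zero_G by (auto simp: X_def)
  have Xb: "bdd_above X" 
   by (rule bdd_aboveI[of X "p (\<lambda>x. 0 + g0 x) - 0"]) (use le[OF _ zero_G] in \<open>unfold X_def, blast\<close>)
  define \<xi> where "\<xi> = Sup X"
  have \<xi>1: "a - p (\<lambda>x. f x - g0 x) \<le> \<xi>" if "(f, a) \<in> G" for f a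
   unfolding \<xi>_def using that by (intro cSup_upper Xb) (auto simp: X_def)
  have \<xi>2: "\<xi> \<le> p (\<lambda>x. g x + g0 x) - b" if "(g, b) \<in> G" for g b
   unfolding \<xi>_def using that le X0 by (intro cSup_least) (auto simp: X_def)
  define H where "H = {((\<lambda>x. f x + t * g0 x), a + t * \<xi>) | f a t. (f, a) \<in> G}"
  have HI: "((\<lambda>x. f x + t * g0 x), a + t * \<xi>) \<in> H" if "(f, a) \<in> G" for f a t unfolding H_def using that by blast
  have "good H" unfolding good_def
  proof (intro conjI allI impI)
   fix f a assume "(f, a) \<in> H"
   then obtain g b t where gb: "(g, b) \<in> G" "f = (\<lambda>x. g x + t * g0 x)" "a = b + t * \<xi>" by (auto simp: H_def)
   thus fV: "f \<in> V" using G_le g0 by (auto intro!: V_add V_scale)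
   show "a \<le> p f"
   proof (cases t "0::real" rule: linorder_cases)
    case equal
    thus ?thesis using gb G_le by simp
   next
    case greater
    have "\<xi> \<le> p (\<lambda>x. inverse t * g x + g0 x) - inverse t * b" by (rule \<xi>2[OF G_scale[OF gb(1)]])
    also have "(\<lambda>x. inverse t * g x + g0 x) = (\<lambda>x. inverse t * f x)" using greater by (auto simp: gb field_simps)
    also have "p \<dots> = inverse t * p f" using greater by (intro p_scale fV) simp
    finally show ?thesis using greater by (simp add: gb field_simps)
   next
    case less
    define s where "s = - t"
    have s: "s > 0" "t = - s" using less by (auto simp: s_def)
    have "inverse s * b - p (\<lambda>x. inverse s * g x - g0 x) \<le> \<xi>" by (rule \<xi>1[OF G_scale[OF gb(1)]])
    also have "(\<lambda>x. inverse s * g x - g0 x) = (\<lambda>x. inverse s * f x)" using s by (auto simp: gb field_simps)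
    also have "p \<dots> = inverse s * p f" using s by (intro p_scale fV) simp
    finally show ?thesis using s by (simp add: gb field_simps)
   qed
  next
   fix f a g b assume "(f, a) \<in> H" "(g, b) \<in> H"
   then obtain f' a' t g' b' s where *: "(f', a') \<in> G" "f = (\<lambda>x. f' x + t * g0 x)" "a = a' + t * \<xi>"
    "(g', b') \<in> G" "g = (\<lambda>x. g' x + s * g0 x)" "b = b' + s * \<xi>" by (auto simp: H_def)
   have "((\<lambda>x. f x + g x), a + b) = ((\<lambda>x. (f' x + g' x) + (t + s) * g0 x), (a' + b') + (t + s) * \<xi>)"
    by (auto simp: * algebra_simps)
   thus "((\<lambda>x. f x + g x), a + b) \<in> H" using HI[OF G_add[OF *(1,4)], of "t + s"] by (simp only:)
  next
   fix f a c assume "(f, a) \<in> H"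
   then obtain f' a' t where *: "(f', a') \<in> G" "f = (\<lambda>x. f' x + t * g0 x)" "a = a' + t * \<xi>" by (auto simp: H_def)
   have "((\<lambda>x. c * f x), c * a) = ((\<lambda>x. c * f' x + (c * t) * g0 x), c * a' + (c * t) * \<xi>)"
    by (auto simp: * algebra_simps)
   thus "((\<lambda>x. c * f x), c * a) \<in> H" using HI[OF G_scale[OF *(1), of c], of "c * t"] by (simp only:)
  next
   show "(\<lambda>f. (f, l f)) ` S \<subseteq> H"
   proof clarify
    fix f assume "f \<in> S"
    show "(f, l f) \<in> H" using HI[OF G_l[OF \<open>f \<in> S\<close>], of 0] by simp
   qed
  qed
  moreover have "G \<subseteq> H"
  proof clarify
   fix f a assume "(f, a) \<in> G"
   from HI[OF this, of 0] show "(f, a) \<in> H" by simp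
  qed
  ultimately have "H = G" by (rule max)
  moreover have "(g0, \<xi>) \<in> H" using HI[OF zero_G, of 1] by simp
  ultimately show ?thesis by blast
 qed
 define F where "F f = (THE a. (f, a) \<in> G)" for f
 have F: "(f, F f) \<in> G" if "f \<in> V" for f
 proof -
  obtain a where a: "(f, a) \<in> G" using dom[OF \<open>f \<in> V\<close>] by auto
  show ?thesis unfolding F_def by (rule theI[where P="\<lambda>a. (f, a) \<in> G", OF a]) (rule uniq[OF _ a])
 qed
 show ?thesis
 proof (rule that[of F])
  show "F f = l f" if "f \<in> S" for f using uniq[OF F[of f] G_l[OF that]] SV that by auto
  show "F f \<le> p f" if "f \<in> V" for f using G_le[OF F[OF that]] by simp
  show "F (\<lambda>x. f x + g x) = F f + F g" if "f \<in> V" "g \<in> V" for f g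
   using uniq[OF F[OF V_add[OF that]] G_add[OF F[OF that(1)] F[OF that(2)]]] .
  show "F (\<lambda>x. c * f x) = c * F f" if "f \<in> V" for f c using uniq[OF F[OF V_scale[OF that]] G_scale[OF F[OF that]]] .
 qed
qed


lemma L1_dual_representation:
 fixes F :: "('a::euclidean_space => real) => real"
 assumes F_add: "\<And>f g. L1 f ==> L1 g ==> F (\<lambda>x. f x + g x) = F f + F g"
  and F_scale: "\<And>f c. L1 f ==> F (\<lambda>x. c * f x) = c * F f"
  and F_le: "\<And>f. L1 f ==> F f \<le> B * (LBINT x. \<bar>f x\<bar>)"
  and B: "B \<ge> 0"
 obtains u where "u \<in> Borel" "\<And>x. \<bar>u x\<bar> \<le> B"
  "\<And>f. L1 f ==> F f = (LBINT x. u x * f x)"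
proof -
 have F_abs: "\<bar>F f\<bar> \<le> B * (LBINT x. \<bar>f x\<bar>)" if "L1 f" for f
  using F_le[OF that] F_le[of "\<lambda>x. -1 * f x"] F_scale[OF that, of "-1"] that by auto
 have F_diff: "F (\<lambda>x. f x - g x) = F f - F g" if "L1 f" "L1 g" for f g
  using F_add[of f "\<lambda>x. -1 * g x"] F_scale[of g "-1"] that by simp
 obtain h :: "'a => ennreal" where h: "h \<in> Borel" "(NNBINT x. h x) \<noteq> \<infinity>"
  "\<And>x. 0 < h x" "\<And>x. h x < \<infinity>"
  using sigma_finite_measure.Ex_finite_integrable_function[OF lborel.sigma_finite_measure_axioms] by auto
 define k where "k x = enn2real (h x)" for x
 have k: "k x > 0" "ennreal (k x) = h x" for x using h(3,4)[of x] by (auto simp: k_def enn2real_positive_iff)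
 have [measurable]: "k \<in> Borel" using h(1) unfolding k_def by measurable
 have ik: "L1 k" using h(2) k(1) by (intro integrableI_bounded) (auto simp: k(2) less_top less_imp_le)
 define K where "K = density lborel (\<lambda>x. ennreal (k x))"
 have [simp]: "space K = UNIV" "sets K = sets borel" by (auto simp: K_def)
 have [measurable_cong]: "sets K = sets borel" by simp
 interpret K: finite_measure K by (rule finite_measureI) (use h(1,2) in \<open>simp add: K_def emeasure_density k(2)\<close>)
 have K_int: "integrable K \<phi> \<longleftrightarrow> L1 (\<lambda>x. \<phi> x * k x)"
  if "\<phi> \<in> Borel" for \<phi> :: "'a => real"
  unfolding K_def using that k(1) by (subst integrable_density) (auto simp: less_imp_le mult.commute)
 have K_lint: "(\<integral>x. \<phi> x \<partial>K) = (LBINT x. \<phi> x * k x)"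
  if "\<phi> \<in> Borel" for \<phi> :: "'a => real"
  unfolding K_def using that k(1) by (subst integral_density) (auto simp: less_imp_le mult.commute)
 have iA: "L1 (\<lambda>x. ind A x * k x)" if "A \<in> sets borel" for A
 proof -
  have "integrable K (ind A :: 'a => real)"
   using that K.emeasure_finite[of A] by (intro integrable_real_indicator) (auto simp: less_top[symmetric])
  thus ?thesis using K_int[of "ind A"] that by simp
 qed
 define G where "G A = F (\<lambda>x. ind A x * k x)" for A
 have mK: "measure K A = (LBINT x. \<bar>ind A x * k x\<bar>)" if "A \<in> sets borel" for A
  using K_lint[of "ind A"] that k(1) by (simp add: abs_mult less_imp_le)
 have G_abs: "\<bar>G A\<bar> \<le> B * measure K A" if "A \<in> sets borel" for A unfolding G_def mK[OF that] by (intro F_abs iA that)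
 have G_Un: "G (A \<union> A') = G A + G A'" if "A \<in> sets borel" "A' \<in> sets borel" "A \<inter> A' = {}" for A A'
 proof -
  have "(\<lambda>x. ind (A \<union> A') x * k x) = (\<lambda>x. ind A x * k x + ind A' x * k x)"
   using that(3) by (auto simp: indicator_def fun_eq_iff)
  thus ?thesis unfolding G_def using F_add[OF iA[OF that(1)] iA[OF that(2)]] by simp
 qed
 define \<nu> where "\<nu> A = G A + B * measure K A" for A
 have \<nu>_nonneg: "\<nu> A \<ge> 0" and \<nu>_le: "\<nu> A \<le> 2 * B * measure K A" if "A \<in> sets borel" for A
  using G_abs[OF that] by (auto simp: \<nu>_def)
 have \<nu>_Un: "\<nu> (A \<union> A') = \<nu> A + \<nu> A'" if "A \<in> sets borel" "A' \<in> sets borel" "A \<inter> A' = {}" for A A'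
  using G_Un[OF that] K.finite_measure_Union[of A A'] that by (simp add: \<nu>_def algebra_simps)
 have \<nu>_empty: "\<nu> {} = 0" using \<nu>_Un[of "{}" "{}"] by simp
 define N where "N = measure_of UNIV (sets borel) (\<lambda>A. ennreal (\<nu> A))"
 have ca: "countably_additive (sets borel) (\<lambda>A. ennreal (\<nu> A))" unfolding countably_additive_def
 proof (intro allI impI)
  fix A :: "nat => 'a set" assume A: "range A \<subseteq> sets borel" "disjoint_family A" "\<Union>(range A) \<in> sets borel"
  define U where "U n = (\<Union>i<n. A i)" for n
  have U: "U n \<in> sets borel" for n using A by (auto simp: U_def)
  have sumU: "(\<Sum>i<n. \<nu> (A i)) = \<nu> (U n)" for n
  proof (induction n)
   case 0 thus ?case by (simp add: U_def \<nu>_empty)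
  next
   case (Suc n)
   have "A i \<inter> A n = {}" if "i < n" for i using disjoint_family_onD[OF A(2), of i n] that by simp
   hence "U n \<inter> A n = {}" by (auto simp: U_def)
   moreover have "U (Suc n) = U n \<union> A n" by (auto simp: U_def less_Suc_eq)
   ultimately show ?case using Suc \<nu>_Un[OF U, of "A n" n] A by auto
  qed
  define X where "X = \<Union>(range A)"
  have X: "X \<in> sets borel" "(\<Union>n. U n) = X" "U n \<subseteq> X" for n using A(3) by (auto simp: X_def U_def)
  have "incseq U" by (force simp: incseq_def U_def)
  hence "(\<lambda>n. measure K (U n)) \<longlonglongrightarrow> measure K X" using K.finite_Lim_measure_incseq[of U] U X(2) by auto
  hence lim: "(\<lambda>n. 2 * B * (measure K X - measure K (U n))) \<longlonglongrightarrow> 2 * B * (measure K X - measure K X)"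
   by (intro tendsto_intros)
  have diff: "0 \<le> \<nu> X - \<nu> (U n)" "\<nu> X - \<nu> (U n) \<le> 2 * B * (measure K X - measure K (U n))" for n
  proof -
   have d: "X - U n \<in> sets borel" using X(1) U by (intro sets.Diff)
   have "\<nu> X = \<nu> (U n) + \<nu> (X - U n)" using \<nu>_Un[OF U[of n] d] Diff_partition[OF X(3), of n] by simp
   moreover have "measure K (X - U n) = measure K X - measure K (U n)"
    by (rule K.finite_measure_Diff) (simp_all add: U X(1,3))
   ultimately show "0 \<le> \<nu> X - \<nu> (U n)" "\<nu> X - \<nu> (U n) \<le> 2 * B * (measure K X - measure K (U n))"
    using \<nu>_nonneg[OF d] \<nu>_le[OF d] by simp_all
  qed
  have lim0: "(\<lambda>n. 2 * B * (measure K X - measure K (U n))) \<longlonglongrightarrow> 0" using lim by simp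
  have "(\<lambda>n. \<nu> X - \<nu> (U n)) \<longlonglongrightarrow> 0" by (rule tendsto_sandwich[OF _ _ tendsto_const lim0]) (use diff in auto)
  from tendsto_diff[OF tendsto_const[of "\<nu> X"] this]
  have "(\<lambda>i. \<nu> (A i)) sums \<nu> X" unfolding sums_def sumU by simp
  thus "(\<Sum>i. ennreal (\<nu> (A i))) = ennreal (\<nu> (\<Union>(range A)))"
   unfolding X_def[symmetric] using \<nu>_nonneg A(1) by (intro suminf_ennreal_eq) auto
 qed
 have [simp]: "sets N = sets borel" "space N = UNIV" using sets.sigma_sets_eq[of borel] by (auto simp: N_def)
 have emN: "emeasure N A = ennreal (\<nu> A)" if "A \<in> sets borel" for A
  unfolding N_def using ca that sets.sigma_algebra_axioms[of borel]
  by (intro emeasure_measure_of_sigma) (auto simp: positive_def \<nu>_empty)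
 have ac: "absolutely_continuous K N" unfolding absolutely_continuous_def null_sets_def
 proof safe
  fix A assume A: "A \<in> sets K" "emeasure K A = 0"
  hence "\<nu> A \<le> 0" using \<nu>_le[of A] by (simp add: measure_def)
  thus "emeasure N A = 0" using A by (simp add: emN ennreal_neg)
 qed auto
 obtain g where g: "g \<in> borel_measurable K" "density K g = N" using K.Radon_Nikodym[OF ac] by auto
 hence [measurable]: "g \<in> Borel" by (simp cong: measurable_cong_sets)
 have gA: "(\<integral>\<^sup>+x. g x * ind A x \<partial>K) = ennreal (\<nu> A)" if "A \<in> sets borel" for A
  using emN[OF that] emeasure_density[of g K A] g that by simp
 have g_le: "AE x in K. g x \<le> ennreal (2 * B)"
 proof -
  define A where "A = {x. g x > ennreal (2 * B)}"
  have [measurable]: "A \<in> sets borel" unfolding A_def by measurable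
  have "(\<integral>\<^sup>+x. (g x - ennreal (2 * B)) * ind A x \<partial>K) = (\<integral>\<^sup>+x. g x * ind A x - ennreal (2 * B) * ind A x \<partial>K)"
   by (intro nn_integral_cong) (auto simp: indicator_def)
  also have "\<dots> = (\<integral>\<^sup>+x. g x * ind A x \<partial>K) - (\<integral>\<^sup>+x. ennreal (2 * B) * ind A x \<partial>K)"
  proof (rule nn_integral_diff)
   show "(\<integral>\<^sup>+x. ennreal (2 * B) * ind A x \<partial>K) \<noteq> \<infinity>"
    by (simp add: nn_integral_cmult K.emeasure_eq_measure ennreal_mult_eq_top_iff)
   show "AE x in K. ennreal (2 * B) * ind A x \<le> g x * ind A x" by (intro AE_I2) (auto simp: A_def indicator_def)
  qed measurable
  also have "\<dots> = ennreal (\<nu> A) - ennreal (2 * B * measure K A)"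
   using B by (simp add: gA nn_integral_cmult K.emeasure_eq_measure ennreal_mult)
  also have "\<dots> = 0"  using ennreal_leI[OF \<nu>_le[of A]] by (simp add: diff_eq_0_iff_ennreal)
  finally have "AE x in K. (g x - ennreal (2 * B)) * ind A x = 0" by (subst (asm) nn_integral_0_iff_AE) auto
  thus ?thesis by eventually_elim (auto simp: A_def indicator_def diff_eq_0_iff_ennreal not_less split: if_splits)
 qed
 define u0 where "u0 x = enn2real (g x) - B" for x
 have u0_le: "AE x in K. \<bar>u0 x\<bar> \<le> B" using g_le
 proof eventually_elim
  fix x assume "g x \<le> ennreal (2 * B)"
  hence "enn2real (g x) \<le> 2 * B" using B by (intro enn2real_leI) auto
  thus "\<bar>u0 x\<bar> \<le> B" unfolding u0_def using enn2real_nonneg[of "g x"] by linarith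
 qed
 define u where "u x = (if \<bar>u0 x\<bar> \<le> B then u0 x else 0)" for x
 have [measurable]: "u0 \<in> Borel" "u \<in> Borel" unfolding u_def u0_def by measurable
 have u_le: "\<bar>u x\<bar> \<le> B" for x using B by (simp add: u_def)
 have u_eq: "AE x in K. u x = u0 x" using u0_le by eventually_elim (simp add: u_def)
 have base: "G A = (\<integral>x. u x * ind A x \<partial>K)" if A: "A \<in> sets borel" for A
 proof -
  have "(\<integral>x. u x * ind A x \<partial>K) = (\<integral>x. enn2real (g x * ind A x) - B * ind A x \<partial>K)"
   using u_eq A by (intro integral_cong_AE) (auto simp: u0_def indicator_def elim!: eventually_mono)
  also have "\<dots> = (\<integral>x. enn2real (g x * ind A x) \<partial>K) - B * measure K A"
  proof (subst int_diff)
   show "integrable K (\<lambda>x. enn2real (g x * ind A x))"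
   proof (rule K.integrable_const_bound[where B="2 * B"])
    show "AE x in K. norm (enn2real (g x * ind A x)) \<le> 2 * B"
     using g_le by eventually_elim (use B in \<open>auto intro!: enn2real_leI simp: indicator_def\<close>)
   qed (use A in measurable)
  qed (use A K.emeasure_finite in \<open>auto intro!: integrable_mult_right integrable_real_indicator simp: less_top[symmetric]\<close>)
  also have "(\<integral>x. enn2real (g x * ind A x) \<partial>K) = enn2real (\<integral>\<^sup>+x. g x * ind A x \<partial>K)"
  proof -
   have "(\<integral>\<^sup>+x. ennreal (enn2real (g x * ind A x)) \<partial>K) = (\<integral>\<^sup>+x. g x * ind A x \<partial>K)"
    using g_le by (intro nn_integral_cong_AE, eventually_elim)
     (auto simp: indicator_def ennreal_enn2real_if top_unique)
   thus ?thesis using A by (subst integral_eq_nn_integral) auto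
  qed
  also have "\<dots> = \<nu> A" using gA[OF A] \<nu>_nonneg[OF A] by simp
  finally show ?thesis by (simp add: \<nu>_def)
 qed
 have rep: "F (\<lambda>x. \<phi> x * k x) = (\<integral>x. u x * \<phi> x \<partial>K)" if "integrable K \<phi>" for \<phi> using that
 proof (induction \<phi>)
  case (base A c)
  have "F (\<lambda>x. ind A x *\<^sub>R c * k x) = F (\<lambda>x. c * (ind A x * k x))" by (simp add: ac_simps)
  also have "\<dots> = c * G A" unfolding G_def using base by (intro F_scale iA) simp
  also have "\<dots> = (\<integral>x. u x * (ind A x *\<^sub>R c) \<partial>K)"
   using base(1) \<open>\<And>A. A \<in> sets borel ==> G A = (\<integral>x. u x * ind A x \<partial>K)\<close>[of A] by (simp add: ac_simps)
  finally show ?case .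
 next
  case (add f g)
  have "(\<lambda>x. (f x + g x) * k x) = (\<lambda>x. f x * k x + g x * k x)" by (simp add: distrib_right)
  moreover have "L1 (\<lambda>x. f x * k x)" "L1 (\<lambda>x. g x * k x)"
   using add.hyps K_int[of f] K_int[of g] by (auto dest: borel_measurable_integrable)
  moreover have "integrable K (\<lambda>x. u x * f x)" "integrable K (\<lambda>x. u x * g x)"
   using add.hyps u_le by (auto intro!: integrable_bounded_mult[where C=B])
  ultimately show ?case using add.IH F_add[of "\<lambda>x. f x * k x" "\<lambda>x. g x * k x"] by (simp add: distrib_left)
 next
  case (lim f s)
  have meas: "f \<in> Borel" "s i \<in> Borel" for i using lim.hyps by (auto dest: borel_measurable_integrable)
  note [measurable] = meas
  have i: "L1 (\<lambda>x. f x * k x)" "L1 (\<lambda>x. s i x * k x)" for i using lim.hyps K_int[of f] K_int[of "s i"] meas by auto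
  have "(\<lambda>i. LBINT x. \<bar>s i x * k x - f x * k x\<bar>) \<longlonglongrightarrow> (\<integral>x. (0::real) \<partial>(lborel :: 'a measure))"
  proof (rule integral_dominated_convergence[where w="\<lambda>x. 3 * \<bar>f x * k x\<bar>"])
   show "L1 (\<lambda>x. 3 * \<bar>f x * k x\<bar>)" using i by auto
   show "AE x in lborel. (\<lambda>i. \<bar>s i x * k x - f x * k x\<bar>) \<longlonglongrightarrow> 0"
   proof (intro AE_I2)
    fix x
    have "(\<lambda>i. \<bar>s i x * k x - f x * k x\<bar>) \<longlonglongrightarrow> \<bar>f x * k x - f x * k x\<bar>"
     using lim.hyps(2)[of x] by (intro tendsto_intros) simp
    thus "(\<lambda>i. \<bar>s i x * k x - f x * k x\<bar>) \<longlonglongrightarrow> 0" by simp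
   qed
   show "AE x in lborel. norm \<bar>s i x * k x - f x * k x\<bar> \<le> 3 * \<bar>f x * k x\<bar>" for i
   proof (intro AE_I2)
    fix x
    have "\<bar>s i x - f x\<bar> \<le> 3 * \<bar>f x\<bar>" using lim.hyps(3)[of x i] by auto
    hence "\<bar>s i x - f x\<bar> * \<bar>k x\<bar> \<le> 3 * \<bar>f x\<bar> * \<bar>k x\<bar>" by (rule mult_right_mono) simp
    thus "norm \<bar>s i x * k x - f x * k x\<bar> \<le> 3 * \<bar>f x * k x\<bar>" by (simp add: abs_mult flip: left_diff_distrib)
   qed
  qed measurable
  hence "(\<lambda>i. B * (LBINT x. \<bar>s i x * k x - f x * k x\<bar>)) \<longlonglongrightarrow> 0" by (auto intro: tendsto_mult_right_zero)
  hence "(\<lambda>i. F (\<lambda>x. s i x * k x) - F (\<lambda>x. f x * k x)) \<longlonglongrightarrow> 0"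
  proof (rule Lim_null_comparison[rotated])
   show "\<forall>\<^sub>F i in sequentially. norm (F (\<lambda>x. s i x * k x) - F (\<lambda>x. f x * k x)) \<le> B * (LBINT x. \<bar>s i x * k x - f x * k x\<bar>)"
    using F_abs[OF L1_diff[OF i(2) i(1)]] F_diff[OF i(2) i(1)] by (intro always_eventually allI) simp
  qed
  hence l1: "(\<lambda>i. F (\<lambda>x. s i x * k x)) \<longlonglongrightarrow> F (\<lambda>x. f x * k x)" by (simp add: LIM_zero_iff)
  have "(\<lambda>i. \<integral>x. u x * s i x \<partial>K) \<longlonglongrightarrow> (\<integral>x. u x * f x \<partial>K)"
  proof (rule integral_dominated_convergence[where w="\<lambda>x. B * (2 * norm (f x))"])
   show "integrable K (\<lambda>x. B * (2 * norm (f x)))" using lim.hyps(4) by auto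
   show "AE x in K. (\<lambda>i. u x * s i x) \<longlonglongrightarrow> u x * f x" using lim.hyps(2) by (intro AE_I2 tendsto_intros) auto
   show "AE x in K. norm (u x * s i x) \<le> B * (2 * norm (f x))" for i
    using lim.hyps(3) u_le B by (intro AE_I2) (auto simp: abs_mult intro!: mult_mono)
  qed measurable
  hence "(\<lambda>i. F (\<lambda>x. s i x * k x)) \<longlonglongrightarrow> (\<integral>x. u x * f x \<partial>K)" by (simp add: lim.IH)
  with l1 show ?case using LIMSEQ_unique by blast
 qed
 show ?thesis
 proof (rule that[of u])
  fix f :: "'a => real" assume f: "L1 f"
  hence [measurable]: "f \<in> Borel" by auto
  have k0: "k x \<noteq> 0" for x using k(1)[of x] by simp
  have "integrable K (\<lambda>x. f x / k x)" using f k0 by (subst K_int) auto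
  from rep[OF this] have "F f = (\<integral>x. u x * (f x / k x) \<partial>K)" using k0 by simp
  also have "\<dots> = (LBINT x. u x * f x)" using k0 by (subst K_lint) auto
  finally show "F f = (LBINT x. u x * f x)" .
 qed (use u_le in auto)
qed


lemma fst_snd_borel[measurable]:
 "(fst :: 'a::euclidean_space \<times> 'b::euclidean_space => 'a) \<in> borel \<rightarrow>\<^sub>M borel"
 "(snd :: 'a::euclidean_space \<times> 'b::euclidean_space => 'b) \<in> borel \<rightarrow>\<^sub>M borel"
 by (auto intro!: borel_measurable_continuous_onI continuous_intros)

lemma st_testD:
 assumes "\<phi> \<in> ST T"
 shows "Ck_on k ({0..T} \<times> UNIV) (\<lambda>(t, x). \<phi> t x)" "\<phi> T x = 0"
 using assms by (auto simp: spacetime_test_functions_def smooth_on_def)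

lemma st_testI:
 assumes "\<And>k. Ck_on k ({0..T} \<times> UNIV) (\<lambda>(t, x). \<phi> t x)"
  and "\<And>t x. t \<in> {0..T} ==> norm x > r ==> \<phi> t x = 0" "\<And>x. \<phi> T x = 0"
 shows "\<phi> \<in> ST T" unfolding spacetime_test_functions_def smooth_on_def
 using assms by (auto intro!: exI[of _ "cball 0 r"])

lemma st_test_support:
 assumes "\<phi> \<in> ST T"
 obtains r where "r > 0" "\<And>t x. t \<in> {0..T} ==> norm x > r ==> \<phi> t x = 0"
proof -
 obtain K where K: "compact K" "\<And>t x. t \<in> {0..T} ==> x \<notin> K ==> \<phi> t x = 0"
  using assms by (auto simp: spacetime_test_functions_def)
 obtain r where "r > 0" "\<And>x. x \<in> K ==> norm x \<le> r" using compact_imp_bounded[OF K(1)] unfolding bounded_pos by auto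
 with K(2) show ?thesis by (intro that[of r]) (fastforce simp: not_le)+
qed

lemma st_test_has_derivative:
 assumes "\<phi> \<in> ST T" "t \<in> {0..T}"
 shows "((\<lambda>(t, x). \<phi> t x) has_derivative frechet_derivative (\<lambda>(t, x). \<phi> t x) (at (t, x) within {0..T} \<times> UNIV))
   (at (t, x) within {0..T} \<times> UNIV)"
 using Ck_on_SucD(1)[OF st_testD(1)[OF assms(1), of "Suc 0"], of "(t, x)"] assms(2) by auto

lemma Ck_on_slice:
 fixes f :: "real \<times> 'a::euclidean_space => real"
 assumes "Ck_on k ({0..T} \<times> UNIV) f" "t \<in> {0..T}"
 shows "Ck_on k UNIV (\<lambda>x. f (t, x))"
 using Ck_on_compose_affine[OF unique_derivs_UNIV, of "\<lambda>x. (0, x)" "(t, 0)" "{0..T} \<times> UNIV" k f] assms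
 by (simp add: bounded_linear_Pair bounded_linear_zero bounded_linear_ident)

lemma st_test_slice:
 assumes "\<phi> \<in> ST T" "t \<in> {0..T}"
 shows "\<phi> t \<in> test_functions"
proof -
 obtain r where "\<And>x. norm x > r ==> \<phi> t x = 0" using st_test_support[OF assms(1)] assms(2) by metis
 thus ?thesis using Ck_on_slice[OF st_testD(1)[OF assms(1)] assms(2)] by (intro test_functionI) auto
qed

lemma st_test_gradient:
 assumes "\<phi> \<in> ST T" "t \<in> {0..T}"
 shows "gradient (\<phi> t) x \<bullet> v = frechet_derivative (\<lambda>(t, x). \<phi> t x) (at (t, x) within {0..T} \<times> UNIV) (0, v)"
proof -
 have "((\<lambda>x. (t, x)) has_derivative (\<lambda>v. (0, v))) (at x within UNIV)" by (auto intro!: derivative_eq_intros)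
 from has_derivative_in_compose2[OF _ _ UNIV_I this, of "{0..T} \<times> UNIV" "\<lambda>(t, x). \<phi> t x"
   "\<lambda>p. frechet_derivative (\<lambda>(t, x). \<phi> t x) (at p within {0..T} \<times> UNIV)"]
 have "(\<phi> t has_derivative (\<lambda>v. frechet_derivative (\<lambda>(t, x). \<phi> t x) (at (t, x) within {0..T} \<times> UNIV) (0, v))) (at x)"
  using st_test_has_derivative[OF assms(1)] assms(2) by (auto simp: image_subset_iff)
 from frechet_derivative_at[OF this] show ?thesis using gradient_inner[OF st_test_slice[OF assms], of x v] by metis
qed

lemma st_test_time_derivative:
 assumes "\<phi> \<in> ST T" "t \<in> {0..T}"
 shows "((\<lambda>s. \<phi> s x) has_real_derivative
   frechet_derivative (\<lambda>(t, x). \<phi> t x) (at (t, x) within {0..T} \<times> UNIV) (1, 0)) (at t within {0..T})"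
proof -
 let ?D = "\<lambda>p. frechet_derivative (\<lambda>(t, x). \<phi> t x) (at p within {0..T} \<times> UNIV)"
 have 1: "((\<lambda>s. (s, x)) has_derivative (\<lambda>v. (v, 0))) (at t within {0..T})" by (auto intro!: derivative_eq_intros)
 have d: "((\<lambda>s. \<phi> s x) has_derivative (\<lambda>v. ?D (t, x) (v, 0))) (at t within {0..T})"
  using has_derivative_in_compose2[OF _ _ assms(2) 1, of "{0..T} \<times> UNIV" "\<lambda>(t, x). \<phi> t x" ?D]
   st_test_has_derivative[OF assms(1)] by (auto simp: image_subset_iff)
 have D: "?D (t, x) (v, 0) = ?D (t, x) (1, 0) * v" for v
 proof -
  interpret bounded_linear "?D (t, x)" using st_test_has_derivative[OF assms] by (rule has_derivative_bounded_linear)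
  show ?thesis using scaleR[of v "(1, 0)"] by (simp add: mult.commute)
 qed
 hence "(\<lambda>v. ?D (t, x) (v, 0)) = (*) (?D (t, x) (1, 0))" by blast
 with d show ?thesis unfolding has_field_derivative_def by simp
qed

lemma st_test_deriv:
 assumes "\<phi> \<in> ST T" "t \<in> {0<..<T}"
 shows "((\<lambda>s. \<phi> s x) has_real_derivative deriv (\<lambda>s. \<phi> s x) t) (at t)"
  and "deriv (\<lambda>s. \<phi> s x) t = frechet_derivative (\<lambda>(t, x). \<phi> t x) (at (t, x) within {0..T} \<times> UNIV) (1, 0)"
proof -
 have "at t within {0..T} = at t" using assms(2) by (intro at_within_interior) simp
 hence "((\<lambda>s. \<phi> s x) has_real_derivative
   frechet_derivative (\<lambda>(t, x). \<phi> t x) (at (t, x) within {0..T} \<times> UNIV) (1, 0)) (at t)"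
  using st_test_time_derivative[OF assms(1), of t x] assms(2) by auto
 thus "deriv (\<lambda>s. \<phi> s x) t = frechet_derivative (\<lambda>(t, x). \<phi> t x) (at (t, x) within {0..T} \<times> UNIV) (1, 0)"
  "((\<lambda>s. \<phi> s x) has_real_derivative deriv (\<lambda>s. \<phi> s x) t) (at t)" by (auto simp: DERIV_imp_deriv)
qed

lemma continuous_on_slab_bounded:
 fixes f :: "real \<times> 'a::euclidean_space => real"
 assumes "continuous_on ({0..T} \<times> UNIV) f"
 obtains C where "C > 0" "\<And>t x. t \<in> {0..T} ==> norm x \<le> r ==> \<bar>f (t, x)\<bar> \<le> C"
proof -
 have "compact (f ` ({0..T} \<times> cball 0 r))"
  by (intro compact_continuous_image continuous_on_subset[OF assms] compact_Times compact_Icc compact_cball) auto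
 from compact_imp_bounded[OF this] obtain C where "C > 0" "\<forall>y\<in>f ` ({0..T} \<times> cball 0 r). norm y \<le> C"
  unfolding bounded_pos by auto
 thus ?thesis by (intro that[of C]) auto
qed

text \<open>bounds in a bundle\<close>

lemma st_test_bounds:
 fixes \<phi> :: "real => 'a::euclidean_space => real"
 assumes \<phi>: "\<phi> \<in> ST T"
 obtains r C where "r > 0" "C > 0" "\<And>t x. t \<in> {0..T} ==> norm x > r ==> \<phi> t x = 0"
  "\<And>t x. t \<in> {0..T} ==> \<bar>\<phi> t x\<bar> \<le> C"
  "\<And>t x. t \<in> {0<..<T} ==> \<bar>deriv (\<lambda>s. \<phi> s x) t\<bar> \<le> C"
  "\<And>t x. t \<in> {0<..<T} ==> norm x > r ==> deriv (\<lambda>s. \<phi> s x) t = 0"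
  "\<And>t x. t \<in> {0..T} ==> norm (gradient (\<phi> t) x) \<le> C"
  "\<And>t x. t \<in> {0..T} ==> norm x > r ==> gradient (\<phi> t) x = 0"
proof -
 let ?S = "{0..T} \<times> (UNIV :: 'a set)"
 let ?D = "\<lambda>v p. frechet_derivative (\<lambda>(t, x). \<phi> t x) (at p within ?S) v"
 obtain r where r: "r > 0" "\<And>t x. t \<in> {0..T} ==> norm x > r ==> \<phi> t x = 0" using st_test_support[OF \<phi>] by metis
 have c: "continuous_on ?S (?D v)" for v using Ck_on_SucD(2)[OF st_testD(1)[OF \<phi>, of "Suc 0"], of v] by simp
 have grad0: "gradient (\<phi> t) x = 0" if "t \<in> {0..T}" "norm x > r" for t x
  using gradient_support[OF st_test_slice[OF \<phi> that(1)], of r x] r(2)[OF that(1)] that(2) by blast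
 have deriv0: "deriv (\<lambda>s. \<phi> s x) t = 0" if "t \<in> {0<..<T}" "norm x > r" for t x
 proof -
  have "((\<lambda>s. 0) has_real_derivative 0) (at t)" by simp
  hence "((\<lambda>s. \<phi> s x) has_real_derivative 0) (at t)"
   by (rule has_field_derivative_transform_within_open[where S="{0<..<T}"]) (use that r in auto)
  thus ?thesis by (rule DERIV_imp_deriv)
 qed
 obtain C0 where C0: "C0 > 0" "\<And>t x. t \<in> {0..T} ==> norm x \<le> r ==> \<bar>\<phi> t x\<bar> \<le> C0"
  using continuous_on_slab_bounded[OF Ck_on_imp_continuous_on[OF st_testD(1)[OF \<phi>]], of r] by auto
 have "\<exists>C>0. \<forall>t x. t \<in> {0..T} --> norm x \<le> r --> \<bar>?D v (t, x)\<bar> \<le> C" for v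
  using continuous_on_slab_bounded[OF c[of v], of r] by metis
 then obtain C where C: "\<And>v. C v > 0" "\<And>v t x. t \<in> {0..T} ==> norm x \<le> r ==> \<bar>?D v (t, x)\<bar> \<le> C v" by metis
 define C1 where "C1 = (\<Sum>i\<in>(Basis::'a set). C (0, i))"
 have C1: "C1 > 0" unfolding C1_def using C(1) by (intro sum_pos) auto
 have g: "norm (gradient (\<phi> t) x) \<le> C1" if "t \<in> {0..T}" for t x
 proof (cases "norm x \<le> r")
  case True
  have "norm (gradient (\<phi> t) x) \<le> (\<Sum>i\<in>Basis. \<bar>gradient (\<phi> t) x \<bullet> i\<bar>)" by (rule norm_le_l1)
  also have "\<dots> \<le> C1" unfolding C1_def by (intro sum_mono) (simp add: st_test_gradient[OF \<phi> that] C(2)[OF that True])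
  finally show ?thesis .
 qed (use grad0 that C1 in auto)
 define M where "M = C0 + C (1, 0) + C1"
 have M: "C0 \<le> M" "C (1, 0) \<le> M" "C1 \<le> M" "M > 0" using C0(1) C(1)[of "(1, 0)"] C1 by (auto simp: M_def)
 show ?thesis
 proof (rule that[of r M])
  show "\<bar>\<phi> t x\<bar> \<le> M" if "t \<in> {0..T}" for t x
   using C0(2)[OF that, of x] r(2)[OF that, of x] M by (cases "norm x \<le> r") auto
  show "\<bar>deriv (\<lambda>s. \<phi> s x) t\<bar> \<le> M" if "t \<in> {0<..<T}" for t x
  proof (cases "norm x \<le> r")
   case True
   thus ?thesis using C(2)[of t x "(1, 0)"] that M st_test_deriv(2)[OF \<phi> that, of x] by auto
  qed (use deriv0 that M in auto)
  show "norm (gradient (\<phi> t) x) \<le> M" if "t \<in> {0..T}" for t x using g[OF that, of x] M by linarith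
 qed (use r M deriv0 grad0 in auto)
qed

lemma st_test_measurable:
 fixes \<phi> :: "real => 'a::euclidean_space => real"
 assumes \<phi>: "\<phi> \<in> ST T"
 shows "(\<lambda>p. ind {0<..<T} (fst p) * \<phi> (fst p) (snd p)) \<in> Borel"
  and "(\<lambda>p. ind {0<..<T} (fst p) * deriv (\<lambda>s. \<phi> s (snd p)) (fst p)) \<in> Borel"
  and "(\<lambda>p. ind {0<..<T} (fst p) *\<^sub>R gradient (\<phi> (fst p)) (snd p)) \<in> Borel"
proof -
 let ?S = "{0..T} \<times> (UNIV :: 'a set)"
 let ?D = "\<lambda>v p. frechet_derivative (\<lambda>(t, x). \<phi> t x) (at p within ?S) v"
 have S: "?S \<in> sets borel" by (intro borel_closed closed_Times) auto
 have m: "(\<lambda>p. ind {0<..<T} (fst p) * f p) \<in> Borel" if "continuous_on ?S f" for f :: "real \<times> 'a => real"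
 proof -
  have "(\<lambda>p. ind ?S p *\<^sub>R f p) \<in> Borel" by (rule borel_measurable_continuous_on_indicator[OF S that])
  moreover have "(\<lambda>p::real \<times> 'a. ind {0<..<T} (fst p) :: real) \<in> Borel" by measurable
  ultimately have "(\<lambda>p. ind {0<..<T} (fst p) * (ind ?S p *\<^sub>R f p)) \<in> Borel" by measurable
  moreover have "(\<lambda>p. ind {0<..<T} (fst p) * (ind ?S p *\<^sub>R f p)) = (\<lambda>p. ind {0<..<T} (fst p) * f p)"
   by (auto simp: indicator_def fun_eq_iff)
  ultimately show ?thesis by (simp only:)
 qed
 have c: "continuous_on ?S (?D v)" for v using Ck_on_SucD(2)[OF st_testD(1)[OF \<phi>, of "Suc 0"], of v] by simp
 show "(\<lambda>p. ind {0<..<T} (fst p) * \<phi> (fst p) (snd p)) \<in> Borel"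
  using m[OF Ck_on_imp_continuous_on[OF st_testD(1)[OF \<phi>]]] by (simp add: split_beta')
 have "(\<lambda>p. ind {0<..<T} (fst p) * deriv (\<lambda>s. \<phi> s (snd p)) (fst p))
   = (\<lambda>p. ind {0<..<T} (fst p) * ?D (1, 0) p)" using st_test_deriv(2)[OF \<phi>] by (auto simp: indicator_def fun_eq_iff)
 thus "(\<lambda>p. ind {0<..<T} (fst p) * deriv (\<lambda>s. \<phi> s (snd p)) (fst p)) \<in> Borel" using m[OF c] by simp
 have "(\<lambda>p. (ind {0<..<T} (fst p) *\<^sub>R gradient (\<phi> (fst p)) (snd p)) \<bullet> i) = (\<lambda>p. ind {0<..<T} (fst p) * ?D (0, i) p)" for i
  using st_test_gradient[OF \<phi>] by (auto simp: indicator_def fun_eq_iff)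
 thus "(\<lambda>p. ind {0<..<T} (fst p) *\<^sub>R gradient (\<phi> (fst p)) (snd p)) \<in> Borel"
  using m[OF c] by (subst borel_measurable_euclidean_space) simp
qed

lemma st_test_add_scale:
 assumes "T > 0" "\<phi> \<in> ST T" "\<psi> \<in> ST T"
 shows "(\<lambda>t x. \<phi> t x + \<psi> t x) \<in> ST T" "(\<lambda>t x. c * \<phi> t x) \<in> ST T"
proof -
 obtain r where r: "\<And>t x. t \<in> {0..T} ==> norm x > r ==> \<phi> t x = 0" using st_test_support[OF assms(2)] by metis
 obtain r' where r': "\<And>t x. t \<in> {0..T} ==> norm x > r' ==> \<psi> t x = 0" using st_test_support[OF assms(3)] by metis
 note U = unique_derivs_slab[OF assms(1)]
 show "(\<lambda>t x. \<phi> t x + \<psi> t x) \<in> ST T"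
  using Ck_on_add[OF U st_testD(1)[OF assms(2)] st_testD(1)[OF assms(3)]] r r' st_testD(2)[OF assms(2)] st_testD(2)[OF assms(3)]
  by (intro st_testI[where r="max r r'"]) (auto simp: split_beta')
 show "(\<lambda>t x. c * \<phi> t x) \<in> ST T" using Ck_on_cmult[OF U st_testD(1)[OF assms(2)]] r st_testD(2)[OF assms(2)]
  by (intro st_testI[where r=r]) (auto simp: split_beta')
qed


lemma lborel_Fubini:
 fixes F :: "'a::euclidean_space \<times> 'b::euclidean_space => 'c::{banach, second_countable_topology}"
 assumes "L1 F"
 shows "(LBINT p. F p) = (LBINT x. (LBINT y. F (x, y)))"
  and "(LBINT p. F p) = (LBINT y. (LBINT x. F (x, y)))"
  and "AE x in lborel. L1 (\<lambda>y. F (x, y))"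
  and "L1 (\<lambda>x. LBINT y. F (x, y))"
  and "AE y in lborel. L1 (\<lambda>x. F (x, y))"
  and "L1 (\<lambda>y. LBINT x. F (x, y))"
proof -
 have F: "integrable (lborel \<Otimes>\<^sub>M lborel) F" using assms by (simp add: lborel_prod)
 show "(LBINT p. F p) = (LBINT x. (LBINT y. F (x, y)))"
  using lborel_pair.integral_fst'[OF F] by (simp add: lborel_prod)
 have "integrable (lborel \<Otimes>\<^sub>M lborel) (case_prod (\<lambda>x y. F (x, y)))" using F by (simp add: split_beta')
 from lborel_pair.integral_snd[OF this] show "(LBINT p. F p) = (LBINT y. (LBINT x. F (x, y)))"
  by (simp add: lborel_prod split_beta')
 show "AE x in lborel. L1 (\<lambda>y. F (x, y))" by (rule lborel_pair.AE_integrable_fst'[OF F])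
 show "L1 (\<lambda>x. LBINT y. F (x, y))" by (rule lborel_pair.integrable_fst'[OF F])
 have F': "integrable (lborel \<Otimes>\<^sub>M lborel) (\<lambda>(y, x). F (x, y))" using lborel_pair.integrable_product_swap[OF F] .
 show "AE y in lborel. L1 (\<lambda>x. F (x, y))" using lborel_pair.AE_integrable_fst'[OF F'] by simp
 show "L1 (\<lambda>y. LBINT x. F (x, y))" using lborel_pair.integrable_fst'[OF F'] by simp
qed

lemmas [measurable] = borel_Times

text \<open>operator\<close>

definition time_cut :: "real => (real => 'a => 'b::real_vector) => real \<times> 'a => 'b" where
 "time_cut T f p = ind {0<..<T} (fst p) *\<^sub>R f (fst p) (snd p)"

locale transport_field =
 fixes T :: real and b :: "real \<times> 'a::euclidean_space => 'a" and D :: "real \<times> 'a => real"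
 assumes T_pos: "T > 0"
  and b_meas[measurable]: "b \<in> Borel"
  and D_meas[measurable]: "D \<in> Borel"
  and b_int: "L1 (\<lambda>p. cyl T r p *\<^sub>R b p)"
  and D_int: "L1 (\<lambda>p. cyl T r p * D p)"
  and divergence: "AE t in lborel. t \<in> {0<..<T} -->
   (\<forall>\<psi>\<in>test_functions. (LBINT x. b (t, x) \<bullet> gradient \<psi> x) = - (LBINT x. D (t, x) * \<psi> x))"
begin

lemmas [measurable] = b_meas D_meas

definition Lop :: "(real => 'a => real) => real \<times> 'a => real" where
 "Lop \<phi> p = time_cut T (\<lambda>t x. deriv (\<lambda>s. \<phi> s x) t) p + D p * time_cut T \<phi> p + b p \<bullet> time_cut T (\<lambda>t. gradient (\<phi> t)) p"

lemma cut_measurable: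
 assumes "\<phi> \<in> ST T"
 shows "time_cut T \<phi> \<in> Borel"
  "time_cut T (\<lambda>t x. deriv (\<lambda>s. \<phi> s x) t) \<in> Borel"
  "time_cut T (\<lambda>t. gradient (\<phi> t)) \<in> Borel"
 using st_test_measurable[OF assms] by (simp_all add: time_cut_def[abs_def])

lemma bounded_slab_integrable:
 fixes k :: "real \<times> 'a => real"
 assumes "k \<in> Borel" "\<And>p. \<bar>k p\<bar> \<le> C" "\<And>p. fst p \<notin> {0<..<T} \<or> norm (snd p) > r ==> k p = 0"
 shows "L1 k" "L1 (\<lambda>p. D p * k p)"
proof -
 let ?Z = "{0<..<T} \<times> cball (0::'a) r"
 have k0: "k p * ind ?Z p = k p" for p
 proof (cases "p \<in> ?Z")
  case False
  hence "fst p \<notin> {0<..<T} \<or> norm (snd p) > r" by (cases p) auto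
  thus ?thesis using assms(3) by simp
 qed simp
 have "emeasure lborel ?Z < \<infinity>" by (intro emeasure_bounded_finite bounded_Times) auto
 hence "L1 (\<lambda>p. k p * ind ?Z p)"
  using assms by (intro integrable_bounded_mult[where C=C] integrable_real_indicator) auto
 thus "L1 k" by (simp only: k0)
 have "L1 (\<lambda>p. k p * (ind ?Z p * D p))" using assms D_int[of r] by (intro integrable_bounded_mult[of _ _ k C]) auto
 moreover have "k p * (ind ?Z p * D p) = D p * k p" for p using k0[of p] by (metis mult.assoc mult.commute)
 ultimately show "L1 (\<lambda>p. D p * k p)" by simp
qed

lemma bounded_slab_integrable_b:
 fixes k :: "real \<times> 'a => 'a"
 assumes [measurable]: "k \<in> Borel" and k: "\<And>p. norm (k p) \<le> C" "\<And>p. fst p \<notin> {0<..<T} \<or> norm (snd p) > r ==> k p = 0"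
 shows "L1 (\<lambda>p. b p \<bullet> k p)"
proof (rule L1_bound)
 let ?Z = "{0<..<T} \<times> cball (0::'a) r"
 show "L1 (\<lambda>p. C * norm (ind ?Z p *\<^sub>R b p))" by (intro integrable_mult_right integrable_norm b_int)
 show "AE p in lborel. norm (b p \<bullet> k p) \<le> norm (C * norm (ind ?Z p *\<^sub>R b p))"
 proof (intro AE_I2)
  fix p
  have C: "C \<ge> 0" using k(1)[of p] norm_ge_zero order_trans by blast
  show "norm (b p \<bullet> k p) \<le> norm (C * norm (ind ?Z p *\<^sub>R b p))"
  proof (cases "p \<in> ?Z")
   case True
   have "norm (b p \<bullet> k p) \<le> norm (b p) * C" using order_trans[OF Cauchy_Schwarz_ineq2 mult_left_mono[OF k(1)]] by simp
   thus ?thesis using True C by (simp add: mult.commute)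
  next
   case False
   hence "k p = 0" using k(2)[of p] by (cases p) auto
   thus ?thesis by simp
  qed
 qed
qed measurable

lemma cut_bounds:
 assumes \<phi>: "\<phi> \<in> ST T"
 obtains r C where "\<And>p. \<bar>time_cut T \<phi> p\<bar> \<le> C" "\<And>p. \<bar>time_cut T (\<lambda>t x. deriv (\<lambda>s. \<phi> s x) t) p\<bar> \<le> C"
  "\<And>p. norm (time_cut T (\<lambda>t. gradient (\<phi> t)) p) \<le> C"
  "\<And>p. fst p \<notin> {0<..<T} \<or> norm (snd p) > r ==> time_cut T \<phi> p = 0"
  "\<And>p. fst p \<notin> {0<..<T} \<or> norm (snd p) > r ==> time_cut T (\<lambda>t x. deriv (\<lambda>s. \<phi> s x) t) p = 0"
  "\<And>p. fst p \<notin> {0<..<T} \<or> norm (snd p) > r ==> time_cut T (\<lambda>t. gradient (\<phi> t)) p = 0"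
proof (rule st_test_bounds[OF \<phi>])
 fix r C assume C: "C > 0" "\<And>t x. t \<in> {0..T} ==> norm x > r ==> \<phi> t x = 0"
  "\<And>t x. t \<in> {0..T} ==> \<bar>\<phi> t x\<bar> \<le> C"
  "\<And>t x. t \<in> {0<..<T} ==> \<bar>deriv (\<lambda>s. \<phi> s x) t\<bar> \<le> C"
  "\<And>t x. t \<in> {0<..<T} ==> norm x > r ==> deriv (\<lambda>s. \<phi> s x) t = 0"
  "\<And>t x. t \<in> {0..T} ==> norm (gradient (\<phi> t) x) \<le> C"
  "\<And>t x. t \<in> {0..T} ==> norm x > r ==> gradient (\<phi> t) x = 0"
 show thesis by (rule that[of C r]; use C in \<open>force simp: time_cut_def indicator_def\<close>)
qed

lemma Lop_parts_integrable:
 assumes \<phi>: "\<phi> \<in> ST T"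
 shows "L1 (time_cut T (\<lambda>t x. deriv (\<lambda>s. \<phi> s x) t))" "L1 (\<lambda>p. D p * time_cut T \<phi> p)"
  "L1 (\<lambda>p. b p \<bullet> time_cut T (\<lambda>t. gradient (\<phi> t)) p)" "L1 (Lop \<phi>)"
proof (atomize (full), rule cut_bounds[OF \<phi>], goal_cases)
 case (1 r C)
 have i1: "L1 (time_cut T (\<lambda>t x. deriv (\<lambda>s. \<phi> s x) t))"
  by (rule bounded_slab_integrable(1)[OF cut_measurable(2)[OF \<phi>] 1(2,5)])
 have i2: "L1 (\<lambda>p. D p * time_cut T \<phi> p)" by (rule bounded_slab_integrable(2)[OF cut_measurable(1)[OF \<phi>] 1(1,4)])
 have i3: "L1 (\<lambda>p. b p \<bullet> time_cut T (\<lambda>t. gradient (\<phi> t)) p)"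
  by (rule bounded_slab_integrable_b[OF cut_measurable(3)[OF \<phi>] 1(3,6)])
 show ?case unfolding Lop_def[abs_def] using i1 i2 i3 by simp
qed

lemma slices_loc_int:
 "AE t\<in>{0<..<T} in lborel. loc_int (\<lambda>x. D (t, x)) \<and> (\<forall>v. loc_int (\<lambda>x. b (t, x) \<bullet> v))"
proof -
 have "AE t in lborel. \<forall>n. L1 (\<lambda>x. ind ({0<..<T} \<times> cball 0 (real n)) (t, x) * D (t, x))"
  unfolding AE_all_countable using lborel_Fubini(3)[OF D_int] by blast
 moreover have "AE t in lborel. \<forall>n. L1 (\<lambda>x. ind ({0<..<T} \<times> cball 0 (real n)) (t, x) *\<^sub>R b (t, x))"
  unfolding AE_all_countable using lborel_Fubini(3)[OF b_int] by blast
 ultimately show ?thesis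
 proof eventually_elim
  fix t assume D: "\<forall>n. L1 (\<lambda>x. ind ({0<..<T} \<times> cball 0 (real n)) (t, x) * D (t, x))"
   and b: "\<forall>n. L1 (\<lambda>x. ind ({0<..<T} \<times> cball 0 (real n)) (t, x) *\<^sub>R b (t, x))"
  have loc: "loc_int f" if [measurable]: "f \<in> Borel"
   and i: "\<And>n::nat. L1 (\<lambda>x. ind (cball 0 (real n)) x * f x)" for f :: "'a => real" unfolding loc_int_def
  proof safe
   fix r :: real
   obtain n :: nat where n: "r \<le> real n" using real_arch_simple by blast
   have "L1 (\<lambda>x. ind (cball 0 r) x * (ind (cball 0 (real n)) x * f x))"
    by (rule integrable_bounded_mult[where C=1, OF i]) (auto simp: indicator_def)
   moreover have "ind (cball 0 r) x * (ind (cball 0 (real n)) x * f x) = ind (cball 0 r) x * f x" for x :: 'a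
    using n by (auto simp: indicator_def)
   ultimately show "L1 (\<lambda>x. ind (cball 0 r) x * f x)" by simp
  qed fact
  show "t \<in> {0<..<T} --> loc_int (\<lambda>x. D (t, x)) \<and> (\<forall>v. loc_int (\<lambda>x. b (t, x) \<bullet> v))"
  proof (intro impI conjI allI)
   assume t: "t \<in> {0<..<T}"
   have ind: "ind ({0<..<T} \<times> cball 0 (real n)) (t, x) = (ind (cball 0 (real n)) x :: real)" for x :: 'a and n
    using t by (auto simp: indicator_def)
   show "loc_int (\<lambda>x. D (t, x))" using D by (intro loc) (auto simp: ind)
   fix v
   show "loc_int (\<lambda>x. b (t, x) \<bullet> v)"
   proof (rule loc)
    fix n :: nat
    from integrable_inner_left[OF b[rule_format, of n], of v]
    show "L1 (\<lambda>x. ind (cball 0 (real n)) x * (b (t, x) \<bullet> v))" by (simp add: ind)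
   qed measurable
  qed
 qed
qed

lemma loc_int_inner_bounded_support:
 fixes B k :: "'a => 'a"
 assumes B: "\<And>v. loc_int (\<lambda>x. B x \<bullet> v)" and k: "k \<in> Borel" "\<And>x. norm (k x) \<le> C" "\<And>x. norm x > r ==> k x = 0"
 shows "L1 (\<lambda>x. B x \<bullet> k x)"
proof -
 have "L1 (\<lambda>x. \<Sum>i\<in>Basis. (B x \<bullet> i) * (k x \<bullet> i))"
  using k by (intro L1_sum loc_int_bounded_support[OF B, where C=C and r=r])
        (auto intro: order_trans[OF Basis_le_norm])
 thus ?thesis by (simp add: euclidean_inner[symmetric])
qed

lemma inner_gradient_integrable:
 fixes B :: "'a => 'a"
 assumes B: "\<And>v. loc_int (\<lambda>x. B x \<bullet> v)" and \<psi>: "\<psi> \<in> test_functions"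
 shows "L1 (\<lambda>x. B x \<bullet> gradient \<psi> x)"
proof -
 obtain r where r: "\<And>x. norm x > r ==> \<psi> x = 0" using test_function_support[OF \<psi>] by metis
 obtain C where C: "\<And>x. norm (gradient \<psi> x) \<le> C" using gradient_bounded[OF \<psi>] by metis
 show ?thesis using gradient_support[OF \<psi> r] C gradient_measurable[OF \<psi>]
  by (intro loc_int_inner_bounded_support[OF B, where C=C and r=r]) auto
qed

end


context transport_field
begin

lemma smooth_abs_test:
 assumes \<psi>: "\<psi> \<in> test_functions" and "\<delta> > 0"
 shows "(\<lambda>x. sqrt ((\<psi> x)\<^sup>2 + \<delta>\<^sup>2) - \<delta>) \<in> test_functions"
  and "gradient (\<lambda>x. sqrt ((\<psi> x)\<^sup>2 + \<delta>\<^sup>2) - \<delta>) x = (\<psi> x / sqrt ((\<psi> x)\<^sup>2 + \<delta>\<^sup>2)) *\<^sub>R gradient \<psi> x"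
proof -
 obtain r where r: "\<And>x. norm x > r ==> \<psi> x = 0" using test_function_support[OF \<psi>] by metis
 have pos: "(\<psi> x)\<^sup>2 + \<delta>\<^sup>2 > 0" for x using assms(2) by (simp add: add_nonneg_pos)
 show "(\<lambda>x. sqrt ((\<psi> x)\<^sup>2 + \<delta>\<^sup>2) - \<delta>) \<in> test_functions"
 proof (rule test_functionI[where r=r])
  fix k
  have "Ck_on k UNIV (\<lambda>x. (\<psi> x * \<psi> x + \<delta> * \<delta>) powr (1/2) - \<delta>)"
   using pos by (intro Ck_on_diff Ck_on_powr Ck_on_add Ck_on_mult Ck_on_const unique_derivs_UNIV test_functionD \<psi>)
     (auto simp: power2_eq_square)
  thus "Ck_on k UNIV (\<lambda>x. sqrt ((\<psi> x)\<^sup>2 + \<delta>\<^sup>2) - \<delta>)"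
   using pos by (simp add: powr_half_sqrt less_imp_le power2_eq_square)
 qed (use r assms(2) in auto)
 show "gradient (\<lambda>x. sqrt ((\<psi> x)\<^sup>2 + \<delta>\<^sup>2) - \<delta>) x = (\<psi> x / sqrt ((\<psi> x)\<^sup>2 + \<delta>\<^sup>2)) *\<^sub>R gradient \<psi> x"
 proof (rule gradient_eqI)
  have "((\<lambda>s. sqrt (s\<^sup>2 + \<delta>\<^sup>2) - \<delta>) has_real_derivative \<psi> x / sqrt ((\<psi> x)\<^sup>2 + \<delta>\<^sup>2)) (at (\<psi> x))"
   using pos[of x] by (auto intro!: derivative_eq_intros simp: field_simps)
  hence "((\<lambda>s. sqrt (s\<^sup>2 + \<delta>\<^sup>2) - \<delta>) has_derivative (*) (\<psi> x / sqrt ((\<psi> x)\<^sup>2 + \<delta>\<^sup>2))) (at (\<psi> x))"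
   by (simp add: has_field_derivative_def)
  from has_derivative_compose[OF gradient_has_derivative[OF \<psi>] this]
  show "((\<lambda>x. sqrt ((\<psi> x)\<^sup>2 + \<delta>\<^sup>2) - \<delta>) has_derivative
    (\<lambda>v. ((\<psi> x / sqrt ((\<psi> x)\<^sup>2 + \<delta>\<^sup>2)) *\<^sub>R gradient \<psi> x) \<bullet> v)) (at x)" by simp
 qed
qed

lemma a_priori_estimate:
 assumes \<phi>: "\<phi> \<in> ST T"
 shows "(LBINT x. \<bar>\<phi> 0 x\<bar>) \<le> (LBINT p. \<bar>Lop \<phi> p\<bar>)"
proof -
 obtain r C where "r > 0" and C: "C > 0" "\<And>t x. t \<in> {0..T} ==> norm x > r ==> \<phi> t x = 0"
  "\<And>t x. t \<in> {0..T} ==> \<bar>\<phi> t x\<bar> \<le> C"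
  "\<And>t x. t \<in> {0<..<T} ==> \<bar>deriv (\<lambda>s. \<phi> s x) t\<bar> \<le> C"
  "\<And>t x. t \<in> {0<..<T} ==> norm x > r ==> deriv (\<lambda>s. \<phi> s x) t = 0"
  "\<And>t x. t \<in> {0..T} ==> norm (gradient (\<phi> t) x) \<le> C"
  "\<And>t x. t \<in> {0..T} ==> norm x > r ==> gradient (\<phi> t) x = 0" by (rule st_test_bounds[OF \<phi>], rule that)
 define I where "I = (LBINT p. \<bar>cyl T r p * D p\<bar>)"
 define V where "V = measure lborel (cball (0::'a) r)"
 have "I \<ge> 0" unfolding I_def by simp
 have \<phi>0: "\<phi> 0 \<in> test_functions" using st_test_slice[OF \<phi>, of 0] T_pos by simp
 define \<Phi> where "\<Phi> = time_cut T \<phi>"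
 define \<Phi>t where "\<Phi>t = time_cut T (\<lambda>t x. deriv (\<lambda>s. \<phi> s x) t)"
 define \<Phi>x where "\<Phi>x = time_cut T (\<lambda>t. gradient (\<phi> t))"
 have [measurable]: "\<Phi> \<in> Borel" "\<Phi>t \<in> Borel" "\<Phi>x \<in> Borel"
  using cut_measurable[OF \<phi>] by (simp_all add: \<Phi>_def \<Phi>t_def \<Phi>x_def)
 have Lop: "Lop \<phi> p = \<Phi>t p + D p * \<Phi> p + b p \<bullet> \<Phi>x p" for p by (simp add: Lop_def \<Phi>_def \<Phi>t_def \<Phi>x_def)
 note int = Lop_parts_integrable[OF \<phi>, folded \<Phi>_def \<Phi>t_def \<Phi>x_def]
 have \<Phi>0: "\<Phi> p = 0" if "fst p \<notin> {0<..<T} \<or> norm (snd p) > r" for p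
  using C that by (auto simp: \<Phi>_def time_cut_def indicator_def)
 have "(LBINT x. \<bar>\<phi> 0 x\<bar>) \<le> (LBINT p. \<bar>Lop \<phi> p\<bar>) + \<delta> * (I + V)" if \<delta>: "\<delta> > 0" for \<delta>
 proof -
  define \<beta> where "\<beta> s = sqrt (s\<^sup>2 + \<delta>\<^sup>2) - \<delta>" for s :: real
  define \<beta>' where "\<beta>' s = s / sqrt (s\<^sup>2 + \<delta>\<^sup>2)" for s :: real
  have pos: "s\<^sup>2 + \<delta>\<^sup>2 > 0" for s :: real using \<delta> by (simp add: add_nonneg_pos)
  have sq: "sqrt (s\<^sup>2 + \<delta>\<^sup>2) \<ge> \<bar>s\<bar>" "sqrt (s\<^sup>2 + \<delta>\<^sup>2) \<ge> \<delta>" "sqrt (s\<^sup>2 + \<delta>\<^sup>2) > 0" for s :: real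
   using pos[of s] \<delta> real_sqrt_le_mono[of "s\<^sup>2" "s\<^sup>2 + \<delta>\<^sup>2"] real_sqrt_le_mono[of "\<delta>\<^sup>2" "s\<^sup>2 + \<delta>\<^sup>2"] by auto
  have [simp]: "\<beta> 0 = 0" "\<beta>' 0 = 0" using \<delta> by (auto simp: \<beta>_def \<beta>'_def)
  have \<beta>'1: "\<bar>\<beta>' s\<bar> \<le> 1" for s using sq[of s] by (simp add: \<beta>'_def abs_divide)
  have e: "\<bar>s * \<beta>' s - \<beta> s\<bar> \<le> \<delta>" for s
  proof -
   define q where "q = sqrt (s\<^sup>2 + \<delta>\<^sup>2)"
   have q: "q > 0" "q \<ge> \<delta>" "q * q = s * s + \<delta> * \<delta>"
    using sq[of s] pos[of s] by (auto simp: q_def less_imp_le power2_eq_square)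
   have "s * \<beta>' s - \<beta> s = (s * s) / q - q + \<delta>" by (simp add: \<beta>_def \<beta>'_def q_def)
   also have "(s * s) / q = q - \<delta> * \<delta> / q" using q by (simp add: field_simps)
   finally have eq: "s * \<beta>' s - \<beta> s = \<delta> - \<delta> * \<delta> / q" by simp
   have "\<delta> * \<delta> / q \<le> \<delta>" using q \<delta> by (simp add: field_simps)
   moreover have "\<delta> * \<delta> / q \<ge> 0" using q by simp
   ultimately show ?thesis unfolding eq by simp
  qed
  have \<beta>_lower: "\<bar>s\<bar> \<le> \<beta> s + \<delta>" for s using sq[of s] by (simp add: \<beta>_def)
  have [measurable]: "\<beta> \<in> Borel" "\<beta>' \<in> Borel" unfolding \<beta>_def[abs_def] \<beta>'_def[abs_def] by measurable
  have i1: "L1 (\<lambda>p. \<beta>' (\<Phi> p) * \<Phi>t p)" using \<beta>'1 by (intro integrable_bounded_mult[OF int(1), where C=1]) auto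
  have i2: "L1 (\<lambda>p. \<beta>' (\<Phi> p) * (D p * \<Phi> p + b p \<bullet> \<Phi>x p))"
   using \<beta>'1 int(2,3) by (intro integrable_bounded_mult[where C=1]) auto
  have i3: "L1 (\<lambda>p. D p * (\<Phi> p * \<beta>' (\<Phi> p) - \<beta> (\<Phi> p)))"
   using e \<Phi>0 by (intro bounded_slab_integrable(2)[where C=\<delta> and r=r]) auto

  have t1: "(LBINT p. \<beta>' (\<Phi> p) * \<Phi>t p) = - (LBINT x. \<beta> (\<phi> 0 x))"
  proof -
   have "(LBINT t. \<beta>' (\<Phi> (t, x)) * \<Phi>t (t, x)) = - \<beta> (\<phi> 0 x)" for x
   proof -
    define f where "f t = \<beta>' (\<phi> t x) * frechet_derivative (\<lambda>(t, x). \<phi> t x) (at (t, x) within {0..T} \<times> UNIV) (1, 0)" for t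
    have cphi: "continuous_on {0..T} (\<lambda>t. \<phi> t x)"
    proof -
     have "continuous_on {0..T} (\<lambda>t. (\<lambda>(t, x). \<phi> t x) (t, x))"
      by (rule continuous_on_compose2[OF Ck_on_imp_continuous_on[OF st_testD(1)[OF \<phi>, of 0]]])
        (auto intro!: continuous_intros)
     thus ?thesis by simp
    qed
    have cD: "continuous_on {0..T} (\<lambda>t. frechet_derivative (\<lambda>(t, x). \<phi> t x) (at (t, x) within {0..T} \<times> UNIV) (1, 0))"
    proof (rule continuous_on_compose2[where f="\<lambda>t. (t, x)" and t="{0..T} \<times> UNIV"])
     show "continuous_on ({0..T} \<times> UNIV) (\<lambda>p. frechet_derivative (\<lambda>(t, x). \<phi> t x) (at p within {0..T} \<times> UNIV) (1, 0))"
      using Ck_on_SucD(2)[OF st_testD(1)[OF \<phi>, of "Suc 0"], of "(1, 0)"] by simp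
    qed (auto intro!: continuous_intros)
    have "(LBINT t. ind {0..T} t *\<^sub>R f t) = \<beta> (\<phi> T x) - \<beta> (\<phi> 0 x)"
    proof (rule integral_FTC_Icc)
     fix t assume t: "0 \<le> t" "t \<le> T"
     have "(\<beta> has_real_derivative \<beta>' (\<phi> t x)) (at (\<phi> t x))" unfolding \<beta>_def[abs_def] \<beta>'_def using pos[of "\<phi> t x"]
      by (auto intro!: derivative_eq_intros simp: field_simps)
     from DERIV_chain2[OF this st_test_time_derivative[OF \<phi>, of t x]] t
     show "((\<lambda>t. \<beta> (\<phi> t x)) has_vector_derivative f t) (at t within {0..T})"
      by (simp add: has_real_derivative_iff_has_vector_derivative f_def)
    next
     show "continuous_on {0..T} f" unfolding f_def \<beta>'_def using pos
      by (intro continuous_intros cphi cD) (auto simp: less_imp_neq[symmetric])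
    qed (use T_pos in simp)
    moreover have "(LBINT t. ind {0..T} t *\<^sub>R f t) = (LBINT t. \<beta>' (\<Phi> (t, x)) * \<Phi>t (t, x))"
    proof (rule integral_cong_AE)
     have "continuous_on {0..T} f" unfolding f_def \<beta>'_def using pos
      by (intro continuous_intros cphi cD) (auto simp: less_imp_neq[symmetric])
     thus "(\<lambda>t. ind {0..T} t *\<^sub>R f t) \<in> borel_measurable lborel"
      using borel_measurable_continuous_on_indicator[of "{0..T}" f] by simp
     show "AE t in lborel. ind {0..T} t *\<^sub>R f t = \<beta>' (\<Phi> (t, x)) * \<Phi>t (t, x)"
      using AE_lborel_singleton[of 0] AE_lborel_singleton[of T]
     proof eventually_elim
      fix t :: real assume "t \<noteq> 0" "t \<noteq> T"
      thus "ind {0..T} t *\<^sub>R f t = \<beta>' (\<Phi> (t, x)) * \<Phi>t (t, x)"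
       using st_test_deriv(2)[OF \<phi>, of t x] by (auto simp: indicator_def \<Phi>_def \<Phi>t_def time_cut_def f_def)
     qed
    qed measurable
    ultimately show ?thesis using st_testD(2)[OF \<phi>, of x] by simp
   qed
   thus ?thesis using lborel_Fubini(2)[OF i1] by simp
  qed
  have t2: "(LBINT p. \<beta>' (\<Phi> p) * (D p * \<Phi> p + b p \<bullet> \<Phi>x p)) = (LBINT p. D p * (\<Phi> p * \<beta>' (\<Phi> p) - \<beta> (\<Phi> p)))"
   unfolding lborel_Fubini(1)[OF i2] lborel_Fubini(1)[OF i3]
  proof (rule integral_cong_AE)
   show "AE t in lborel. (LBINT x. \<beta>' (\<Phi> (t, x)) * (D (t, x) * \<Phi> (t, x) + b (t, x) \<bullet> \<Phi>x (t, x))) =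
     (LBINT x. D (t, x) * (\<Phi> (t, x) * \<beta>' (\<Phi> (t, x)) - \<beta> (\<Phi> (t, x))))" using divergence slices_loc_int
   proof eventually_elim
    fix t assume div: "t \<in> {0<..<T} --> (\<forall>\<psi>\<in>test_functions. (LBINT x. b (t, x) \<bullet> gradient \<psi> x) = - (LBINT x. D (t, x) * \<psi> x))"
     and loc: "t \<in> {0<..<T} --> loc_int (\<lambda>x. D (t, x)) \<and> (\<forall>v. loc_int (\<lambda>x. b (t, x) \<bullet> v))"
    show "(LBINT x. \<beta>' (\<Phi> (t, x)) * (D (t, x) * \<Phi> (t, x) + b (t, x) \<bullet> \<Phi>x (t, x))) =
     (LBINT x. D (t, x) * (\<Phi> (t, x) * \<beta>' (\<Phi> (t, x)) - \<beta> (\<Phi> (t, x))))"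
    proof (cases "t \<in> {0<..<T}")
     case False
     thus ?thesis by (simp add: \<Phi>_def \<Phi>x_def time_cut_def)
    next
     case True
     hence p: "\<phi> t \<in> test_functions" using st_test_slice[OF \<phi>, of t] by auto
     hence [measurable]: "\<phi> t \<in> Borel" by auto
     have \<psi>: "(\<lambda>x. \<beta> (\<phi> t x)) \<in> test_functions" unfolding \<beta>_def by (rule smooth_abs_test(1)[OF p \<delta>])
     have g: "gradient (\<lambda>x. \<beta> (\<phi> t x)) x = \<beta>' (\<phi> t x) *\<^sub>R gradient (\<phi> t) x" for x
      unfolding \<beta>_def \<beta>'_def by (rule smooth_abs_test(2)[OF p \<delta>])
     have lD: "loc_int (\<lambda>x. D (t, x))" and lb: "\<And>v. loc_int (\<lambda>x. b (t, x) \<bullet> v)" using loc True by auto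
     have j1: "L1 (\<lambda>x. D (t, x) * (\<beta>' (\<phi> t x) * \<phi> t x))"
     proof (rule loc_int_bounded_support[OF lD, where C=C and r=r])
      fix x
      have "\<bar>\<beta>' (\<phi> t x)\<bar> * \<bar>\<phi> t x\<bar> \<le> 1 * C" using \<beta>'1 C(3)[of t x] True by (intro mult_mono) auto
      thus "\<bar>\<beta>' (\<phi> t x) * \<phi> t x\<bar> \<le> C" by (simp add: abs_mult)
     qed (use C(2)[of t] True in auto)
     have j2: "L1 (\<lambda>x. b (t, x) \<bullet> gradient (\<lambda>x. \<beta> (\<phi> t x)) x)" by (rule inner_gradient_integrable[OF lb \<psi>])
     have j3: "L1 (\<lambda>x. D (t, x) * \<beta> (\<phi> t x))" by (rule loc_int_test[OF lD \<psi>])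
     have "(LBINT x. \<beta>' (\<Phi> (t, x)) * (D (t, x) * \<Phi> (t, x) + b (t, x) \<bullet> \<Phi>x (t, x)))
       = (LBINT x. D (t, x) * (\<beta>' (\<phi> t x) * \<phi> t x) + b (t, x) \<bullet> gradient (\<lambda>x. \<beta> (\<phi> t x)) x)"
      using True by (intro int_cong) (auto simp: \<Phi>_def \<Phi>x_def time_cut_def g distrib_left ac_simps)
     also have "\<dots> = (LBINT x. D (t, x) * (\<beta>' (\<phi> t x) * \<phi> t x)) - (LBINT x. D (t, x) * \<beta> (\<phi> t x))"
      using div True \<psi> j1 j2 by (simp add: int_add)
     also have "\<dots> = (LBINT x. D (t, x) * (\<beta>' (\<phi> t x) * \<phi> t x) - D (t, x) * \<beta> (\<phi> t x))"
      using j1 j3 by (simp add: int_diff)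
     also have "\<dots> = (LBINT x. D (t, x) * (\<Phi> (t, x) * \<beta>' (\<Phi> (t, x)) - \<beta> (\<Phi> (t, x))))"
      using True by (intro int_cong) (auto simp: \<Phi>_def time_cut_def right_diff_distrib ac_simps)
     finally show ?thesis .
    qed
   qed
  qed measurable
  have "(LBINT x. \<beta> (\<phi> 0 x)) = (LBINT p. D p * (\<Phi> p * \<beta>' (\<Phi> p) - \<beta> (\<Phi> p))) - (LBINT p. \<beta>' (\<Phi> p) * Lop \<phi> p)"
  proof -
   have "(LBINT p. \<beta>' (\<Phi> p) * Lop \<phi> p) = (LBINT p. \<beta>' (\<Phi> p) * \<Phi>t p + \<beta>' (\<Phi> p) * (D p * \<Phi> p + b p \<bullet> \<Phi>x p))"
    by (simp add: Lop algebra_simps)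
   also have "\<dots> = (LBINT p. \<beta>' (\<Phi> p) * \<Phi>t p) + (LBINT p. \<beta>' (\<Phi> p) * (D p * \<Phi> p + b p \<bullet> \<Phi>x p))"
    by (rule int_add[OF i1 i2])
   finally show ?thesis using t1 t2 by simp
  qed
  moreover have "(LBINT p. D p * (\<Phi> p * \<beta>' (\<Phi> p) - \<beta> (\<Phi> p))) \<le> \<delta> * I"
  proof -
   have "(LBINT p. D p * (\<Phi> p * \<beta>' (\<Phi> p) - \<beta> (\<Phi> p))) \<le> (LBINT p. \<delta> * \<bar>cyl T r p * D p\<bar>)"
   proof (rule integral_mono[OF i3])
    show "L1 (\<lambda>p. \<delta> * \<bar>cyl T r p * D p\<bar>)" using D_int[of r] by auto
    fix p
    show "D p * (\<Phi> p * \<beta>' (\<Phi> p) - \<beta> (\<Phi> p)) \<le> \<delta> * \<bar>cyl T r p * D p\<bar>"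
    proof (cases "p \<in> {0<..<T} \<times> cball 0 r")
     case True
     have "D p * (\<Phi> p * \<beta>' (\<Phi> p) - \<beta> (\<Phi> p)) \<le> \<bar>D p\<bar> * \<bar>\<Phi> p * \<beta>' (\<Phi> p) - \<beta> (\<Phi> p)\<bar>" by (metis abs_ge_self abs_mult)
     also have "\<dots> \<le> \<bar>D p\<bar> * \<delta>" using e by (intro mult_left_mono) auto
     finally show ?thesis using True by (simp add: mult.commute)
    next
     case False
     hence "\<Phi> p = 0" using \<Phi>0[of p] by (cases p) auto
     thus ?thesis using \<delta> by simp
    qed
   qed
   also have "\<dots> = \<delta> * I" by (simp add: I_def)
   finally show ?thesis .
  qed
  moreover have "- (LBINT p. \<beta>' (\<Phi> p) * Lop \<phi> p) \<le> (LBINT p. \<bar>Lop \<phi> p\<bar>)"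
  proof -
   have "- (LBINT p. \<beta>' (\<Phi> p) * Lop \<phi> p) \<le> (LBINT p. \<bar>\<beta>' (\<Phi> p) * Lop \<phi> p\<bar>)"
    using integral_abs_bound[of lborel "\<lambda>p. \<beta>' (\<Phi> p) * Lop \<phi> p"] by linarith
   also have "\<dots> \<le> (LBINT p. \<bar>Lop \<phi> p\<bar>)"
   proof (rule integral_mono)
    show "L1 (\<lambda>p. \<bar>\<beta>' (\<Phi> p) * Lop \<phi> p\<bar>)"
     using \<beta>'1 by (intro integrable_abs integrable_bounded_mult[OF int(4), where C=1]) auto
    show "L1 (\<lambda>p. \<bar>Lop \<phi> p\<bar>)" using int(4) by auto
    show "\<bar>\<beta>' (\<Phi> p) * Lop \<phi> p\<bar> \<le> \<bar>Lop \<phi> p\<bar>" for p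
     using mult_right_mono[OF \<beta>'1[of "\<Phi> p"], of "\<bar>Lop \<phi> p\<bar>"] by (simp add: abs_mult)
   qed
   finally show ?thesis .
  qed
  moreover have "(LBINT x. \<bar>\<phi> 0 x\<bar>) \<le> (LBINT x. \<beta> (\<phi> 0 x)) + \<delta> * V"
  proof -
   have iv: "L1 (\<lambda>x::'a. \<delta> * ind (cball 0 r) x)"
    using emeasure_lborel_cball_finite[of "0::'a" r] by (intro integrable_mult_right integrable_real_indicator) auto
   have ib: "L1 (\<lambda>x. \<beta> (\<phi> 0 x))" unfolding \<beta>_def by (rule test_integrable[OF smooth_abs_test(1)[OF \<phi>0 \<delta>]])
   have "(LBINT x. \<bar>\<phi> 0 x\<bar>) \<le> (LBINT x. \<beta> (\<phi> 0 x) + \<delta> * ind (cball 0 r) x)"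
   proof (rule integral_mono)
    show "L1 (\<lambda>x. \<bar>\<phi> 0 x\<bar>)" using test_integrable[OF \<phi>0] by auto
    show "L1 (\<lambda>x. \<beta> (\<phi> 0 x) + \<delta> * ind (cball 0 r) x)" using ib iv by auto
    show "\<bar>\<phi> 0 x\<bar> \<le> \<beta> (\<phi> 0 x) + \<delta> * ind (cball 0 r) x" for x
     using \<beta>_lower[of "\<phi> 0 x"] C(2)[of 0 x] T_pos by (cases "norm x \<le> r") auto
   qed
   also have "\<dots> = (LBINT x. \<beta> (\<phi> 0 x)) + \<delta> * V" using ib iv by (simp add: V_def)
   finally show ?thesis .
  qed
  ultimately show ?thesis by (simp add: distrib_left)
 qed
 note est = this
 have *: "(LBINT x. \<bar>\<phi> 0 x\<bar>) - (LBINT p. \<bar>Lop \<phi> p\<bar>) \<le> \<delta> * (I + V)" if "\<delta> > 0" for \<delta> using est[OF that] by linarith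
 have IV: "I + V \<ge> 0" using \<open>I \<ge> 0\<close> by (simp add: V_def)
 have "(LBINT x. \<bar>\<phi> 0 x\<bar>) - (LBINT p. \<bar>Lop \<phi> p\<bar>) \<le> 0 + e" if "e > 0" for e
 proof -
  have "e / (I + V + 1) * (I + V) \<le> e" using IV that by (simp add: field_simps)
  thus ?thesis using *[of "e / (I + V + 1)"] IV that by (simp add: add_nonneg_pos)
 qed
 hence "(LBINT x. \<bar>\<phi> 0 x\<bar>) - (LBINT p. \<bar>Lop \<phi> p\<bar>) \<le> 0" by (rule field_le_epsilon)
 thus ?thesis by simp
qed

lemma Lop_linear:
 assumes "\<phi> \<in> ST T" "\<psi> \<in> ST T"
 shows "Lop (\<lambda>t x. \<phi> t x + \<psi> t x) p = Lop \<phi> p + Lop \<psi> p" "Lop (\<lambda>t x. c * \<phi> t x) p = c * Lop \<phi> p"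
proof -
 obtain t x where p: "p = (t, x)" by (cases p)
 have "Lop (\<lambda>t x. \<phi> t x + \<psi> t x) p = Lop \<phi> p + Lop \<psi> p \<and> Lop (\<lambda>t x. c * \<phi> t x) p = c * Lop \<phi> p"
 proof (cases "t \<in> {0<..<T}")
  case True
  hence t: "t \<in> {0..T}" by auto
  note d = st_test_deriv(1)[OF assms(1) True, of x] st_test_deriv(1)[OF assms(2) True, of x]
  have 1: "deriv (\<lambda>s. \<phi> s x + \<psi> s x) t = deriv (\<lambda>s. \<phi> s x) t + deriv (\<lambda>s. \<psi> s x) t"
   by (rule DERIV_imp_deriv[OF DERIV_add[OF d]])
  have 2: "deriv (\<lambda>s. c * \<phi> s x) t = c * deriv (\<lambda>s. \<phi> s x) t" by (rule DERIV_imp_deriv[OF DERIV_cmult[OF d(1)]])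
  note g = gradient_has_derivative[OF st_test_slice[OF assms(1) t], of x] gradient_has_derivative[OF st_test_slice[OF assms(2) t], of x]
  have 3: "gradient (\<lambda>x. \<phi> t x + \<psi> t x) x = gradient (\<phi> t) x + gradient (\<psi> t) x"
   using has_derivative_add[OF g] by (intro gradient_eqI) (simp add: inner_add_left)
  have 4: "gradient (\<lambda>x. c * \<phi> t x) x = c *\<^sub>R gradient (\<phi> t) x"
   using has_derivative_mult_right[OF g(1), of c] by (intro gradient_eqI) simp
  show ?thesis using True by (simp add: Lop_def time_cut_def p 1 2 3 4 algebra_simps)
 qed (simp add: Lop_def time_cut_def p)
 thus "Lop (\<lambda>t x. \<phi> t x + \<psi> t x) p = Lop \<phi> p + Lop \<psi> p" "Lop (\<lambda>t x. c * \<phi> t x) p = c * Lop \<phi> p" by auto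
qed

lemma solution_exists:
 assumes u0: "u0 \<in> Borel" "\<And>x. \<bar>u0 x\<bar> \<le> M"
 obtains u where "u \<in> Borel" "\<And>p. \<bar>u p\<bar> \<le> M"
  "\<And>\<phi>. \<phi> \<in> ST T ==> (LBINT p. u p * Lop \<phi> p) = - (LBINT x. u0 x * \<phi> 0 x)"
proof -
 have M: "M \<ge> 0" using u0(2)[of 0] by linarith
 define S where "S = Lop ` ST T"
 define m where "m \<phi> = - (LBINT x. u0 x * \<phi> 0 x)" for \<phi> :: "real => 'a => real"
 have sl: "\<phi> 0 \<in> test_functions" if "\<phi> \<in> ST T" for \<phi> :: "real => 'a => real"
  using st_test_slice[OF that, of 0] T_pos by simp
 have ui: "L1 (\<lambda>x. u0 x * \<phi> 0 x)" if "\<phi> \<in> ST T" for \<phi>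
  using test_integrable[OF sl[OF that]] u0 by (intro integrable_bounded_mult[where C=M]) auto
 have m_le: "m \<phi> \<le> M * (LBINT p. \<bar>Lop \<phi> p\<bar>)" if "\<phi> \<in> ST T" for \<phi>
 proof -
  have "m \<phi> \<le> (LBINT x. \<bar>u0 x * \<phi> 0 x\<bar>)"
   unfolding m_def using integral_abs_bound[of lborel "\<lambda>x. u0 x * \<phi> 0 x"] by linarith
  also have "\<dots> \<le> (LBINT x. M * \<bar>\<phi> 0 x\<bar>)"
  proof (rule integral_mono)
   show "L1 (\<lambda>x. \<bar>u0 x * \<phi> 0 x\<bar>)" by (rule integrable_abs[OF ui[OF that]])
   show "L1 (\<lambda>x. M * \<bar>\<phi> 0 x\<bar>)" using test_integrable[OF sl[OF that]] by auto
  qed (use u0 in \<open>auto simp: abs_mult intro!: mult_right_mono\<close>)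
  also have "\<dots> = M * (LBINT x. \<bar>\<phi> 0 x\<bar>)" by simp
  also have "\<dots> \<le> M * (LBINT p. \<bar>Lop \<phi> p\<bar>)" using a_priori_estimate[OF that] M by (rule mult_left_mono)
  finally show ?thesis .
 qed
 have add: "(\<lambda>t x. \<phi> t x + \<psi> t x) \<in> ST T" "m (\<lambda>t x. \<phi> t x + \<psi> t x) = m \<phi> + m \<psi>"
  "Lop (\<lambda>t x. \<phi> t x + \<psi> t x) = (\<lambda>p. Lop \<phi> p + Lop \<psi> p)"
  if "\<phi> \<in> ST T" "\<psi> \<in> ST T" for \<phi> \<psi>
  using st_test_add_scale(1)[OF T_pos that] Lop_linear(1)[OF that] ui[OF that(1)] ui[OF that(2)]
  by (auto simp: m_def distrib_left)
 have scale: "(\<lambda>t x. c * \<phi> t x) \<in> ST T" "m (\<lambda>t x. c * \<phi> t x) = c * m \<phi>"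
  "Lop (\<lambda>t x. c * \<phi> t x) = (\<lambda>p. c * Lop \<phi> p)"
  if "\<phi> \<in> ST T" for \<phi> c
 proof -
  have "(\<lambda>x. u0 x * (c * \<phi> 0 x)) = (\<lambda>x. c * (u0 x * \<phi> 0 x))" by (auto simp: ac_simps)
  thus "m (\<lambda>t x. c * \<phi> t x) = c * m \<phi>" by (simp add: m_def)
 qed (use st_test_add_scale(2)[OF T_pos that that] Lop_linear(2)[OF that that] in auto)
 have wd: "m \<phi> = m \<psi>" if "\<phi> \<in> ST T" "\<psi> \<in> ST T" "Lop \<phi> = Lop \<psi>" for \<phi> \<psi>
 proof -
  have "m \<phi> - m \<psi> \<le> 0" if "\<phi> \<in> ST T" "\<psi> \<in> ST T" "Lop \<phi> = Lop \<psi>" for \<phi> \<psi>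
  proof -
   note s = scale[OF that(2), of "-1"]
   have "m \<phi> - m \<psi> = m (\<lambda>t x. \<phi> t x + (-1) * \<psi> t x)" using add(2)[OF that(1) s(1)] s(2) by simp
   also have "\<dots> \<le> M * (LBINT p. \<bar>Lop (\<lambda>t x. \<phi> t x + (-1) * \<psi> t x) p\<bar>)" by (rule m_le[OF add(1)[OF that(1) s(1)]])
   also have "\<dots> = 0" using add(3)[OF that(1) s(1)] s(3) that(3) by simp
   finally show ?thesis .
  qed
  from this[OF that] this[OF that(2,1) that(3)[symmetric]] show ?thesis by simp
 qed
 define l where "l f = m (SOME \<phi>. \<phi> \<in> ST T \<and> Lop \<phi> = f)" for f
 have l: "l (Lop \<phi>) = m \<phi>" if "\<phi> \<in> ST T" for \<phi> unfolding l_def using someI[of "\<lambda>\<psi>. \<psi> \<in> ST T \<and> Lop \<psi> = Lop \<phi>" \<phi>] that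
  by (intro wd) auto
 have zero: "(\<lambda>t (x::'a). 0) \<in> ST T"
  using Ck_on_const[OF unique_derivs_slab[OF T_pos], of _ 0] by (intro st_testI) (auto simp: split_beta')
 obtain F where F: "\<And>f. f \<in> S ==> F f = l f"
  "\<And>f. f \<in> {f. L1 f} ==> F f \<le> M * (LBINT p. \<bar>f p\<bar>)"
  "\<And>f g. f \<in> {f. L1 f} ==> g \<in> {f. L1 f} ==> F (\<lambda>x. f x + g x) = F f + F g"
  "\<And>f c. f \<in> {f. L1 f} ==> F (\<lambda>x. c * f x) = c * F f"
 proof (rule Hahn_Banach_functions[of "{f :: real \<times> 'a => real. L1 f}" "\<lambda>f. M * (LBINT p. \<bar>f p\<bar>)" S l])
  fix f g :: "real \<times> 'a => real" assume fg: "f \<in> {f. L1 f}" "g \<in> {f. L1 f}"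
  have "(LBINT p. \<bar>f p + g p\<bar>) \<le> (LBINT p. \<bar>f p\<bar> + \<bar>g p\<bar>)" using fg by (intro integral_mono) auto
  also have "\<dots> = (LBINT p. \<bar>f p\<bar>) + (LBINT p. \<bar>g p\<bar>)" using fg by simp
  finally show "M * (LBINT p. \<bar>f p + g p\<bar>) \<le> M * (LBINT p. \<bar>f p\<bar>) + M * (LBINT p. \<bar>g p\<bar>)"
   using M by (simp add: mult_left_mono flip: distrib_left)
 next
  fix f :: "real \<times> 'a => real" and c :: real assume "c \<ge> 0"
  thus "M * (LBINT p. \<bar>c * f p\<bar>) = c * (M * (LBINT p. \<bar>f p\<bar>))" by (simp add: abs_mult)
 next
  show "S \<subseteq> {f. L1 f}" unfolding S_def using Lop_parts_integrable(4) by auto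
  show "S \<noteq> {}" using zero by (auto simp: S_def)
 next
  fix f g assume "f \<in> S" "g \<in> S"
  then obtain \<phi> \<psi> where *: "\<phi> \<in> ST T" "\<psi> \<in> ST T" "f = Lop \<phi>" "g = Lop \<psi>" by (auto simp: S_def)
  have eq: "(\<lambda>x. f x + g x) = Lop (\<lambda>t x. \<phi> t x + \<psi> t x)" using add(3)[OF *(1,2)] * by simp
  have "Lop (\<lambda>t x. \<phi> t x + \<psi> t x) \<in> S" unfolding S_def by (rule imageI[OF add(1)[OF *(1,2)]])
  moreover have "l (Lop (\<lambda>t x. \<phi> t x + \<psi> t x)) = l f + l g"
   unfolding *(3,4) l[OF add(1)[OF *(1,2)]] l[OF *(1)] l[OF *(2)] by (rule add(2)[OF *(1,2)])
  ultimately show "(\<lambda>x. f x + g x) \<in> S \<and> l (\<lambda>x. f x + g x) = l f + l g" unfolding eq by (rule conjI)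
 next
  fix f c assume "f \<in> S"
  then obtain \<phi> where *: "\<phi> \<in> ST T" "f = Lop \<phi>" by (auto simp: S_def)
  have eq: "(\<lambda>x. c * f x) = Lop (\<lambda>t x. c * \<phi> t x)" using scale(3)[OF *(1)] * by simp
  have "Lop (\<lambda>t x. c * \<phi> t x) \<in> S" unfolding S_def by (rule imageI[OF scale(1)[OF *(1)]])
  moreover have "l (Lop (\<lambda>t x. c * \<phi> t x)) = c * l f"
   unfolding *(2) l[OF scale(1)[OF *(1)]] l[OF *(1)] by (rule scale(2)[OF *(1)])
  ultimately show "(\<lambda>x. c * f x) \<in> S \<and> l (\<lambda>x. c * f x) = c * l f" unfolding eq by (rule conjI)
 next
  fix f assume "f \<in> S"
  thus "l f \<le> M * (LBINT p. \<bar>f p\<bar>)" using l m_le by (auto simp: S_def)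
 qed auto
 obtain u where u: "u \<in> Borel" "\<And>p. \<bar>u p\<bar> \<le> M"
  "\<And>f. L1 f ==> F f = (LBINT p. u p * f p)" using L1_dual_representation[of F M] F(2,3,4) M by auto
 show ?thesis
 proof (rule that[OF u(1,2)])
  fix \<phi> :: "real => 'a => real" assume \<phi>: "\<phi> \<in> ST T"
  have "(LBINT p. u p * Lop \<phi> p) = F (Lop \<phi>)" using u(3)[OF Lop_parts_integrable(4)[OF \<phi>]] by simp
  also have "\<dots> = m \<phi>" using F(1)[of "Lop \<phi>"] l[OF \<phi>] \<phi> by (simp add: S_def)
  finally show "(LBINT p. u p * Lop \<phi> p) = - (LBINT x. u0 x * \<phi> 0 x)" by (simp add: m_def)
 qed
qed

end


lemma integral_gradient_zero:
 assumes \<psi>: "\<psi> \<in> test_functions"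
 shows "(LBINT x. gradient \<psi> x \<bullet> v) = 0"
proof -
 have shift: "conv (\<lambda>_. 1) k x = (LBINT y. k y)" if "k \<in> Borel" for k :: "'a => real" and x
  using has_bochner_integral_lborel_affine(2)[OF that, of "-1" x] by (simp add: conv_def)
 have "(conv (\<lambda>_. 1) \<psi> has_derivative (\<lambda>v. conv (\<lambda>_. 1) (\<lambda>z. gradient \<psi> z \<bullet> v) 0)) (at 0)"
  by (rule conv_has_derivative[where M=1]) (auto simp: \<psi>)
 moreover have "conv (\<lambda>_. 1) \<psi> = (\<lambda>x. LBINT y. \<psi> y)" using shift[of \<psi>] \<psi> by auto
 ultimately have "((\<lambda>x::'a. LBINT y. \<psi> y) has_derivative (\<lambda>v. conv (\<lambda>_. 1) (\<lambda>z. gradient \<psi> z \<bullet> v) 0)) (at 0)" by simp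
 from has_derivative_unique[OF this has_derivative_const] have "conv (\<lambda>_. 1) (\<lambda>z. gradient \<psi> z \<bullet> v) 0 = 0" by metis
 thus ?thesis using shift[of "\<lambda>z. gradient \<psi> z \<bullet> v" 0] test_gradient_component[OF \<psi>, of v] by auto
qed

lemma mult_gradient:
 assumes "\<psi> \<in> test_functions" "(f has_derivative (\<lambda>v. g \<bullet> v)) (at x)"
 shows "gradient (\<lambda>x. f x * \<psi> x) x = \<psi> x *\<^sub>R g + f x *\<^sub>R gradient \<psi> x"
proof (rule gradient_eqI)
 show "((\<lambda>x. f x * \<psi> x) has_derivative (\<lambda>v. (\<psi> x *\<^sub>R g + f x *\<^sub>R gradient \<psi> x) \<bullet> v)) (at x)"
  using has_derivative_mult[OF assms(2) gradient_has_derivative[OF assms(1), of x]]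
  by (simp add: inner_add_left algebra_simps)
qed

lemma first_moment_gradient:
 assumes \<psi>: "\<psi> \<in> test_functions"
 shows "(LBINT x. (x \<bullet> i) * (gradient \<psi> x \<bullet> v)) = - (v \<bullet> i) * (LBINT x. \<psi> x)"
  and "L1 (\<lambda>x. (x \<bullet> i) * (gradient \<psi> x \<bullet> v))"
proof -
 have t: "(\<lambda>x. (x \<bullet> i) * \<psi> x) \<in> test_functions" by (intro test_mult_smooth \<psi> Ck_on_inner unique_derivs_UNIV)
 have g: "gradient (\<lambda>x. (x \<bullet> i) * \<psi> x) x \<bullet> v = (v \<bullet> i) * \<psi> x + (x \<bullet> i) * (gradient \<psi> x \<bullet> v)" for x
 proof -
  have "((\<lambda>x. x \<bullet> i) has_derivative (\<lambda>v. i \<bullet> v)) (at x)" by (auto intro!: derivative_eq_intros simp: inner_commute)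
  from mult_gradient[OF \<psi> this] show ?thesis by (simp add: inner_add_left mult.commute) (simp add: inner_commute)
 qed
 show i: "L1 (\<lambda>x. (x \<bullet> i) * (gradient \<psi> x \<bullet> v))"
  by (intro test_integrable test_mult_smooth test_gradient_component \<psi> Ck_on_inner unique_derivs_UNIV)
 have "0 = (LBINT x. (v \<bullet> i) * \<psi> x + (x \<bullet> i) * (gradient \<psi> x \<bullet> v))"
  using integral_gradient_zero[OF t, of v] by (simp add: g)
 also have "\<dots> = (v \<bullet> i) * (LBINT x. \<psi> x) + (LBINT x. (x \<bullet> i) * (gradient \<psi> x \<bullet> v))"
  using i test_integrable[OF \<psi>] by simp
 finally show "(LBINT x. (x \<bullet> i) * (gradient \<psi> x \<bullet> v)) = - (v \<bullet> i) * (LBINT x. \<psi> x)" by simp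
qed

lemma AE_lborel_pairI:
 fixes P :: "'a::euclidean_space \<times> 'b::euclidean_space => bool"
 assumes "Measurable.pred borel P" "AE x in lborel. AE y in lborel. P (x, y)"
 shows "AE p in lborel. P p"
proof -
 have "{p \<in> space (lborel \<Otimes>\<^sub>M lborel). P p} \<in> sets (lborel \<Otimes>\<^sub>M lborel)"
  using assms(1) unfolding lborel_prod by (simp add: pred_def)
 from lborel_pair.AE_pair_measure[OF this assms(2)] show ?thesis unfolding lborel_prod .
qed

lemma AE_lborel_pairD:
 fixes P :: "'a::euclidean_space \<times> 'b::euclidean_space => bool"
 assumes "AE p in lborel. P p" shows "AE x in lborel. AE y in lborel. P (x, y)"
 using lborel_pair.AE_pair[of P, unfolded lborel_prod] assms by blast

lemma nn_integral_lborel_Fubini: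
 fixes F :: "'a::euclidean_space \<times> 'b::euclidean_space => ennreal"
 assumes "F \<in> Borel"
 shows "(NNBINT p. F p) = (NNBINT x. (NNBINT y. F (x, y)))"
 using lborel.nn_integral_fst[of F lborel] assms by (simp add: lborel_prod)

text \<open>The integrals below are zero when the integrand is not integrable, so the bounds hold for every measurable integrand.\<close>

lemma integral_minus_le_nn_integral:
 fixes f g :: "'a => real"
 assumes "integrable M g" and f: "f \<in> borel_measurable M"
 shows "ennreal \<bar>(\<integral>x. f x \<partial>M) - (\<integral>x. g x \<partial>M)\<bar> \<le> (\<integral>\<^sup>+x. ennreal \<bar>f x - g x\<bar> \<partial>M)"
proof (cases "(\<integral>\<^sup>+x. ennreal \<bar>f x - g x\<bar> \<partial>M) < \<infinity>")
 case True
 hence i: "integrable M (\<lambda>x. f x - g x)" using assms by (intro integrableI_bounded) auto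
 hence "integrable M f" using L1_add[OF i assms(1)] by simp
 hence "(\<integral>x. f x \<partial>M) - (\<integral>x. g x \<partial>M) = (\<integral>x. f x - g x \<partial>M)" using assms(1) by simp
 thus ?thesis using integral_norm_bound_ennreal[OF i] by simp
qed (simp add: less_top[symmetric])

lemma slice_loc_int:
 fixes f :: "real \<times> 'a::euclidean_space => real"
 assumes [measurable]: "f \<in> Borel"
  and "\<And>r. L1 (\<lambda>p. cyl T r p * f p)"
 shows "AE t\<in>{0<..<T} in lborel. loc_int (\<lambda>x. f (t, x))"
proof -
 have "AE t in lborel. \<forall>n. L1 (\<lambda>x. ind ({0<..<T} \<times> cball 0 (real n)) (t, x) * f (t, x))"
  unfolding AE_all_countable using lborel_Fubini(3)[OF assms(2)] by blast
 thus ?thesis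
 proof eventually_elim
  case (elim t)
  show ?case unfolding loc_int_def
  proof safe
   fix r :: real assume t: "t \<in> {0<..<T}"
   obtain n :: nat where n: "r \<le> real n" using real_arch_simple by blast
   have "L1 (\<lambda>x. ind (cball 0 r) x * (ind ({0<..<T} \<times> cball 0 (real n)) (t, x) * f (t, x)))"
    by (rule integrable_bounded_mult[where C=1, OF elim[rule_format]]) (auto simp: indicator_def)
   moreover have "ind (cball 0 r) x * (ind ({0<..<T} \<times> cball 0 (real n)) (t, x) * f (t, x)) = ind (cball 0 r) x * f (t, x)" for x
    using n t by (auto simp: indicator_def)
   ultimately show "L1 (\<lambda>x. ind (cball 0 r) x * f (t, x))" by simp
  qed measurable
 qed
qed

locale transport_field_W11 = transport_field T b D
 for T :: real and b :: "real \<times> 'a::euclidean_space => 'a" and D :: "real \<times> 'a => real" +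
 fixes G :: "'a => real \<times> 'a => 'a"
 assumes G_meas[measurable]: "i \<in> Basis ==> G i \<in> Borel"
  and G_int: "i \<in> Basis ==> L1 (\<lambda>p. cyl T r p *\<^sub>R G i p)"
  and G_weak: "i \<in> Basis ==> AE t in lborel. t \<in> {0<..<T} -->
   (\<forall>\<psi>\<in>test_functions. \<forall>j\<in>Basis. (LBINT x. (gradient \<psi> x \<bullet> i) * (b (t, x) \<bullet> j)) = - (LBINT x. \<psi> x * (G i (t, x) \<bullet> j)))"
begin

lemma G_slices: "AE t\<in>{0<..<T} in lborel. (\<forall>i\<in>Basis. \<forall>j\<in>Basis. loc_int (\<lambda>x. G i (t, x) \<bullet> j))"
proof -
 have "AE t\<in>{0<..<T} in lborel. loc_int (\<lambda>x. G i (t, x) \<bullet> j)" if i: "i \<in> Basis" and j: "j \<in> Basis" for i j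
 proof (rule slice_loc_int)
  show "(\<lambda>p. G i p \<bullet> j) \<in> Borel" using G_meas[OF i] by measurable
  show "L1 (\<lambda>p. cyl T r p * (G i p \<bullet> j))" for r using integrable_inner_left[OF G_int[OF i, of r], of j] by simp
 qed
 hence "AE t in lborel. \<forall>i\<in>Basis. \<forall>j\<in>Basis. t \<in> {0<..<T} --> loc_int (\<lambda>x. G i (t, x) \<bullet> j)"
  by (intro AE_finite_allI finite_Basis)
 thus ?thesis by eventually_elim blast
qed

lemma G_weak_all: "AE t\<in>{0<..<T} in lborel. (\<forall>i\<in>Basis. \<forall>j\<in>Basis. \<forall>\<psi>\<in>test_functions.
  (LBINT x. (gradient \<psi> x \<bullet> i) * (b (t, x) \<bullet> j)) = - (LBINT x. \<psi> x * (G i (t, x) \<bullet> j)))"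
proof -
 have "AE t in lborel. \<forall>i\<in>Basis. t \<in> {0<..<T} -->
   (\<forall>\<psi>\<in>test_functions. \<forall>j\<in>Basis. (LBINT x. (gradient \<psi> x \<bullet> i) * (b (t, x) \<bullet> j)) = - (LBINT x. \<psi> x * (G i (t, x) \<bullet> j)))"
  by (intro AE_finite_allI finite_Basis G_weak)
 thus ?thesis by eventually_elim blast
qed

text \<open>The weak divergence is the trace of the weak gradient.\<close>

lemma divergence_eq_trace:
 "AE p in lborel. fst p \<in> {0<..<T} --> D p = (\<Sum>i\<in>Basis. G i p \<bullet> i)"
proof (rule AE_lborel_pairI)
 have [measurable]: "(\<lambda>p. \<Sum>i\<in>Basis. G i p \<bullet> i) \<in> Borel" using G_meas by (intro borel_measurable_sum) measurable
 show "Measurable.pred borel (\<lambda>p. fst p \<in> {0<..<T} --> D p = (\<Sum>i\<in>Basis. G i p \<bullet> i))" by measurable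
 show "AE t in lborel. AE x in lborel. fst (t, x) \<in> {0<..<T} --> D (t, x) = (\<Sum>i\<in>Basis. G i (t, x) \<bullet> i)"
  using divergence slices_loc_int G_slices G_weak_all
 proof eventually_elim
  case (elim t)
  show ?case
  proof (cases "t \<in> {0<..<T}")
   case True
   have div: "\<And>\<psi>. \<psi> \<in> test_functions ==> (LBINT x. b (t, x) \<bullet> gradient \<psi> x) = - (LBINT x. D (t, x) * \<psi> x)"
    and lD: "loc_int (\<lambda>x. D (t, x))" and lb: "\<And>v. loc_int (\<lambda>x. b (t, x) \<bullet> v)"
    and lG: "\<And>i. i \<in> Basis ==> loc_int (\<lambda>x. G i (t, x) \<bullet> i)"
    and wG: "\<And>i \<psi>. i \<in> Basis ==> \<psi> \<in> test_functions ==>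
     (LBINT x. (gradient \<psi> x \<bullet> i) * (b (t, x) \<bullet> i)) = - (LBINT x. \<psi> x * (G i (t, x) \<bullet> i))" using elim True by auto
   define F where "F x = D (t, x) - (\<Sum>i\<in>Basis. G i (t, x) \<bullet> i)" for x
   have ls: "loc_int (\<lambda>x. \<Sum>i\<in>B. G i (t, x) \<bullet> i)" if "B \<subseteq> Basis" for B using finite_subset[OF that finite_Basis] that
   proof (induction B rule: finite_induct)
    case empty thus ?case by (simp add: loc_int_def)
   next
    case (insert i B)
    thus ?case using loc_int_add[OF lG] by simp
   qed
   have lF: "loc_int F" unfolding F_def[abs_def] by (intro loc_int_diff lD ls order_refl)
   have "AE x in lborel. F x = 0"
   proof (rule fundamental_lemma)
    show "F \<in> Borel" "\<And>r. L1 (\<lambda>x. ind (cball 0 r) x * F x)" using lF by (auto simp: loc_int_def)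
    fix \<psi> :: "'a => real" assume \<psi>: "\<psi> \<in> test_functions"
    have i1: "L1 (\<lambda>x. (gradient \<psi> x \<bullet> i) * (b (t, x) \<bullet> i))" for i
     using loc_int_test[OF lb[of i] test_gradient_component[OF \<psi>, of i]] by (simp add: mult.commute)
    have i2: "L1 (\<lambda>x. \<psi> x * (G i (t, x) \<bullet> i))" if "i \<in> Basis" for i
     using loc_int_test[OF lG[OF that] \<psi>] by (simp add: mult.commute)
    have "(LBINT x. D (t, x) * \<psi> x) = - (LBINT x. b (t, x) \<bullet> gradient \<psi> x)" using div[OF \<psi>] by simp
    also have "(LBINT x. b (t, x) \<bullet> gradient \<psi> x) = (LBINT x. (\<Sum>i\<in>Basis. (gradient \<psi> x \<bullet> i) * (b (t, x) \<bullet> i)))"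
     by (subst inner_commute, subst euclidean_inner) simp
    also have "\<dots> = (\<Sum>i\<in>Basis. - (LBINT x. \<psi> x * (G i (t, x) \<bullet> i)))" using i1 wG \<psi> by (simp add: int_sum)
    also have "\<dots> = - (LBINT x. (\<Sum>i\<in>Basis. \<psi> x * (G i (t, x) \<bullet> i)))" using i2 by (simp add: int_sum sum_negf)
    finally have "(LBINT x. D (t, x) * \<psi> x) = (LBINT x. (\<Sum>i\<in>Basis. G i (t, x) \<bullet> i) * \<psi> x)"
     by (simp add: sum_distrib_left mult.commute)
    thus "(LBINT x. F x * \<psi> x) = 0" using loc_int_test[OF lD \<psi>] loc_int_test[OF ls[OF order_refl] \<psi>]
     by (simp add: F_def left_diff_distrib int_diff)
   qed
   thus ?thesis by (simp add: F_def)
  qed auto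
 qed
qed

lemma difference_formula:
 "AE p in lborel. fst p \<in> {0<..<T} --> (\<forall>j\<in>Basis. b p \<bullet> j - b (p - (0, h)) \<bullet> j =
   (LBINT \<sigma>. ind01 \<sigma> * (\<Sum>i\<in>Basis. (h \<bullet> i) * (G i (p - (0, \<sigma> *\<^sub>R h)) \<bullet> j))))"
proof (rule AE_lborel_pairI)
 have Gm: "(\<lambda>z. G i (fst z - (0, snd z *\<^sub>R h)) \<bullet> j) \<in> borel_measurable (borel \<Otimes>\<^sub>M borel)" if "i \<in> Basis" for i j
  using G_meas[OF that] by measurable
 have [measurable]: "(\<lambda>p. LBINT \<sigma>. ind01 \<sigma> * (\<Sum>i\<in>Basis. (h \<bullet> i) * (G i (p - (0, \<sigma> *\<^sub>R h)) \<bullet> j)))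
    \<in> Borel" for j
 proof -
  have "(\<lambda>z. ind01 (snd z) * (\<Sum>i\<in>Basis. (h \<bullet> i) * (G i (fst z - (0, snd z *\<^sub>R h)) \<bullet> j))) \<in> borel_measurable (borel \<Otimes>\<^sub>M borel)"
   by (intro borel_measurable_times borel_measurable_sum borel_measurable_const Gm) measurable
  hence "(\<lambda>p. LBINT \<sigma>. ind01 \<sigma> * (\<Sum>i\<in>Basis. (h \<bullet> i) * (G i (p - (0, \<sigma> *\<^sub>R h)) \<bullet> j))) \<in> borel_measurable lborel"
   by (intro lborel.borel_measurable_lebesgue_integral) (simp add: split_beta')
  thus ?thesis by simp
 qed
 have "Measurable.pred borel (\<lambda>p. \<forall>j\<in>Basis. b p \<bullet> j - b (p - (0, h)) \<bullet> j =
   (LBINT \<sigma>. ind01 \<sigma> * (\<Sum>i\<in>Basis. (h \<bullet> i) * (G i (p - (0, \<sigma> *\<^sub>R h)) \<bullet> j))))"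
  by (intro pred_intros_finite finite_Basis) measurable
 thus "Measurable.pred borel (\<lambda>p. fst p \<in> {0<..<T} --> (\<forall>j\<in>Basis. b p \<bullet> j - b (p - (0, h)) \<bullet> j =
   (LBINT \<sigma>. ind01 \<sigma> * (\<Sum>i\<in>Basis. (h \<bullet> i) * (G i (p - (0, \<sigma> *\<^sub>R h)) \<bullet> j)))))" by measurable
 show "AE t in lborel. AE x in lborel. fst (t, x) \<in> {0<..<T} --> (\<forall>j\<in>Basis. b (t, x) \<bullet> j - b ((t, x) - (0, h)) \<bullet> j =
   (LBINT \<sigma>. ind01 \<sigma> * (\<Sum>i\<in>Basis. (h \<bullet> i) * (G i ((t, x) - (0, \<sigma> *\<^sub>R h)) \<bullet> j))))"
  using slices_loc_int G_slices G_weak_all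
 proof eventually_elim
  case (elim t)
  show ?case
  proof (cases "t \<in> {0<..<T}")
   case True
   have "AE x in lborel. b (t, x) \<bullet> j - b (t, x - h) \<bullet> j =
    (LBINT \<sigma>. ind01 \<sigma> * (\<Sum>i\<in>Basis. (h \<bullet> i) * (G i (t, x - \<sigma> *\<^sub>R h) \<bullet> j)))" if j: "j \<in> Basis" for j
   proof (rule weak_derivative_difference)
    show "loc_int (\<lambda>x. b (t, x) \<bullet> j)" using elim True by auto
    have lG: "loc_int (\<lambda>x. G i (t, x) \<bullet> j)" if "i \<in> Basis" for i using elim True that j by auto
    have "loc_int (\<lambda>x. \<Sum>i\<in>B. (h \<bullet> i) * (G i (t, x) \<bullet> j))" if "B \<subseteq> Basis" for B
     using finite_subset[OF that finite_Basis] that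
    proof (induction B rule: finite_induct)
     case empty thus ?case by (simp add: loc_int_def)
    next
     case (insert i B)
     thus ?case using loc_int_add[OF loc_int_cmult[OF lG]] by simp
    qed
    thus "loc_int (\<lambda>x. \<Sum>i\<in>Basis. (h \<bullet> i) * (G i (t, x) \<bullet> j))" by simp
    fix \<psi> :: "'a => real" assume \<psi>: "\<psi> \<in> test_functions"
    have i1: "L1 (\<lambda>x. (gradient \<psi> x \<bullet> i) * (b (t, x) \<bullet> j))" for i
     using loc_int_test[of "\<lambda>x. b (t, x) \<bullet> j", OF _ test_gradient_component[OF \<psi>, of i]] elim True by (simp add: mult.commute)
    have i2: "L1 (\<lambda>x. \<psi> x * (G i (t, x) \<bullet> j))" if "i \<in> Basis" for i
     using loc_int_test[OF lG[OF that] \<psi>] by (simp add: mult.commute)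
    have "(LBINT x. (gradient \<psi> x \<bullet> h) * (b (t, x) \<bullet> j)) = (LBINT x. (\<Sum>i\<in>Basis. (h \<bullet> i) * ((gradient \<psi> x \<bullet> i) * (b (t, x) \<bullet> j))))"
     by (subst euclidean_inner) (simp add: sum_distrib_left ac_simps)
    also have "\<dots> = (\<Sum>i\<in>Basis. (h \<bullet> i) * (LBINT x. (gradient \<psi> x \<bullet> i) * (b (t, x) \<bullet> j)))"
     using i1 by (subst int_sum) auto
    also have "\<dots> = (\<Sum>i\<in>Basis. (h \<bullet> i) * - (LBINT x. \<psi> x * (G i (t, x) \<bullet> j)))"
     using elim True \<psi> j by (intro sum.cong) auto
    also have "\<dots> = - (\<Sum>i\<in>Basis. (LBINT x. (h \<bullet> i) * (\<psi> x * (G i (t, x) \<bullet> j))))" by (simp add: sum_negf)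
    also have "\<dots> = - (LBINT x. (\<Sum>i\<in>Basis. (h \<bullet> i) * (\<psi> x * (G i (t, x) \<bullet> j))))" using i2 by (subst int_sum) auto
    finally show "(LBINT x. (gradient \<psi> x \<bullet> h) * (b (t, x) \<bullet> j)) = - (LBINT x. \<psi> x * (\<Sum>i\<in>Basis. (h \<bullet> i) * (G i (t, x) \<bullet> j)))"
     by (simp add: sum_distrib_left ac_simps)
   qed
   hence "AE x in lborel. \<forall>j\<in>Basis. b (t, x) \<bullet> j - b (t, x - h) \<bullet> j =
    (LBINT \<sigma>. ind01 \<sigma> * (\<Sum>i\<in>Basis. (h \<bullet> i) * (G i (t, x - \<sigma> *\<^sub>R h) \<bullet> j)))" by (intro AE_finite_allI finite_Basis)
   thus ?thesis by eventually_elim simp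
  qed auto
 qed
qed

end


lemma shift_diff_small_family:
 fixes \<F> :: "('b::euclidean_space => real) set"
 assumes "finite \<F>" "\<And>f. f \<in> \<F> ==> L1 f" "e > 0"
 obtains d where "d > 0" "\<And>f h. f \<in> \<F> ==> norm h < d ==> shift_diff f h \<le> ennreal e"
proof -
 have "\<exists>d>0. \<forall>f\<in>\<F>. \<forall>h. norm h < d --> shift_diff f h \<le> ennreal e" using assms(1,2)
 proof (induction \<F> rule: finite_induct)
  case empty
  thus ?case by (intro exI[of _ 1]) auto
 next
  case (insert f \<F>)
  then obtain d where "d > 0" "\<forall>f\<in>\<F>. \<forall>h. norm h < d --> shift_diff f h \<le> ennreal e" by auto
  moreover obtain d' where "d' > 0" "\<forall>h. norm h < d' --> shift_diff f h \<le> ennreal e"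
   using shift_diff_small[of f e] insert.prems assms(3) by auto
  ultimately show ?case by (intro exI[of _ "min d d'"]) auto
 qed
 thus ?thesis using that by blast
qed

lemma gradient_mollifier:
 fixes z :: "'a::euclidean_space"
 assumes "e > 0"
 shows "gradient (mollifier e) (e *\<^sub>R z) = (1 / e ^ (DIM('a) + 1)) *\<^sub>R gradient (mollifier 1) z"
proof (rule gradient_eqI)
 have m: "(mollifier 1 :: 'a => real) \<in> test_functions" by (rule mollifier_test) simp
 have eq: "(mollifier e :: 'a => real) = (\<lambda>x. (1 / e ^ DIM('a)) * mollifier 1 (0 + inverse e *\<^sub>R x))"
  using mollifier_scale[OF assms] by (auto simp: fun_eq_iff)
 have a: "(\<lambda>y::'a. mollifier 1 (0 + inverse e *\<^sub>R y)) \<in> test_functions" using assms by (intro test_affine m) simp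
 have "gradient (\<lambda>y. mollifier 1 (0 + inverse e *\<^sub>R y)) (e *\<^sub>R z) = inverse e *\<^sub>R gradient (mollifier 1) z"
  using gradient_affine[OF m, of 0 "inverse e" "e *\<^sub>R z"] assms by simp
 with has_derivative_mult_right[OF gradient_has_derivative[OF a, of "e *\<^sub>R z"], of "1 / e ^ DIM('a)"]
 have "(mollifier e has_derivative (\<lambda>v. (1 / e ^ DIM('a)) * (inverse e *\<^sub>R gradient (mollifier 1) z \<bullet> v))) (at (e *\<^sub>R z))"
  unfolding eq by (simp only:)
 thus "(mollifier e has_derivative (\<lambda>v. (1 / e ^ (DIM('a) + 1)) *\<^sub>R gradient (mollifier 1) z \<bullet> v)) (at (e *\<^sub>R z))"
  by (rule has_derivative_eq_rhs) (use assms in \<open>auto simp: field_simps\<close>)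
qed

context transport_field_W11
begin

definition comm :: "(real \<times> 'a => real) => ('a => real) => real \<times> 'a => real" where
 "comm w \<kappa> p = (LBINT y. w (fst p, y) * (D (fst p, y) * \<kappa> (snd p - y) + (b p - b (fst p, y)) \<bullet> gradient \<kappa> (snd p - y)))"

definition comm_scaled :: "(real \<times> 'a => real) => real => real \<times> 'a => 'a => real" where
 "comm_scaled w e p z = w (p - (0, e *\<^sub>R z)) * (D (p - (0, e *\<^sub>R z)) * mollifier 1 z
   + (1 / e) * ((b p - b (p - (0, e *\<^sub>R z))) \<bullet> gradient (mollifier 1) z))"

lemma comm_scaled:
 assumes [measurable]: "w \<in> Borel" and e: "e > 0"
 shows "comm w (mollifier e) p = (LBINT z. comm_scaled w e p z)"
proof -
 have m: "(mollifier e :: 'a => real) \<in> test_functions" by (rule mollifier_test[OF e])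
 hence [measurable]: "(mollifier e :: 'a => real) \<in> Borel" "gradient (mollifier e :: 'a => real) \<in> Borel"
  by (auto intro: test_measurable gradient_measurable)
 obtain s x where p: "p = (s, x)" by (cases p)
 define F where "F y = w (s, y) * (D (s, y) * mollifier e (x - y) + (b p - b (s, y)) \<bullet> gradient (mollifier e) (x - y))" for y
 have [measurable]: "F \<in> Borel" unfolding F_def by measurable
 have "comm w (mollifier e) p = (LBINT y. F y)" by (simp add: comm_def F_def p)
 also have "\<dots> = e ^ DIM('a) * (LBINT z. F (x + (- e) *\<^sub>R z))"
  using has_bochner_integral_lborel_affine(2)[of F "- e" x] e by simp
 also have "\<dots> = (LBINT z. e ^ DIM('a) * F (x + (- e) *\<^sub>R z))" by simp
 also have "\<dots> = (LBINT z. comm_scaled w e p z)"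
 proof (rule int_cong[OF refl])
  fix z :: 'a
  have 1: "mollifier e (e *\<^sub>R z) = mollifier 1 z / e ^ DIM('a)" using mollifier_scale[OF e, of "e *\<^sub>R z"] e by simp
  show "e ^ DIM('a) * F (x + (- e) *\<^sub>R z) = comm_scaled w e p z"
   using e by (simp add: F_def comm_scaled_def p 1 gradient_mollifier[OF e] field_simps)
 qed
 finally show ?thesis .
qed

lemma commutator_vanishes:
 assumes w[measurable]: "w \<in> Borel" and wM: "\<And>p. \<bar>w p\<bar> \<le> M" and "e > 0"
 obtains e0 where "e0 > 0" "\<And>\<epsilon>. 0 < \<epsilon> ==> \<epsilon> < e0 ==>
  (NNBINT p. cyl T \<rho> p * ennreal \<bar>comm w (mollifier \<epsilon>) p\<bar>) \<le> ennreal e"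
proof -
 have M: "M \<ge> 0" using wM[of 0] by linarith
 define \<eta> where "\<eta> = (mollifier 1 :: 'a => real)"
 have \<eta>: "\<eta> \<in> test_functions" unfolding \<eta>_def by (rule mollifier_test) simp
 hence [measurable]: "\<eta> \<in> Borel" "gradient \<eta> \<in> Borel" by (auto intro: test_measurable gradient_measurable)
 have \<eta>1: "(LBINT z. \<eta> z) = 1" by (simp add: \<eta>_def mollifier_integral)
 have \<eta>0: "\<eta> z = 0" "gradient \<eta> z = 0" if "norm z > 1" for z
  using that gradient_support[OF \<eta>, of 1 z] mollifier_support[of 1, where 'a='a] by (auto simp: \<eta>_def)
 obtain C where C: "C \<ge> 0" "\<And>z. \<bar>\<eta> z\<bar> \<le> C" "\<And>z. norm (gradient \<eta> z) \<le> C"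
 proof -
  obtain C1 where "\<And>z. \<bar>\<eta> z\<bar> \<le> C1" using test_bounded[OF \<eta>] by metis
  moreover obtain C2 where "C2 > 0" "\<And>z. norm (gradient \<eta> z) \<le> C2" using gradient_bounded[OF \<eta>] by metis
  ultimately show ?thesis by (intro that[of "max C1 C2"]) (auto simp: le_max_iff_disj)
 qed
 define P where "P = {0<..<T} \<times> cball (0::'a) \<rho>"
 define Z where "Z = {0<..<T} \<times> cball (0::'a) (\<rho> + 1)"
 have [measurable]: "P \<in> sets borel" "Z \<in> sets borel" by (auto simp: P_def Z_def)
 define Gx where "Gx i p = (if i \<in> Basis then G i p else 0)" for i p
 have [measurable]: "Gx i \<in> Borel" for i using G_meas[of i] by (cases "i \<in> Basis") (auto simp: Gx_def[abs_def])
 define WD where "WD p = ind Z p * (w p * D p)" for p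
 define H where "H i j p = ind Z p * (Gx i p \<bullet> j)" for i j p
 define WH where "WH i j p = ind Z p * (w p * (Gx i p \<bullet> j))" for i j p
 have [measurable]: "WD \<in> Borel" "H i j \<in> Borel" "WH i j \<in> Borel" for i j
  unfolding WD_def[abs_def] H_def[abs_def] WH_def[abs_def] by measurable
 have iWD: "L1 WD"
 proof -
  have "L1 (\<lambda>p. w p * (ind Z p * D p))"
   using D_int[of "\<rho> + 1"] wM unfolding Z_def[symmetric] by (intro integrable_bounded_mult[of _ _ w M]) auto
  thus ?thesis by (simp add: WD_def[abs_def] ac_simps)
 qed
 have iH: "L1 (H i j)" for i j
 proof (cases "i \<in> Basis")
  case True
  have "L1 (\<lambda>p. (ind Z p *\<^sub>R G i p) \<bullet> j)" unfolding Z_def by (rule integrable_inner_left[OF G_int[OF True]])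
  thus ?thesis using True by (simp add: H_def[abs_def] Gx_def)
 qed (simp add: H_def[abs_def] Gx_def)
 have iWH: "L1 (WH i j)" for i j
 proof -
  have "L1 (\<lambda>p. w p * H i j p)" using iH wM by (intro integrable_bounded_mult[where C=M]) auto
  thus ?thesis by (simp add: WH_def[abs_def] H_def[abs_def] ac_simps)
 qed
 define N where "N = real (DIM('a)) * real (DIM('a))"
 define V where "V = measure lborel (cball (0::'a) 1)"
 define K where "K = C * (1 + N * (2 * M + 1))"
 have K: "K \<ge> 0" and N: "N \<ge> 0" using C M by (auto simp: K_def N_def)
 have V: "V \<ge> 0" by (simp add: V_def)
 define e' where "e' = e / (K * V + 1)"
 have KV: "K * V + 1 > 0" using K V by (simp add: add_nonneg_pos)
 have e': "e' > 0" using \<open>e > 0\<close> KV by (simp add: e'_def)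
 have e'_le: "K * e' * V \<le> e" using \<open>e > 0\<close> KV by (simp add: e'_def field_simps)
 define \<F> where "\<F> = insert WD ((\<lambda>(i, j). H i j) ` (Basis \<times> Basis) \<union> (\<lambda>(i, j). WH i j) ` (Basis \<times> Basis))"
 have "finite \<F>" by (auto simp: \<F>_def)
 moreover have "L1 f" if "f \<in> \<F>" for f using that iWD iH iWH by (auto simp: \<F>_def)
 ultimately obtain d where d: "d > 0" "\<And>f h. f \<in> \<F> ==> norm h < d ==> shift_diff f h \<le> ennreal e'"
  using shift_diff_small_family[of \<F> e'] e' by blast
 define Q where "Q p z = w p * (D p * \<eta> z + (\<Sum>i\<in>Basis. (z \<bullet> i) * (gradient \<eta> z \<bullet> Gx i p)))" for p z
 have iQ: "L1 (Q p)" for p unfolding Q_def[abs_def] using test_integrable[OF \<eta>] first_moment_gradient(2)[OF \<eta>]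
  by (intro integrable_mult_right L1_add L1_sum) auto
 have Q_int: "(LBINT z. Q p z) = w p * (D p - (\<Sum>i\<in>Basis. Gx i p \<bullet> i))" for p
 proof -
  have "(LBINT z. Q p z) = w p * (D p * (LBINT z. \<eta> z) + (\<Sum>i\<in>Basis. (LBINT z. (z \<bullet> i) * (gradient \<eta> z \<bullet> Gx i p))))"
   unfolding Q_def using test_integrable[OF \<eta>] first_moment_gradient(2)[OF \<eta>] by (simp add: int_add int_sum L1_sum)
  thus ?thesis by (simp add: first_moment_gradient(1)[OF \<eta>] \<eta>1 sum_negf)
 qed
 show ?thesis
 proof (rule that[of "min d 1"])
  show "min d 1 > 0" using d by simp
  fix \<epsilon> :: real assume \<epsilon>: "0 < \<epsilon>" "\<epsilon> < min d 1"
  define J where "J = comm_scaled w \<epsilon>"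
  have J_meas[measurable]: "(\<lambda>q. J (fst q) (snd q)) \<in> borel_measurable (borel \<Otimes>\<^sub>M borel)"
   unfolding J_def comm_scaled_def \<eta>_def[symmetric] by measurable
  have Q_meas[measurable]: "(\<lambda>q. Q (fst q) (snd q)) \<in> borel_measurable (borel \<Otimes>\<^sub>M borel)"
   unfolding Q_def by measurable
  have slice: "(NNBINT p. ind P p * ennreal \<bar>J p z - Q p z\<bar>) \<le> ind (cball 0 1) z * ennreal (K * e')" for z
  proof (cases "norm z \<le> 1")
   case False
   hence "J p z = 0" "Q p z = 0" for p using \<eta>0[of z] by (simp_all add: J_def comm_scaled_def Q_def \<eta>_def)
   thus ?thesis by simp
  next
   case True
   define h where "h = \<epsilon> *\<^sub>R z"
   have h: "norm h < d" "norm h \<le> 1"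
   proof -
    have "norm h \<le> \<epsilon> * 1" using True \<epsilon> by (simp add: h_def)
    thus "norm h < d" "norm h \<le> 1" using \<epsilon> by auto
   qed
   have sh: "norm (s *\<^sub>R h) < d" "norm (s *\<^sub>R h) \<le> 1" if "s \<in> {0..1}" for s :: real
   proof -
    have "norm (s *\<^sub>R h) \<le> 1 * norm h" unfolding norm_scaleR using that by (intro mult_right_mono) auto
    thus "norm (s *\<^sub>R h) < d" "norm (s *\<^sub>R h) \<le> 1" using h by auto
   qed
   have inZ: "p - (0, s *\<^sub>R h) \<in> Z" if p: "p \<in> P" and "s \<in> {0..1}" for p s
    using p sh(2)[OF that(2)] norm_triangle_ineq4[of "snd p" "s *\<^sub>R h"] by (cases p) (auto simp: P_def Z_def)
   have inZ0: "p \<in> Z" "p - (0, h) \<in> Z" if "p \<in> P" for p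
    using inZ[OF that, of 0] inZ[OF that, of 1] by (simp_all flip: zero_prod_def)
   define R where "R p = ennreal C * (ennreal \<bar>WD (p - (0, h)) - WD p\<bar> + (\<Sum>j\<in>Basis. \<Sum>i\<in>Basis.
     ennreal M * (NNBINT s. ind01 s * ennreal \<bar>H i j (p - (0, s *\<^sub>R h)) - H i j p\<bar>)
     + (ennreal \<bar>WH i j (p - (0, h)) - WH i j p\<bar> + ennreal M * ennreal \<bar>H i j (p - (0, h)) - H i j p\<bar>)))" for p
   have pointwise: "AE p in lborel. ind P p * ennreal \<bar>J p z - Q p z\<bar> \<le> R p" using difference_formula[of h]
   proof eventually_elim
    case (elim p)
    show ?case
    proof (cases "p \<in> P")
     case p: True
     define p' where "p' = p - (0, h)"
     have pZ: "p \<in> Z" "p' \<in> Z" using inZ0[OF p] by (auto simp: p'_def)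
     have formula: "b p \<bullet> j - b p' \<bullet> j = (LBINT s. ind01 s * (\<Sum>i\<in>Basis. (h \<bullet> i) * (Gx i (p - (0, s *\<^sub>R h)) \<bullet> j)))" if "j \<in> Basis" for j
      using elim p that by (auto simp: P_def p'_def Gx_def)
     define X where "X j = (1 / \<epsilon>) * (b p \<bullet> j - b p' \<bullet> j) - (\<Sum>i\<in>Basis. (z \<bullet> i) * (Gx i p \<bullet> j))" for j
     have X: "ennreal \<bar>X j\<bar> \<le> (\<Sum>i\<in>Basis. NNBINT s. ind01 s * ennreal \<bar>H i j (p - (0, s *\<^sub>R h)) - H i j p\<bar>)"
      if j: "j \<in> Basis" for j
     proof -
      define f where "f s = ind01 s * (\<Sum>i\<in>Basis. (z \<bullet> i) * (Gx i (p - (0, s *\<^sub>R h)) \<bullet> j))" for s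
      define g where "g s = ind01 s * (\<Sum>i\<in>Basis. (z \<bullet> i) * (Gx i p \<bullet> j))" for s
      have "(1 / \<epsilon>) * (b p \<bullet> j - b p' \<bullet> j) = (LBINT s. f s)"
      proof -
       have "b p \<bullet> j - b p' \<bullet> j = (LBINT s. \<epsilon> * f s)"
        unfolding formula[OF j] f_def h_def by (intro int_cong) (auto simp: sum_distrib_left ac_simps)
       thus ?thesis using \<epsilon> by simp
      qed
      moreover have "(\<Sum>i\<in>Basis. (z \<bullet> i) * (Gx i p \<bullet> j)) = (LBINT s. g s)" by (simp add: g_def)
      ultimately have "X j = (LBINT s. f s) - (LBINT s. g s)" by (simp add: X_def)
      also have "ennreal \<bar>\<dots>\<bar> \<le> (NNBINT s. ennreal \<bar>f s - g s\<bar>)"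
      proof (rule integral_minus_le_nn_integral)
       show "L1 g" unfolding g_def[abs_def] by (intro integrable_mult_left integrable_real_indicator) auto
       show "f \<in> borel_measurable lborel" unfolding f_def[abs_def] by measurable
      qed
      also have "\<dots> \<le> (NNBINT s. (\<Sum>i\<in>Basis. ind01 s * ennreal \<bar>H i j (p - (0, s *\<^sub>R h)) - H i j p\<bar>))"
      proof (rule nn_integral_mono)
       fix s :: real
       show "ennreal \<bar>f s - g s\<bar> \<le> (\<Sum>i\<in>Basis. ind01 s * ennreal \<bar>H i j (p - (0, s *\<^sub>R h)) - H i j p\<bar>)"
       proof (cases "s \<in> {0..1}")
        case s: True
        have "f s - g s = (\<Sum>i\<in>Basis. (z \<bullet> i) * (H i j (p - (0, s *\<^sub>R h)) - H i j p))"
         using s inZ[OF p s] pZ(1) by (simp add: f_def g_def H_def sum_subtractf right_diff_distrib)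
        also have "\<bar>\<dots>\<bar> \<le> (\<Sum>i\<in>Basis. \<bar>H i j (p - (0, s *\<^sub>R h)) - H i j p\<bar>)"
        proof (rule order_trans[OF sum_abs sum_mono])
         fix i :: 'a assume "i \<in> Basis"
         hence "\<bar>z \<bullet> i\<bar> \<le> 1" using Basis_le_norm[of i z] True by linarith
         thus "\<bar>(z \<bullet> i) * (H i j (p - (0, s *\<^sub>R h)) - H i j p)\<bar> \<le> \<bar>H i j (p - (0, s *\<^sub>R h)) - H i j p\<bar>"
          unfolding abs_mult using mult_right_mono[of "\<bar>z \<bullet> i\<bar>" 1] by simp
        qed
        finally have "ennreal \<bar>f s - g s\<bar> \<le> ennreal (\<Sum>i\<in>Basis. \<bar>H i j (p - (0, s *\<^sub>R h)) - H i j p\<bar>)" by (rule ennreal_leI)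
        thus ?thesis using s by (simp add: sum_ennreal)
       qed (simp add: f_def g_def)
      qed
      also have "\<dots> = (\<Sum>i\<in>Basis. NNBINT s. ind01 s * ennreal \<bar>H i j (p - (0, s *\<^sub>R h)) - H i j p\<bar>)"
       by (intro nn_integral_sum) measurable
      finally show ?thesis .
     qed
     define Y where "Y j = (\<Sum>i\<in>Basis. \<bar>WH i j p' - WH i j p\<bar> + M * \<bar>H i j p' - H i j p\<bar>)" for j
     have Y: "\<bar>(\<Sum>i\<in>Basis. (z \<bullet> i) * ((w p' - w p) * (Gx i p \<bullet> j)))\<bar> \<le> Y j" for j unfolding Y_def
     proof (rule order_trans[OF sum_abs sum_mono])
      fix i :: 'a assume "i \<in> Basis"
      hence zi: "\<bar>z \<bullet> i\<bar> \<le> 1" using Basis_le_norm[of i z] True by linarith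
      have "(w p' - w p) * (Gx i p \<bullet> j) = (WH i j p' - WH i j p) - w p' * (H i j p' - H i j p)"
       using pZ by (simp add: WH_def H_def algebra_simps)
      also have "\<bar>\<dots>\<bar> \<le> \<bar>WH i j p' - WH i j p\<bar> + \<bar>w p'\<bar> * \<bar>H i j p' - H i j p\<bar>"
       by (rule order_trans[OF abs_triangle_ineq4]) (simp add: abs_mult)
      also have "\<dots> \<le> \<bar>WH i j p' - WH i j p\<bar> + M * \<bar>H i j p' - H i j p\<bar>"
       using wM by (intro add_mono mult_right_mono) auto
      finally have "\<bar>z \<bullet> i\<bar> * \<bar>(w p' - w p) * (Gx i p \<bullet> j)\<bar> \<le> 1 * (\<bar>WH i j p' - WH i j p\<bar> + M * \<bar>H i j p' - H i j p\<bar>)"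
       using zi by (intro mult_mono) auto
      thus "\<bar>(z \<bullet> i) * ((w p' - w p) * (Gx i p \<bullet> j))\<bar> \<le> \<bar>WH i j p' - WH i j p\<bar> + M * \<bar>H i j p' - H i j p\<bar>"
       by (simp add: abs_mult)
     qed
     have split: "J p z - Q p z = (WD p' - WD p) * \<eta> z + (\<Sum>j\<in>Basis. (gradient \<eta> z \<bullet> j) *
       (w p' * X j + (\<Sum>i\<in>Basis. (z \<bullet> i) * ((w p' - w p) * (Gx i p \<bullet> j)))))"
     proof -
      have g1: "(b p - b p') \<bullet> gradient \<eta> z = (\<Sum>j\<in>Basis. (gradient \<eta> z \<bullet> j) * (b p \<bullet> j - b p' \<bullet> j))"
       by (subst euclidean_inner) (simp add: inner_diff_left mult.commute)
      have g2: "(\<Sum>i\<in>Basis. (z \<bullet> i) * (gradient \<eta> z \<bullet> Gx i p)) = (\<Sum>j\<in>Basis. (gradient \<eta> z \<bullet> j) * (\<Sum>i\<in>Basis. (z \<bullet> i) * (Gx i p \<bullet> j)))"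
      proof -
       have "(\<Sum>i\<in>Basis. (z \<bullet> i) * (gradient \<eta> z \<bullet> Gx i p)) = (\<Sum>i\<in>Basis. \<Sum>j\<in>Basis. (z \<bullet> i) * ((gradient \<eta> z \<bullet> j) * (Gx i p \<bullet> j)))"
        by (subst euclidean_inner) (simp add: sum_distrib_left)
       also have "\<dots> = (\<Sum>j\<in>Basis. \<Sum>i\<in>Basis. (z \<bullet> i) * ((gradient \<eta> z \<bullet> j) * (Gx i p \<bullet> j)))" by (rule sum.swap)
       finally show ?thesis by (simp add: sum_distrib_left ac_simps)
      qed
      have "J p z - Q p z = (w p' * D p' - w p * D p) * \<eta> z + (\<Sum>j\<in>Basis. (gradient \<eta> z \<bullet> j) *
        (w p' * ((1 / \<epsilon>) * (b p \<bullet> j - b p' \<bullet> j)) - w p * (\<Sum>i\<in>Basis. (z \<bullet> i) * (Gx i p \<bullet> j))))"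
       unfolding J_def comm_scaled_def Q_def \<eta>_def[symmetric] h_def[symmetric] p'_def[symmetric] g1 g2
       by (simp add: right_diff_distrib left_diff_distrib distrib_left sum_subtractf sum_distrib_left ac_simps)
      moreover have "w p' * ((1 / \<epsilon>) * (b p \<bullet> j - b p' \<bullet> j)) - w p * (\<Sum>i\<in>Basis. (z \<bullet> i) * (Gx i p \<bullet> j))
        = w p' * X j + (\<Sum>i\<in>Basis. (z \<bullet> i) * ((w p' - w p) * (Gx i p \<bullet> j)))" for j
      proof -
       have "(\<Sum>i\<in>Basis. (z \<bullet> i) * ((w p' - w p) * (Gx i p \<bullet> j))) = (w p' - w p) * (\<Sum>i\<in>Basis. (z \<bullet> i) * (Gx i p \<bullet> j))"
        by (simp add: sum_distrib_left ac_simps)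
       thus ?thesis by (simp only:) (simp add: X_def algebra_simps)
      qed
      ultimately show ?thesis using pZ by (simp add: WD_def)
     qed
     have "\<bar>J p z - Q p z\<bar> \<le> \<bar>(WD p' - WD p) * \<eta> z\<bar> + (\<Sum>j\<in>Basis. \<bar>(gradient \<eta> z \<bullet> j) *
       (w p' * X j + (\<Sum>i\<in>Basis. (z \<bullet> i) * ((w p' - w p) * (Gx i p \<bullet> j))))\<bar>)"
      unfolding split by (intro order_trans[OF abs_triangle_ineq] add_mono order_refl sum_abs)
     also have "\<dots> \<le> C * \<bar>WD p' - WD p\<bar> + (\<Sum>j\<in>Basis. C * (M * \<bar>X j\<bar> + Y j))"
     proof (intro add_mono sum_mono)
      show "\<bar>(WD p' - WD p) * \<eta> z\<bar> \<le> C * \<bar>WD p' - WD p\<bar>"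
       using mult_right_mono[OF C(2)[of z], of "\<bar>WD p' - WD p\<bar>"] by (simp add: abs_mult mult.commute)
      fix j :: 'a assume j: "j \<in> Basis"
      have "\<bar>gradient \<eta> z \<bullet> j\<bar> \<le> C" using Basis_le_norm[OF j, of "gradient \<eta> z"] C(3)[of z] by linarith
      moreover have "\<bar>w p' * X j + (\<Sum>i\<in>Basis. (z \<bullet> i) * ((w p' - w p) * (Gx i p \<bullet> j)))\<bar> \<le> M * \<bar>X j\<bar> + Y j"
       using Y[of j] mult_right_mono[OF wM[of p'], of "\<bar>X j\<bar>"]
       by (intro order_trans[OF abs_triangle_ineq] add_mono) (auto simp: abs_mult)
      ultimately show "\<bar>(gradient \<eta> z \<bullet> j) * (w p' * X j + (\<Sum>i\<in>Basis. (z \<bullet> i) * ((w p' - w p) * (Gx i p \<bullet> j))))\<bar> \<le> C * (M * \<bar>X j\<bar> + Y j)"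
       unfolding abs_mult using C(1) by (intro mult_mono) auto
     qed
     finally have "ennreal \<bar>J p z - Q p z\<bar> \<le> ennreal (C * \<bar>WD p' - WD p\<bar> + (\<Sum>j\<in>Basis. C * (M * \<bar>X j\<bar> + Y j)))"
      by (rule ennreal_leI)
     also have "\<dots> = ennreal C * (ennreal \<bar>WD p' - WD p\<bar> + (\<Sum>j\<in>Basis. ennreal M * ennreal \<bar>X j\<bar> + ennreal (Y j)))"
     proof -
      have Y0: "Y j \<ge> 0" for j unfolding Y_def using M by (intro sum_nonneg) auto
      have "ennreal (C * \<bar>WD p' - WD p\<bar> + (\<Sum>j\<in>Basis. C * (M * \<bar>X j\<bar> + Y j)))
        = ennreal (C * \<bar>WD p' - WD p\<bar>) + ennreal (\<Sum>j\<in>Basis. C * (M * \<bar>X j\<bar> + Y j))"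
       using C(1) M Y0 by (intro ennreal_plus sum_nonneg) auto
      also have "ennreal (\<Sum>j\<in>Basis. C * (M * \<bar>X j\<bar> + Y j)) = (\<Sum>j\<in>Basis. ennreal (C * (M * \<bar>X j\<bar> + Y j)))"
       using C(1) M Y0 by (intro sum_ennreal[symmetric]) auto
      also have "\<dots> = (\<Sum>j\<in>Basis. ennreal C * (ennreal M * ennreal \<bar>X j\<bar> + ennreal (Y j)))"
       using C(1) M Y0 by (intro sum.cong) (auto simp: ennreal_mult ennreal_plus)
      finally show ?thesis using C(1) by (simp add: ennreal_mult distrib_left sum_distrib_left)
     qed
     also have "\<dots> \<le> ennreal C * (ennreal \<bar>WD p' - WD p\<bar> + (\<Sum>j\<in>Basis.
       ennreal M * (\<Sum>i\<in>Basis. NNBINT s. ind01 s * ennreal \<bar>H i j (p - (0, s *\<^sub>R h)) - H i j p\<bar>) + ennreal (Y j)))"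
      using X by (intro mult_left_mono add_mono sum_mono order_refl) auto
     also have "\<dots> = R p"
     proof -
      have "ennreal (Y j) = (\<Sum>i\<in>Basis. ennreal \<bar>WH i j p' - WH i j p\<bar> + ennreal M * ennreal \<bar>H i j p' - H i j p\<bar>)" for j
       unfolding Y_def using M by (subst sum_ennreal[symmetric]) (auto simp: ennreal_mult ennreal_plus)
      thus ?thesis unfolding R_def p'_def by (simp add: sum_distrib_left sum.distrib)
     qed
     finally show ?thesis using p by simp
    qed simp
   qed
   have "(NNBINT p. ind P p * ennreal \<bar>J p z - Q p z\<bar>) \<le> (NNBINT p. R p)" by (rule nn_integral_mono_AE[OF pointwise])
   also have "\<dots> = ennreal C * (shift_diff WD (0, h) + (\<Sum>j\<in>Basis. \<Sum>i\<in>Basis.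
     ennreal M * (NNBINT s. ind01 s * shift_diff (H i j) (0, s *\<^sub>R h))
     + (shift_diff (WH i j) (0, h) + ennreal M * shift_diff (H i j) (0, h))))"
   proof -
    have mS: "(\<lambda>q. ind01 (snd q) * ennreal \<bar>H i j (fst q - (0, snd q *\<^sub>R h)) - H i j (fst q)\<bar>) \<in> borel_measurable (borel \<Otimes>\<^sub>M borel)" for i j
     by measurable
    hence [measurable]: "(\<lambda>p. NNBINT s. ind01 s * ennreal \<bar>H i j (p - (0, s *\<^sub>R h)) - H i j p\<bar>) \<in> Borel" for i j
     using lborel.borel_measurable_nn_integral[of "\<lambda>p s. ind01 s * ennreal \<bar>H i j (p - (0, s *\<^sub>R h)) - H i j p\<bar>" borel]
     by (simp add: split_beta')
    have swap: "(NNBINT p. (NNBINT s. ind01 s * ennreal \<bar>H i j (p - (0, s *\<^sub>R h)) - H i j p\<bar>))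
      = (NNBINT s. ind01 s * shift_diff (H i j) (0, s *\<^sub>R h))" for i j
    proof -
     have "(NNBINT p. (NNBINT s. ind01 s * ennreal \<bar>H i j (p - (0, s *\<^sub>R h)) - H i j p\<bar>))
      = (NNBINT s. (NNBINT p. ind01 s * ennreal \<bar>H i j (p - (0, s *\<^sub>R h)) - H i j p\<bar>))"
      using mS[of i j] by (intro lborel_pair.Fubini') (simp add: split_beta')
     thus ?thesis unfolding shift_diff_def by (simp add: nn_integral_cmult)
    qed
    show ?thesis unfolding R_def
     by (simp add: nn_integral_cmult nn_integral_add nn_integral_sum swap flip: shift_diff_def)
   qed
   also have "\<dots> \<le> ennreal C * (ennreal e' + (\<Sum>j\<in>(Basis::'a set). \<Sum>i\<in>(Basis::'a set).
     ennreal M * ennreal e' + (ennreal e' + ennreal M * ennreal e')))"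
   proof (intro mult_left_mono add_mono sum_mono)
    have n: "norm ((0::real), h) < d" using h by (simp add: norm_Pair)
    show "shift_diff WD (0, h) \<le> ennreal e'" using d(2)[OF _ n, of WD] by (simp add: \<F>_def)
    fix i j :: 'a assume ij: "j \<in> Basis" "i \<in> Basis"
    have HF: "H i j \<in> \<F>" "WH i j \<in> \<F>" using ij by (auto simp: \<F>_def)
    show "shift_diff (WH i j) (0, h) \<le> ennreal e'" "shift_diff (H i j) (0, h) \<le> ennreal e'"
     using d(2)[OF HF(1) n] d(2)[OF HF(2) n] by auto
    have "(NNBINT s. ind01 s * shift_diff (H i j) (0, s *\<^sub>R h)) \<le> (NNBINT s. ennreal e' * ind01 s)"
    proof (rule nn_integral_mono)
     fix s :: real
     show "ind01 s * shift_diff (H i j) (0, s *\<^sub>R h) \<le> ennreal e' * ind01 s"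
     proof (cases "s \<in> {0..1}")
      case True
      thus ?thesis using d(2)[OF HF(1), of "(0, s *\<^sub>R h)"] sh(1)[OF True] by (simp add: norm_Pair)
     qed simp
    qed
    also have "\<dots> = ennreal e'" by (simp add: nn_integral_cmult)
    finally show "(NNBINT s. ind01 s * shift_diff (H i j) (0, s *\<^sub>R h)) \<le> ennreal e'" .
   qed simp_all
   also have "\<dots> = ennreal (K * e')"
   proof -
    have "(\<Sum>j\<in>(Basis::'a set). \<Sum>i\<in>(Basis::'a set). ennreal M * ennreal e' + (ennreal e' + ennreal M * ennreal e'))
      = ennreal (\<Sum>j\<in>(Basis::'a set). \<Sum>i\<in>(Basis::'a set). M * e' + (e' + M * e'))"
    proof -
     have "ennreal M * ennreal e' + (ennreal e' + ennreal M * ennreal e') = ennreal (M * e' + (e' + M * e'))"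
      using M e' by (simp only: ennreal_plus ennreal_mult mult_nonneg_nonneg add_nonneg_nonneg less_imp_le)
     moreover have "0 \<le> M * e' + (e' + M * e')" using M e' by simp
     ultimately show ?thesis by (simp only: sum_ennreal sum_nonneg)
    qed
    also have "(\<Sum>j\<in>(Basis::'a set). \<Sum>i\<in>(Basis::'a set). M * e' + (e' + M * e')) = N * (2 * M + 1) * e'"
     by (simp add: N_def algebra_simps)
    finally have "ennreal C * (ennreal e' + (\<Sum>j\<in>(Basis::'a set). \<Sum>i\<in>(Basis::'a set). ennreal M * ennreal e' + (ennreal e' + ennreal M * ennreal e')))
      = ennreal C * (ennreal e' + ennreal (N * (2 * M + 1) * e'))" by simp
    also have "\<dots> = ennreal (C * (e' + N * (2 * M + 1) * e'))"
     using C(1) e' N M by (simp add: ennreal_mult ennreal_plus)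
    also have "C * (e' + N * (2 * M + 1) * e') = K * e'" by (simp add: K_def algebra_simps)
    finally show ?thesis .
   qed
   finally show ?thesis using True by simp
  qed
  have "(NNBINT p. ind P p * ennreal \<bar>comm w (mollifier \<epsilon>) p\<bar>)
    \<le> (NNBINT p. (NNBINT z. ind P p * ennreal \<bar>J p z - Q p z\<bar>))" using divergence_eq_trace
  proof (intro nn_integral_mono_AE, eventually_elim)
   case (elim p)
   show ?case
   proof (cases "p \<in> P")
    case True
    hence "(LBINT z. Q p z) = 0" using elim by (auto simp: Q_int Gx_def P_def)
    hence "comm w (mollifier \<epsilon>) p = (LBINT z. J p z) - (LBINT z. Q p z)"
     using comm_scaled[OF w \<epsilon>(1), of p] by (simp add: J_def)
    also have "ennreal \<bar>\<dots>\<bar> \<le> (NNBINT z. ennreal \<bar>J p z - Q p z\<bar>)"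
    proof (rule integral_minus_le_nn_integral[OF iQ])
     show "J p \<in> borel_measurable lborel" using measurable_compose[OF measurable_Pair1' J_meas, of p] by simp
    qed
    finally show ?thesis using True by simp
   qed simp
  qed
  also have "\<dots> = (NNBINT z. (NNBINT p. ind P p * ennreal \<bar>J p z - Q p z\<bar>))"
  proof -
   have [measurable]: "(\<lambda>q. J (snd q) (fst q)) \<in> borel_measurable (borel \<Otimes>\<^sub>M borel)"
    "(\<lambda>q. Q (snd q) (fst q)) \<in> borel_measurable (borel \<Otimes>\<^sub>M borel)"
    unfolding J_def comm_scaled_def \<eta>_def[symmetric] Q_def by measurable
   have "(\<lambda>q. ind P (snd q) * ennreal \<bar>J (snd q) (fst q) - Q (snd q) (fst q)\<bar>) \<in> borel_measurable (borel \<Otimes>\<^sub>M borel)"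
    by measurable
   moreover have "(\<lambda>q. ind P (fst q) * ennreal \<bar>J (fst q) (snd q) - Q (fst q) (snd q)\<bar>) \<in> borel_measurable (borel \<Otimes>\<^sub>M borel)"
    by measurable
   ultimately show ?thesis by (intro lborel_pair.Fubini') (simp add: split_beta')
  qed
  also have "\<dots> \<le> (NNBINT z. ennreal (K * e') * ind (cball (0::'a) 1) z)"
   using slice by (intro nn_integral_mono) (simp add: mult.commute)
  also have "\<dots> = ennreal (K * e') * emeasure lborel (cball (0::'a) 1)" by (simp add: nn_integral_cmult)
  also have "emeasure lborel (cball (0::'a) 1) = ennreal V"
   unfolding V_def using emeasure_lborel_cball_finite[of "0::'a" 1] by (intro emeasure_eq_ennreal_measure) auto
  also have "ennreal (K * e') * ennreal V = ennreal (K * e' * V)" using K e' V by (simp add: ennreal_mult)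
  also have "\<dots> \<le> ennreal e" by (rule ennreal_leI[OF e'_le])
  finally show "(NNBINT p. cyl T \<rho> p * ennreal \<bar>comm w (mollifier \<epsilon>) p\<bar>) \<le> ennreal e" by (simp add: P_def)
 qed
qed

end


lemma integrable_prod_mult:
 fixes f :: "'a::euclidean_space => real" and g :: "'b::euclidean_space => real"
 assumes f: "L1 f" and g: "L1 g"
 shows "L1 (\<lambda>p. f (fst p) * g (snd p))"
proof -
 have [measurable]: "f \<in> Borel" "g \<in> Borel" using f g by auto
 have "integrable (lborel \<Otimes>\<^sub>M lborel) (\<lambda>p. f (fst p) * g (snd p))"
 proof (rule integrable_pairI)
  have "(NNBINT x. (NNBINT y. ennreal (norm (f (fst (x, y)) * g (snd (x, y))))))
    = (NNBINT x. ennreal (norm (f x))) * (NNBINT y. ennreal (norm (g y)))"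
   by (simp add: abs_mult ennreal_mult nn_integral_cmult nn_integral_multc)
  also have "\<dots> < \<infinity>" using f g by (simp add: integrable_iff_bounded ennreal_mult_less_top)
  finally show "(NNBINT x. (NNBINT y. ennreal (norm (f (fst (x, y)) * g (snd (x, y)))))) < \<infinity>" .
 qed measurable
 thus ?thesis by (simp add: lborel_prod)
qed

text \<open>product rule\<close>

definition primitive :: "(real => real) => real => real" where
 "primitive f t = (LBINT s. ind {0<..<t} s * f s)"

lemma primitive_integrable:
 fixes f :: "real => real"
 shows "L1 f ==> L1 (\<lambda>s. ind {0<..<t} s * f s)"
 by (rule integrable_bounded_mult[where C=1]) (auto simp: indicator_def)

lemma indicator_open_interval_measurable[measurable]:
 assumes [measurable]: "f \<in> borel_measurable M" "g \<in> borel_measurable M"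
 shows "(\<lambda>x. ind {0<..<f x} (g x :: real) :: real) \<in> borel_measurable M"
proof -
 have "(\<lambda>x. if 0 < g x \<and> g x < f x then 1 else (0::real)) \<in> borel_measurable M" by measurable
 thus ?thesis by (simp add: indicator_def of_bool_def)
qed

lemma primitive_measurable[measurable]:
 assumes [measurable]: "f \<in> Borel" shows "primitive f \<in> Borel" unfolding primitive_def by measurable

lemma primitive_bound:
 assumes "L1 f" shows "\<bar>primitive f t\<bar> \<le> (LBINT s. \<bar>f s\<bar>)"
proof -
 have "\<bar>primitive f t\<bar> \<le> (LBINT s. \<bar>ind {0<..<t} s * f s\<bar>)" unfolding primitive_def by (rule integral_abs_bound)
 also have "\<dots> \<le> (LBINT s. \<bar>f s\<bar>)"
  using assms by (intro integral_mono integrable_abs primitive_integrable) (auto simp: indicator_def)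
 finally show ?thesis .
qed

lemma product_of_primitives:
 assumes f: "L1 f" and g: "L1 g"
 shows "primitive f t * primitive g t = primitive (\<lambda>s. f s * primitive g s + primitive f s * g s) t"
proof -
 have [measurable]: "f \<in> Borel" "g \<in> Borel" using f g by auto
 define F where "F s = ind {0<..<t} s * f s" for s
 define H where "H s = ind {0<..<t} s * g s" for s
 have iF: "L1 F" and iH: "L1 H" using f g by (auto simp: F_def[abs_def] H_def[abs_def] primitive_integrable)
 have [measurable]: "F \<in> Borel" "H \<in> Borel" using iF iH by auto
 have i: "L1 (\<lambda>p. F (fst p) * H (snd p))" by (rule integrable_prod_mult[OF iF iH])
 have i1: "L1 (\<lambda>p. of_bool (snd p < fst p) * (F (fst p) * H (snd p)))"
  and i2: "L1 (\<lambda>p. of_bool (fst p \<le> snd p) * (F (fst p) * H (snd p)))"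
  using i by (auto intro!: integrable_bounded_mult[where C=1])
 have "primitive f t * primitive g t = (LBINT s. F s * (LBINT r. H r))" by (simp add: primitive_def F_def H_def)
 also have "\<dots> = (LBINT p. F (fst p) * H (snd p))" by (subst lborel_Fubini(1)[OF i]) simp
 also have "\<dots> = (LBINT p. of_bool (snd p < fst p) * (F (fst p) * H (snd p)) + of_bool (fst p \<le> snd p) * (F (fst p) * H (snd p)))"
  by (intro int_cong) (auto simp: not_less)
 also have "\<dots> = (LBINT p. of_bool (snd p < fst p) * (F (fst p) * H (snd p))) + (LBINT p. of_bool (fst p \<le> snd p) * (F (fst p) * H (snd p)))"
  by (rule int_add[OF i1 i2])
 also have "(LBINT p. of_bool (snd p < fst p) * (F (fst p) * H (snd p))) = (LBINT s. ind {0<..<t} s * (f s * primitive g s))"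
  unfolding lborel_Fubini(1)[OF i1]
 proof (rule int_cong[OF refl])
  fix s
  have "(LBINT r. of_bool (r < s) * (F s * H r)) = (LBINT r. F s * (ind {0<..<s} r * g r))"
   by (intro int_cong) (auto simp: F_def H_def indicator_def)
  thus "(LBINT y. of_bool (snd (s, y) < fst (s, y)) * (F (fst (s, y)) * H (snd (s, y)))) = ind {0<..<t} s * (f s * primitive g s)"
   by (simp add: F_def primitive_def)
 qed
 also have "(LBINT p. of_bool (fst p \<le> snd p) * (F (fst p) * H (snd p))) = (LBINT s. ind {0<..<t} s * (primitive f s * g s))"
  unfolding lborel_Fubini(2)[OF i2]
 proof (rule int_cong[OF refl])
  fix s
  have "(LBINT r. of_bool (r \<le> s) * (F r * H s)) = (LBINT r. H s * (ind {0<..<s} r * f r))"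
  proof (rule integral_cong_AE)
   show "AE r in lborel. of_bool (r \<le> s) * (F r * H s) = H s * (ind {0<..<s} r * f r)"
    using AE_lborel_singleton[of s] by eventually_elim (auto simp: F_def H_def indicator_def)
  qed measurable
  thus "(LBINT x. of_bool (fst (x, s) \<le> snd (x, s)) * (F (fst (x, s)) * H (snd (x, s)))) = ind {0<..<t} s * (primitive f s * g s)"
   by (simp add: H_def primitive_def)
 qed
 also have "(LBINT s. ind {0<..<t} s * (f s * primitive g s)) + (LBINT s. ind {0<..<t} s * (primitive f s * g s))
   = primitive (\<lambda>s. f s * primitive g s + primitive f s * g s) t"
 proof -
  have "L1 (\<lambda>s. primitive g s * f s)"
   by (rule integrable_bounded_mult[where C="LBINT s. \<bar>g s\<bar>"]) (use primitive_bound[OF g] f in auto)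
  hence 1: "L1 (\<lambda>s. ind {0<..<t} s * (f s * primitive g s))"
   using primitive_integrable[of "\<lambda>s. f s * primitive g s" t] by (simp add: mult.commute)
  have "L1 (\<lambda>s. primitive f s * g s)"
   by (rule integrable_bounded_mult[where C="LBINT s. \<bar>f s\<bar>"]) (use primitive_bound[OF f] g in auto)
  note 1 primitive_integrable[OF this, of t]
  thus ?thesis by (simp add: primitive_def distrib_left)
 qed
 finally show ?thesis .
qed

lemma test_function_antiderivative:
 fixes \<psi> :: "real => real"
 assumes \<psi>: "\<psi> \<in> test_functions"
 obtains \<theta> where "\<theta> T = 0" "\<And>t. (\<theta> has_real_derivative \<psi> t) (at t)" "\<And>k. Ck_on k UNIV \<theta>"
proof -
 have "\<And>x. isCont \<psi> x" using test_continuous[OF \<psi>] by (simp add: continuous_on_eq_continuous_at)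
 then obtain F where F: "\<And>x. (F has_vector_derivative \<psi> x) (at x)"
  using einterval_antiderivative[of "-\<infinity>" "\<infinity>" \<psi>] by auto
 define \<theta> where "\<theta> t = F t - F T" for t
 have d: "(\<theta> has_real_derivative \<psi> t) (at t)" for t
  unfolding \<theta>_def[abs_def] has_real_derivative_iff_has_vector_derivative
  using has_vector_derivative_diff[OF F has_vector_derivative_const] by simp
 have "Ck_on (Suc k) UNIV \<theta>" for k
 proof (rule Ck_on_SucI[OF unique_derivs_UNIV])
  show "(\<theta> has_derivative (*) (\<psi> t)) (at t within UNIV)" for t using d[of t] by (simp add: has_field_derivative_def)
  show "Ck_on k UNIV (\<lambda>t. \<psi> t * v)" for v by (intro Ck_on_mult unique_derivs_UNIV test_functionD \<psi> Ck_on_const)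
 qed
 thus ?thesis using d by (intro that[of \<theta>]) (auto simp: \<theta>_def intro: Ck_on_lower)
qed

lemma separated_st_test:
 fixes \<kappa> :: "'a::euclidean_space => real"
 assumes T: "T > 0" and \<theta>: "\<theta> T = 0" "\<And>k. Ck_on k UNIV \<theta>" and \<kappa>: "\<kappa> \<in> test_functions"
 shows "(\<lambda>t y. \<theta> t * \<kappa> (x - y)) \<in> ST T"
proof -
 note U = unique_derivs_slab[OF T, where 'b='a]
 obtain r where r: "\<And>x. norm x > r ==> \<kappa> x = 0" using test_function_support[OF \<kappa>] by metis
 show ?thesis
 proof (rule st_testI[where r="\<bar>r\<bar> + norm x"])
  fix k
  have "Ck_on k ({0..T} \<times> (UNIV :: 'a set)) (\<lambda>p. \<theta> (fst p + 0))"
   by (rule Ck_on_compose_affine[where A=fst and c=0 and S=UNIV, OF U bounded_linear_fst _ \<theta>(2)]) simp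
  moreover have "Ck_on k ({0..T} \<times> UNIV) (\<lambda>p. \<kappa> (- snd p + x))"
   by (rule Ck_on_compose_affine[where A="\<lambda>p. - snd p" and c=x and S=UNIV, OF U bounded_linear_minus[OF bounded_linear_snd] _ test_functionD[OF \<kappa>]]) simp
  ultimately have "Ck_on k ({0..T} \<times> UNIV) (\<lambda>p. \<theta> (fst p + 0) * \<kappa> (- snd p + x))" by (rule Ck_on_mult[OF U])
  thus "Ck_on k ({0..T} \<times> UNIV) (\<lambda>(t, y). \<theta> t * \<kappa> (x - y))" by (simp add: split_beta')
 next
  fix t and y :: 'a assume "norm y > \<bar>r\<bar> + norm x"
  hence "norm (x - y) > r" using norm_triangle_ineq2[of y x] by (simp add: norm_minus_commute)
  thus "\<theta> t * \<kappa> (x - y) = 0" by (simp add: r)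
 qed (simp add: \<theta>)
qed

context transport_field
begin

definition source :: "(real \<times> 'a => real) => ('a => real) => 'a => real \<times> 'a => real" where
 "source w \<kappa> x p = ind {0<..<T} (fst p) * (w p * (D p * \<kappa> (x - snd p) - b p \<bullet> gradient \<kappa> (x - snd p)))"

definition mollified_source :: "(real \<times> 'a => real) => ('a => real) => 'a => real => real" where
 "mollified_source w \<kappa> x s = (LBINT y. source w \<kappa> x (s, y))"

abbreviation mollified :: "(real \<times> 'a => real) => ('a => real) => real \<times> 'a => real" where
 "mollified w \<kappa> p \<equiv> conv (\<lambda>y. w (fst p, y)) \<kappa> (snd p)"

lemma source_integrable:
 assumes [measurable]: "w \<in> Borel" and wM: "\<And>p. \<bar>w p\<bar> \<le> M" and \<kappa>: "\<kappa> \<in> test_functions"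
 shows "L1 (source w \<kappa> x)"
proof -
 have [measurable]: "\<kappa> \<in> Borel" "gradient \<kappa> \<in> Borel" using \<kappa> by (auto intro: test_measurable gradient_measurable)
 obtain r where r: "r > 0" "\<And>x. norm x > r ==> \<kappa> x = 0" using test_function_support[OF \<kappa>] by metis
 obtain C where C: "C > 0" "\<And>x. \<bar>\<kappa> x\<bar> \<le> C" using test_bounded[OF \<kappa>] by metis
 obtain C' where C': "C' > 0" "\<And>x. norm (gradient \<kappa> x) \<le> C'" using gradient_bounded[OF \<kappa>] by metis
 have far: "norm (x - y) > r" if "norm y > r + norm x" for y
  using that norm_triangle_ineq2[of y x] by (simp add: norm_minus_commute)
 have "L1 (\<lambda>p. D p * (ind {0<..<T} (fst p) * \<kappa> (x - snd p)))"
  using C far r by (intro bounded_slab_integrable(2)[where C=C and r="r + norm x"]) (auto simp: indicator_def)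
 moreover have "L1 (\<lambda>p. b p \<bullet> (ind {0<..<T} (fst p) *\<^sub>R gradient \<kappa> (x - snd p)))"
  using C' far gradient_support[OF \<kappa> r(2)]
  by (intro bounded_slab_integrable_b[where C=C' and r="r + norm x"]) (auto simp: indicator_def less_imp_le)
 ultimately have "L1 (\<lambda>p. w p * (D p * (ind {0<..<T} (fst p) * \<kappa> (x - snd p)) - b p \<bullet> (ind {0<..<T} (fst p) *\<^sub>R gradient \<kappa> (x - snd p))))"
  using wM by (intro integrable_bounded_mult[of _ _ w M] L1_diff) auto
 moreover have "(\<lambda>p. w p * (D p * (ind {0<..<T} (fst p) * \<kappa> (x - snd p)) - b p \<bullet> (ind {0<..<T} (fst p) *\<^sub>R gradient \<kappa> (x - snd p)))) = source w \<kappa> x"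
  by (rule ext) (simp add: source_def algebra_simps)
 ultimately show ?thesis by (simp only:)
qed

lemma mollified_equation:
 assumes w[measurable]: "w \<in> Borel" and wM: "\<And>p. \<bar>w p\<bar> \<le> M" and \<kappa>: "\<kappa> \<in> test_functions"
  and sol: "\<And>\<phi>. \<phi> \<in> ST T ==> (LBINT p. w p * Lop \<phi> p) = 0"
 shows "AE t\<in>{0<..<T} in lborel. mollified w \<kappa> (t, x) = primitive (mollified_source w \<kappa> x) t"
proof -
 have [measurable]: "\<kappa> \<in> Borel" "gradient \<kappa> \<in> Borel" using \<kappa> by (auto intro: test_measurable gradient_measurable)
 define g where "g = mollified_source w \<kappa> x"
 note isrc = source_integrable[OF w wM \<kappa>, of x]
 have ig: "L1 g" unfolding g_def mollified_source_def[abs_def] by (rule lborel_Fubini(4)[OF isrc])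
 hence [measurable]: "g \<in> Borel" by auto
 define A where "A t = mollified w \<kappa> (t, x)" for t
 have [measurable]: "A \<in> Borel" unfolding A_def conv_def by measurable
 have M: "M \<ge> 0" using wM[of 0] by linarith
 obtain CA where CA: "\<And>t. \<bar>A t\<bar> \<le> CA"
 proof -
  have "\<bar>A t\<bar> \<le> M * (LBINT y. \<bar>\<kappa> (x - y)\<bar>)" for t
  proof -
   have "\<bar>A t\<bar> \<le> (LBINT y. \<bar>w (t, y) * \<kappa> (x - y)\<bar>)" unfolding A_def conv_def fst_conv snd_conv by (rule integral_abs_bound)
   also have "\<dots> \<le> (LBINT y. M * \<bar>\<kappa> (x - y)\<bar>)"
    using wM by (intro integral_mono integrable_abs conv_integrable[where M=M] \<kappa> integrable_mult_right test_integrable test_reflect)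
      (auto simp: abs_mult intro!: mult_right_mono)
   finally show ?thesis by simp
  qed
  thus ?thesis by (rule that)
 qed
 have "AE t in lborel. ind {0<..<T} t * (A t - primitive g t) = 0"
 proof (rule fundamental_lemma)
  have b: "\<bar>ind {0<..<T} t * (A t - primitive g t)\<bar> \<le> CA + (LBINT s. \<bar>g s\<bar>)" for t
   using CA[of t] primitive_bound[OF ig, of t] by (auto simp: indicator_def)
  show "(\<lambda>t. ind {0<..<T} t * (A t - primitive g t)) \<in> Borel" by measurable
  show "L1 (\<lambda>t. ind (cball 0 r) t * (ind {0<..<T} t * (A t - primitive g t)))" for r
   by (rule integrable_bounded_support[where r=r and C="CA + (LBINT s. \<bar>g s\<bar>)"])
     (use b in \<open>auto simp: indicator_def intro: order_trans[OF abs_ge_zero]\<close>)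
  fix \<psi> :: "real => real" assume \<psi>: "\<psi> \<in> test_functions"
  hence [measurable]: "\<psi> \<in> Borel" by auto
  obtain \<theta> where \<theta>: "\<theta> T = 0" "\<And>t. (\<theta> has_real_derivative \<psi> t) (at t)" "\<And>k. Ck_on k UNIV \<theta>"
   using test_function_antiderivative[OF \<psi>] by metis
  have [measurable]: "\<theta> \<in> Borel"
   using \<theta>(2) by (intro borel_measurable_continuous_onI continuous_at_imp_continuous_on ballI DERIV_isCont) auto
  define \<phi> where "\<phi> t y = \<theta> t * \<kappa> (x - y)" for t y
  have \<phi>: "\<phi> \<in> ST T" unfolding \<phi>_def[abs_def] by (rule separated_st_test[OF T_pos \<theta>(1,3) \<kappa>])
  have der: "deriv (\<lambda>s. \<phi> s y) t = \<psi> t * \<kappa> (x - y)" for t y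
   unfolding \<phi>_def using DERIV_cmult_right[OF \<theta>(2)] by (intro DERIV_imp_deriv)
  have grad: "gradient (\<phi> t) y = - \<theta> t *\<^sub>R gradient \<kappa> (x - y)" for t y
  proof (rule gradient_eqI)
   have "((\<lambda>y. \<theta> t * \<kappa> (x - y)) has_derivative (\<lambda>v. \<theta> t * (gradient (\<lambda>y. \<kappa> (x - y)) y \<bullet> v))) (at y)"
    by (intro has_derivative_mult_right gradient_has_derivative test_reflect \<kappa>)
   thus "(\<phi> t has_derivative (\<lambda>v. (- \<theta> t *\<^sub>R gradient \<kappa> (x - y)) \<bullet> v)) (at y)"
    by (simp add: \<phi>_def[abs_def] gradient_reflect[OF \<kappa>])
  qed
  have \<psi>T: "L1 (\<lambda>s. ind {0<..<T} s * \<psi> s)" by (rule primitive_integrable[OF test_integrable[OF \<psi>]])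
  have \<theta>_eq: "\<theta> t = - (LBINT s. of_bool (t < s \<and> s < T) * \<psi> s)" if "t < T" for t
  proof -
   have "(LBINT s. ind {t..T} s *\<^sub>R \<psi> s) = \<theta> T - \<theta> t" using that \<theta>(2) test_continuous[OF \<psi>]
    by (intro integral_FTC_Icc) (auto simp: has_real_derivative_iff_has_vector_derivative[symmetric]
      intro: has_field_derivative_at_within continuous_on_subset)
   moreover have "(LBINT s. ind {t..T} s *\<^sub>R \<psi> s) = (LBINT s. of_bool (t < s \<and> s < T) * \<psi> s)"
   proof (rule integral_cong_AE)
    show "AE s in lborel. ind {t..T} s *\<^sub>R \<psi> s = of_bool (t < s \<and> s < T) * \<psi> s"
     using AE_lborel_singleton[of t] AE_lborel_singleton[of T] by eventually_elim (auto simp: indicator_def)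
   qed measurable
   ultimately show ?thesis using \<theta>(1) by simp
  qed
  have parts: "(LBINT t. \<theta> t * g t) = - (LBINT s. ind {0<..<T} s * (\<psi> s * primitive g s))"
  proof -
   have g0: "g t = 0" if "t \<notin> {0<..<T}" for t using that by (simp add: g_def mollified_source_def source_def)
   have ip: "L1 (\<lambda>p. of_bool (fst p < snd p) * (g (fst p) * (ind {0<..<T} (snd p) * \<psi> (snd p))))"
    by (rule integrable_bounded_mult[where C=1, OF integrable_prod_mult[OF ig \<psi>T]]) auto
   have "(LBINT t. \<theta> t * g t) = (LBINT t. - (LBINT s. of_bool (t < s) * (g t * (ind {0<..<T} s * \<psi> s))))"
   proof (rule int_cong[OF refl])
    fix t
    show "\<theta> t * g t = - (LBINT s. of_bool (t < s) * (g t * (ind {0<..<T} s * \<psi> s)))"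
    proof (cases "t \<in> {0<..<T}")
     case True
     hence "(LBINT s. of_bool (t < s) * (g t * (ind {0<..<T} s * \<psi> s))) = (LBINT s. g t * (of_bool (t < s \<and> s < T) * \<psi> s))"
      by (intro int_cong) (auto simp: indicator_def)
     thus ?thesis using \<theta>_eq[of t] True by simp
    qed (simp add: g0)
   qed
   also have "\<dots> = - (LBINT p. of_bool (fst p < snd p) * (g (fst p) * (ind {0<..<T} (snd p) * \<psi> (snd p))))"
    by (subst lborel_Fubini(1)[OF ip]) simp
   also have "(LBINT p. of_bool (fst p < snd p) * (g (fst p) * (ind {0<..<T} (snd p) * \<psi> (snd p))))
     = (LBINT s. ind {0<..<T} s * (\<psi> s * primitive g s))" unfolding lborel_Fubini(2)[OF ip]
   proof (rule int_cong[OF refl])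
    fix s
    have "(LBINT t. of_bool (t < s) * (g t * (ind {0<..<T} s * \<psi> s))) = (LBINT t. (ind {0<..<T} s * \<psi> s) * (ind {0<..<s} t * g t))"
     using g0 by (intro int_cong) (auto simp: indicator_def)
    thus "(LBINT t. of_bool (fst (t, s) < snd (t, s)) * (g (fst (t, s)) * (ind {0<..<T} (snd (t, s)) * \<psi> (snd (t, s)))))
      = ind {0<..<T} s * (\<psi> s * primitive g s)" by (simp add: primitive_def)
   qed
   finally show ?thesis .
  qed
  have i1: "L1 (\<lambda>p. w p * time_cut T (\<lambda>t y. deriv (\<lambda>s. \<phi> s y) t) p)"
   using Lop_parts_integrable(1)[OF \<phi>] wM by (intro integrable_bounded_mult[where C=M]) auto
  obtain C\<theta> where C\<theta>: "\<And>t. t \<in> {0..T} ==> \<bar>\<theta> t\<bar> \<le> C\<theta>"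
  proof -
   have "compact (\<theta> ` {0..T})"
    using \<theta>(2) by (intro compact_continuous_image continuous_at_imp_continuous_on ballI DERIV_isCont) auto
   from compact_imp_bounded[OF this] obtain c where "\<forall>y\<in>\<theta> ` {0..T}. norm y \<le> c" unfolding bounded_iff ..
   thus ?thesis by (intro that[of c]) auto
  qed
  have i2: "L1 (\<lambda>p. \<theta> (fst p) * source w \<kappa> x p)"
  proof -
   have "L1 (\<lambda>p. (ind {0<..<T} (fst p) * \<theta> (fst p)) * source w \<kappa> x p)"
    using C\<theta> order_trans[OF abs_ge_zero C\<theta>, of 0] T_pos by (intro integrable_bounded_mult[where C=C\<theta>, OF isrc]) (auto simp: indicator_def)
   moreover have "(ind {0<..<T} (fst p) * \<theta> (fst p)) * source w \<kappa> x p = \<theta> (fst p) * source w \<kappa> x p" for p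
    by (auto simp: source_def indicator_def)
   ultimately show ?thesis by simp
  qed
  have "0 = (LBINT p. w p * time_cut T (\<lambda>t y. deriv (\<lambda>s. \<phi> s y) t) p + \<theta> (fst p) * source w \<kappa> x p)"
  proof -
   have "w p * Lop \<phi> p = w p * time_cut T (\<lambda>t y. deriv (\<lambda>s. \<phi> s y) t) p + \<theta> (fst p) * source w \<kappa> x p" for p
    by (simp add: Lop_def time_cut_def source_def grad \<phi>_def algebra_simps)
   thus ?thesis using sol[OF \<phi>] by simp
  qed
  also have "\<dots> = (LBINT p. w p * time_cut T (\<lambda>t y. deriv (\<lambda>s. \<phi> s y) t) p) + (LBINT p. \<theta> (fst p) * source w \<kappa> x p)"
   by (rule int_add[OF i1 i2])
  also have "(LBINT p. \<theta> (fst p) * source w \<kappa> x p) = (LBINT t. \<theta> t * g t)"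
   by (subst lborel_Fubini(1)[OF i2]) (simp add: g_def mollified_source_def)
  also have "(LBINT p. w p * time_cut T (\<lambda>t y. deriv (\<lambda>s. \<phi> s y) t) p) = (LBINT t. ind {0<..<T} t * (\<psi> t * A t))"
   unfolding lborel_Fubini(1)[OF i1]
  proof (rule int_cong[OF refl])
   fix t
   have "(LBINT y. w (t, y) * time_cut T (\<lambda>t y. deriv (\<lambda>s. \<phi> s y) t) (t, y)) = (LBINT y. (ind {0<..<T} t * \<psi> t) * (w (t, y) * \<kappa> (x - y)))"
    by (intro int_cong) (auto simp: time_cut_def der)
   thus "(LBINT y. w (t, y) * time_cut T (\<lambda>t y. deriv (\<lambda>s. \<phi> s y) t) (t, y)) = ind {0<..<T} t * (\<psi> t * A t)"
    by (simp add: A_def conv_def)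
  qed
  finally have "(LBINT t. ind {0<..<T} t * (\<psi> t * A t)) - (LBINT s. ind {0<..<T} s * (\<psi> s * primitive g s)) = 0"
   using parts by simp
  moreover have "L1 (\<lambda>t. A t * (ind {0<..<T} t * \<psi> t))"
   by (rule integrable_bounded_mult[where C=CA, OF \<psi>T]) (use CA in auto)
  moreover have "L1 (\<lambda>t. primitive g t * (ind {0<..<T} t * \<psi> t))"
   by (rule integrable_bounded_mult[where C="LBINT s. \<bar>g s\<bar>", OF \<psi>T]) (use primitive_bound[OF ig] in auto)
  ultimately show "(LBINT t. ind {0<..<T} t * (A t - primitive g t) * \<psi> t) = 0" by (simp add: algebra_simps)
 qed
 thus ?thesis by eventually_elim (auto simp: A_def g_def indicator_def)
qed

end


lemma ennreal_abs_integral_le: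
 "f \<in> borel_measurable M ==> ennreal \<bar>\<integral>x. f x \<partial>M\<bar> \<le> (\<integral>\<^sup>+x. ennreal \<bar>f x\<bar> \<partial>M)" for f :: "'a => real"
 using integral_minus_le_nn_integral[of M "\<lambda>_. 0" f] by simp

context transport_field
begin

lemma mollified_measurable[measurable]:
 fixes w :: "real \<times> 'a => real"
 assumes [measurable]: "w \<in> Borel" "\<kappa> \<in> Borel"
 shows "(\<lambda>q. conv (\<lambda>y. w (fst q, y)) \<kappa> (snd q)) \<in> Borel" unfolding conv_def by measurable

lemma mollified_source_integrable:
 assumes w[measurable]: "w \<in> Borel" and wM: "\<And>p. \<bar>w p\<bar> \<le> M" and \<kappa>: "\<kappa> \<in> test_functions"
 shows "L1 (\<lambda>p. ind (cball 0 \<rho>) (snd p) * mollified_source w \<kappa> (snd p) (fst p))"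
proof (rule integrableI_bounded)
 have [measurable]: "\<kappa> \<in> Borel" "gradient \<kappa> \<in> Borel" using \<kappa> by (auto intro: test_measurable gradient_measurable)
 have M: "M \<ge> 0" using wM[of 0] by linarith
 show [measurable]: "(\<lambda>p. ind (cball 0 \<rho>) (snd p) * mollified_source w \<kappa> (snd p) (fst p)) \<in> borel_measurable lborel"
  unfolding mollified_source_def source_def by measurable
 obtain r where r: "r > 0" "\<And>x. norm x > r ==> \<kappa> x = 0" using test_function_support[OF \<kappa>] by metis
 obtain C where C: "C > 0" "\<And>x. \<bar>\<kappa> x\<bar> \<le> C" using test_bounded[OF \<kappa>] by metis
 obtain C' where C': "C' > 0" "\<And>x. norm (gradient \<kappa> x) \<le> C'" using gradient_bounded[OF \<kappa>] by metis
 let ?Z = "{0<..<T} \<times> cball (0::'a) (\<rho> + r)"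
 define k where "k p = M * (C * \<bar>ind ?Z p * D p\<bar> + C' * norm (ind ?Z p *\<^sub>R b p))" for p
 have k: "L1 k" unfolding k_def[abs_def]
  by (intro integrable_mult_right L1_add integrable_abs integrable_norm D_int b_int)
 hence [measurable]: "k \<in> Borel" by auto
 have le: "\<bar>source w \<kappa> x p\<bar> \<le> k p" if x: "norm x \<le> \<rho>" for x p
 proof (cases "p \<in> ?Z")
  case True
  have "\<bar>D p * \<kappa> (x - snd p) - b p \<bullet> gradient \<kappa> (x - snd p)\<bar> \<le> \<bar>D p\<bar> * C + norm (b p) * C'"
   using mult_left_mono[OF C(2), of "\<bar>D p\<bar>" "x - snd p"] order_trans[OF Cauchy_Schwarz_ineq2 mult_left_mono[OF C'(2)], of "b p" "x - snd p"]
    abs_triangle_ineq4[of "D p * \<kappa> (x - snd p)" "b p \<bullet> gradient \<kappa> (x - snd p)"]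
   unfolding abs_mult[symmetric] by (simp add: abs_mult)
  hence "\<bar>w p * (D p * \<kappa> (x - snd p) - b p \<bullet> gradient \<kappa> (x - snd p))\<bar> \<le> M * (\<bar>D p\<bar> * C + norm (b p) * C')"
   unfolding abs_mult using wM M by (intro mult_mono) auto
  thus ?thesis using True by (auto simp: source_def k_def mult.commute indicator_def)
 next
  case False
  have "norm (x - snd p) > r" if "norm (snd p) > \<rho> + r"
   using that x norm_triangle_ineq2[of "snd p" x] by (simp add: norm_minus_commute)
  hence "source w \<kappa> x p = 0"
   using False r gradient_support[OF \<kappa> r(2)] by (cases p) (auto simp: source_def indicator_def)
  thus ?thesis using M C C' by (auto simp: k_def)
 qed
 have "(NNBINT p. ennreal (norm (ind (cball 0 \<rho>) (snd p) * mollified_source w \<kappa> (snd p) (fst p))))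
   \<le> (NNBINT p. ind (cball 0 \<rho>) (snd p) * (NNBINT y. ennreal \<bar>source w \<kappa> (snd p) (fst p, y)\<bar>))"
 proof (rule nn_integral_mono)
  fix p :: "real \<times> 'a"
  have "(\<lambda>y. source w \<kappa> (snd p) (fst p, y)) \<in> borel_measurable lborel" unfolding source_def by measurable
  from ennreal_abs_integral_le[OF this]
  show "ennreal (norm (ind (cball 0 \<rho>) (snd p) * mollified_source w \<kappa> (snd p) (fst p)))
    \<le> ind (cball 0 \<rho>) (snd p) * (NNBINT y. ennreal \<bar>source w \<kappa> (snd p) (fst p, y)\<bar>)"
   by (auto simp: mollified_source_def indicator_def)
 qed
 also have "\<dots> = (NNBINT s. (NNBINT x. ind (cball 0 \<rho>) x * (NNBINT y. ennreal \<bar>source w \<kappa> x (s, y)\<bar>)))"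
  unfolding source_def by (subst nn_integral_lborel_Fubini) simp_all
 also have "\<dots> = (NNBINT x. (NNBINT s. ind (cball 0 \<rho>) x * (NNBINT y. ennreal \<bar>source w \<kappa> x (s, y)\<bar>)))"
  unfolding source_def by (rule lborel_pair.Fubini') measurable
 also have "\<dots> \<le> (NNBINT x. ind (cball (0::'a) \<rho>) x * (NNBINT p. ennreal (k p)))"
 proof (rule nn_integral_mono)
  fix x :: 'a
  have [measurable]: "(\<lambda>p. source w \<kappa> x p) \<in> Borel" unfolding source_def by measurable
  have "(NNBINT s. ind (cball 0 \<rho>) x * (NNBINT y. ennreal \<bar>source w \<kappa> x (s, y)\<bar>))
    = ind (cball 0 \<rho>) x * (NNBINT p. ennreal \<bar>source w \<kappa> x p\<bar>)"
   by (subst nn_integral_lborel_Fubini) (simp_all add: nn_integral_cmult)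
  also have "\<dots> \<le> ind (cball 0 \<rho>) x * (NNBINT p. ennreal (k p))"
   using le by (auto simp: indicator_def intro!: nn_integral_mono ennreal_leI)
  finally show "(NNBINT s. ind (cball 0 \<rho>) x * (NNBINT y. ennreal \<bar>source w \<kappa> x (s, y)\<bar>))
    \<le> ind (cball 0 \<rho>) x * (NNBINT p. ennreal (k p))" .
 qed
 also have "\<dots> = emeasure lborel (cball (0::'a) \<rho>) * (NNBINT p. ennreal (k p))" by (simp add: nn_integral_multc)
 also have "\<dots> < \<infinity>"
 proof -
  have "(NNBINT p. ennreal (k p)) \<le> (NNBINT p. ennreal (norm (k p)))" by (intro nn_integral_mono ennreal_leI) simp
  also have "\<dots> < \<infinity>" using k by (simp add: integrable_iff_bounded)
  finally show ?thesis using emeasure_lborel_cball_finite[of "0::'a" \<rho>] by (simp add: ennreal_mult_less_top)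
 qed
 finally show "(NNBINT p. ennreal (norm (ind (cball 0 \<rho>) (snd p) * mollified_source w \<kappa> (snd p) (fst p)))) < \<infinity>" .
qed

lemma mollified_square:
 assumes w[measurable]: "w \<in> Borel" and wM: "\<And>p. \<bar>w p\<bar> \<le> M"
  and \<kappa>: "\<kappa> \<in> test_functions" "\<And>x. \<kappa> x \<ge> 0" "(LBINT x. \<kappa> x) = 1"
  and sol: "\<And>\<phi>. \<phi> \<in> ST T ==> (LBINT p. w p * Lop \<phi> p) = 0"
  and \<psi>: "\<psi> \<in> test_functions" "\<And>x. norm x > \<rho> ==> \<psi> x = 0"
 defines "F \<equiv> \<lambda>p. 2 * mollified_source w \<kappa> (snd p) (fst p) * mollified w \<kappa> p * \<psi> (snd p)"
 shows "L1 F"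
  and "AE t\<in>{0<..<T} in lborel. (LBINT x. (mollified w \<kappa> (t, x))\<^sup>2 * \<psi> x) = (LBINT p. ind {0<..<t} (fst p) * F p)"
proof -
 have [measurable]: "\<kappa> \<in> Borel" "gradient \<kappa> \<in> Borel" "\<psi> \<in> Borel"
  using \<kappa>(1) \<psi>(1) by (auto intro: test_measurable gradient_measurable)
 define W where "W p = mollified w \<kappa> p" for p
 have W_meas[measurable]: "W \<in> Borel" unfolding W_def by measurable
 have WM: "\<bar>W p\<bar> \<le> M" for p unfolding W_def by (intro conv_bound wM \<kappa>) measurable
 obtain C where C: "C > 0" "\<And>x. \<bar>\<psi> x\<bar> \<le> C" using test_bounded[OF \<psi>(1)] by metis
 have M: "M \<ge> 0" using wM[of 0] by linarith
 define g where "g x = mollified_source w \<kappa> x" for x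
 have g_meas[measurable]: "(\<lambda>q. g (fst q) (snd q)) \<in> borel_measurable (borel \<Otimes>\<^sub>M borel)"
  unfolding g_def mollified_source_def source_def by measurable
 have F_eq: "F p = (2 * W p * \<psi> (snd p)) * (ind (cball 0 \<rho>) (snd p) * g (snd p) (fst p))" for p
  using \<psi>(2)[of "snd p"] by (auto simp: F_def W_def g_def indicator_def)
 show iF: "L1 F" unfolding F_eq[abs_def]
 proof (rule integrable_bounded_mult[where C="2 * M * C"])
  show "L1 (\<lambda>p. ind (cball 0 \<rho>) (snd p) * g (snd p) (fst p))"
   unfolding g_def by (rule mollified_source_integrable[OF w wM \<kappa>(1)])
  have "\<bar>2 * W p * \<psi> (snd p)\<bar> \<le> 2 * M * C" for p unfolding abs_mult using WM C M by (intro mult_mono) auto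
  thus "AE p in lborel. \<bar>2 * W p * \<psi> (snd p)\<bar> \<le> 2 * M * C" by simp
 qed measurable
 have g_int: "L1 (g x)" for x
  unfolding g_def mollified_source_def[abs_def] by (rule lborel_Fubini(4)[OF source_integrable[OF w wM \<kappa>(1)]])
 have sq: "AE t\<in>{0<..<T} in lborel. (W (t, x))\<^sup>2 = (LBINT s. ind {0<..<t} s * (2 * g x s * W (s, x)))" for x
 proof -
  have eq: "AE t\<in>{0<..<T} in lborel. W (t, x) = primitive (g x) t"
   unfolding W_def g_def by (rule mollified_equation[OF w wM \<kappa>(1) sol])
  have gx[measurable]: "g x \<in> Borel" using g_int[of x] by auto
  show ?thesis using eq
  proof eventually_elim
   fix t assume t: "t \<in> {0<..<T} --> W (t, x) = primitive (g x) t"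
   show "t \<in> {0<..<T} --> (W (t, x))\<^sup>2 = (LBINT s. ind {0<..<t} s * (2 * g x s * W (s, x)))"
   proof
    assume tT: "t \<in> {0<..<T}"
    have "(W (t, x))\<^sup>2 = primitive (\<lambda>s. g x s * primitive (g x) s + primitive (g x) s * g x s) t"
     using t tT product_of_primitives[OF g_int g_int, of x t x] by (simp add: power2_eq_square)
    also have "\<dots> = (LBINT s. ind {0<..<t} s * (2 * g x s * W (s, x)))" unfolding primitive_def[of "\<lambda>s. _ s + _ s"]
    proof (rule integral_cong_AE)
     show "AE s in lborel. ind {0<..<t} s * (g x s * primitive (g x) s + primitive (g x) s * g x s)
       = ind {0<..<t} s * (2 * g x s * W (s, x))" using eq by eventually_elim (use tT in \<open>auto simp: indicator_def\<close>)
    qed measurable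
    finally show "(W (t, x))\<^sup>2 = (LBINT s. ind {0<..<t} s * (2 * g x s * W (s, x)))" .
   qed
  qed
 qed
 have "AE t in lborel. AE x in lborel. t \<in> {0<..<T} --> (W (t, x))\<^sup>2 = (LBINT s. ind {0<..<t} s * (2 * g x s * W (s, x)))"
 proof (subst lborel_pair.AE_commute)
  define H where "H q = (LBINT s. ind {0<..<fst q} s * (2 * g (snd q) s * W (s, snd q)))" for q :: "real \<times> 'a"
  have [measurable]: "H \<in> borel_measurable (borel \<Otimes>\<^sub>M borel)" unfolding H_def g_def mollified_source_def source_def by measurable
  have "Measurable.pred (borel \<Otimes>\<^sub>M borel) (\<lambda>q. fst q \<in> {0<..<T} --> (W (fst q, snd q))\<^sup>2 = H q)" by measurable
  thus "{q \<in> space (lborel \<Otimes>\<^sub>M lborel). fst q \<in> {0<..<T} --> (W (fst q, snd q))\<^sup>2 = (LBINT s. ind {0<..<fst q} s * (2 * g (snd q) s * W (s, snd q)))} \<in> sets (lborel \<Otimes>\<^sub>M lborel)"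
   by (simp add: H_def pred_def space_pair_measure cong: sets_pair_measure_cong)
 qed (use sq in auto)
 from this
 show "AE t\<in>{0<..<T} in lborel. (LBINT x. (mollified w \<kappa> (t, x))\<^sup>2 * \<psi> x) = (LBINT p. ind {0<..<t} (fst p) * F p)"
 proof eventually_elim
  fix t assume sq: "AE x in lborel. t \<in> {0<..<T} --> (W (t, x))\<^sup>2 = (LBINT s. ind {0<..<t} s * (2 * g x s * W (s, x)))"
  show "t \<in> {0<..<T} --> (LBINT x. (mollified w \<kappa> (t, x))\<^sup>2 * \<psi> x) = (LBINT p. ind {0<..<t} (fst p) * F p)"
  proof
   assume t: "t \<in> {0<..<T}"
   have i: "L1 (\<lambda>p. ind {0<..<t} (fst p) * F p)"
    by (rule integrable_bounded_mult[where C=1, OF iF]) (auto simp: indicator_def)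
   have "(LBINT x. (mollified w \<kappa> (t, x))\<^sup>2 * \<psi> x) = (LBINT x. (LBINT s. ind {0<..<t} s * F (s, x)))"
   proof (rule integral_cong_AE)
    show "AE x in lborel. (mollified w \<kappa> (t, x))\<^sup>2 * \<psi> x = (LBINT s. ind {0<..<t} s * F (s, x))" using sq
    proof eventually_elim
     fix x assume "t \<in> {0<..<T} --> (W (t, x))\<^sup>2 = (LBINT s. ind {0<..<t} s * (2 * g x s * W (s, x)))"
     hence "(W (t, x))\<^sup>2 * \<psi> x = (LBINT s. ind {0<..<t} s * (2 * g x s * W (s, x)) * \<psi> x)" using t by simp
     also have "\<dots> = (LBINT s. ind {0<..<t} s * F (s, x))" by (simp add: F_def W_def g_def ac_simps)
     finally show "(mollified w \<kappa> (t, x))\<^sup>2 * \<psi> x = (LBINT s. ind {0<..<t} s * F (s, x))" by (simp add: W_def)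
    qed
    show "(\<lambda>x. (mollified w \<kappa> (t, x))\<^sup>2 * \<psi> x) \<in> borel_measurable lborel" unfolding conv_def by measurable
    show "(\<lambda>x. LBINT s. ind {0<..<t} s * F (s, x)) \<in> borel_measurable lborel" using lborel_Fubini(6)[OF i] by simp
   qed
   also have "\<dots> = (LBINT p. ind {0<..<t} (fst p) * F p)" by (subst lborel_Fubini(2)[OF i]) simp
   finally show "(LBINT x. (mollified w \<kappa> (t, x))\<^sup>2 * \<psi> x) = (LBINT p. ind {0<..<t} (fst p) * F p)" .
  qed
 qed
qed

end

context transport_field_W11
begin

lemma slice_energy:
 assumes w[measurable]: "w \<in> Borel" and wM: "\<And>p. \<bar>w p\<bar> \<le> M"
  and \<kappa>: "\<kappa> \<in> test_functions" "\<And>x. \<kappa> x \<ge> 0" "(LBINT x. \<kappa> x) = 1"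
  and \<psi>: "\<psi> \<in> test_functions" "\<And>x. norm x > \<rho> ==> \<psi> x = 0" "\<And>x. \<bar>\<psi> x\<bar> \<le> C"
  and s: "s \<in> {0<..<T}" and D: "loc_int (\<lambda>x. D (s, x))" and B: "\<And>v. loc_int (\<lambda>x. b (s, x) \<bullet> v)"
  and div: "\<And>\<psi>. \<psi> \<in> test_functions ==> (LBINT x. b (s, x) \<bullet> gradient \<psi> x) = - (LBINT x. D (s, x) * \<psi> x)"
  and i: "L1 (\<lambda>x. 2 * mollified_source w \<kappa> x s * mollified w \<kappa> (s, x) * \<psi> x)"
 shows "L1 (\<lambda>x. (D (s, x) * \<psi> x + b (s, x) \<bullet> gradient \<psi> x) * (mollified w \<kappa> (s, x))\<^sup>2)"
  and "ennreal \<bar>(LBINT x. 2 * mollified_source w \<kappa> x s * mollified w \<kappa> (s, x) * \<psi> x)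
      - (LBINT x. (D (s, x) * \<psi> x + b (s, x) \<bullet> gradient \<psi> x) * (mollified w \<kappa> (s, x))\<^sup>2)\<bar>
   \<le> ennreal (2 * M * C) * (NNBINT x. ind (cball 0 \<rho>) x * ennreal \<bar>comm w \<kappa> (s, x)\<bar>)"
proof -
 have [measurable]: "\<kappa> \<in> Borel" "gradient \<kappa> \<in> Borel" "\<psi> \<in> Borel" "gradient \<psi> \<in> Borel"
  using \<kappa>(1) \<psi>(1) by (auto intro: test_measurable gradient_measurable)
 have M: "M \<ge> 0" using wM[of 0] by linarith
 have C: "C \<ge> 0" using \<psi>(3)[of 0] by linarith
 define u where "u y = w (s, y)" for y
 have um[measurable]: "u \<in> Borel" unfolding u_def by measurable
 have uM: "\<And>y. \<bar>u y\<bar> \<le> M" using wM by (simp add: u_def)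
 define V where "V = conv u \<kappa>"
 have VM: "\<bar>V x\<bar> \<le> M" for x unfolding V_def by (rule conv_bound[OF um uM \<kappa>])
 have VC: "Ck_on k UNIV V" for k unfolding V_def by (rule Ck_on_conv[OF um uM \<kappa>(1)])
 have Vd: "(V has_derivative (\<lambda>v. conv u (\<lambda>z. gradient \<kappa> z \<bullet> v) x)) (at x)" for x
  unfolding V_def by (rule conv_has_derivative[OF um uM \<kappa>(1)])
 have [measurable]: "V \<in> Borel" using VC[of 0] by (auto intro: borel_measurable_continuous_onI)
 have Vt: "(\<lambda>x. V x * (V x * \<psi> x)) \<in> test_functions" and Vt1: "(\<lambda>x. V x * \<psi> x) \<in> test_functions"
  by (intro test_mult_smooth \<psi>(1) VC)+
 have comm_eq: "comm w \<kappa> (s, x) = mollified_source w \<kappa> x s + conv u (\<lambda>z. gradient \<kappa> z \<bullet> b (s, x)) x" for x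
 proof -
  obtain r where r: "r > 0" "\<And>x. norm x > r ==> \<kappa> x = 0" using test_function_support[OF \<kappa>(1)] by metis
  have "L1 (\<lambda>y. D (s, y) * \<kappa> (x - y))" by (intro loc_int_test D test_reflect \<kappa>)
  moreover have "L1 (\<lambda>y. b (s, y) \<bullet> gradient \<kappa> (x - y))"
   using integrable_minus[OF inner_gradient_integrable[OF B test_reflect[OF \<kappa>(1), of x]]] by (simp add: gradient_reflect[OF \<kappa>(1)])
  ultimately have "L1 (\<lambda>y. u y * (D (s, y) * \<kappa> (x - y) - b (s, y) \<bullet> gradient \<kappa> (x - y)))"
   by (intro integrable_bounded_mult[where C=M, OF L1_diff]) (use uM in auto)
  moreover have "L1 (\<lambda>y. u y * (gradient \<kappa> (x - y) \<bullet> b (s, x)))"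
   using conv_integrable[OF um uM test_gradient_component[OF \<kappa>(1)]] .
  ultimately have "(LBINT y. u y * (D (s, y) * \<kappa> (x - y) - b (s, y) \<bullet> gradient \<kappa> (x - y)) + u y * (gradient \<kappa> (x - y) \<bullet> b (s, x)))
   = (LBINT y. u y * (D (s, y) * \<kappa> (x - y) - b (s, y) \<bullet> gradient \<kappa> (x - y))) + (LBINT y. u y * (gradient \<kappa> (x - y) \<bullet> b (s, x)))"
   by (rule int_add)
  moreover have "u y * (D (s, y) * \<kappa> (x - y) - b (s, y) \<bullet> gradient \<kappa> (x - y)) + u y * (gradient \<kappa> (x - y) \<bullet> b (s, x))
    = w (s, y) * (D (s, y) * \<kappa> (x - y) + (b (s, x) - b (s, y)) \<bullet> gradient \<kappa> (x - y))" for y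
   by (simp add: u_def algebra_simps inner_diff_left inner_commute)
  ultimately show ?thesis using s by (simp add: comm_def mollified_source_def source_def conv_def u_def)
 qed
 have grad: "b (s, x) \<bullet> gradient (\<lambda>x. V x * (V x * \<psi> x)) x
   = 2 * conv u (\<lambda>z. gradient \<kappa> z \<bullet> b (s, x)) x * V x * \<psi> x + (b (s, x) \<bullet> gradient \<psi> x) * (V x)\<^sup>2" for x
 proof -
  have "frechet_derivative (\<lambda>x. V x * (V x * \<psi> x)) (at x) (b (s, x))
    = V x * (V x * (gradient \<psi> x \<bullet> b (s, x)) + conv u (\<lambda>z. gradient \<kappa> z \<bullet> b (s, x)) x * \<psi> x)
     + conv u (\<lambda>z. gradient \<kappa> z \<bullet> b (s, x)) x * (V x * \<psi> x)"
   by (subst frechet_derivative_at[symmetric, OF has_derivative_mult[OF Vd has_derivative_mult[OF Vd gradient_has_derivative[OF \<psi>(1)]]]]) simp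
  thus ?thesis unfolding gradient_inner[OF Vt] by (simp add: inner_commute algebra_simps power2_eq_square)
 qed
 define E where "E x = b (s, x) \<bullet> gradient (\<lambda>x. V x * (V x * \<psi> x)) x + D (s, x) * (V x * (V x * \<psi> x))" for x
 have iE1: "L1 (\<lambda>x. b (s, x) \<bullet> gradient (\<lambda>x. V x * (V x * \<psi> x)) x)" by (rule inner_gradient_integrable[OF B Vt])
 have iE2: "L1 (\<lambda>x. D (s, x) * (V x * (V x * \<psi> x)))" by (rule loc_int_test[OF D Vt])
 have iE: "L1 E" unfolding E_def[abs_def] using iE1 iE2 by simp
 have E0: "(LBINT x. E x) = 0" unfolding E_def using iE1 iE2 div[OF Vt] by simp
 define S where "S x = (D (s, x) * \<psi> x + b (s, x) \<bullet> gradient \<psi> x) * (V x)\<^sup>2" for x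
 have "L1 (\<lambda>x. (V x)\<^sup>2 * (D (s, x) * \<psi> x + b (s, x) \<bullet> gradient \<psi> x))"
 proof (rule integrable_bounded_mult[where C="M\<^sup>2"])
  show "L1 (\<lambda>x. D (s, x) * \<psi> x + b (s, x) \<bullet> gradient \<psi> x)"
   by (intro L1_add loc_int_test D inner_gradient_integrable B \<psi>)
  show "AE x in lborel. \<bar>(V x)\<^sup>2\<bar> \<le> M\<^sup>2" using VM M by (auto simp: abs_le_square_iff[symmetric])
 qed measurable
 hence iS: "L1 S" by (simp add: S_def[abs_def] mult.commute)
 thus "L1 (\<lambda>x. (D (s, x) * \<psi> x + b (s, x) \<bullet> gradient \<psi> x) * (mollified w \<kappa> (s, x))\<^sup>2)"
  by (simp add: S_def[abs_def] V_def u_def[abs_def])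
 define F where "F x = 2 * mollified_source w \<kappa> x s * V x * \<psi> x" for x
 have iF: "L1 F" using i by (simp add: F_def[abs_def] V_def u_def[abs_def])
 have FE: "F x + E x - S x = 2 * comm w \<kappa> (s, x) * V x * \<psi> x" for x
  unfolding F_def E_def S_def grad comm_eq by (simp add: algebra_simps power2_eq_square)
 have "(LBINT x. F x) - (LBINT x. S x) = (LBINT x. F x + E x) - (LBINT x. S x)" using iF iE E0 by simp
 also have "ennreal \<bar>\<dots>\<bar> \<le> (NNBINT x. ennreal \<bar>F x + E x - S x\<bar>)"
  using iF iE iS by (intro integral_minus_le_nn_integral) auto
 also have "\<dots> \<le> (NNBINT x. ennreal (2 * M * C) * (ind (cball 0 \<rho>) x * ennreal \<bar>comm w \<kappa> (s, x)\<bar>))"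
 proof (rule nn_integral_mono)
  fix x
  show "ennreal \<bar>F x + E x - S x\<bar> \<le> ennreal (2 * M * C) * (ind (cball 0 \<rho>) x * ennreal \<bar>comm w \<kappa> (s, x)\<bar>)"
  proof (cases "norm x > \<rho>")
   case True
   thus ?thesis using \<psi>(2) by (simp add: FE)
  next
   case False
   have "\<bar>F x + E x - S x\<bar> = (2 * \<bar>V x\<bar> * \<bar>\<psi> x\<bar>) * \<bar>comm w \<kappa> (s, x)\<bar>" unfolding FE by (simp add: abs_mult)
   also have "\<dots> \<le> (2 * M * C) * \<bar>comm w \<kappa> (s, x)\<bar>" using VM \<psi>(3) M C by (intro mult_right_mono mult_mono) auto
   finally have "ennreal \<bar>F x + E x - S x\<bar> \<le> ennreal ((2 * M * C) * \<bar>comm w \<kappa> (s, x)\<bar>)" by (rule ennreal_leI)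
   thus ?thesis using False M C by (simp add: ennreal_mult)
  qed
 qed
 also have "\<dots> = ennreal (2 * M * C) * (NNBINT x. ind (cball 0 \<rho>) x * ennreal \<bar>comm w \<kappa> (s, x)\<bar>)"
  unfolding comm_def by (rule nn_integral_cmult) measurable
 finally show "ennreal \<bar>(LBINT x. 2 * mollified_source w \<kappa> x s * mollified w \<kappa> (s, x) * \<psi> x)
      - (LBINT x. (D (s, x) * \<psi> x + b (s, x) \<bullet> gradient \<psi> x) * (mollified w \<kappa> (s, x))\<^sup>2)\<bar>
   \<le> ennreal (2 * M * C) * (NNBINT x. ind (cball 0 \<rho>) x * ennreal \<bar>comm w \<kappa> (s, x)\<bar>)"
  by (simp add: F_def S_def V_def u_def[abs_def])
qed

lemma mollified_energy:
 assumes w[measurable]: "w \<in> Borel" and wM: "\<And>p. \<bar>w p\<bar> \<le> M"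
  and \<kappa>: "\<kappa> \<in> test_functions" "\<And>x. \<kappa> x \<ge> 0" "(LBINT x. \<kappa> x) = 1"
  and sol: "\<And>\<phi>. \<phi> \<in> ST T ==> (LBINT p. w p * Lop \<phi> p) = 0"
  and \<psi>: "\<psi> \<in> test_functions" "\<And>x. norm x > \<rho> ==> \<psi> x = 0" "\<And>x. \<bar>\<psi> x\<bar> \<le> C"
 shows "AE t in lborel. t \<in> {0<..<T} -->
  ennreal \<bar>(LBINT x. (mollified w \<kappa> (t, x))\<^sup>2 * \<psi> x)
   - (LBINT p. ind {0<..<t} (fst p) * ((D p * \<psi> (snd p) + b p \<bullet> gradient \<psi> (snd p)) * (mollified w \<kappa> p)\<^sup>2))\<bar>
  \<le> ennreal (2 * M * C) * (NNBINT p. cyl T \<rho> p * ennreal \<bar>comm w \<kappa> p\<bar>)"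
proof -
 have [measurable]: "\<kappa> \<in> Borel" "gradient \<kappa> \<in> Borel" "\<psi> \<in> Borel" "gradient \<psi> \<in> Borel"
  using \<kappa>(1) \<psi>(1) by (auto intro: test_measurable gradient_measurable)
 have M: "M \<ge> 0" using wM[of 0] by linarith
 define W where "W p = mollified w \<kappa> p" for p
 have W_meas[measurable]: "W \<in> Borel" unfolding W_def by measurable
 have WM: "\<bar>W p\<bar> \<le> M" for p unfolding W_def by (intro conv_bound wM \<kappa>) measurable
 define F where "F p = 2 * mollified_source w \<kappa> (snd p) (fst p) * W p * \<psi> (snd p)" for p
 have sq: "L1 F"
  "AE t\<in>{0<..<T} in lborel. (LBINT x. (W (t, x))\<^sup>2 * \<psi> x) = (LBINT p. ind {0<..<t} (fst p) * F p)"
  unfolding F_def W_def by (rule mollified_square[OF w wM \<kappa> sol \<psi>(1,2)]; assumption)+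
 define S where "S p = ind {0<..<T} (fst p) * ((D p * \<psi> (snd p) + b p \<bullet> gradient \<psi> (snd p)) * (W p)\<^sup>2)" for p
 have iS: "L1 S"
 proof -
  obtain C' where C': "\<And>x. norm (gradient \<psi> x) \<le> C'" "C' > 0" using gradient_bounded[OF \<psi>(1)] by metis
  have "L1 (\<lambda>p. D p * (ind {0<..<T} (fst p) * \<psi> (snd p)))"
   using \<psi> order_trans[OF abs_ge_zero \<psi>(3)] by (intro bounded_slab_integrable(2)[where C=C and r=\<rho>]) (auto simp: indicator_def)
  moreover have "L1 (\<lambda>p. b p \<bullet> (ind {0<..<T} (fst p) *\<^sub>R gradient \<psi> (snd p)))" using C' gradient_support[OF \<psi>(1,2)]
   by (intro bounded_slab_integrable_b[where C=C' and r=\<rho>]) (auto simp: indicator_def less_imp_le)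
  ultimately have "L1 (\<lambda>p. (W p)\<^sup>2 * (D p * (ind {0<..<T} (fst p) * \<psi> (snd p)) + b p \<bullet> (ind {0<..<T} (fst p) *\<^sub>R gradient \<psi> (snd p))))"
   by (intro integrable_bounded_mult[where C="M\<^sup>2", OF L1_add])
     (use WM M in \<open>auto simp: abs_le_square_iff[symmetric]\<close>)
  moreover have "(\<lambda>p. (W p)\<^sup>2 * (D p * (ind {0<..<T} (fst p) * \<psi> (snd p)) + b p \<bullet> (ind {0<..<T} (fst p) *\<^sub>R gradient \<psi> (snd p)))) = S"
   by (rule ext) (simp add: S_def algebra_simps)
  ultimately show ?thesis by (simp only:)
 qed
 have comm_meas[measurable]: "(\<lambda>p. comm w \<kappa> p) \<in> Borel" unfolding comm_def by measurable
 define c where "c s = (NNBINT x. ind (cball (0::'a) \<rho>) x * ennreal \<bar>comm w \<kappa> (s, x)\<bar>)" for s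
 have [measurable]: "c \<in> Borel" unfolding c_def by measurable
 have slice: "AE s in lborel. s \<in> {0<..<T} -->
   ennreal \<bar>(LBINT x. F (s, x)) - (LBINT x. S (s, x))\<bar> \<le> ennreal (2 * M * C) * c s"
  using slices_loc_int divergence lborel_Fubini(3)[OF sq(1)]
 proof eventually_elim
  case (elim s)
  show ?case
  proof
   assume s: "s \<in> {0<..<T}"
   have "ennreal \<bar>(LBINT x. 2 * mollified_source w \<kappa> x s * mollified w \<kappa> (s, x) * \<psi> x)
      - (LBINT x. (D (s, x) * \<psi> x + b (s, x) \<bullet> gradient \<psi> x) * (mollified w \<kappa> (s, x))\<^sup>2)\<bar>
    \<le> ennreal (2 * M * C) * (NNBINT x. ind (cball 0 \<rho>) x * ennreal \<bar>comm w \<kappa> (s, x)\<bar>)"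
    using elim s by (intro slice_energy(2)[OF w wM \<kappa> \<psi> s]) (auto simp: F_def W_def)
   thus "ennreal \<bar>(LBINT x. F (s, x)) - (LBINT x. S (s, x))\<bar> \<le> ennreal (2 * M * C) * c s"
    using s by (simp add: F_def S_def W_def c_def)
  qed
 qed
 have Tc: "(NNBINT s. ind {0<..<T} s * (ennreal (2 * M * C) * c s))
   = ennreal (2 * M * C) * (NNBINT p. cyl T \<rho> p * ennreal \<bar>comm w \<kappa> p\<bar>)"
 proof -
  have "(NNBINT s. ind {0<..<T} s * (ennreal (2 * M * C) * c s)) = ennreal (2 * M * C) * (NNBINT s. ind {0<..<T} s * c s)"
   by (subst nn_integral_cmult[symmetric]) (auto simp: ac_simps)
  also have "(NNBINT s. ind {0<..<T} s * c s) = (NNBINT p. cyl T \<rho> p * ennreal \<bar>comm w \<kappa> p\<bar>)"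
   unfolding c_def by (subst nn_integral_lborel_Fubini) (simp_all add: nn_integral_cmult indicator_times mult.assoc)
  finally show ?thesis .
 qed
 show ?thesis using sq(2)
 proof eventually_elim
  case (elim t)
  show ?case
  proof
   assume t: "t \<in> {0<..<T}"
   define I where "I f = (\<lambda>p. ind {0<..<t} (fst p) * f p)" for f :: "real \<times> 'a => real"
   have iI: "L1 (I f)" if "L1 f" for f
    unfolding I_def by (rule integrable_bounded_mult[where C=1, OF that]) (auto simp: indicator_def)
   have "(LBINT x. (W (t, x))\<^sup>2 * \<psi> x) - (LBINT p. I S p) = (LBINT p. I F p) - (LBINT p. I S p)"
    using elim t by (simp add: W_def I_def)
   also have "\<dots> = (LBINT s. (LBINT x. I F (s, x)) - (LBINT x. I S (s, x)))"
    using lborel_Fubini(4)[OF iI[OF sq(1)]] lborel_Fubini(4)[OF iI[OF iS]]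
    by (simp add: lborel_Fubini(1)[OF iI[OF sq(1)]] lborel_Fubini(1)[OF iI[OF iS]])
   also have "ennreal \<bar>\<dots>\<bar> \<le> (NNBINT s. ennreal \<bar>(LBINT x. I F (s, x)) - (LBINT x. I S (s, x))\<bar>)"
    using lborel_Fubini(4)[OF iI[OF sq(1)]] lborel_Fubini(4)[OF iI[OF iS]] by (intro ennreal_abs_integral_le) auto
   also have "\<dots> \<le> (NNBINT s. ind {0<..<T} s * (ennreal (2 * M * C) * c s))"
    using slice by (intro nn_integral_mono_AE, elim eventually_mono) (use t in \<open>auto simp: I_def indicator_def\<close>)
   finally have "ennreal \<bar>(LBINT x. (W (t, x))\<^sup>2 * \<psi> x) - (LBINT p. I S p)\<bar>
     \<le> ennreal (2 * M * C) * (NNBINT p. cyl T \<rho> p * ennreal \<bar>comm w \<kappa> p\<bar>)" unfolding Tc .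
   moreover have "I S p = ind {0<..<t} (fst p) * ((D p * \<psi> (snd p) + b p \<bullet> gradient \<psi> (snd p)) * (mollified w \<kappa> p)\<^sup>2)" for p
    using t by (auto simp: I_def S_def W_def indicator_def)
   ultimately show "ennreal \<bar>(LBINT x. (mollified w \<kappa> (t, x))\<^sup>2 * \<psi> x)
    - (LBINT p. ind {0<..<t} (fst p) * ((D p * \<psi> (snd p) + b p \<bullet> gradient \<psi> (snd p)) * (mollified w \<kappa> p)\<^sup>2))\<bar>
    \<le> ennreal (2 * M * C) * (NNBINT p. cyl T \<rho> p * ennreal \<bar>comm w \<kappa> p\<bar>)" by (simp add: W_def)
  qed
 qed
qed

end


context transport_field_W11
begin

lemma mollified_tendsto_L1:
 assumes w[measurable]: "w \<in> Borel" and wM: "\<And>p. \<bar>w p\<bar> \<le> M" and "e > 0"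
 obtains e0 where "e0 > 0" "\<And>\<epsilon>. 0 < \<epsilon> ==> \<epsilon> < e0 ==>
  (NNBINT p. cyl T \<rho> p * ennreal \<bar>mollified w (mollifier \<epsilon>) p - w p\<bar>) \<le> ennreal e"
proof -
 define Z where "Z = {0<..<T} \<times> cball (0::'a) (\<rho> + 1)"
 have [measurable]: "Z \<in> sets borel" by (auto simp: Z_def)
 define f where "f p = ind Z p * w p" for p
 have M: "M \<ge> 0" using wM[of 0] by linarith
 have f[measurable]: "f \<in> Borel" unfolding f_def by measurable
 have fM: "\<bar>f p\<bar> \<le> M" for p using wM M by (auto simp: f_def indicator_def)
 have intf: "L1 f"
  using fM by (rule bounded_slab_integrable(1)[where r="\<rho> + 1", OF f]) (auto simp: f_def Z_def indicator_def)
 obtain d where d: "d > 0" "\<And>h. norm h < d ==> shift_diff f h \<le> ennreal e"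
  using shift_diff_small[OF intf \<open>e > 0\<close>] by metis
 show ?thesis
 proof (rule that[of "min d 1"])
  show "min d 1 > 0" using d by simp
  fix \<epsilon> assume \<epsilon>: "0 < \<epsilon>" "\<epsilon> < min d 1"
  define k where "k = (mollifier \<epsilon> :: 'a => real)"
  have k: "k \<in> test_functions" unfolding k_def by (rule mollifier_test[OF \<epsilon>(1)])
  hence [measurable]: "k \<in> Borel" by auto
  obtain C where C: "\<And>x. \<bar>k x\<bar> \<le> C" using test_bounded[OF k] by metis
  have bound: "(NNBINT p. ennreal \<bar>(LBINT z. f (p - (0, z)) * k z) - f p\<bar>) \<le> ennreal e"
  proof (rule mollification_L1[OF intf])
   show "k z \<le> C" for z using C[of z] by linarith
   show "AE p in lborel. L1 (\<lambda>z. f (p - (0, z)) * k z)"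
    by (intro AE_I2 integrable_bounded_mult[where C=M] test_integrable k) (use fM in auto)
   show "shift_diff f (0, z) \<le> ennreal e" if "norm z \<le> \<epsilon>" for z :: 'a using that \<epsilon> by (intro d) (simp add: norm_Pair)
  qed (use \<epsilon> k in \<open>auto simp: k_def mollifier_nonneg mollifier_integral mollifier_support intro: test_integrable\<close>)
  have le: "cyl T \<rho> p * ennreal \<bar>mollified w k p - w p\<bar>
    \<le> ennreal \<bar>(LBINT z. f (p - (0, z)) * k z) - f p\<bar>" for p
  proof (cases "p \<in> {0<..<T} \<times> cball 0 \<rho>")
   case True
   have "mollified w k p = (LBINT z. w (fst p, snd p - z) * k z)"
    using has_bochner_integral_lborel_affine(2)[of "\<lambda>y. w (fst p, y) * k (snd p - y)" "-1" "snd p"] by (simp add: conv_def)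
   also have "\<dots> = (LBINT z. f (p - (0, z)) * k z)"
   proof (rule int_cong[OF refl])
    fix z
    show "w (fst p, snd p - z) * k z = f (p - (0, z)) * k z"
    proof (cases "norm z \<le> \<epsilon>")
     case z: True
     have "norm (snd p - z) \<le> \<rho> + 1" using True z \<epsilon> norm_triangle_ineq4[of "snd p" z] by auto
     thus ?thesis using True by (cases p) (auto simp: f_def Z_def)
    qed (use \<epsilon> mollifier_support[OF \<epsilon>(1), of z] in \<open>simp add: k_def not_le\<close>)
   qed
   moreover have "w p = f p" using True by (cases p) (auto simp: f_def Z_def)
   ultimately show ?thesis by (simp add: indicator_def)
  qed simp
  show "(NNBINT p. cyl T \<rho> p * ennreal \<bar>mollified w (mollifier \<epsilon>) p - w p\<bar>) \<le> ennreal e"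
   using order_trans[OF nn_integral_mono bound, OF le] unfolding k_def .
 qed
qed

lemma energy_identity:
 assumes w[measurable]: "w \<in> Borel" and wM: "\<And>p. \<bar>w p\<bar> \<le> M"
  and sol: "\<And>\<phi>. \<phi> \<in> ST T ==> (LBINT p. w p * Lop \<phi> p) = 0"
  and \<psi>: "\<psi> \<in> test_functions"
 shows "AE t\<in>{0<..<T} in lborel. (LBINT x. (w (t, x))\<^sup>2 * \<psi> x)
  = (LBINT p. ind {0<..<t} (fst p) * ((D p * \<psi> (snd p) + b p \<bullet> gradient \<psi> (snd p)) * (w p)\<^sup>2))"
proof -
 have [measurable]: "\<psi> \<in> Borel" "gradient \<psi> \<in> Borel" using \<psi> by (auto intro: test_measurable gradient_measurable)
 have M: "M \<ge> 0" using wM[of 0] by linarith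
 obtain \<rho> where \<rho>: "\<And>x. norm x > \<rho> ==> \<psi> x = 0" using test_function_support[OF \<psi>] by metis
 obtain C where C: "C > 0" "\<And>x. \<bar>\<psi> x\<bar> \<le> C" using test_bounded[OF \<psi>] by metis
 obtain C' where C': "C' > 0" "\<And>x. norm (gradient \<psi> x) \<le> C'" using gradient_bounded[OF \<psi>] by metis
 define P where "P = {0<..<T} \<times> cball (0::'a) \<rho>"
 have [measurable]: "P \<in> sets borel" by (auto simp: P_def)
 define ok where "ok n \<epsilon> \<longleftrightarrow> \<epsilon> > 0 \<and> (NNBINT p. ind P p * ennreal \<bar>mollified w (mollifier \<epsilon>) p - w p\<bar>) \<le> ennreal (1 / Suc n)
   \<and> (NNBINT p. ind P p * ennreal \<bar>comm w (mollifier \<epsilon>) p\<bar>) \<le> ennreal (1 / Suc n)" for n \<epsilon>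
 have "\<exists>\<epsilon>. ok n \<epsilon>" for n
 proof -
  have n: "(1 / Suc n :: real) > 0" by simp
  obtain e1 where e1: "e1 > 0" "\<And>\<epsilon>. 0 < \<epsilon> ==> \<epsilon> < e1 ==> (NNBINT p. ind P p * ennreal \<bar>mollified w (mollifier \<epsilon>) p - w p\<bar>) \<le> ennreal (1 / Suc n)"
   by (rule mollified_tendsto_L1[OF w wM n, of \<rho>, folded P_def]; rule that; assumption)
  obtain e2 where e2: "e2 > 0" "\<And>\<epsilon>. 0 < \<epsilon> ==> \<epsilon> < e2 ==> (NNBINT p. ind P p * ennreal \<bar>comm w (mollifier \<epsilon>) p\<bar>) \<le> ennreal (1 / Suc n)"
   by (rule commutator_vanishes[OF w wM n, of \<rho>, folded P_def]; rule that; assumption)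
  show ?thesis by (rule exI[of _ "min e1 e2 / 2"]) (use e1 e2 in \<open>auto simp: ok_def\<close>)
 qed
 then obtain \<epsilon> where "\<And>n. ok n (\<epsilon> n)" by metis
 hence \<epsilon>: "\<And>n. \<epsilon> n > 0"
  "\<And>n. (NNBINT p. ind P p * ennreal \<bar>mollified w (mollifier (\<epsilon> n)) p - w p\<bar>) \<le> ennreal (1 / Suc n)"
  "\<And>n. (NNBINT p. ind P p * ennreal \<bar>comm w (mollifier (\<epsilon> n)) p\<bar>) \<le> ennreal (1 / Suc n)" unfolding ok_def by blast+
 define \<kappa> where "\<kappa> n = (mollifier (\<epsilon> n) :: 'a => real)" for n
 have \<kappa>: "\<kappa> n \<in> test_functions" "\<And>x. \<kappa> n x \<ge> 0" "(LBINT x. \<kappa> n x) = 1" for n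
  unfolding \<kappa>_def by (intro mollifier_test mollifier_nonneg mollifier_integral \<epsilon>)+
 have [measurable]: "\<kappa> n \<in> Borel" for n using \<kappa>(1) by auto
 define W where "W n p = mollified w (\<kappa> n) p" for n p
 have [measurable]: "W n \<in> Borel" for n unfolding W_def by measurable
 have WM: "\<bar>W n p\<bar> \<le> M" for n p unfolding W_def by (intro conv_bound wM \<kappa>) measurable
 have sqM: "x\<^sup>2 \<le> M\<^sup>2" if "\<bar>x\<bar> \<le> M" for x using that M by (simp add: abs_le_square_iff[symmetric])
 define V where "V n p = ind P p * (W n p - w p)" for n p
 have [measurable]: "V n \<in> Borel" for n unfolding V_def by measurable
 have V_le: "(NNBINT p. ennreal \<bar>V n p\<bar>) \<le> ennreal (1 / Suc n)" for n
 proof -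
  have "(NNBINT p. ennreal \<bar>V n p\<bar>) = (NNBINT p. ind P p * ennreal \<bar>W n p - w p\<bar>)"
   by (intro nn_integral_cong) (auto simp: V_def indicator_def)
  thus ?thesis using \<epsilon>(2)[of n] by (simp only: W_def \<kappa>_def)
 qed
 have iV: "L1 (V n)" for n using le_less_trans[OF V_le[of n]] by (intro integrableI_bounded) auto
 have "(\<lambda>n. LBINT p. norm (V n p)) \<longlonglongrightarrow> 0"
 proof (rule tendsto_sandwich[OF _ _ tendsto_const LIMSEQ_Suc[OF lim_inverse_n']])
  show "\<forall>\<^sub>F n in sequentially. (LBINT p. norm (V n p)) \<le> 1 / real (Suc n)"
  proof (intro always_eventually allI)
   fix n
   have "ennreal (LBINT p. norm (V n p)) \<le> ennreal (1 / Suc n)"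
    using V_le[of n] iV[of n] by (subst nn_integral_eq_integral[symmetric]) auto
   thus "(LBINT p. norm (V n p)) \<le> 1 / real (Suc n)" by (subst (asm) ennreal_le_iff) auto
  qed
 qed auto
 from tendsto_L1_AE_subseq[OF iV this] obtain r where r: "strict_mono r" "AE p in lborel. (\<lambda>n. V (r n) p) \<longlonglongrightarrow> 0" by auto
 define \<delta> where "\<delta> n = 2 * M * C * (1 / Suc (r n))" for n
 have \<delta>: "\<delta> \<longlonglongrightarrow> 0"
  unfolding \<delta>_def using LIMSEQ_subseq_LIMSEQ[OF LIMSEQ_Suc[OF lim_inverse_n'] r(1)] by (intro tendsto_mult_right_zero) (simp add: o_def)
 have Wlim: "(\<lambda>n. W (r n) p) \<longlonglongrightarrow> w p" if "(\<lambda>n. V (r n) p) \<longlonglongrightarrow> 0" "p \<in> P" for p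
  using tendsto_add[OF that(1) tendsto_const[of "w p"]] that(2) by (simp add: V_def)
 define S where "S p = ind {0<..<T} (fst p) * (D p * \<psi> (snd p) + b p \<bullet> gradient \<psi> (snd p))" for p
 have [measurable]: "S \<in> Borel" unfolding S_def by measurable
 have iS: "L1 S"
 proof -
  have "L1 (\<lambda>p. D p * (ind {0<..<T} (fst p) * \<psi> (snd p)))"
   using \<rho> C by (intro bounded_slab_integrable(2)[where C=C and r=\<rho>]) (auto simp: indicator_def)
  moreover have "L1 (\<lambda>p. b p \<bullet> (ind {0<..<T} (fst p) *\<^sub>R gradient \<psi> (snd p)))" using C' gradient_support[OF \<psi> \<rho>]
   by (intro bounded_slab_integrable_b[where C=C' and r=\<rho>]) (auto simp: indicator_def less_imp_le)
  ultimately have "L1 (\<lambda>p. D p * (ind {0<..<T} (fst p) * \<psi> (snd p)) + b p \<bullet> (ind {0<..<T} (fst p) *\<^sub>R gradient \<psi> (snd p)))"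
   by (rule L1_add)
  moreover have "(\<lambda>p. D p * (ind {0<..<T} (fst p) * \<psi> (snd p)) + b p \<bullet> (ind {0<..<T} (fst p) *\<^sub>R gradient \<psi> (snd p))) = S"
   by (rule ext) (simp add: S_def algebra_simps)
  ultimately show ?thesis by (simp only:)
 qed
 have S0: "S p = 0" if "p \<notin> P" for p
 proof (cases "fst p \<in> {0<..<T}")
  case True
  hence "norm (snd p) > \<rho>" using that by (cases p) (auto simp: P_def)
  thus ?thesis using \<rho> gradient_support[OF \<psi> \<rho>] by (simp add: S_def)
 qed (simp add: S_def)
 have energy: "AE t in lborel. \<forall>n. t \<in> {0<..<T} -->
  \<bar>(LBINT x. (W (r n) (t, x))\<^sup>2 * \<psi> x) - (LBINT p. ind {0<..<t} (fst p) * (S p * (W (r n) p)\<^sup>2))\<bar> \<le> \<delta> n"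
  unfolding AE_all_countable
 proof
  fix n
  have "AE t in lborel. t \<in> {0<..<T} -->
  ennreal \<bar>(LBINT x. (W (r n) (t, x))\<^sup>2 * \<psi> x)
   - (LBINT p. ind {0<..<t} (fst p) * ((D p * \<psi> (snd p) + b p \<bullet> gradient \<psi> (snd p)) * (W (r n) p)\<^sup>2))\<bar>
  \<le> ennreal (2 * M * C) * (NNBINT p. ind P p * ennreal \<bar>comm w (\<kappa> (r n)) p\<bar>)"
   unfolding W_def P_def by (rule mollified_energy[OF w wM \<kappa> sol \<psi> \<rho> C(2)])
  thus "AE t in lborel. t \<in> {0<..<T} -->
   \<bar>(LBINT x. (W (r n) (t, x))\<^sup>2 * \<psi> x) - (LBINT p. ind {0<..<t} (fst p) * (S p * (W (r n) p)\<^sup>2))\<bar> \<le> \<delta> n"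
  proof eventually_elim
   case (elim t)
   show ?case
   proof
    assume t: "t \<in> {0<..<T}"
    have eq: "ind {0<..<t} (fst p) * (S p * (W (r n) p)\<^sup>2) = ind {0<..<t} (fst p) * ((D p * \<psi> (snd p) + b p \<bullet> gradient \<psi> (snd p)) * (W (r n) p)\<^sup>2)" for p
     using t by (auto simp: S_def indicator_def)
    have "ennreal (2 * M * C) * (NNBINT p. ind P p * ennreal \<bar>comm w (\<kappa> (r n)) p\<bar>) \<le> ennreal (2 * M * C) * ennreal (1 / Suc (r n))"
     using \<epsilon>(3)[of "r n"] unfolding \<kappa>_def by (rule mult_left_mono) simp
    also have "\<dots> = ennreal (\<delta> n)" unfolding \<delta>_def using M C by (subst ennreal_mult) auto
    finally have "ennreal \<bar>(LBINT x. (W (r n) (t, x))\<^sup>2 * \<psi> x) - (LBINT p. ind {0<..<t} (fst p) * (S p * (W (r n) p)\<^sup>2))\<bar> \<le> ennreal (\<delta> n)"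
     using order_trans[OF elim[rule_format, OF t]] unfolding eq by blast
    thus "\<bar>(LBINT x. (W (r n) (t, x))\<^sup>2 * \<psi> x) - (LBINT p. ind {0<..<t} (fst p) * (S p * (W (r n) p)\<^sup>2))\<bar> \<le> \<delta> n"
     using M C by (subst (asm) ennreal_le_iff) (auto simp: \<delta>_def)
   qed
  qed
 qed
 show ?thesis using energy AE_lborel_pairD[OF r(2)]
 proof eventually_elim
  case (elim t)
  show ?case
  proof
   assume t: "t \<in> {0<..<T}"
   have A: "(\<lambda>n. LBINT x. (W (r n) (t, x))\<^sup>2 * \<psi> x) \<longlonglongrightarrow> (LBINT x. (w (t, x))\<^sup>2 * \<psi> x)"
   proof (rule integral_dominated_convergence)
    show "L1 (\<lambda>x. M\<^sup>2 * \<bar>\<psi> x\<bar>)" using test_integrable[OF \<psi>] by simp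
    show "AE x in lborel. (\<lambda>n. (W (r n) (t, x))\<^sup>2 * \<psi> x) \<longlonglongrightarrow> (w (t, x))\<^sup>2 * \<psi> x" using elim(2)
    proof eventually_elim
     fix x assume lim: "(\<lambda>n. V (r n) (t, x)) \<longlonglongrightarrow> 0"
     show "(\<lambda>n. (W (r n) (t, x))\<^sup>2 * \<psi> x) \<longlonglongrightarrow> (w (t, x))\<^sup>2 * \<psi> x"
     proof (cases "norm x \<le> \<rho>")
      case True
      thus ?thesis using t lim by (intro tendsto_intros Wlim) (auto simp: P_def)
     qed (use \<rho> in auto)
    qed
    show "AE x in lborel. norm ((W (r n) (t, x))\<^sup>2 * \<psi> x) \<le> M\<^sup>2 * \<bar>\<psi> x\<bar>" for n
     using sqM[OF WM] by (auto simp: abs_mult intro!: mult_right_mono)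
   qed measurable
   have B: "(\<lambda>n. LBINT p. ind {0<..<t} (fst p) * (S p * (W (r n) p)\<^sup>2)) \<longlonglongrightarrow> (LBINT p. ind {0<..<t} (fst p) * (S p * (w p)\<^sup>2))"
   proof (rule integral_dominated_convergence)
    show "L1 (\<lambda>p. \<bar>S p\<bar> * M\<^sup>2)" using iS by simp
    show "AE p in lborel. (\<lambda>n. ind {0<..<t} (fst p) * (S p * (W (r n) p)\<^sup>2)) \<longlonglongrightarrow> ind {0<..<t} (fst p) * (S p * (w p)\<^sup>2)"
     using r(2)
    proof eventually_elim
     fix p assume lim: "(\<lambda>n. V (r n) p) \<longlonglongrightarrow> 0"
     show "(\<lambda>n. ind {0<..<t} (fst p) * (S p * (W (r n) p)\<^sup>2)) \<longlonglongrightarrow> ind {0<..<t} (fst p) * (S p * (w p)\<^sup>2)"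
     proof (cases "p \<in> P")
      case True
      thus ?thesis using lim by (intro tendsto_intros Wlim)
     qed (simp add: S0)
    qed
    show "AE p in lborel. norm (ind {0<..<t} (fst p) * (S p * (W (r n) p)\<^sup>2)) \<le> \<bar>S p\<bar> * M\<^sup>2" for n
     using sqM[OF WM] by (auto simp: abs_mult indicator_def intro!: mult_left_mono)
   qed measurable
   have "(\<lambda>n. (LBINT x. (W (r n) (t, x))\<^sup>2 * \<psi> x) - (LBINT p. ind {0<..<t} (fst p) * (S p * (W (r n) p)\<^sup>2))) \<longlonglongrightarrow> 0"
    by (rule Lim_null_comparison[OF _ \<delta>]) (use elim(1) t in auto)
   with tendsto_diff[OF A B] have "(LBINT x. (w (t, x))\<^sup>2 * \<psi> x) = (LBINT p. ind {0<..<t} (fst p) * (S p * (w p)\<^sup>2))"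
    using LIMSEQ_unique by fastforce
   also have "\<dots> = (LBINT p. ind {0<..<t} (fst p) * ((D p * \<psi> (snd p) + b p \<bullet> gradient \<psi> (snd p)) * (w p)\<^sup>2))"
    using t by (intro int_cong) (auto simp: S_def indicator_def)
   finally show "(LBINT x. (w (t, x))\<^sup>2 * \<psi> x)
    = (LBINT p. ind {0<..<t} (fst p) * ((D p * \<psi> (snd p) + b p \<bullet> gradient \<psi> (snd p)) * (w p)\<^sup>2))" .
  qed
 qed
qed

end


lemma primitive_cmult: "primitive (\<lambda>s. c * f s) t = c * primitive f t"
 unfolding primitive_def by (subst integral_mult_right_zero[symmetric]) (simp add: ac_simps)

lemma primitive_mono:
 assumes "L1 f" "L1 g" "AE s in lborel. s \<in> {0<..<t} --> f s \<le> g s"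
 shows "primitive f t \<le> primitive g t" unfolding primitive_def
proof (rule integral_mono_AE)
 show "AE s in lborel. ind {0<..<t} s * f s \<le> ind {0<..<t} s * g s"
  using assms(3) by eventually_elim (auto simp: indicator_def)
qed (intro primitive_integrable assms)+

lemma integrable_mult_primitive:
 assumes f: "L1 f" and g[measurable]: "L1 g"
 shows "L1 (\<lambda>s. f s * primitive g s ^ n)"
proof -
 have [measurable]: "g \<in> Borel" using g by auto
 have "\<bar>primitive g s ^ n\<bar> \<le> (LBINT s. \<bar>g s\<bar>) ^ n" for s
  unfolding power_abs by (intro power_mono primitive_bound g) auto
 hence "L1 (\<lambda>s. primitive g s ^ n * f s)" by (intro integrable_bounded_mult[where C="(LBINT s. \<bar>g s\<bar>) ^ n"] f) auto
 thus ?thesis by (simp add: mult.commute)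
qed

lemma primitive_power:
 assumes f: "L1 f"
 shows "primitive f t ^ Suc n / fact (Suc n) = primitive (\<lambda>s. f s * (primitive f s ^ n / fact n)) t"
proof -
 define a where "a m y = y ^ m / fact m" for m and y :: real
 have a: "y * a m y = real (Suc m) * a (Suc m) y" for m y unfolding a_def fact_Suc power_Suc by (simp del: of_nat_Suc)
 have "a (Suc n) (primitive f t) = primitive (\<lambda>s. f s * a n (primitive f s)) t"
 proof (induction n arbitrary: t)
  case 0
  thus ?case by (simp add: a_def)
 next
  case (Suc n)
  have i: "L1 (\<lambda>s. f s * a n (primitive f s))" using integrable_mult_primitive[OF f f, of n] by (simp add: a_def)
  have "real (Suc (Suc n)) * a (Suc (Suc n)) (primitive f t) = primitive f t * primitive (\<lambda>s. f s * a n (primitive f s)) t"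
   unfolding Suc[symmetric] by (rule a[symmetric])
  also have "\<dots> = primitive (\<lambda>s. f s * primitive (\<lambda>s. f s * a n (primitive f s)) s + primitive f s * (f s * a n (primitive f s))) t"
   by (rule product_of_primitives[OF f i])
  also have "\<dots> = primitive (\<lambda>s. real (Suc (Suc n)) * (f s * a (Suc n) (primitive f s))) t"
  proof (rule arg_cong[of _ _ "\<lambda>f. primitive f t"], rule ext)
   fix s
   show "f s * primitive (\<lambda>s. f s * a n (primitive f s)) s + primitive f s * (f s * a n (primitive f s))
     = real (Suc (Suc n)) * (f s * a (Suc n) (primitive f s))"
    using a[of "primitive f s" n] unfolding Suc[symmetric] by (simp add: algebra_simps)
  qed
  finally show ?case unfolding primitive_cmult by (simp del: of_nat_Suc)
 qed
 thus ?thesis by (simp only: a_def)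
qed

lemma exp_primitive:
 assumes f: "L1 f"
 shows "exp (primitive f t) = 1 + primitive (\<lambda>s. f s * exp (primitive f s)) t"
  and "L1 (\<lambda>s. f s * exp (primitive f s))"
proof -
 have [measurable]: "f \<in> Borel" using f by auto
 define Q where "Q = (LBINT s. \<bar>f s\<bar>)"
 have Q: "\<bar>primitive f s\<bar> \<le> Q" for s unfolding Q_def by (rule primitive_bound[OF f])
 define a where "a n s = ind {0<..<t} s * (f s * (primitive f s ^ n / fact n))" for n s
 have ia: "L1 (a n)" for n
  unfolding a_def using integrable_mult_primitive[OF f f, of n] by (intro primitive_integrable) simp
 have e: "(\<lambda>n. x ^ n / fact n) sums exp x" for x :: real
  using exp_converges[of x] by (simp add: divide_inverse mult.commute scaleR_conv_of_real)
 have an: "norm (a n s) \<le> \<bar>f s\<bar> * (Q ^ n / fact n)" for n s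
  using power_mono[OF Q abs_ge_zero, of s n] order_trans[OF abs_ge_zero Q] by (auto simp: a_def abs_mult power_abs indicator_def intro!: mult_left_mono divide_right_mono)
 have Qs: "summable (\<lambda>n. C * (Q ^ n / fact n))" for C using sums_summable[OF sums_mult[OF e]] .
 have sa: "(\<lambda>n. LBINT s. a n s) sums (LBINT s. (\<Sum>n. a n s))"
 proof (rule sums_integral[OF ia])
  show "AE s in lborel. summable (\<lambda>n. norm (a n s))" using an by (intro AE_I2 summable_comparison_test'[OF Qs]) auto
  show "summable (\<lambda>n. LBINT s. norm (a n s))"
  proof (rule summable_comparison_test'[OF Qs[of Q]])
   fix n
   have "(LBINT s. norm (a n s)) \<le> (LBINT s. \<bar>f s\<bar> * (Q ^ n / fact n))"
    using f by (intro integral_mono integrable_norm ia an) auto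
   thus "norm (LBINT s. norm (a n s)) \<le> Q * (Q ^ n / fact n)" by (simp add: Q_def)
  qed
 qed
 have "(\<Sum>n. a n s) = ind {0<..<t} s * (f s * exp (primitive f s))" for s
  unfolding a_def by (intro sums_unique[symmetric] sums_mult e)
 hence "(\<lambda>n. primitive f t ^ Suc n / fact (Suc n)) sums primitive (\<lambda>s. f s * exp (primitive f s)) t"
  using sa unfolding primitive_power[OF f] by (simp add: a_def primitive_def)
 from iffD1[OF sums_Suc_iff[of "\<lambda>n. primitive f t ^ n / fact n"] this]
 have "(\<lambda>n. primitive f t ^ n / fact n) sums (primitive (\<lambda>s. f s * exp (primitive f s)) t + 1)" by simp
 from sums_unique2[OF this e] show "exp (primitive f t) = 1 + primitive (\<lambda>s. f s * exp (primitive f s)) t" by simp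
 have "L1 (\<lambda>s. exp (primitive f s) * f s)"
  using Q by (intro integrable_bounded_mult[where C="exp Q"] f) (auto intro: order_trans[OF abs_ge_self])
 thus "L1 (\<lambda>s. f s * exp (primitive f s))" by (simp add: mult.commute)
qed

lemma gronwall_primitive:
 assumes \<mu>: "L1 \<mu>" "\<And>s. \<mu> s \<ge> 0" and Z[measurable]: "Z \<in> Borel" and S: "\<And>s. Z s \<le> S"
  and le: "AE t\<in>{0<..<T} in lborel. Z t \<le> primitive (\<lambda>s. \<mu> s * max 0 (Z s)) t"
 shows "AE t\<in>{0<..<T} in lborel. Z t \<le> 0"
proof -
 have [measurable]: "\<mu> \<in> Borel" using \<mu> by auto
 define S' where "S' = max 0 S"
 have S': "S' \<ge> 0" "\<And>s. max 0 (Z s) \<le> S'" unfolding S'_def by (simp, intro max.mono S order_refl)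
 have i: "L1 (\<lambda>s. \<mu> s * max 0 (Z s))"
 proof -
  have "L1 (\<lambda>s. max 0 (Z s) * \<mu> s)" using S' by (intro integrable_bounded_mult[where C=S'] \<mu>) auto
  thus ?thesis by (simp add: mult.commute)
 qed
 have pos: "primitive \<mu> t \<ge> 0" for t unfolding primitive_def using \<mu> by (intro integral_nonneg_AE) auto
 have "AE t\<in>{0<..<T} in lborel. max 0 (Z t) \<le> S' * (primitive \<mu> t ^ n / fact n)" for n
 proof (induction n)
  case 0
  thus ?case using S' by simp
 next
  case (Suc n)
  show ?case using le
  proof eventually_elim
   case (elim t)
   show ?case
   proof
    assume t: "t \<in> {0<..<T}"
    have "primitive (\<lambda>s. \<mu> s * max 0 (Z s)) t \<le> primitive (\<lambda>s. S' * (\<mu> s * (primitive \<mu> s ^ n / fact n))) t"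
    proof (rule primitive_mono[OF i])
     show "L1 (\<lambda>s. S' * (\<mu> s * (primitive \<mu> s ^ n / fact n)))"
      using integrable_mult_primitive[OF \<mu>(1) \<mu>(1), of n] by simp
     show "AE s in lborel. s \<in> {0<..<t} --> \<mu> s * max 0 (Z s) \<le> S' * (\<mu> s * (primitive \<mu> s ^ n / fact n))" using Suc
     proof eventually_elim
      fix s assume *: "s \<in> {0<..<T} --> max 0 (Z s) \<le> S' * (primitive \<mu> s ^ n / fact n)"
      show "s \<in> {0<..<t} --> \<mu> s * max 0 (Z s) \<le> S' * (\<mu> s * (primitive \<mu> s ^ n / fact n))"
       using mult_left_mono[OF mp[OF *] \<mu>(2)[of s]] t by (auto simp: ac_simps)
     qed
    qed
    hence "primitive (\<lambda>s. \<mu> s * max 0 (Z s)) t \<le> S' * (primitive \<mu> t ^ Suc n / fact (Suc n))"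
     unfolding primitive_cmult primitive_power[OF \<mu>(1)] .
    moreover have "0 \<le> S' * (primitive \<mu> t ^ Suc n / fact (Suc n))" using S' pos by (intro mult_nonneg_nonneg divide_nonneg_nonneg zero_le_power) auto
    ultimately show "max 0 (Z t) \<le> S' * (primitive \<mu> t ^ Suc n / fact (Suc n))" using elim t by simp
   qed
  qed
 qed
 hence "AE t in lborel. \<forall>n. t \<in> {0<..<T} --> max 0 (Z t) \<le> S' * (primitive \<mu> t ^ n / fact n)"
  unfolding AE_all_countable by blast
 thus ?thesis
 proof eventually_elim
  case (elim t)
  show ?case
  proof
   assume t: "t \<in> {0<..<T}"
   have "(\<lambda>n. S' * (primitive \<mu> t ^ n / fact n)) \<longlonglongrightarrow> S' * 0"
    using summable_LIMSEQ_zero[OF summable_exp[of "primitive \<mu> t"]]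
    by (intro tendsto_mult tendsto_const) (simp add: divide_inverse mult.commute)
   hence "max 0 (Z t) \<le> S' * 0" by (rule LIMSEQ_le_const) (use elim t in auto)
   thus "Z t \<le> 0" by simp
  qed
 qed
qed

lemma osgood_uniqueness:
 assumes X[measurable]: "X \<in> Borel" "\<And>s. 0 \<le> X s" "\<And>s. X s \<le> S"
  and h: "L1 h" and \<Lambda>: "L1 \<Lambda>" "\<And>s. \<Lambda> s \<ge> 0" and c: "c > 0" and B: "B \<ge> 0"
  and le: "AE t\<in>{0<..<T} in lborel. X t \<le> primitive h t"
  and hle: "AE s\<in>{0<..<T} in lborel. (\<forall>K\<ge>0. h s \<le> \<Lambda> s * (K * X s + B * exp (- c * K)))"
 shows "AE t\<in>{0<..<T} in lborel. X t = 0"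
proof -
 have [measurable]: "h \<in> Borel" "\<Lambda> \<in> Borel" using h \<Lambda> by auto
 define L where "L = (LBINT s. \<bar>\<Lambda> s\<bar>)"
 have pL: "primitive \<Lambda> s \<le> L" for s using primitive_bound[OF \<Lambda>(1), of s] by (simp add: L_def)
 have p0: "primitive \<Lambda> s \<ge> 0" for s unfolding primitive_def using \<Lambda> by (intro integral_nonneg_AE) auto
 define \<theta> where "\<theta> = 1 / c + 1"
 have \<theta>: "\<theta> > 0" using c by (simp add: \<theta>_def add_pos_pos)
 have S: "S \<ge> 0" using X(2,3)[of 0] by linarith
 have main: "AE t\<in>{0<..<T} in lborel. X t \<le> exp (- N * exp (- \<theta> * L))" if N: "N \<ge> B * exp (\<theta> * L)" for N
 proof -
  have N0: "N \<ge> 0" using N B by (meson exp_ge_zero mult_nonneg_nonneg order_trans)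
  define E where "E s = exp (- \<theta> * primitive \<Lambda> s)" for s
  have E: "0 \<le> E s" "E s \<le> 1" "exp (- \<theta> * L) \<le> E s" for s using p0[of s] pL[of s] \<theta> by (auto simp: E_def)
  have NE: "B \<le> N * E s" for s
  proof -
   have "B = (B * exp (\<theta> * L)) * exp (- \<theta> * L)" by (simp add: mult.assoc flip: exp_add)
   also have "\<dots> \<le> N * E s" using N N0 E(3) by (intro mult_mono) auto
   finally show ?thesis .
  qed
  have [measurable]: "E \<in> Borel" unfolding E_def by measurable
  define g where "g s = (N * \<theta>) * (\<Lambda> s * E s)" for s
  have iE: "L1 (\<lambda>s. \<Lambda> s * E s)"
  proof -
   have "L1 (\<lambda>s. E s * \<Lambda> s)" using E by (intro integrable_bounded_mult[where C=1] \<Lambda>) auto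
   thus ?thesis by (simp add: mult.commute)
  qed
  hence ig: "L1 g" unfolding g_def by simp
  have pg: "primitive g t = N - N * E t" for t
  proof -
   have "primitive (\<lambda>s. - \<theta> * \<Lambda> s) = (\<lambda>s. - \<theta> * primitive \<Lambda> s)" by (rule ext, rule primitive_cmult)
   from exp_primitive(1)[OF integrable_mult_right[OF \<Lambda>(1)], of "- \<theta>" t, unfolded this mult.assoc primitive_cmult]
   have p: "E t = 1 - \<theta> * primitive (\<lambda>s. \<Lambda> s * E s) t" by (simp add: E_def)
   show ?thesis unfolding g_def primitive_cmult p by (simp add: algebra_simps)
  qed
  define Y where "Y s = exp (- N * E s)" for s
  have Y: "0 \<le> Y s" "Y s \<le> 1" for s using N0 E(1)[of s] by (auto simp: Y_def)
  have [measurable]: "Y \<in> Borel" unfolding Y_def by measurable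
  have Yg: "Y s = exp (- N) * exp (primitive g s)" for s unfolding Y_def pg by (simp flip: exp_add)
  have Y_eq: "Y t = exp (- N) + primitive (\<lambda>s. g s * Y s) t" for t
  proof -
   have "Y t = exp (- N) * (1 + primitive (\<lambda>s. g s * exp (primitive g s)) t)"
    unfolding Yg exp_primitive(1)[OF ig, symmetric] ..
   also have "\<dots> = exp (- N) + primitive (\<lambda>s. exp (- N) * (g s * exp (primitive g s))) t"
    unfolding primitive_cmult by (simp add: distrib_left)
   finally show ?thesis unfolding Yg by (simp add: ac_simps)
  qed
  define \<kappa> where "\<kappa> s = (1 / c) * (N * E s)" for s
  have \<kappa>0: "\<kappa> s \<ge> 0" for s using c N0 E(1) by (simp add: \<kappa>_def)
  have \<kappa>Y: "exp (- c * \<kappa> s) = Y s" for s using c by (simp add: \<kappa>_def Y_def)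
  have ibd: "L1 (\<lambda>s. \<Lambda> s * k s)" if [measurable]: "k \<in> Borel" and "\<And>s. \<bar>k s\<bar> \<le> C" for k C
  proof -
   have "L1 (\<lambda>s. k s * \<Lambda> s)" using that by (intro integrable_bounded_mult[where C=C] \<Lambda>) auto
   thus ?thesis by (simp add: mult.commute)
  qed
  have \<kappa>N: "\<kappa> s \<le> N / c" for s
   unfolding \<kappa>_def using mult_left_mono[OF E(2) N0, of s] c by (simp add: divide_right_mono)
  have [measurable]: "\<kappa> \<in> Borel" unfolding \<kappa>_def by measurable
  define Z where "Z s = X s - Y s" for s
  have [measurable]: "Z \<in> Borel" unfolding Z_def by measurable
  have ZS: "Z s \<le> S" for s using X(3)[of s] Y(1)[of s] by (simp add: Z_def)
  define k where "k s = \<kappa> s * X s + B * Y s" for s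
  have k_bd: "\<bar>k s\<bar> \<le> N / c * S + B" for s
  proof -
   have "\<kappa> s * X s \<le> N / c * S" using \<kappa>N \<kappa>0 X(2,3) N0 c by (intro mult_mono) auto
   moreover have "B * Y s \<le> B * 1" using Y B by (intro mult_left_mono)
   moreover have "0 \<le> k s" using \<kappa>0 X(2) B Y by (simp add: k_def)
   ultimately show ?thesis by (simp add: k_def)
  qed
  have [measurable]: "k \<in> Borel" unfolding k_def by measurable
  have ik: "L1 (\<lambda>s. \<Lambda> s * k s)" by (rule ibd[OF _ k_bd]) measurable
  have igY: "L1 (\<lambda>s. g s * Y s)"
  proof -
   have "L1 (\<lambda>s. Y s * g s)" using Y by (intro integrable_bounded_mult[where C=1] ig) auto
   thus ?thesis by (simp add: mult.commute)
  qed
  have iZ: "L1 (\<lambda>s. (\<Lambda> s * \<kappa> s) * max 0 (Z s))"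
  proof -
   have "\<bar>\<kappa> s * max 0 (Z s)\<bar> \<le> N / c * S" for s unfolding abs_mult using \<kappa>N \<kappa>0 ZS S N0 c by (intro mult_mono) auto
   hence "L1 (\<lambda>s. \<Lambda> s * (\<kappa> s * max 0 (Z s)))" by (intro ibd) measurable
   thus ?thesis by (simp add: mult.assoc)
  qed
  have "AE t\<in>{0<..<T} in lborel. Z t \<le> 0"
  proof (rule gronwall_primitive[where \<mu>="\<lambda>s. \<Lambda> s * \<kappa> s" and S=S])
   show "L1 (\<lambda>s. \<Lambda> s * \<kappa> s)" using \<kappa>N \<kappa>0 by (intro ibd[where C="N / c"]) auto
   show "AE t\<in>{0<..<T} in lborel. Z t \<le> primitive (\<lambda>s. \<Lambda> s * \<kappa> s * max 0 (Z s)) t" using le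
   proof eventually_elim
    case (elim t)
    show ?case
    proof
     assume t: "t \<in> {0<..<T}"
     have "X t \<le> primitive h t" using elim t by simp
     also have "\<dots> \<le> primitive (\<lambda>s. \<Lambda> s * k s) t"
     proof (rule primitive_mono[OF h ik])
      show "AE s in lborel. s \<in> {0<..<t} --> h s \<le> \<Lambda> s * k s" using hle
      proof eventually_elim
       case (elim s)
       have "h s \<le> \<Lambda> s * (\<kappa> s * X s + B * exp (- c * \<kappa> s))" if "s \<in> {0<..<t}" using elim that t \<kappa>0[of s] by auto
       thus ?case unfolding \<kappa>Y k_def by blast
      qed
     qed
     finally have "Z t \<le> primitive (\<lambda>s. \<Lambda> s * k s) t - primitive (\<lambda>s. g s * Y s) t"
      unfolding Z_def Y_eq[of t] using exp_ge_zero[of "- N"] by linarith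
     also have "\<dots> = primitive (\<lambda>s. \<Lambda> s * k s - g s * Y s) t"
      using primitive_integrable[OF ik, of t] primitive_integrable[OF igY, of t]
      unfolding primitive_def by (simp add: right_diff_distrib)
     also have "\<dots> \<le> primitive (\<lambda>s. \<Lambda> s * \<kappa> s * max 0 (Z s)) t"
     proof (rule primitive_mono[OF L1_diff[OF ik igY] iZ], intro AE_I2 impI)
      fix s
      define d where "d = 1 / c"
      have "\<Lambda> s * k s - g s * Y s = \<Lambda> s * (\<kappa> s * Z s) - \<Lambda> s * Y s * (N * E s - B)"
       by (simp add: k_def g_def Z_def \<kappa>_def \<theta>_def d_def[symmetric] algebra_simps)
      also have "\<dots> \<le> \<Lambda> s * (\<kappa> s * Z s)" using \<Lambda>(2) Y NE by simp
      also have "\<dots> \<le> \<Lambda> s * (\<kappa> s * max 0 (Z s))" using \<Lambda>(2) \<kappa>0 by (intro mult_left_mono) auto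
      finally show "\<Lambda> s * k s - g s * Y s \<le> \<Lambda> s * \<kappa> s * max 0 (Z s)" by (simp add: mult.assoc)
     qed
     finally show "Z t \<le> primitive (\<lambda>s. \<Lambda> s * \<kappa> s * max 0 (Z s)) t" .
    qed
   qed
  qed (use \<Lambda> \<kappa>0 ZS in auto)
  thus ?thesis
  proof eventually_elim
   case (elim t)
   have "Y t \<le> exp (- N * exp (- \<theta> * L))" unfolding Y_def using mult_left_mono[OF E(3) N0, of t] by simp
   thus ?case using elim by (auto simp: Z_def)
  qed
 qed
 define n0 where "n0 = nat \<lceil>B * exp (\<theta> * L)\<rceil>"
 have "AE t in lborel. \<forall>n. t \<in> {0<..<T} --> X t \<le> exp (- real (n + n0) * exp (- \<theta> * L))" unfolding AE_all_countable
 proof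
  fix n
  have "B * exp (\<theta> * L) \<le> real (n + n0)" unfolding n0_def by linarith
  from main[OF this] show "AE t\<in>{0<..<T} in lborel. X t \<le> exp (- real (n + n0) * exp (- \<theta> * L))" .
 qed
 thus ?thesis
 proof eventually_elim
  case (elim t)
  show ?case
  proof
   assume t: "t \<in> {0<..<T}"
   have "filterlim (\<lambda>n. real (n + n0)) at_top sequentially"
    by (rule filterlim_compose[OF filterlim_real_sequentially]) (rule filterlim_add_const_nat_at_top)
   hence "filterlim (\<lambda>n. - (real (n + n0) * exp (- \<theta> * L))) at_bot sequentially"
    by (simp add: filterlim_uminus_at_bot filterlim_at_top_mult_tendsto_pos[OF tendsto_const])
   from filterlim_compose[OF exp_at_bot this] have "(\<lambda>n. exp (- real (n + n0) * exp (- \<theta> * L))) \<longlonglongrightarrow> 0" by (simp only: mult_minus_left)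
   hence "X t \<le> 0" by (rule LIMSEQ_le_const) (use elim t in auto)
   thus "X t = 0" using X(2)[of t] by simp
  qed
 qed
qed


lemma cutoff_family:
 obtains C :: real and \<psi> :: "nat => 'a::euclidean_space => real" where "C > 0"
  "\<And>k. k \<ge> 1 ==> \<psi> k \<in> test_functions" "\<And>k x. 0 \<le> \<psi> k x" "\<And>k x. \<psi> k x \<le> 1"
  "\<And>k x. k \<ge> 1 ==> norm x \<le> k ==> \<psi> k x = 1"
  "\<And>k x. k \<ge> 1 ==> norm (gradient (\<psi> k) x) \<le> C * (if norm x < k then 0 else 1 / (1 + norm x))"
proof -
 obtain \<zeta> :: "'a => real" where \<zeta>: "\<zeta> \<in> test_functions" "\<And>x. 0 \<le> \<zeta> x" "\<And>x. \<zeta> x \<le> 1"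
  "\<And>x. norm x \<le> 1 ==> \<zeta> x = 1" "\<And>x. norm x > 2 ==> \<zeta> x = 0" by (rule cutoff_exists) blast
 obtain C where C: "C > 0" "\<And>x. norm (gradient \<zeta> x) \<le> C" using gradient_bounded[OF \<zeta>(1)] by metis
 have g0: "gradient \<zeta> y = 0" if "norm y < 1" for y
 proof (rule gradient_eqI)
  have "((\<lambda>x. 1) has_derivative (\<lambda>v. 0 \<bullet> v)) (at y)" by simp
  thus "(\<zeta> has_derivative (\<lambda>v. 0 \<bullet> v)) (at y)"
   by (rule has_derivative_transform_within_open[of _ _ _ _ "ball 0 1"]) (use that \<zeta>(4) in auto)
 qed
 define \<psi> where "\<psi> k x = \<zeta> (0 + (1 / real k) *\<^sub>R x)" for k :: nat and x :: 'a
 show ?thesis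
 proof (rule that[of "3 * C" \<psi>])
  fix k :: nat and x :: 'a assume k: "k \<ge> 1"
  show "\<psi> k \<in> test_functions" unfolding \<psi>_def[abs_def] using k by (intro test_affine \<zeta>) simp
  show "\<psi> k x = 1" if "norm x \<le> k" using that k \<zeta>(4) by (simp add: \<psi>_def)
  have g: "gradient (\<psi> k) x = (1 / real k) *\<^sub>R gradient \<zeta> ((1 / real k) *\<^sub>R x)"
   using gradient_affine[OF \<zeta>(1), of 0 "1 / real k" x] by (simp add: \<psi>_def[abs_def])
  show "norm (gradient (\<psi> k) x) \<le> 3 * C * (if norm x < k then 0 else 1 / (1 + norm x))"
  proof (cases "k \<le> norm x \<and> norm x \<le> 2 * k")
   case True
   have "norm (gradient (\<psi> k) x) \<le> (1 / real k) * C" unfolding g using C(2) k by (simp add: divide_right_mono)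
   also have "1 / real k \<le> 3 / (1 + norm x)" using True k by (simp add: field_simps)
   finally show ?thesis using True C(1) by (simp add: mult_right_mono)
  next
   case False
   hence "gradient (\<psi> k) x = 0"
   proof (cases "norm x < k")
    case True
    hence "norm ((1 / real k) *\<^sub>R x) < 1" using k by simp
    from g0[OF this] show ?thesis unfolding g by simp
   next
    case x: False
    hence "norm ((1 / real k) *\<^sub>R x) > 2" using k False by (simp add: field_simps)
    from gradient_support[OF \<zeta>(1,5) this] show ?thesis unfolding g by simp
   qed
   thus ?thesis using C by simp
  qed
 qed (use C \<zeta> in \<open>auto simp: \<psi>_def\<close>)
qed

context transport_field_W11
begin

lemma energy_inequality:
 assumes w[measurable]: "w \<in> Borel" and wM: "\<And>p. \<bar>w p\<bar> \<le> M"
  and sol: "\<And>\<phi>. \<phi> \<in> ST T ==> (LBINT p. w p * Lop \<phi> p) = 0"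
  and D0: "AE p in lborel. fst p \<in> {0<..<T} --> R \<le> norm (snd p) --> D p = 0"
  and growth: "L1 (\<lambda>p. ind {0<..<T} (fst p) * (norm (b p) / (1 + norm (snd p))))"
 defines "H \<equiv> \<lambda>p. ind ({0<..<T} \<times> ball 0 R) p * (\<bar>D p\<bar> * (w p)\<^sup>2)"
 shows "L1 H"
  and "AE t\<in>{0<..<T} in lborel. (LBINT x. ind (cball 0 r) x * (w (t, x))\<^sup>2) \<le> primitive (\<lambda>s. LBINT x. H (s, x)) t"
proof -
 have M: "M \<ge> 0" using wM[of 0] by linarith
 have w2: "(w p)\<^sup>2 \<le> M\<^sup>2" for p using wM[of p] M by (simp add: abs_le_square_iff[symmetric])
 have H0: "H p \<ge> 0" for p by (simp add: H_def)
 show iH: "L1 H"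
 proof -
  have "L1 (\<lambda>p. (ind ({0<..<T} \<times> ball 0 R) p * (w p)\<^sup>2) * \<bar>cyl T R p * D p\<bar>)"
   using w2 by (intro integrable_bounded_mult[where C="M\<^sup>2"] integrable_abs D_int) (auto simp: indicator_def)
  moreover have "(\<lambda>p. (ind ({0<..<T} \<times> ball 0 R) p * (w p)\<^sup>2) * \<bar>cyl T R p * D p\<bar>) = H"
   by (rule ext) (auto simp: H_def indicator_def)
  ultimately show ?thesis by (simp only:)
 qed
 obtain C :: real and \<psi> :: "nat => 'a => real" where C: "C > 0" and \<psi>:
  "\<And>k. k \<ge> 1 ==> \<psi> k \<in> test_functions" "\<And>k x. 0 \<le> \<psi> k x" "\<And>k x. \<psi> k x \<le> 1"
  "\<And>k x. k \<ge> 1 ==> norm x \<le> k ==> \<psi> k x = 1"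
  "\<And>k x. k \<ge> 1 ==> norm (gradient (\<psi> k) x) \<le> C * (if norm x < k then 0 else 1 / (1 + norm x))"
  by (rule cutoff_family) blast
 define B where "B p = C * M\<^sup>2 * (ind {0<..<T} (fst p) * (norm (b p) / (1 + norm (snd p))))" for p
 have iB: "L1 B" unfolding B_def by (intro integrable_mult_right growth)
 have B0: "B p \<ge> 0" for p using C by (simp add: B_def)
 have [measurable]: "B \<in> Borel" using iB by auto
 define Bk where "Bk k p = (if norm (snd p) < real k then 0 else 1) * B p" for k p
 have iBk: "L1 (Bk k)" for k unfolding Bk_def by (rule integrable_bounded_mult[where C=1, OF iB]) auto
 have Bk0: "Bk k p \<ge> 0" for k p using B0 by (simp add: Bk_def)
 have lim: "(\<lambda>k. LBINT p. Bk k p) \<longlonglongrightarrow> (\<integral>p. 0 \<partial>(lborel :: (real \<times> 'a) measure))"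
 proof (rule integral_dominated_convergence[where w=B])
  show "AE p in lborel. (\<lambda>k. Bk k p) \<longlonglongrightarrow> 0"
  proof (intro AE_I2 tendsto_eventually)
   fix p :: "real \<times> 'a"
   obtain n :: nat where "norm (snd p) < real n" using reals_Archimedean2 by blast
   thus "\<forall>\<^sub>F k in sequentially. Bk k p = 0" by (intro eventually_sequentiallyI[of n]) (auto simp: Bk_def)
  qed
  show "AE p in lborel. norm (Bk k p) \<le> B p" for k using B0 by (auto simp: Bk_def)
  show "Bk k \<in> borel_measurable lborel" for k using iBk by auto
 qed (use iB in auto)
 have key: "AE t in lborel. \<forall>k. t \<in> {0<..<T} --> k \<ge> 1 --> (LBINT x. (w (t, x))\<^sup>2 * \<psi> k x)
   = (LBINT p. ind {0<..<t} (fst p) * ((D p * \<psi> k (snd p) + b p \<bullet> gradient (\<psi> k) (snd p)) * (w p)\<^sup>2))"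
  unfolding AE_all_countable
 proof
  fix k
  show "AE t\<in>{0<..<T} in lborel. k \<ge> 1 --> (LBINT x. (w (t, x))\<^sup>2 * \<psi> k x)
   = (LBINT p. ind {0<..<t} (fst p) * ((D p * \<psi> k (snd p) + b p \<bullet> gradient (\<psi> k) (snd p)) * (w p)\<^sup>2))"
  proof (cases "k \<ge> 1")
   case True
   from energy_identity[OF w wM sol \<psi>(1)[OF this]] show ?thesis by auto
  qed auto
 qed
 thus "AE t\<in>{0<..<T} in lborel. (LBINT x. ind (cball 0 r) x * (w (t, x))\<^sup>2) \<le> primitive (\<lambda>s. LBINT x. H (s, x)) t"
 proof eventually_elim
  case (elim t)
  show ?case
  proof
   assume t: "t \<in> {0<..<T}"
   have iHt: "L1 (\<lambda>p. ind {0<..<t} (fst p) * H p)"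
    by (rule integrable_bounded_mult[where C=1, OF iH]) (auto simp: indicator_def)
   have Hprim: "(LBINT p. ind {0<..<t} (fst p) * H p) = primitive (\<lambda>s. LBINT x. H (s, x)) t"
    by (subst lborel_Fubini(1)[OF iHt]) (simp add: primitive_def)
   obtain k0 :: nat where k0: "max (max r R) 1 \<le> real k0" using real_arch_simple by blast
   have bound: "(LBINT x. ind (cball 0 r) x * (w (t, x))\<^sup>2) \<le> primitive (\<lambda>s. LBINT x. H (s, x)) t + (LBINT p. Bk k p)"
    if k: "k \<ge> k0" for k
   proof -
    have k1: "k \<ge> 1" "r \<le> real k" "R \<le> real k" using k k0 by auto
    have "(LBINT x. ind (cball 0 r) x * (w (t, x))\<^sup>2) \<le> (LBINT x. (w (t, x))\<^sup>2 * \<psi> k x)"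
    proof (rule integral_mono')
     have [measurable]: "\<psi> k \<in> Borel" using \<psi>(1)[OF k1(1)] by auto
     show "L1 (\<lambda>x. (w (t, x))\<^sup>2 * \<psi> k x)"
      using w2 by (intro integrable_bounded_mult[where C="M\<^sup>2"] test_integrable \<psi> k1) auto
     show "ind (cball 0 r) x * (w (t, x))\<^sup>2 \<le> (w (t, x))\<^sup>2 * \<psi> k x" for x
      using \<psi>(4)[OF k1(1), of x] \<psi>(2)[of k x] k1 by (auto simp: indicator_def)
     show "0 \<le> (w (t, x))\<^sup>2 * \<psi> k x" for x using \<psi>(2) by simp
    qed
    also have "\<dots> = (LBINT p. ind {0<..<t} (fst p) * ((D p * \<psi> k (snd p) + b p \<bullet> gradient (\<psi> k) (snd p)) * (w p)\<^sup>2))"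
     using elim t k1 by blast
    also have "\<dots> \<le> (LBINT p. ind {0<..<t} (fst p) * H p + Bk k p)"
    proof (rule Bochner_Integration.integral_mono_AE')
     show "L1 (\<lambda>p. ind {0<..<t} (fst p) * H p + Bk k p)" using iHt iBk by simp
     show "AE p in lborel. 0 \<le> ind {0<..<t} (fst p) * H p + Bk k p" using H0 Bk0 by auto
     show "AE p in lborel. ind {0<..<t} (fst p) * ((D p * \<psi> k (snd p) + b p \<bullet> gradient (\<psi> k) (snd p)) * (w p)\<^sup>2)
       \<le> ind {0<..<t} (fst p) * H p + Bk k p" using D0
     proof eventually_elim
      case (elim p)
      show ?case
      proof (cases "fst p \<in> {0<..<t}")
       case True
       hence T: "fst p \<in> {0<..<T}" using t by auto
       have 1: "D p * \<psi> k (snd p) * (w p)\<^sup>2 \<le> H p"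
       proof (cases "R \<le> norm (snd p)")
        case False
        hence "H p = \<bar>D p\<bar> * (w p)\<^sup>2" using T by (cases p) (auto simp: H_def)
        moreover have "D p * \<psi> k (snd p) \<le> \<bar>D p\<bar> * 1"
         using mult_left_mono[OF \<psi>(3), of "\<bar>D p\<bar>" k "snd p"] \<psi>(2)[of k "snd p"] abs_ge_self[of "D p * \<psi> k (snd p)"]
         by (simp add: abs_mult)
        ultimately show ?thesis using mult_right_mono[of "D p * \<psi> k (snd p)" "\<bar>D p\<bar>" "(w p)\<^sup>2"] by simp
       qed (use elim T H0 in auto)
       have "(b p \<bullet> gradient (\<psi> k) (snd p)) \<le> norm (b p) * (C * (if norm (snd p) < k then 0 else 1 / (1 + norm (snd p))))"
        using \<psi>(5)[OF k1(1)] by (intro order_trans[OF norm_cauchy_schwarz] mult_left_mono) auto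
       hence "(b p \<bullet> gradient (\<psi> k) (snd p)) * (w p)\<^sup>2 \<le> (norm (b p) * (C * (if norm (snd p) < k then 0 else 1 / (1 + norm (snd p))))) * M\<^sup>2"
        using C by (intro order_trans[OF mult_right_mono mult_left_mono[OF w2]]) auto
       also have "\<dots> = Bk k p" using T by (simp add: Bk_def B_def)
       finally show ?thesis using 1 True by (simp add: distrib_right)
      qed (use Bk0 in simp)
     qed
    qed
    also have "\<dots> = primitive (\<lambda>s. LBINT x. H (s, x)) t + (LBINT p. Bk k p)"
     unfolding Hprim[symmetric] by (rule int_add[OF iHt iBk])
    finally show ?thesis .
   qed
   have "(\<lambda>k. primitive (\<lambda>s. LBINT x. H (s, x)) t + (LBINT p. Bk k p)) \<longlonglongrightarrow> primitive (\<lambda>s. LBINT x. H (s, x)) t + 0"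
    using lim by (intro tendsto_add tendsto_const) simp
   hence "(LBINT x. ind (cball 0 r) x * (w (t, x))\<^sup>2) \<le> primitive (\<lambda>s. LBINT x. H (s, x)) t + 0"
    by (rule LIMSEQ_le_const) (use bound in auto)
   thus "(LBINT x. ind (cball 0 r) x * (w (t, x))\<^sup>2) \<le> primitive (\<lambda>s. LBINT x. H (s, x)) t" by simp
  qed
 qed
qed

theorem homogeneous_solution_zero:
 assumes w[measurable]: "w \<in> Borel" and wM: "\<And>p. \<bar>w p\<bar> \<le> M"
  and sol: "\<And>\<phi>. \<phi> \<in> ST T ==> (LBINT p. w p * Lop \<phi> p) = 0"
  and D0: "AE p in lborel. fst p \<in> {0<..<T} --> R \<le> norm (snd p) --> D p = 0"
  and growth: "L1 (\<lambda>p. ind {0<..<T} (fst p) * (norm (b p) / (1 + norm (snd p))))"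
  and \<Lambda>: "L1 \<Lambda>" "\<And>s. \<Lambda> s \<ge> 0" and c: "c > 0"
  and expint: "AE s\<in>{0<..<T} in lborel. \<Lambda> s > 0 \<and> (NNBINT x. ind (ball 0 R) x * ennreal (exp (c * \<bar>D (s, x)\<bar> / \<Lambda> s))) \<le> ennreal A"
 shows "AE p in lborel. fst p \<in> {0<..<T} --> w p = 0"
proof -
 have M: "M \<ge> 0" using wM[of 0] by linarith
 have w2: "(w p)\<^sup>2 \<le> M\<^sup>2" for p using wM[of p] M by (simp add: abs_le_square_iff[symmetric])
 define H where "H p = ind ({0<..<T} \<times> ball 0 R) p * (\<bar>D p\<bar> * (w p)\<^sup>2)" for p
 define h where "h s = (LBINT x. H (s, x))" for s
 have iH: "L1 H" unfolding H_def by (rule energy_inequality(1)[OF w wM sol D0 growth])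
 have energy: "AE t\<in>{0<..<T} in lborel. (LBINT x. ind (cball 0 r) x * (w (t, x))\<^sup>2) \<le> primitive h t" for r
  unfolding H_def h_def by (rule energy_inequality(2)[OF w wM sol D0 growth])
 have ih: "L1 h" unfolding h_def by (rule lborel_Fubini(4)[OF iH])
 have [measurable]: "ball (0::'a) R \<in> sets borel" by simp
 define X where "X s = (LBINT x. ind (ball 0 R) x * (w (s, x))\<^sup>2)" for s
 have [measurable]: "X \<in> Borel" unfolding X_def by measurable
 have iX: "L1 (\<lambda>x. ind (ball 0 R) x * (w (s, x))\<^sup>2)" for s
  using w2 by (intro integrable_bounded_support[where r=R and C="M\<^sup>2"]) (auto simp: indicator_def)
 have X0: "0 \<le> X s" for s unfolding X_def by (intro integral_nonneg_AE) auto
 define S where "S = (LBINT x. ind (ball (0::'a) R) x * M\<^sup>2)"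
 have XS: "X s \<le> S" for s unfolding X_def S_def
 proof (rule integral_mono[OF iX])
  show "L1 (\<lambda>x. ind (ball (0::'a) R) x * M\<^sup>2)"
   by (intro integrable_bounded_support[where r=R and C="M\<^sup>2"]) (auto simp: indicator_def)
 qed (use w2 in \<open>auto intro: mult_left_mono\<close>)
 define B where "B = M\<^sup>2 * (2 / c) * max 0 A"
 have hle: "AE s\<in>{0<..<T} in lborel. (\<forall>K\<ge>0. h s \<le> \<Lambda> s * (K * X s + B * exp (- (c / 2) * K)))" using expint
 proof eventually_elim
  case (elim s)
  show ?case
  proof (intro impI allI)
   fix K :: real assume s: "s \<in> {0<..<T}" and K: "K \<ge> 0"
   define q where "q x = ind (ball 0 R) x * exp (c * \<bar>D (s, x)\<bar> / \<Lambda> s)" for x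
   have [measurable]: "q \<in> Borel" unfolding q_def by measurable
   have qle: "(NNBINT x. ennreal (q x)) \<le> ennreal (max 0 A)"
   proof -
    have "(NNBINT x. ennreal (q x)) = (NNBINT x. ind (ball 0 R) x * ennreal (exp (c * \<bar>D (s, x)\<bar> / \<Lambda> s)))"
     by (intro nn_integral_cong) (auto simp: q_def indicator_def)
    also have "\<dots> \<le> ennreal A" using elim s by blast
    also have "\<dots> \<le> ennreal (max 0 A)" by (intro ennreal_leI) simp
    finally show ?thesis .
   qed
   have q0: "q x \<ge> 0" for x by (simp add: q_def)
   have iq: "L1 q" using le_less_trans[OF qle] q0 by (intro integrableI_bounded) auto
   have qA: "(LBINT x. q x) \<le> max 0 A" using qle q0 nn_integral_eq_integral[OF iq] by (simp add: ennreal_le_iff)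
   have L: "\<Lambda> s > 0" using elim s by blast
   have pt: "H (s, x) \<le> \<Lambda> s * K * (ind (ball 0 R) x * (w (s, x))\<^sup>2) + \<Lambda> s * (M\<^sup>2 * (2 / c) * exp (- (c / 2) * K)) * q x" for x
   proof (cases "x \<in> ball 0 R")
    case True
    define y where "y = \<bar>D (s, x)\<bar> / \<Lambda> s"
    have Dy: "\<bar>D (s, x)\<bar> = \<Lambda> s * y" using L by (simp add: y_def)
    have y0: "y \<ge> 0" using L by (simp add: y_def)
    have "y * (w (s, x))\<^sup>2 \<le> K * (w (s, x))\<^sup>2 + M\<^sup>2 * (2 / c) * exp (- (c / 2) * K) * exp (c * y)"
    proof (cases "y \<le> K")
     case True
     hence "y * (w (s, x))\<^sup>2 \<le> K * (w (s, x))\<^sup>2" by (rule mult_right_mono) simp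
     moreover have "0 \<le> M\<^sup>2 * (2 / c) * exp (- (c / 2) * K) * exp (c * y)" using c by simp
     ultimately show ?thesis by linarith
    next
     case False
     have "c / 2 * y \<le> exp (c / 2 * y)" using exp_ge_add_one_self[of "c / 2 * y"] by linarith
     also have "exp (c / 2 * y) \<le> exp (- (c / 2) * K + c * y)" using False c by (simp add: field_simps)
     finally have "y \<le> (2 / c) * (exp (- (c / 2) * K) * exp (c * y))" using c by (simp add: field_simps flip: exp_add)
     hence "y * (w (s, x))\<^sup>2 \<le> (2 / c) * (exp (- (c / 2) * K) * exp (c * y)) * M\<^sup>2"
      using w2 c by (intro mult_mono) auto
     moreover have "0 \<le> K * (w (s, x))\<^sup>2" using K by simp
     ultimately show ?thesis by (simp add: ac_simps)
    qed
    from mult_left_mono[OF this less_imp_le[OF L]] show ?thesis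
     using s True by (simp add: H_def q_def Dy algebra_simps)
   next
    case False
    thus ?thesis by (simp add: H_def q_def)
   qed
   have "h s \<le> (LBINT x. \<Lambda> s * K * (ind (ball 0 R) x * (w (s, x))\<^sup>2) + \<Lambda> s * (M\<^sup>2 * (2 / c) * exp (- (c / 2) * K)) * q x)"
    unfolding h_def
   proof (rule integral_mono')
    show "L1 (\<lambda>x. \<Lambda> s * K * (ind (ball 0 R) x * (w (s, x))\<^sup>2) + \<Lambda> s * (M\<^sup>2 * (2 / c) * exp (- (c / 2) * K)) * q x)"
     using iX[of s] iq by (intro L1_add integrable_mult_right)
    show "0 \<le> \<Lambda> s * K * (ind (ball 0 R) x * (w (s, x))\<^sup>2) + \<Lambda> s * (M\<^sup>2 * (2 / c) * exp (- (c / 2) * K)) * q x" for x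
     using L K c q0 by (intro add_nonneg_nonneg mult_nonneg_nonneg) auto
   qed (rule pt)
   also have "\<dots> = \<Lambda> s * K * X s + \<Lambda> s * (M\<^sup>2 * (2 / c) * exp (- (c / 2) * K)) * (LBINT x. q x)"
    unfolding X_def using iX[of s] iq by (subst int_add) auto
   also have "\<dots> \<le> \<Lambda> s * K * X s + \<Lambda> s * (M\<^sup>2 * (2 / c) * exp (- (c / 2) * K)) * max 0 A"
    using L c qA by (intro add_left_mono mult_left_mono) auto
   finally show "h s \<le> \<Lambda> s * (K * X s + B * exp (- (c / 2) * K))" by (simp add: B_def algebra_simps)
  qed
 qed
 have Xle: "AE t\<in>{0<..<T} in lborel. X t \<le> primitive h t" using energy[of R]
 proof eventually_elim
  case (elim t)
  have "X t \<le> (LBINT x. ind (cball 0 R) x * (w (t, x))\<^sup>2)" unfolding X_def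
  proof (rule integral_mono[OF iX])
   show "L1 (\<lambda>x. ind (cball 0 R) x * (w (t, x))\<^sup>2)"
    using w2 by (intro integrable_bounded_support[where r=R and C="M\<^sup>2"]) (auto simp: indicator_def)
  qed (auto simp: indicator_def)
  thus ?case using elim by auto
 qed
 have "AE t\<in>{0<..<T} in lborel. X t = 0"
  by (rule osgood_uniqueness[OF _ X0 XS ih \<Lambda> _ _ Xle hle]) (use c in \<open>auto simp: B_def\<close>)
 hence h0: "AE s\<in>{0<..<T} in lborel. h s \<le> 0" using hle
 proof eventually_elim
  case (elim s)
  show ?case
  proof
   assume s: "s \<in> {0<..<T}"
   have "(\<lambda>n. \<Lambda> s * (B * exp (- (c / 2) * real n))) \<longlonglongrightarrow> \<Lambda> s * (B * 0)"
   proof (intro tendsto_mult tendsto_const)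
    have "filterlim (\<lambda>n. - (real n * (c / 2))) at_bot sequentially" unfolding filterlim_uminus_at_bot minus_minus
     by (rule filterlim_at_top_mult_tendsto_pos[OF tendsto_const]) (use c filterlim_real_sequentially in auto)
    from filterlim_compose[OF exp_at_bot this] show "(\<lambda>n. exp (- (c / 2) * real n)) \<longlonglongrightarrow> 0" by (simp add: mult.commute)
   qed
   hence "h s \<le> \<Lambda> s * (B * 0)" by (rule LIMSEQ_le_const) (use elim s in force)
   thus "h s \<le> 0" by simp
  qed
 qed
 have "AE t in lborel. \<forall>n. t \<in> {0<..<T} --> (LBINT x. ind (cball 0 (real n)) x * (w (t, x))\<^sup>2) \<le> primitive h t"
  unfolding AE_all_countable using energy by blast
 hence "AE t in lborel. AE x in lborel. t \<in> {0<..<T} --> w (t, x) = 0"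
 proof eventually_elim
  fix t assume le: "\<forall>n. t \<in> {0<..<T} --> (LBINT x. ind (cball 0 (real n)) x * (w (t, x))\<^sup>2) \<le> primitive h t"
  show "AE x in lborel. t \<in> {0<..<T} --> w (t, x) = 0"
  proof (cases "t \<in> {0<..<T}")
   case t: True
   have p0: "primitive h t \<le> 0"
   proof -
    have "primitive h t \<le> primitive (\<lambda>_. 0) t"
     by (rule primitive_mono[OF ih]) (use h0 t in \<open>auto elim!: eventually_mono\<close>)
    thus ?thesis by (simp add: primitive_def)
   qed
   have "AE x in lborel. \<forall>n. ind (cball 0 (real n)) x * (w (t, x))\<^sup>2 = 0" unfolding AE_all_countable
   proof
    fix n
    have i: "L1 (\<lambda>x. ind (cball 0 (real n)) x * (w (t, x))\<^sup>2)"
     using w2 by (intro integrable_bounded_support[where r="real n" and C="M\<^sup>2"]) (auto simp: indicator_def)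
    have "(LBINT x. ind (cball 0 (real n)) x * (w (t, x))\<^sup>2) \<ge> 0" by (intro integral_nonneg_AE) auto
    hence "(LBINT x. ind (cball 0 (real n)) x * (w (t, x))\<^sup>2) = 0"
     using order_trans[OF le[rule_format, OF t] p0, of n] by linarith
    thus "AE x in lborel. ind (cball 0 (real n)) x * (w (t, x))\<^sup>2 = 0"
     by (subst (asm) integral_nonneg_eq_0_iff_AE[OF i]) auto
   qed
   thus ?thesis
   proof eventually_elim
    case (elim x)
    obtain n :: nat where "norm x \<le> real n" using real_arch_simple by blast
    thus ?case using elim[rule_format, of n] by simp
   qed
  qed auto
 qed
 thus ?thesis by (intro AE_lborel_pairI) (auto simp del: greaterThanLessThan_iff)
qed

end


lemma lebesgue_representative:
 fixes f g :: "'a::euclidean_space => 'b::euclidean_space"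
 assumes g: "g \<in> Borel" and eq: "AE x in lborel. f x = g x"
 shows "f \<in> borel_measurable lebesgue" "(\<integral>x. f x \<partial>lebesgue) = (LBINT x. g x)" "integrable lebesgue f \<longleftrightarrow> L1 g"
proof -
 have eq': "AE x in lebesgue. f x = g x" using eq by (rule AE_completion)
 have g': "g \<in> borel_measurable lebesgue" using g by (auto intro: measurable_completion)
 show f: "f \<in> borel_measurable lebesgue"
 proof (rule measurableI)
  fix A :: "'b set" assume A: "A \<in> sets borel"
  show "f -` A \<inter> space lebesgue \<in> sets lebesgue"
  proof (rule completion.in_sets_AE)
   show "AE x in lebesgue. x \<in> g -` A \<inter> space lebesgue \<longleftrightarrow> x \<in> f -` A \<inter> space lebesgue"
    using eq' by eventually_elim auto
   show "g -` A \<inter> space lebesgue \<in> sets lebesgue" by (rule measurable_sets[OF g' A])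
  qed auto
 qed simp
 show "(\<integral>x. f x \<partial>lebesgue) = (LBINT x. g x)"
  using integral_cong_AE[OF f g' eq'] integral_completion[of g lborel] g by simp
 show "integrable lebesgue f \<longleftrightarrow> L1 g"
  using integrable_cong_AE[OF f g' eq'] integrable_completion[of g lborel] g by simp
qed

lemma borel_representative:
 fixes f :: "'a::euclidean_space => 'b::euclidean_space"
 assumes f: "f \<in> borel_measurable lebesgue"
 obtains g where "g \<in> Borel" "AE x in lborel. f x = g x"
proof -
 have "\<exists>g. g \<in> borel_measurable lborel \<and> (AE x in lborel. f x \<bullet> i = g x)" for i
  using completion_ex_borel_measurable_real[of "\<lambda>x. f x \<bullet> i" lborel] f by auto
 then obtain g where g: "\<And>i. g i \<in> borel_measurable lborel" "\<And>i. AE x in lborel. f x \<bullet> i = g i x" by metis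
 have "AE x in lborel. \<forall>i\<in>Basis. f x \<bullet> i = g i x" using g(2) by (intro AE_finite_allI) auto
 hence "AE x in lborel. f x = (\<Sum>i\<in>Basis. g i x *\<^sub>R i)" by eventually_elim (auto simp: euclidean_eq_iff[where 'a='b])
 moreover have "(\<lambda>x. \<Sum>i\<in>Basis. g i x *\<^sub>R i) \<in> Borel"
  using g(1) by (intro borel_measurable_sum borel_measurable_scaleR) auto
 ultimately show ?thesis by (rule that[rotated])
qed

lemma slab_borel: "slab T \<in> sets borel" unfolding slab_def by (intro borel_open open_Times) auto

lemma slab_lebesgue: "(slab T :: (real \<times> 'a::euclidean_space) set) \<inter> space lebesgue \<in> sets lebesgue"
 by (simp add: sets_completionI_sets slab_borel)

lemma AE_lebesgue_on_slab:
 "(AE p in lebesgue_on (slab T). P p) \<longleftrightarrow> (AE p in lborel. fst p \<in> {0<..<T} --> P p)"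
 unfolding AE_restrict_space_iff[OF slab_lebesgue] AE_completion_iff by (simp add: slab_def mem_Times_iff)

lemma AE_lebesgue_on_interval:
 "(AE t in lebesgue_on {0<..<T::real}. P t) \<longleftrightarrow> (AE t\<in>{0<..<T} in lborel. P t)"
 by (subst AE_restrict_space_iff) (auto simp: AE_completion_iff)

lemma slab_representative:
 fixes f :: "real => 'a::euclidean_space => 'b::euclidean_space"
 assumes f: "(\<lambda>(t, x). f t x) \<in> borel_measurable (lebesgue_on (slab T))"
 obtains g where "g \<in> Borel"
  "AE p in lborel. fst p \<in> {0<..<T} --> f (fst p) (snd p) = g p"
  "AE t\<in>{0<..<T} in lborel. (AE x in lborel. f t x = g (t, x))"
proof -
 from iffD1[OF borel_measurable_restrict_space_iff[OF slab_lebesgue] f]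
 obtain g where g: "g \<in> Borel" "AE p in lborel. ind (slab T) p *\<^sub>R (case p of (t, x) => f t x) = g p"
  by (rule borel_representative)
 have 1: "AE p in lborel. fst p \<in> {0<..<T} --> f (fst p) (snd p) = g p"
  using g(2) by eventually_elim (auto simp: slab_def indicator_def)
 show ?thesis
 proof (rule that[OF g(1) 1])
  show "AE t\<in>{0<..<T} in lborel. (AE x in lborel. f t x = g (t, x))"
   using AE_lborel_pairD[OF 1] by eventually_elim auto
 qed
qed

lemma L1_L1_loc_measurable:
 fixes f :: "real => 'a::euclidean_space => 'b::euclidean_space"
 assumes f: "f \<in> L1_L1_loc T"
 shows "(\<lambda>(t, x). f t x) \<in> borel_measurable (lebesgue_on (slab T))"
proof (subst borel_measurable_restrict_space_iff[OF slab_lebesgue])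
 let ?f = "\<lambda>p. case p of (t, x) => f t x"
 show "(\<lambda>p. ind (slab T) p *\<^sub>R ?f p) \<in> borel_measurable lebesgue"
 proof (rule borel_measurable_LIMSEQ_metric)
  fix n :: nat
  have "set_integrable lebesgue ({0<..<T} \<times> cball 0 (real n)) ?f" using f by (auto simp: L1_L1_loc_def)
  thus "(\<lambda>p. ind ({0<..<T} \<times> cball 0 (real n)) p *\<^sub>R ?f p) \<in> borel_measurable lebesgue"
   unfolding set_integrable_def by (rule borel_measurable_integrable)
 next
  fix p :: "real \<times> 'a"
  obtain n :: nat where "norm (snd p) \<le> real n" using real_arch_simple by blast
  hence "\<forall>\<^sub>F m in sequentially. ind ({0<..<T} \<times> cball 0 (real m)) p *\<^sub>R ?f p = ind (slab T) p *\<^sub>R ?f p"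
   by (intro eventually_sequentiallyI[of n]) (cases p, auto simp: slab_def indicator_def)
  thus "(\<lambda>m. ind ({0<..<T} \<times> cball 0 (real m)) p *\<^sub>R ?f p) \<longlonglongrightarrow> ind (slab T) p *\<^sub>R ?f p" by (rule tendsto_eventually)
 qed
qed

lemma set_integrable_representative:
 fixes f :: "real => 'a::euclidean_space => 'b::euclidean_space"
 assumes "set_integrable lebesgue ({0<..<T} \<times> K) (\<lambda>(t, x). f t x)" and K: "K \<in> sets borel"
  and [measurable]: "g \<in> Borel" and eq: "AE p in lborel. fst p \<in> {0<..<T} --> f (fst p) (snd p) = g p"
 shows "L1 (\<lambda>p. ind ({0<..<T} \<times> K) p *\<^sub>R g p)"
proof -
 have [measurable]: "{0<..<T} \<times> K \<in> sets borel" using K by measurable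
 have "AE p in lborel. ind ({0<..<T} \<times> K) p *\<^sub>R (case p of (t, x) => f t x) = ind ({0<..<T} \<times> K) p *\<^sub>R g p"
  using eq by eventually_elim (auto simp: indicator_def)
 from lebesgue_representative(3)[OF _ this] show ?thesis using assms(1) unfolding set_integrable_def by simp
qed

lemma ess_support_zero:
 fixes f :: "'a::euclidean_space => real"
 shows "AE x in lborel. x \<notin> ess_support f --> f x = 0"
proof -
 define \<U> where "\<U> = {U. open U \<and> (AE x in lebesgue. x \<in> U --> f x = 0)}"
 obtain \<U>' where U: "\<U>' \<subseteq> \<U>" "countable \<U>'" "\<Union>\<U>' = \<Union>\<U>" using Lindelof[of \<U>] by (auto simp: \<U>_def)
 have "AE x in lborel. \<forall>U\<in>\<U>'. x \<in> U --> f x = 0"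
  using U by (intro AE_ball_countable[THEN iffD2]) (auto simp: \<U>_def AE_completion_iff)
 thus ?thesis by eventually_elim (use U in \<open>auto simp: ess_support_def \<U>_def[symmetric]\<close>)
qed

lemma BMO_seminorm_cong:
 fixes f g :: "'a::euclidean_space => real"
 assumes [measurable]: "g \<in> Borel" and eq: "AE x in lborel. f x = g x"
 shows "BMO_seminorm f = BMO_seminorm g"
proof -
 have m: "mean (ball x r) f' = mean (ball x r) g'" if [measurable]: "g' \<in> Borel" and "AE x in lborel. f' x = g' x"
  for x :: 'a and r and f' g' :: "'a => real"
 proof -
  have [measurable]: "ball x r \<in> sets borel" by simp
  have 1: "AE y in lborel. ind (ball x r) y *\<^sub>R f' y = ind (ball x r) y *\<^sub>R g' y"
   using that(2) by eventually_elim simp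
  have "(\<integral>y. ind (ball x r) y *\<^sub>R f' y \<partial>lebesgue) = (\<integral>y. ind (ball x r) y *\<^sub>R g' y \<partial>lebesgue)"
   by (subst (1 2) lebesgue_representative(2)[of "\<lambda>y. ind (ball x r) y *\<^sub>R g' y"]) (use 1 in auto)
  thus ?thesis by (simp add: mean_def set_lebesgue_integral_def)
 qed
 have m1: "mean (ball x r) f = mean (ball x r) g" for x r by (rule m[OF _ eq]) measurable
 have "mean (ball x r) (\<lambda>y. \<bar>f y - c\<bar>) = mean (ball x r) (\<lambda>y. \<bar>g y - c\<bar>)" for x r c
  by (rule m) (measurable, use eq in \<open>auto elim: eventually_mono\<close>)
 thus ?thesis unfolding BMO_seminorm_def m1 by (intro SUP_cong) auto
qed

lemma Linf_norm_AE: "u0 \<in> Linf ==> AE x in lborel. \<bar>u0 x\<bar> \<le> enn2real (Linf_norm u0)"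
proof -
 assume u0: "u0 \<in> Linf"
 define N where "N = enn2real (Linf_norm u0)"
 have e: "ennreal N = Linf_norm u0" using u0 by (simp add: N_def Linf_def)
 have "AE x in lborel. ennreal \<bar>u0 x\<bar> \<le> ennreal N"
  unfolding e Linf_norm_def by (rule AE_completion_iff[THEN iffD1, OF esssup_AE])
 thus "AE x in lborel. \<bar>u0 x\<bar> \<le> enn2real (Linf_norm u0)"
  unfolding N_def[symmetric] by eventually_elim (simp add: ennreal_le_iff N_def)
qed

lemma Linf_Linf_bounded:
 assumes "v \<in> Linf_Linf T"
 obtains N where "N \<ge> 0" "AE t\<in>{0<..<T} in lborel. (AE x in lborel. \<bar>v t x\<bar> \<le> N)"
proof -
 define N where "N = enn2real (Linf_Linf_norm T v)"
 have e: "ennreal N = Linf_Linf_norm T v" using assms by (simp add: N_def Linf_Linf_def)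
 have "AE t\<in>{0<..<T} in lborel. Linf_norm (v t) \<le> ennreal N"
  unfolding e Linf_Linf_norm_def by (rule AE_lebesgue_on_interval[THEN iffD1, OF esssup_AE])
 hence "AE t\<in>{0<..<T} in lborel. (AE x in lborel. \<bar>v t x\<bar> \<le> N)"
 proof eventually_elim
  case (elim t)
  show ?case
  proof
   assume "t \<in> {0<..<T}"
   hence le: "Linf_norm (v t) \<le> ennreal N" using elim by simp
   have "AE x in lborel. ennreal \<bar>v t x\<bar> \<le> Linf_norm (v t)"
    unfolding Linf_norm_def by (rule AE_completion_iff[THEN iffD1, OF esssup_AE])
   thus "AE x in lborel. \<bar>v t x\<bar> \<le> N"
   proof eventually_elim
    case (elim x)
    hence "ennreal \<bar>v t x\<bar> \<le> ennreal N" using le by (rule order_trans)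
    thus ?case by (simp add: ennreal_le_iff N_def)
   qed
  qed
 qed
 thus ?thesis by (intro that[of N]) (simp_all add: N_def)
qed

lemma bounded_Linf_Linf:
 fixes u :: "real \<times> 'a::euclidean_space => real"
 assumes [measurable]: "u \<in> Borel" and uM: "\<And>p. \<bar>u p\<bar> \<le> M"
 shows "Linf_Linf_norm T (\<lambda>t x. u (t, x)) \<le> ennreal M" "(\<lambda>t x. u (t, x)) \<in> Linf_Linf T"
proof -
 have slice[measurable]: "(\<lambda>x. ennreal \<bar>u (t, x)\<bar>) \<in> borel_measurable lebesgue" for t
  by (rule measurable_completion) measurable
 have le_iff: "Linf_norm (\<lambda>x. u (t, x)) \<le> c \<longleftrightarrow> (NNBINT x. ind {c<..} (ennreal \<bar>u (t, x)\<bar>)) = 0" for t c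
 proof -
  have "Linf_norm (\<lambda>x. u (t, x)) \<le> c \<longleftrightarrow> (AE x in lebesgue. ennreal \<bar>u (t, x)\<bar> \<le> c)" unfolding Linf_norm_def
   using esssup_I[OF slice] esssup_AE[where M=lebesgue and f="\<lambda>x. ennreal \<bar>u (t, x)\<bar>"] by (auto elim!: eventually_mono intro: order_trans)
  also have "\<dots> \<longleftrightarrow> (NNBINT x. ind {c<..} (ennreal \<bar>u (t, x)\<bar>)) = (0::ennreal)"
   unfolding AE_completion_iff by (subst nn_integral_0_iff_AE) (auto simp: indicator_def not_less cong: AE_cong)
  finally show ?thesis .
 qed
 have "(\<lambda>t. Linf_norm (\<lambda>x. u (t, x))) \<in> Borel"
 proof (rule borel_measurableI_le)
  fix c :: ennreal
  have "(\<lambda>t. NNBINT x. ind {c<..} (ennreal \<bar>u (t, x)\<bar>)) \<in> Borel" by measurable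
  thus "{t \<in> space borel. Linf_norm (\<lambda>x. u (t, x)) \<le> c} \<in> sets borel" unfolding le_iff by measurable
 qed
 hence m: "(\<lambda>t. Linf_norm (\<lambda>x. u (t, x))) \<in> borel_measurable (lebesgue_on {0<..<T})"
  by (intro measurable_restrict_space1 measurable_completion) simp
 have "Linf_norm (\<lambda>x. u (t, x)) \<le> ennreal M" for t
  unfolding Linf_norm_def by (rule esssup_I[OF slice]) (use uM in \<open>auto intro: ennreal_leI\<close>)
 thus le: "Linf_Linf_norm T (\<lambda>t x. u (t, x)) \<le> ennreal M" unfolding Linf_Linf_norm_def by (intro esssup_I[OF m]) auto
 have "u \<in> borel_measurable (lebesgue_on (slab T))" by (intro measurable_restrict_space1 measurable_completion) simp
 thus "(\<lambda>t x. u (t, x)) \<in> Linf_Linf T"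
  using order.strict_trans1[OF le, of "\<infinity>"] by (simp add: Linf_Linf_def split_beta')
qed

lemma iterated_lebesgue_integral:
 fixes F :: "real \<times> 'a::euclidean_space => real"
 assumes F: "L1 F" and zero: "\<And>t x. t \<notin> {0<..<T} ==> F (t, x) = 0"
  and eq: "AE t\<in>{0<..<T} in lborel. (AE x in lborel. f t x = F (t, x))"
 shows "(LINT t:{0<..<T}|lebesgue. LINT x|lebesgue. f t x) = (LBINT p. F p)"
proof -
 have [measurable]: "F \<in> Borel" using F by auto
 have "AE t in lborel. ind {0<..<T} t *\<^sub>R (LINT x|lebesgue. f t x) = (LBINT x. F (t, x))" using eq
 proof eventually_elim
  case (elim t)
  show ?case
  proof (cases "t \<in> {0<..<T}")
   case True
   have "(LINT x|lebesgue. f t x) = (LBINT x. F (t, x))" by (rule lebesgue_representative(2)) (use elim True in auto)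
   thus ?thesis using True by simp
  qed (simp add: zero)
 qed
 from lebesgue_representative(2)[OF _ this] show ?thesis
  unfolding set_lebesgue_integral_def by (simp add: lborel_Fubini(1)[OF F])
qed


lemma weak_partial_slice:
 fixes f g f' g' :: "'a::euclidean_space => 'b::euclidean_space"
 assumes w: "has_weak_partial i f g" and f'[measurable]: "f' \<in> Borel" and ff: "AE x in lborel. f x = f' x"
  and g'[measurable]: "g' \<in> Borel" and gg: "AE x in lborel. g x = g' x" and \<psi>: "\<psi> \<in> test_functions"
 shows "(LBINT x. (gradient \<psi> x \<bullet> i) * (f' x \<bullet> j)) = - (LBINT x. \<psi> x * (g' x \<bullet> j))"
proof -
 have int: "L1 (\<lambda>x. k x *\<^sub>R h' x)" if "locally_integrable h" and hh: "AE x in lborel. h x = h' x"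
  and [measurable]: "h' \<in> Borel" and k: "k \<in> test_functions" for h h' :: "'a => 'b" and k :: "'a => real"
 proof -
  obtain r where r: "\<And>x. norm x > r ==> k x = 0" using test_function_support[OF k] by metis
  obtain C where C: "\<And>x. \<bar>k x\<bar> \<le> C" using test_bounded[OF k] by metis
  have [measurable]: "k \<in> Borel" using k by auto
  have "set_integrable lebesgue (cball 0 r) h" using that(1) by (auto simp: locally_integrable_def)
  moreover have "AE x in lborel. ind (cball 0 r) x *\<^sub>R h x = ind (cball 0 r) x *\<^sub>R h' x"
   using hh by eventually_elim simp
  ultimately have "L1 (\<lambda>x. ind (cball 0 r) x *\<^sub>R h' x)"
   unfolding set_integrable_def using lebesgue_representative(3)[of "\<lambda>x. ind (cball 0 r) x *\<^sub>R h' x"] by simp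
  hence "L1 (\<lambda>x. C * norm (ind (cball 0 r) x *\<^sub>R h' x))" by (intro integrable_mult_right integrable_norm)
  thus ?thesis
  proof (rule L1_bound)
   have "norm (k x *\<^sub>R h' x) \<le> norm (C * norm (ind (cball 0 r) x *\<^sub>R h' x))" for x
    using r[of x] mult_right_mono[OF C, of "norm (h' x)" x] C[of x]
    by (cases "norm x \<le> r") (auto simp: indicator_def not_le)
   thus "AE x in lborel. norm (k x *\<^sub>R h' x) \<le> norm (C * norm (ind (cball 0 r) x *\<^sub>R h' x))" by simp
  qed measurable
 qed
 have [measurable]: "\<psi> \<in> Borel" "gradient \<psi> \<in> Borel" using \<psi> by (auto intro: test_measurable gradient_measurable)
 have "(LINT x|lebesgue. frechet_derivative \<psi> (at x) i *\<^sub>R f x) = - (LINT x|lebesgue. \<psi> x *\<^sub>R g x)"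
  using w \<psi> by (auto simp: has_weak_partial_def)
 also have "(LINT x|lebesgue. frechet_derivative \<psi> (at x) i *\<^sub>R f x) = (LBINT x. (gradient \<psi> x \<bullet> i) *\<^sub>R f' x)"
  by (rule lebesgue_representative(2)) (use ff in \<open>auto simp: gradient_inner[OF \<psi>] elim: eventually_mono\<close>)
 also have "(LINT x|lebesgue. \<psi> x *\<^sub>R g x) = (LBINT x. \<psi> x *\<^sub>R g' x)"
  by (rule lebesgue_representative(2)) (use gg in \<open>auto elim: eventually_mono\<close>)
 finally have "(LBINT x. (gradient \<psi> x \<bullet> i) *\<^sub>R f' x) \<bullet> j = (- (LBINT x. \<psi> x *\<^sub>R g' x)) \<bullet> j" by simp
 moreover have "L1 (\<lambda>x. (gradient \<psi> x \<bullet> i) *\<^sub>R f' x)"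
  using w by (intro int[OF _ ff] test_gradient_component \<psi>) (auto simp: has_weak_partial_def)
 moreover have "L1 (\<lambda>x. \<psi> x *\<^sub>R g' x)" using w by (intro int[OF _ gg] \<psi>) (auto simp: has_weak_partial_def)
 ultimately show ?thesis by (simp flip: integral_inner_left)
qed

lemma weak_divergence_slice:
 fixes f f' :: "'a::euclidean_space => 'a"
 assumes w: "has_weak_divergence f g" and f'[measurable]: "f' \<in> Borel" and ff: "AE x in lborel. f x = f' x"
  and g'[measurable]: "g' \<in> Borel" and gg: "AE x in lborel. g x = g' x" and \<psi>: "\<psi> \<in> test_functions"
 shows "(LBINT x. f' x \<bullet> gradient \<psi> x) = - (LBINT x. g' x * \<psi> x)"
proof -
 have [measurable]: "\<psi> \<in> Borel" "gradient \<psi> \<in> Borel" using \<psi> by (auto intro: test_measurable gradient_measurable)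
 have "(LINT x|lebesgue. f x \<bullet> gradient \<psi> x) = - (LINT x|lebesgue. g x * \<psi> x)"
  using w \<psi> by (auto simp: has_weak_divergence_def)
 also have "(LINT x|lebesgue. f x \<bullet> gradient \<psi> x) = (LBINT x. f' x \<bullet> gradient \<psi> x)"
  by (rule lebesgue_representative(2)) (use ff in \<open>auto elim: eventually_mono\<close>)
 also have "(LINT x|lebesgue. g x * \<psi> x) = (LBINT x. g' x * \<psi> x)"
  by (rule lebesgue_representative(2)) (use gg in \<open>auto elim: eventually_mono\<close>)
 finally show ?thesis .
qed

lemma exponential_weight:
 fixes D :: "real \<times> 'a::euclidean_space => real"
 assumes D[measurable]: "D \<in> Borel" and R: "R > 0"
  and BMO: "AE t\<in>{0<..<T} in lborel. f t \<in> BMO"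
  and fin: "(\<integral>\<^sup>+t. BMO_seminorm (f t) \<partial>lebesgue_on {0<..<T}) < \<infinity>"
  and eq: "AE t\<in>{0<..<T} in lborel. (AE x in lborel. f t x = D (t, x))"
  and supp: "AE t\<in>{0<..<T} in lborel. (AE x in lborel. x \<notin> ball 0 R --> D (t, x) = 0)"
 obtains \<Lambda> :: "real => real" where "L1 \<Lambda>" "\<And>s. \<Lambda> s \<ge> 0"
  "AE s\<in>{0<..<T} in lborel. \<Lambda> s > 0 \<and>
   (NNBINT x. ind (ball 0 R) x * ennreal (exp (JN_const TYPE('a) * \<bar>D (s, x)\<bar> / \<Lambda> s))) \<le> ennreal (6 * (4 * R) ^ DIM('a))"
proof -
 have [measurable]: "ball (0::'a) R \<in> sets borel" by simp
 define A where "A = 6 * (4 * R) ^ DIM('a)"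
 define Q where "Q n s \<longleftrightarrow> (NNBINT x. ind (ball 0 R) x * ennreal (exp (JN_const TYPE('a) * \<bar>D (s, x)\<bar> / real (Suc n)))) \<le> ennreal A" for n s
 have [measurable]: "Measurable.pred borel (\<lambda>s. Q n s)" for n unfolding Q_def by measurable
 define l where "l s = (LEAST n. Q n s)" for s
 have [measurable]: "l \<in> measurable borel (count_space UNIV)" unfolding l_def by measurable
 define \<Lambda> where "\<Lambda> s = ind {0<..<T} s * real (Suc (l s))" for s
 have \<Lambda>m[measurable]: "\<Lambda> \<in> Borel" unfolding \<Lambda>_def by measurable
 have good: "AE s\<in>{0<..<T} in lborel. Q (l s) s \<and> ennreal (\<Lambda> s - 2) \<le> BMO_seminorm (f s)" using BMO eq supp
 proof eventually_elim
  case (elim s)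
  show ?case
  proof
   assume s: "s \<in> {0<..<T}"
   have eqs: "AE x in lborel. f s x = D (s, x)" and sup: "AE x in lborel. x \<notin> ball 0 R --> D (s, x) = 0" and BMOs: "f s \<in> BMO"
    using elim s by blast+
   have norm_eq: "BMO_seminorm (f s) = BMO_seminorm (\<lambda>x. D (s, x))" by (rule BMO_seminorm_cong[OF _ eqs]) measurable
   have i: "L1 (\<lambda>x. D (s, x))"
   proof -
    have "set_integrable lebesgue (cball 0 R) (f s)" using BMOs by (auto simp: BMO_def locally_integrable_def)
    moreover have "AE x in lborel. ind (cball 0 R) x *\<^sub>R f s x = D (s, x)"
     using eqs sup by eventually_elim (auto simp: indicator_def dist_norm)
    ultimately show ?thesis unfolding set_integrable_def using lebesgue_representative(3)[of "\<lambda>x. D (s, x)"] by simp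
   qed
   define N where "N = enn2real (BMO_seminorm (f s))"
   have N: "BMO_seminorm (f s) = ennreal N" "N \<ge> 0" using BMOs by (simp_all add: N_def BMO_def)
   define n where "n = nat \<lceil>N\<rceil>"
   have n: "N \<le> real (Suc n)" "real n \<le> N + 1" unfolding n_def using N(2) by linarith+
   have "BMO_seminorm (\<lambda>x. D (s, x)) \<le> ennreal (real (Suc n))"
    unfolding norm_eq[symmetric] N(1) by (rule ennreal_leI[OF n(1)])
   hence "Q n s" unfolding Q_def A_def by (rule John_Nirenberg[OF R i sup]) simp
   hence "Q (l s) s" "l s \<le> n" unfolding l_def by (auto intro: LeastI Least_le)
   thus "Q (l s) s \<and> ennreal (\<Lambda> s - 2) \<le> BMO_seminorm (f s)"
    using n(2) s by (auto simp: N(1) \<Lambda>_def intro!: ennreal_leI)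
  qed
 qed
 have "(NNBINT s. ennreal (norm (\<Lambda> s))) \<le> (NNBINT s. ind {0<..<T} s * ennreal (\<Lambda> s - 2) + 2 * ind {0<..<T} s)"
 proof (rule nn_integral_mono)
  fix s
  show "ennreal (norm (\<Lambda> s)) \<le> ind {0<..<T} s * ennreal (\<Lambda> s - 2) + 2 * ind {0<..<T} s"
  proof (cases "s \<in> {0<..<T}")
   case True
   have "\<bar>\<Lambda> s\<bar> \<le> max 0 (\<Lambda> s - 2) + 2" by (auto simp: \<Lambda>_def indicator_def)
   hence "ennreal \<bar>\<Lambda> s\<bar> \<le> ennreal (max 0 (\<Lambda> s - 2) + 2)" by (rule ennreal_leI)
   also have "\<dots> = ennreal (max 0 (\<Lambda> s - 2)) + ennreal 2" by (rule ennreal_plus) auto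
   also have "ennreal (max 0 (\<Lambda> s - 2)) = ennreal (\<Lambda> s - 2)" by (cases "\<Lambda> s - 2 \<ge> 0") (auto simp: max_def ennreal_neg)
   finally show ?thesis using True by simp
  qed (simp add: \<Lambda>_def)
 qed
 also have "\<dots> = (NNBINT s. ind {0<..<T} s * ennreal (\<Lambda> s - 2)) + 2 * emeasure lborel {0<..<T}"
  by (subst nn_integral_add) (auto simp: nn_integral_cmult)
 also have "\<dots> < \<infinity>"
 proof -
  have "(NNBINT s. ind {0<..<T} s * ennreal (\<Lambda> s - 2)) \<le> (NNBINT s. BMO_seminorm (f s) * ind {0<..<T} s)"
   by (rule nn_integral_mono_AE) (use good in \<open>auto simp: indicator_def elim!: eventually_mono\<close>)
  also have "\<dots> = (\<integral>\<^sup>+t. BMO_seminorm (f t) \<partial>lebesgue_on {0<..<T})"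
   by (subst nn_integral_restrict_space) (auto simp: nn_integral_completion)
  finally have "(NNBINT s. ind {0<..<T} s * ennreal (\<Lambda> s - 2)) < \<infinity>" using fin by (rule order.strict_trans1)
  moreover have "emeasure lborel {0<..<T} < \<infinity>" by (cases "0 \<le> T") auto
  ultimately show ?thesis by (simp add: ennreal_mult_less_top)
 qed
 finally have "L1 \<Lambda>" by (intro integrableI_bounded) simp_all
 moreover have "AE s\<in>{0<..<T} in lborel. \<Lambda> s > 0 \<and>
   (NNBINT x. ind (ball 0 R) x * ennreal (exp (JN_const TYPE('a) * \<bar>D (s, x)\<bar> / \<Lambda> s))) \<le> ennreal (6 * (4 * R) ^ DIM('a))"
  using good by eventually_elim (auto simp: Q_def A_def \<Lambda>_def)
 ultimately show ?thesis by (intro that[of \<Lambda>]) (auto simp: \<Lambda>_def)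
qed

lemma integrable_of_exponential_weight:
 fixes D :: "real \<times> 'a::euclidean_space => real"
 assumes D[measurable]: "D \<in> Borel" and \<Lambda>: "L1 \<Lambda>" "\<And>s. \<Lambda> s \<ge> 0" and c: "c > 0"
  and supp: "AE t\<in>{0<..<T} in lborel. (AE x in lborel. x \<notin> ball 0 R --> D (t, x) = 0)"
  and expint: "AE s\<in>{0<..<T} in lborel. \<Lambda> s > 0 \<and> (NNBINT x. ind (ball 0 R) x * ennreal (exp (c * \<bar>D (s, x)\<bar> / \<Lambda> s))) \<le> ennreal A"
 shows "L1 (\<lambda>p. cyl T r p * D p)"
proof (rule integrableI_bounded)
 have [measurable]: "ball (0::'a) R \<in> sets borel" by simp
 have [measurable]: "\<Lambda> \<in> Borel" using \<Lambda> by auto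
 have "(NNBINT p. ennreal (norm (cyl T r p * D p)))
   = (NNBINT s. (NNBINT x. ennreal (norm (cyl T r (s, x) * D (s, x)))))"
  by (rule nn_integral_lborel_Fubini) measurable
 also have "\<dots> \<le> (NNBINT s. ennreal (\<Lambda> s / c) * ennreal A)"
 proof (rule nn_integral_mono_AE)
  show "AE s in lborel. (NNBINT x. ennreal (norm (cyl T r (s, x) * D (s, x)))) \<le> ennreal (\<Lambda> s / c) * ennreal A"
   using supp expint
  proof eventually_elim
   case (elim s)
   show ?case
   proof (cases "s \<in> {0<..<T}")
    case True
    hence sup: "AE x in lborel. x \<notin> ball 0 R --> D (s, x) = 0" and L: "\<Lambda> s > 0"
     and le: "(NNBINT x. ind (ball 0 R) x * ennreal (exp (c * \<bar>D (s, x)\<bar> / \<Lambda> s))) \<le> ennreal A" using elim by auto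
    have "(NNBINT x. ennreal (norm (cyl T r (s, x) * D (s, x))))
      \<le> (NNBINT x. ennreal (\<Lambda> s / c) * (ind (ball 0 R) x * ennreal (exp (c * \<bar>D (s, x)\<bar> / \<Lambda> s))))"
    proof (rule nn_integral_mono_AE)
     show "AE x in lborel. ennreal (norm (cyl T r (s, x) * D (s, x)))
       \<le> ennreal (\<Lambda> s / c) * (ind (ball 0 R) x * ennreal (exp (c * \<bar>D (s, x)\<bar> / \<Lambda> s)))" using sup
     proof eventually_elim
      case (elim x)
      show ?case
      proof (cases "x \<in> ball 0 R")
       case True
       have "norm (cyl T r (s, x) * D (s, x)) \<le> \<bar>D (s, x)\<bar>" by (simp add: indicator_def)
       also have "\<dots> = (\<Lambda> s / c) * (c * \<bar>D (s, x)\<bar> / \<Lambda> s)" using L c by simp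
       also have "\<dots> \<le> (\<Lambda> s / c) * exp (c * \<bar>D (s, x)\<bar> / \<Lambda> s)"
        using L c exp_ge_add_one_self[of "c * \<bar>D (s, x)\<bar> / \<Lambda> s"] by (intro mult_left_mono) (linarith, simp)
       finally have "ennreal (norm (cyl T r (s, x) * D (s, x))) \<le> ennreal ((\<Lambda> s / c) * exp (c * \<bar>D (s, x)\<bar> / \<Lambda> s))"
        by (rule ennreal_leI)
       also have "\<dots> = ennreal (\<Lambda> s / c) * ennreal (exp (c * \<bar>D (s, x)\<bar> / \<Lambda> s))" using L c by (intro ennreal_mult) auto
       finally show ?thesis using True by simp
      qed (use elim in simp)
     qed
    qed
    also have "\<dots> = ennreal (\<Lambda> s / c) * (NNBINT x. ind (ball 0 R) x * ennreal (exp (c * \<bar>D (s, x)\<bar> / \<Lambda> s)))"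
     by (rule nn_integral_cmult) measurable
    also have "\<dots> \<le> ennreal (\<Lambda> s / c) * ennreal A" by (rule mult_left_mono[OF le]) simp
    finally show ?thesis .
   qed (auto simp: indicator_def)
  qed
 qed
 also have "\<dots> = (NNBINT s. ennreal (\<Lambda> s / c)) * ennreal A" by (rule nn_integral_multc) measurable
 also have "\<dots> < \<infinity>"
 proof -
  have "L1 (\<lambda>s. \<Lambda> s / c)" using \<Lambda> by simp
  thus ?thesis using \<Lambda>(2) c by (simp add: nn_integral_eq_integral ennreal_mult_less_top)
 qed
 finally show "(NNBINT p. ennreal (norm (cyl T r p * D p))) < \<infinity>" .
qed measurable

lemma (in transport_field) weak_form:
 assumes bb: "AE t\<in>{0<..<T} in lborel. (AE x in lborel. b0 t x = b (t, x))"
  and dd: "AE t\<in>{0<..<T} in lborel. (AE x in lborel. d0 t x = D (t, x))"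
  and v[measurable]: "v \<in> Borel" and vN: "\<And>p. \<bar>v p\<bar> \<le> N"
  and vv: "AE t\<in>{0<..<T} in lborel. (AE x in lborel. v0 t x = v (t, x))"
  and \<phi>: "\<phi> \<in> ST T"
 shows "(LINT t:{0<..<T}|lebesgue. LINT x|lebesgue. v0 t x * deriv (\<lambda>s. \<phi> s x) t)
    + (LINT t:{0<..<T}|lebesgue. LINT x|lebesgue. d0 t x * v0 t x * \<phi> t x)
    + (LINT t:{0<..<T}|lebesgue. LINT x|lebesgue. (b0 t x \<bullet> gradient (\<phi> t) x) * v0 t x) = (LBINT p. v p * Lop \<phi> p)"
proof -
 have i: "L1 (\<lambda>p. v p * k p)" if "L1 k" for k using vN by (intro integrable_bounded_mult[where C=N] that) auto
 note parts = Lop_parts_integrable[OF \<phi>]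
 have 1: "(LINT t:{0<..<T}|lebesgue. LINT x|lebesgue. v0 t x * deriv (\<lambda>s. \<phi> s x) t) = (LBINT p. v p * time_cut T (\<lambda>t x. deriv (\<lambda>s. \<phi> s x) t) p)"
 proof (rule iterated_lebesgue_integral[OF i[OF parts(1)]])
  show "AE t\<in>{0<..<T} in lborel. (AE x in lborel. v0 t x * deriv (\<lambda>s. \<phi> s x) t = v (t, x) * time_cut T (\<lambda>t x. deriv (\<lambda>s. \<phi> s x) t) (t, x))"
   using vv by eventually_elim (auto simp: time_cut_def elim!: eventually_mono)
 qed (simp add: time_cut_def)
 have 2: "(LINT t:{0<..<T}|lebesgue. LINT x|lebesgue. d0 t x * v0 t x * \<phi> t x) = (LBINT p. v p * (D p * time_cut T \<phi> p))"
 proof (rule iterated_lebesgue_integral[OF i[OF parts(2)]])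
  show "AE t\<in>{0<..<T} in lborel. (AE x in lborel. d0 t x * v0 t x * \<phi> t x = v (t, x) * (D (t, x) * time_cut T \<phi> (t, x)))"
   using vv dd
  proof eventually_elim
   case (elim t)
   show ?case
   proof
    assume t: "t \<in> {0<..<T}"
    have "AE x in lborel. v0 t x = v (t, x)" "AE x in lborel. d0 t x = D (t, x)" using elim t by blast+
    thus "AE x in lborel. d0 t x * v0 t x * \<phi> t x = v (t, x) * (D (t, x) * time_cut T \<phi> (t, x))"
     by eventually_elim (use t in \<open>simp add: time_cut_def\<close>)
   qed
  qed
 qed (simp add: time_cut_def)
 have 3: "(LINT t:{0<..<T}|lebesgue. LINT x|lebesgue. (b0 t x \<bullet> gradient (\<phi> t) x) * v0 t x) = (LBINT p. v p * (b p \<bullet> time_cut T (\<lambda>t. gradient (\<phi> t)) p))"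
 proof (rule iterated_lebesgue_integral[OF i[OF parts(3)]])
  show "AE t\<in>{0<..<T} in lborel. (AE x in lborel. (b0 t x \<bullet> gradient (\<phi> t) x) * v0 t x = v (t, x) * (b (t, x) \<bullet> time_cut T (\<lambda>t. gradient (\<phi> t)) (t, x)))"
   using vv bb
  proof eventually_elim
   case (elim t)
   show ?case
   proof
    assume t: "t \<in> {0<..<T}"
    have "AE x in lborel. v0 t x = v (t, x)" "AE x in lborel. b0 t x = b (t, x)" using elim t by blast+
    thus "AE x in lborel. (b0 t x \<bullet> gradient (\<phi> t) x) * v0 t x = v (t, x) * (b (t, x) \<bullet> time_cut T (\<lambda>t. gradient (\<phi> t)) (t, x))"
     by eventually_elim (use t in \<open>simp add: time_cut_def\<close>)
   qed
  qed
 qed (simp add: time_cut_def)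
 show ?thesis unfolding 1 2 3 Lop_def using i[OF parts(1)] i[OF parts(2)] i[OF parts(3)] by (simp add: distrib_left)
qed


lemma truncated_representative:
 fixes f g :: "'a => real"
 assumes "g \<in> borel_measurable M" "AE x in M. \<bar>g x\<bar> \<le> N" "N \<ge> 0"
 shows "(\<lambda>x. max (- N) (min N (g x))) \<in> borel_measurable M" "\<bar>max (- N) (min N (g x))\<bar> \<le> N"
  "AE x in M. g x = max (- N) (min N (g x))"
proof -
 show "(\<lambda>x. max (- N) (min N (g x))) \<in> borel_measurable M" using assms(1) by measurable
 show "\<bar>max (- N) (min N (g x))\<bar> \<le> N" using assms(3) by auto
 show "AE x in M. g x = max (- N) (min N (g x))" using assms(2) by eventually_elim auto
qed

theorem transport_well_posed:
 fixes T R :: real and b :: "real => 'a::euclidean_space => 'a" and div_b :: "real => 'a => real" and u0 :: "'a => real"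
 assumes T: "T > 0" and b: "b \<in> L1_W11_loc T" and u0: "u0 \<in> Linf" and div: "is_spatial_divergence T b div_b"
  and BMO: "div_b \<in> L1_BMO T" and growth: "(\<lambda>t x. b t x /\<^sub>R (1 + norm x)) \<in> L1_L1 T"
  and R: "R > 0" and supp: "AE t in lebesgue_on {0<..<T}. ess_support (div_b t) \<subseteq> ball 0 R"
 shows "\<exists>u. weak_solution T b div_b u0 u \<and> u \<in> Linf_Linf T \<and> Linf_Linf_norm T u \<le> Linf_norm u0 \<and>
  (\<forall>v. weak_solution T b div_b u0 v --> (AE (t, x) in lebesgue_on (slab T). v t x = u t x))"
proof -
 have bL: "b \<in> L1_L1_loc T" using b by (simp add: L1_W11_loc_def)
 obtain b' where b'[measurable]: "b' \<in> Borel"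
  and bb: "AE p in lborel. fst p \<in> {0<..<T} --> b (fst p) (snd p) = b' p"
   "AE t\<in>{0<..<T} in lborel. (AE x in lborel. b t x = b' (t, x))"
  by (rule slab_representative[OF L1_L1_loc_measurable[OF bL]])
 obtain D where D[measurable]: "D \<in> Borel"
  and dd: "AE p in lborel. fst p \<in> {0<..<T} --> div_b (fst p) (snd p) = D p"
   "AE t\<in>{0<..<T} in lborel. (AE x in lborel. div_b t x = D (t, x))"
  using div unfolding is_spatial_divergence_def by (blast elim: slab_representative)
 define weak where "weak i G \<longleftrightarrow> G \<in> Borel \<and> (\<forall>r. L1 (\<lambda>p. cyl T r p *\<^sub>R G p)) \<and>
   (AE t\<in>{0<..<T} in lborel. (\<forall>\<psi>\<in>test_functions. \<forall>j\<in>Basis.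
    (LBINT x. (gradient \<psi> x \<bullet> i) * (b' (t, x) \<bullet> j)) = - (LBINT x. \<psi> x * (G (t, x) \<bullet> j))))" for i G
 have "\<exists>G. weak i G" if i: "i \<in> Basis" for i
 proof -
  obtain g where g: "g \<in> L1_L1_loc T" "AE t in lebesgue_on {0<..<T}. has_weak_partial i (b t) (g t)"
   using b i unfolding L1_W11_loc_def by auto
  obtain G where G[measurable]: "G \<in> Borel"
   and gg: "AE p in lborel. fst p \<in> {0<..<T} --> g (fst p) (snd p) = G p"
    "AE t\<in>{0<..<T} in lborel. (AE x in lborel. g t x = G (t, x))"
   by (rule slab_representative[OF L1_L1_loc_measurable[OF g(1)]])
  have "L1 (\<lambda>p. cyl T r p *\<^sub>R G p)" for r
   using g(1) by (intro set_integrable_representative[OF _ _ G gg(1)]) (auto simp: L1_L1_loc_def)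
  moreover have "AE t\<in>{0<..<T} in lborel. (\<forall>\<psi>\<in>test_functions. \<forall>j\<in>Basis.
    (LBINT x. (gradient \<psi> x \<bullet> i) * (b' (t, x) \<bullet> j)) = - (LBINT x. \<psi> x * (G (t, x) \<bullet> j)))"
   using g(2)[unfolded AE_lebesgue_on_interval] bb(2) gg(2)
  proof eventually_elim
   case (elim t)
   thus ?case by (auto intro!: weak_partial_slice[of i "b t" "g t"] simp del: greaterThanLessThan_iff)
  qed
  ultimately show ?thesis using G unfolding weak_def by blast
 qed
 then obtain G where "\<And>i. i \<in> Basis ==> weak i (G i)" by metis
 hence G: "\<And>i. i \<in> Basis ==> G i \<in> Borel"
  "\<And>i r. i \<in> Basis ==> L1 (\<lambda>p. cyl T r p *\<^sub>R G i p)"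
  "\<And>i. i \<in> Basis ==> AE t\<in>{0<..<T} in lborel. (\<forall>\<psi>\<in>test_functions. \<forall>j\<in>Basis.
    (LBINT x. (gradient \<psi> x \<bullet> i) * (b' (t, x) \<bullet> j)) = - (LBINT x. \<psi> x * (G i (t, x) \<bullet> j)))"
  unfolding weak_def by blast+
 have supp': "AE t\<in>{0<..<T} in lborel. (AE x in lborel. x \<notin> ball 0 R --> D (t, x) = 0)"
  using supp[unfolded AE_lebesgue_on_interval] dd(2)
 proof eventually_elim
  case (elim t)
  show ?case
  proof
   assume t: "t \<in> {0<..<T}"
   have "AE x in lborel. div_b t x = D (t, x)" using elim t by blast
   with ess_support_zero[of "div_b t"] show "AE x in lborel. x \<notin> ball 0 R --> D (t, x) = 0"
   proof eventually_elim
    case (elim x)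
    thus ?case using \<open>t \<in> {0<..<T} --> ess_support (div_b t) \<subseteq> ball 0 R\<close> t by auto
   qed
  qed
 qed
 obtain \<Lambda> :: "real => real" where \<Lambda>: "L1 \<Lambda>" "\<And>s. \<Lambda> s \<ge> 0"
  "AE s\<in>{0<..<T} in lborel. \<Lambda> s > 0 \<and>
   (NNBINT x. ind (ball 0 R) x * ennreal (exp (JN_const TYPE('a) * \<bar>D (s, x)\<bar> / \<Lambda> s))) \<le> ennreal (6 * (4 * R) ^ DIM('a))"
  using BMO by (auto simp: L1_BMO_def AE_lebesgue_on_interval intro: exponential_weight[OF D R _ _ dd(2) supp'])
 interpret transport_field_W11 T b' D G
 proof
  show "L1 (\<lambda>p. cyl T r p *\<^sub>R b' p)" for r
   using bL by (intro set_integrable_representative[OF _ _ b' bb(1)]) (auto simp: L1_L1_loc_def)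
  show "L1 (\<lambda>p. cyl T r p * D p)" for r
   by (rule integrable_of_exponential_weight[OF D \<Lambda>(1,2) JN_const_pos supp' \<Lambda>(3)])
  have "AE t\<in>{0<..<T} in lborel. has_weak_divergence (b t) (div_b t)"
   using div by (simp only: is_spatial_divergence_def AE_lebesgue_on_interval)
  thus "AE t in lborel. t \<in> {0<..<T} -->
   (\<forall>\<psi>\<in>test_functions. (LBINT x. b' (t, x) \<bullet> gradient \<psi> x) = - (LBINT x. D (t, x) * \<psi> x))" using bb(2) dd(2)
  proof eventually_elim
   case (elim t)
   thus ?case by (auto intro!: weak_divergence_slice[of "b t" "div_b t"] simp del: greaterThanLessThan_iff)
  qed
 qed (use T G in auto)
 define M where "M = enn2real (Linf_norm u0)"
 have M0: "M \<ge> 0" and M: "ennreal M = Linf_norm u0" using u0 by (simp_all add: M_def Linf_def)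
 obtain u0r where u0r: "u0r \<in> Borel" "AE x in lborel. u0 x = u0r x"
  using u0 by (auto simp: Linf_def elim: borel_representative)
 have u0rM: "AE x in lborel. \<bar>u0r x\<bar> \<le> M" using Linf_norm_AE[OF u0] u0r(2) unfolding M_def by eventually_elim simp
 define u0' where "u0' x = max (- M) (min M (u0r x))" for x
 have u0'[measurable]: "u0' \<in> Borel" and u0'M: "\<And>x. \<bar>u0' x\<bar> \<le> M" and u0'eq: "AE x in lborel. u0 x = u0' x"
  using truncated_representative[of u0r lborel M] u0r u0rM M0 unfolding u0'_def[abs_def] by auto
 obtain u where u[measurable]: "u \<in> Borel" and uM: "\<And>p. \<bar>u p\<bar> \<le> M"
  and usol: "\<And>\<phi>. \<phi> \<in> ST T ==> (LBINT p. u p * Lop \<phi> p) = - (LBINT x. u0' x * \<phi> 0 x)"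
  by (rule solution_exists[OF u0' u0'M]) blast
 have rhs: "(LINT x|lebesgue. u0 x * \<phi> 0 x) = (LBINT x. u0' x * \<phi> 0 x)" if "\<phi> \<in> ST T" for \<phi>
 proof (rule lebesgue_representative(2))
  have "\<phi> 0 \<in> test_functions" using st_test_slice[OF that] T_pos by simp
  hence [measurable]: "\<phi> 0 \<in> Borel" by auto
  show "(\<lambda>x. u0' x * \<phi> 0 x) \<in> Borel" by measurable
  show "AE x in lborel. u0 x * \<phi> 0 x = u0' x * \<phi> 0 x" using u0'eq by eventually_elim simp
 qed
 note norms = bounded_Linf_Linf[OF u uM, of T]
 have wsol: "weak_solution T b div_b u0 (\<lambda>t x. u (t, x))" unfolding weak_solution_def
 proof (intro conjI ballI norms(2))
  fix \<phi> :: "real => 'a => real" assume \<phi>: "\<phi> \<in> ST T"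
  show "(LINT t:{0<..<T}|lebesgue. LINT x|lebesgue. u (t, x) * deriv (\<lambda>s. \<phi> s x) t)
    + (LINT t:{0<..<T}|lebesgue. LINT x|lebesgue. div_b t x * u (t, x) * \<phi> t x)
    + (LINT t:{0<..<T}|lebesgue. LINT x|lebesgue. (b t x \<bullet> gradient (\<phi> t) x) * u (t, x)) = - (LINT x|lebesgue. u0 x * \<phi> 0 x)"
   unfolding rhs[OF \<phi>] usol[OF \<phi>, symmetric] by (rule weak_form[OF bb(2) dd(2) u uM _ \<phi>]) simp
 qed
 have unique: "AE (t, x) in lebesgue_on (slab T). v t x = u (t, x)" if v: "weak_solution T b div_b u0 v" for v
 proof -
  have vL: "v \<in> Linf_Linf T" using v by (simp add: weak_solution_def)
  hence "(\<lambda>(t, x). v t x) \<in> borel_measurable (lebesgue_on (slab T))" by (simp add: Linf_Linf_def)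
  then obtain vr where vr[measurable]: "vr \<in> Borel"
   and vv: "AE p in lborel. fst p \<in> {0<..<T} --> v (fst p) (snd p) = vr p"
   "AE t\<in>{0<..<T} in lborel. (AE x in lborel. v t x = vr (t, x))" by (rule slab_representative)
  obtain N where N: "N \<ge> 0" "AE t\<in>{0<..<T} in lborel. (AE x in lborel. \<bar>v t x\<bar> \<le> N)"
   by (rule Linf_Linf_bounded[OF vL])
  define v' where "v' p = max (- N) (min N (vr p))" for p
  have v'[measurable]: "v' \<in> Borel" unfolding v'_def by measurable
  have v'N: "\<bar>v' p\<bar> \<le> N" for p using N(1) by (auto simp: v'_def)
  have vs: "AE t\<in>{0<..<T} in lborel. (AE x in lborel. v t x = v' (t, x))" using vv(2) N(2)
  proof eventually_elim
   case (elim t)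
   show ?case
   proof
    assume "t \<in> {0<..<T}"
    hence "AE x in lborel. v t x = vr (t, x)" "AE x in lborel. \<bar>v t x\<bar> \<le> N" using elim by blast+
    thus "AE x in lborel. v t x = v' (t, x)" by eventually_elim (auto simp: v'_def)
   qed
  qed
  have "AE p in lborel. fst p \<in> {0<..<T} --> vr p = v' p"
  proof (rule AE_lborel_pairI)
   show "AE t in lborel. AE x in lborel. fst (t, x) \<in> {0<..<T} --> vr (t, x) = v' (t, x)" using vv(2) vs
   proof eventually_elim
    case (elim t)
    show ?case
    proof (cases "t \<in> {0<..<T}")
     case True
     hence "AE x in lborel. v t x = vr (t, x)" "AE x in lborel. v t x = v' (t, x)" using elim by blast+
     thus ?thesis by eventually_elim simp
    qed auto
   qed
  qed measurable
  with vv(1) have veq: "AE p in lborel. fst p \<in> {0<..<T} --> v (fst p) (snd p) = v' p" by eventually_elim auto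
  have vsol: "(LBINT p. v' p * Lop \<phi> p) = - (LBINT x. u0' x * \<phi> 0 x)" if \<phi>: "\<phi> \<in> ST T" for \<phi>
   using v \<phi> unfolding weak_solution_def weak_form[OF bb(2) dd(2) v' v'N vs \<phi>, symmetric] rhs[OF \<phi>, symmetric] by blast
  define w where "w p = v' p - u p" for p
  have w[measurable]: "w \<in> Borel" unfolding w_def by measurable
  have "AE p in lborel. fst p \<in> {0<..<T} --> w p = 0"
  proof (rule homogeneous_solution_zero[OF w _ _ _ _ \<Lambda>(1,2) JN_const_pos \<Lambda>(3)])
   show "\<bar>w p\<bar> \<le> N + M" for p using v'N[of p] uM[of p] by (simp add: w_def)
   fix \<phi> :: "real => 'a => real" assume \<phi>: "\<phi> \<in> ST T"
   have "L1 (\<lambda>p. v' p * Lop \<phi> p)" "L1 (\<lambda>p. u p * Lop \<phi> p)"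
    using integrable_bounded_mult[OF Lop_parts_integrable(4)[OF \<phi>], of v' N] integrable_bounded_mult[OF Lop_parts_integrable(4)[OF \<phi>], of u M] v'N uM by auto
   thus "(LBINT p. w p * Lop \<phi> p) = 0" using vsol[OF \<phi>] usol[OF \<phi>] by (simp add: w_def left_diff_distrib)
  next
   show "AE p in lborel. fst p \<in> {0<..<T} --> R \<le> norm (snd p) --> D p = 0"
   proof (rule AE_lborel_pairI)
    show "AE t in lborel. AE x in lborel. fst (t, x) \<in> {0<..<T} --> R \<le> norm (snd (t, x)) --> D (t, x) = 0"
     using supp'
    proof eventually_elim
     case (elim t)
     show ?case
     proof (cases "t \<in> {0<..<T}")
      case True
      hence "AE x in lborel. x \<notin> ball 0 R --> D (t, x) = 0" using elim by blast
      thus ?thesis by eventually_elim auto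
     qed auto
    qed
   qed measurable
  next
   have "set_integrable lebesgue ({0<..<T} \<times> UNIV) (\<lambda>(t, x). b t x /\<^sub>R (1 + norm x))"
    using growth by (simp add: L1_L1_def slab_def)
   hence "L1 (\<lambda>p. ind ({0<..<T} \<times> UNIV) p *\<^sub>R (b' p /\<^sub>R (1 + norm (snd p))))"
    by (rule set_integrable_representative) (use bb(1) in \<open>auto elim: eventually_mono\<close>)
   from integrable_norm[OF this]
   show "L1 (\<lambda>p. ind {0<..<T} (fst p) * (norm (b' p) / (1 + norm (snd p))))"
    by (rule Bochner_Integration.integrable_cong[THEN iffD1, rotated -1]) (auto simp: indicator_def divide_inverse mult.commute)
  qed
  with veq have "AE p in lborel. fst p \<in> {0<..<T} --> v (fst p) (snd p) = u p" by eventually_elim (auto simp: w_def)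
  thus ?thesis unfolding AE_lebesgue_on_slab by eventually_elim auto
 qed
 show ?thesis using wsol norms M unique by (intro exI[of _ "\<lambda>t x. u (t, x)"]) auto
qed


theorem theoremA:
  fixes T R :: real
    and b :: "real \<Rightarrow> real ^ 'n \<Rightarrow> real ^ 'n"
    and div_b :: "real \<Rightarrow> real ^ 'n \<Rightarrow> real"
    and u0 :: "real ^ 'n \<Rightarrow> real"
  assumes "T > 0"
    and "b \<in> L1_W11_loc T"
    and "u0 \<in> Linf"
    and "is_spatial_divergence T b div_b"
    and "div_b \<in> L1_BMO T"
    and "(\<lambda>t x. b t x /\<^sub>R (1 + norm x)) \<in> L1_L1 T"
    and "R > 0"
    and "AE t in lebesgue_on {0<..<T}. ess_support (div_b t) \<subseteq> ball 0 R"
  shows "\<exists>u. weak_solution T b div_b u0 u \<and>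
             u \<in> Linf_Linf T \<and>
             Linf_Linf_norm T u \<le> Linf_norm u0 \<and>
             (\<forall>v. weak_solution T b div_b u0 v \<longrightarrow>
                  (AE (t, x) in lebesgue_on (slab T). v t x = u t x))"
using assms by (rule transport_well_posed)

end
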